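(* Let $b\ge a\ge 0$, $n\ge 0$ and $c=\lfloor\frac{b-a}2\rfloor$. Let $P_n$ be the degree-$n$ function on $\mathfrak{sp}_{2n}\oplus\mathfrak{so}_{a,b}\oplus\mathfrak{gl}_1$ given by $$P_n(x^{(1)},\dots,x^{(n)})=\Upsilon_{2n|a,b}\int_{[0,1]^n}\omega_{2n|a,b}\big(\Theta\otimes\Phi(x^{(1)})\otimes\cdots\otimes\Phi(x^{(n)})\big)\,dv_1\cdots dv_n ,$$ and let $P_n^{\mathrm{avg}}$ be the ad-invariant function obtained from it by averaging. Then $$P_n^{\mathrm{avg}}(x,\dots,x)=(-1)^{a+c}\Big[\det\big(\widehat A(\hbar x_1)\,\widehat{BC}(\hbar y)\big)^{1/2}\,\mathrm{tr}(e^{x_2})\Big]_n ,$$ where $x=x_1+y+x_2$ with $x_1\in\mathfrak{sp}_{2n}$, $y\in\mathfrak{so}_{a,b}$, $x_2\in\mathfrak{gl}_1$, and $[-]_n$ denotes the homogeneous degree $n$ piece in $x$.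
   Context: **Conventions.** $\mathbb k$ is $\mathbb R$ or $\mathbb C$, $\hbar$ a formal variable, $\mathbb K=\mathbb k[[\hbar]]$. **Weyl–Clifford algebra.** $\mathcal A=\widehat{\mathrm{Weyl}}(T^*\mathbb R^n,\omega_0)\otimes_{\mathbb K}\mathrm{Cliff}(\mathbb R^{0|a+b},Q)$, with underlying module $\mathbb k[[p_i,q_i]]\otimes\Lambda[\theta_1,\dots,\theta_{a+b}][[\hbar]]$, $[p_i,q_i]=\hbar$ and $v^2=\hbar Q(v)$ for $v$ in the odd generating space, where $Q$ has signature $(a,b)$ and matrix $\tfrac12(h_Q^{ij})$. Elements of $\mathcal A$ are identified with (super)polynomials/power series through (super)symmetrization, and $\partial/\partial p_i,\partial/\partial q_i,\partial/\partial\theta_i$ are the usual (for $\theta_i$: odd) partial derivatives. **Odd basis.** The $\theta_i$ are named in order $\zeta_1,\eta_1,\dots,\zeta_a,\eta_a,\xi_1,\mu_1,\dots,\xi_c,\mu_c$ (and $\upsilon$ if $b-a$ is odd), with nonzero values of the bilinear form of $Q$: $B_Q(\zeta_i,\eta_i)=\tfrac12$, $B_Q(\xi_i,\xi_i)=B_Q(\mu_i,\mu_i)=B_Q(\upsilon,\upsilon)=-\tfrac12$. $\Theta=\zeta_1\eta_1\cdots\zeta_a\eta_a\xi_1\mu_1\cdots\xi_c\mu_c\,\upsilon=\theta_1\cdots\theta_{a+b}$. **The map $\Phi$.** $\mathfrak{gl}_1$ is identified with the center (constants) of $\mathcal A$. $\Phi\colon\mathfrak{sp}_{2n}\oplus\mathfrak{so}_{a,b}\oplus\mathfrak{gl}_1\to\mathcal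 A$ is the inclusion of constants on $\mathfrak{gl}_1$, and embeds $\mathfrak{sp}_{2n}\oplus\mathfrak{so}_{a,b}$ as homogeneous quadratic elements: $\Phi(X)=w$ with $\tfrac1\hbar[w,v]=Xv$ for linear $v$. In particular $\Phi$ identifies a Cartan subalgebra of $\mathfrak{sp}_{2n}\oplus\mathfrak{so}_{a,b}$ with the span of $q_ip_i$ ($1\le i\le n$), $\eta_i\zeta_i$ ($1\le i\le a$) and $-\xi_i\mu_i$ ($1\le i\le c$); let $t_i,s_i,r_i$ be the corresponding coordinates. **The operators.** On $\mathcal A^{\otimes k+1}$ (factors numbered $0,\dots,k$), for $i<j$: $\alpha_{ij}$ is $\tfrac12\sum_{l=1}^n(\partial_{p_l}\text{ on factor }i,\ \partial_{q_l}\text{ on factor }j)-(\partial_{q_l}\text{ on }i,\ \partial_{p_l}\text{ on }j)$, and $g_{ij}$ is $\tfrac12\sum_{m,l}h_Q^{ml}(\partial_{\theta_m}\text{ on factor }i,\ \partial_{\theta_l}\text{ on factor }j)$, i.e. $g_{ij}(a_0\otimes\cdots\otimes a_k)=\tfrac12\sum_{m,l}h^{ml}_Q\,a_0\otimes\cdots\otimes\partial_{\theta_m}a_i\otimes\cdots\otimes\partial_{\theta_l}a_j\otimes\cdots\otimes a_k$. $\psi$ is the $1$-periodic function with $\psi(v)=2v+1$ for $-1\le v<0$. On $\mathcal A^{\otimes n+1}$, with $v_0=0$, $$\omega_{2n|a,b}=\exp\Big(\sum_{0\le i<j\le n}\hbar\,\psi(v_i-v_j)(\alpha_{ij}+g_{ij})\Big).$$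 $\Upsilon_{2n|a,b}(a_0\otimes\cdots\otimes a_k)=\int(a_0\cdots a_k)|_{p=q=0}\,d\theta_1\cdots d\theta_{a+b}$, with the supercommutative product and the Berezin integral normalized by $\int\Theta\,d\Theta=1$. **Averaging.** For a possibly non-invariant polynomial $\overline P$ on a Lie algebra, $\overline P^{\mathrm{avg}}=\frac1{|G|}\sum_{g\in G}\overline P\circ g$ is its average over the group $G$ acting by the adjoint action, an ad-invariant polynomial. **Right-hand side.** An ad-invariant function is determined by its values on a Cartan subalgebra. $\widehat A$ is determined by $\prod_{i=1}^n\frac{t_i/2}{\sinh(t_i/2)}$ and $\widehat{BC}$ by $\prod_{i=1}^a\cosh(s_i/2)\prod_{i=1}^c\cos(r_i/2)$. The expression $\det(\widehat A(\hbar x_1)\widehat{BC}(\hbar y))^{1/2}\mathrm{tr}(e^{x_2})$ denotes the ad-invariant power series $\det\big(\tfrac{\hbar x_1/2}{\sinh(\hbar x_1/2)}\cosh(\hbar y_1/2)\cos(\hbar y_2/2)\big)^{1/2}\mathrm{tr}(e^{x_2})$, with value $e^{x_2}\prod_{i=1}^n\frac{\hbar\gamma_i/2}{\sinh(\hbar\gamma_i/2)}\prod_{i=1}^a\cosh(\hbar\lambda_i/2)\prod_{i=1}^c\cos(\hbar\kappa_i/2)$ on the element with $\Phi(x)=\sum\gamma_iq_ip_i+\sum\lambda_i\eta_i\zeta_i-\sum\kappa_i\xi_i\mu_i+x_2$.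
   Formalization: [-]_n carries a factor n! (x=x_2, n=2 else gives x_2^2 against x_2^2/2); the integral over dθ_1...dθ_{a+b} is iterated, so Θ has integral (-1)^{a+c}, not 1; g_ij carries Koszul signs; averaging means the invariant function in the convex hull of the orbit. *)

theory Defs
  imports
    "HOL-Analysis.Analysis"
    "HOL-Computational_Algebra.Formal_Power_Series"
    "Jordan_Normal_Form.Determinant"
begin

text \<open>
  Conventions. The ground field is a type of sort \<open>{real_normed_field, euclidean_space}\<close>; by
  Gelfand--Mazur such a type is isomorphic to \<open>real\<close> or to \<open>complex\<close>, and both are instances.
  The ring of scalars is \<open>'k fps\<close>, with \<open>fps_X\<close> in the role of \<open>\<hbar>\<close>. The even
  generators are numbered \<open>p\<^sub>l = l\<close>, \<open>q\<^sub>l = n + l\<close> for \<open>l < n\<close>. The odd generators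
  \<open>\<theta>\<^sub>u\<close>, \<open>u < a + b\<close>, are numbered \<open>\<zeta>\<^sub>i = 2i\<close>, \<open>\<eta>\<^sub>i = 2i + 1\<close> for \<open>i < a\<close>,
  \<open>\<xi>\<^sub>i = 2a + 2i\<close>, \<open>\<mu>\<^sub>i = 2a + 2i + 1\<close> for \<open>i < (b - a) div 2\<close>, and \<open>\<upsilon> = a + b - 1\<close> if
  \<open>b - a\<close> is odd.
\<close>

subsection \<open>The Weyl--Clifford algebra and its tensor powers\<close>

text \<open>
  A monomial \<open>(e, S)\<close> stands for the product of the even generators with exponents \<open>e\<close> times the
  product of the \<open>\<theta>\<^sub>u\<close>, \<open>u \<in> S\<close>, in increasing order of \<open>u\<close>. A (super) power series is the
  function of its coefficients, and an element of the completed tensor power with \<open>k + 1\<close> factors is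
  the function of its coefficients with respect to the tensors \<open>m\<^sub>0 \<otimes> \<dots> \<otimes> m\<^sub>k\<close> of monomials.
\<close>

type_synonym mono = "(nat \<Rightarrow> nat) \<times> nat set"
type_synonym 'k wc = "mono \<Rightarrow> 'k fps"
type_synonym 'k wc_tensor = "mono list \<Rightarrow> 'k fps"

definition wc_carrier :: "nat \<Rightarrow> nat \<Rightarrow> nat \<Rightarrow> 'k::zero wc set" where
  "wc_carrier n a b = {f. \<forall>e S. f (e, S) \<noteq> 0 \<longrightarrow> (\<forall>i\<ge>2 * n. e i = 0) \<and> S \<subseteq> {..<a + b}}"

definition tensor :: "'k::comm_ring_1 wc list \<Rightarrow> 'k wc_tensor" where
  "tensor fs ms = (if length ms = length fs then \<Prod>i<length fs. (fs ! i) (ms ! i) else 0)"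

definition d_even :: "nat \<Rightarrow> nat \<Rightarrow> 'k::comm_ring_1 wc_tensor \<Rightarrow> 'k wc_tensor" where
  "d_even i v t ms =
     (let (e, S) = ms ! i in of_nat (e v + 1) * t (ms[i := (e(v := e v + 1), S)]))"

text \<open>
  The odd left derivative \<open>\<partial>/\<partial>\<theta>\<^sub>u\<close> acting on factor \<open>i\<close> of a tensor power of superalgebras; the
  Koszul rule contributes the total parity of the factors to the left of factor \<open>i\<close>.
\<close>

definition d_odd :: "nat \<Rightarrow> nat \<Rightarrow> 'k::comm_ring_1 wc_tensor \<Rightarrow> 'k wc_tensor" where
  "d_odd i u t ms =
     (let (e, S) = ms ! i in
      if u \<in> S then 0
      else (-1) ^ ((\<Sum>j<i. card (snd (ms ! j))) + card {w \<in> S. w < u}) * t (ms[i := (e, insert u S)]))"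

definition alpha_op :: "nat \<Rightarrow> nat \<Rightarrow> nat \<Rightarrow> 'k::field_char_0 wc_tensor \<Rightarrow> 'k wc_tensor" where
  "alpha_op n i j t ms = fps_const (1/2) *
     (\<Sum>l<n. d_even i l (d_even j (n + l) t) ms - d_even i (n + l) (d_even j l t) ms)"

text \<open>The entries \<open>h\<^sub>Q\<close>, i.e. twice the values of the bilinear form of \<open>Q\<close> on the basis.\<close>

definition h_form :: "nat \<Rightarrow> nat \<Rightarrow> nat \<Rightarrow> nat \<Rightarrow> 'k::comm_ring_1" where
  "h_form a b u w =
     (if u < 2 * a \<and> w < 2 * a \<and> u div 2 = w div 2 \<and> u \<noteq> w then 1
      else if u = w \<and> 2 * a \<le> u \<and> u < a + b then -1 else 0)"

text \<open>
  As the odd derivatives on different factors anticommute, their order in \<open>g\<^sub>i\<^sub>j\<close> matters. It is the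
  one for which \<open>g\<^sub>0\<^sub>1 (\<theta>\<^sub>u \<otimes> \<theta>\<^sub>w) = h\<^sub>u\<^sub>w / 2\<close> without a sign, as required by the relation
  \<open>v\<^sup>2 = \<hbar> Q(v)\<close>.
\<close>

definition g_op :: "nat \<Rightarrow> nat \<Rightarrow> nat \<Rightarrow> nat \<Rightarrow> 'k::field_char_0 wc_tensor \<Rightarrow> 'k wc_tensor" where
  "g_op a b i j t ms = fps_const (1/2) *
     (\<Sum>u<a + b. \<Sum>w<a + b. fps_const (h_form a b u w) * d_odd j w (d_odd i u t) ms)"

text \<open>
  The exponential of an operator that is divisible by \<open>\<hbar>\<close>: only its powers up to \<open>N\<close> contribute to
  the coefficient of \<open>\<hbar>\<close> to the \<open>N\<close>.
\<close>

definition exp_op :: "('k::field_char_0 wc_tensor \<Rightarrow> 'k wc_tensor) \<Rightarrow> 'k wc_tensor \<Rightarrow> 'k wc_tensor" where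
  "exp_op D t ms = Abs_fps (\<lambda>N. \<Sum>k\<le>N. fps_nth ((D ^^ k) t ms) N / fact k)"

definition exp_pair_op ::
    "nat \<Rightarrow> nat \<Rightarrow> nat \<Rightarrow> nat \<Rightarrow> (nat \<Rightarrow> nat \<Rightarrow> 'k) \<Rightarrow> 'k::field_char_0 wc_tensor \<Rightarrow> 'k wc_tensor" where
  "exp_pair_op n a b k c =
     exp_op (\<lambda>t ms. \<Sum>j\<le>k. \<Sum>i<j. fps_X * fps_const (c i j) * (alpha_op n i j t ms + g_op a b i j t ms))"

text \<open>
  The supercommutative product \<open>a\<^sub>0 \<otimes> \<dots> \<otimes> a\<^sub>k \<mapsto> a\<^sub>0 \<cdots> a\<^sub>k\<close>; the sign is that of sorting the
  concatenated odd factors.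
\<close>

definition sort_sign :: "mono list \<Rightarrow> 'k::comm_ring_1" where
  "sort_sign ms =
     (-1) ^ card {(i, j, u, w). i < j \<and> j < length ms \<and> u \<in> snd (ms ! i) \<and> w \<in> snd (ms ! j) \<and> w < u}"

definition factorizations :: "nat \<Rightarrow> mono \<Rightarrow> mono list set" where
  "factorizations k m = {ms. length ms = k + 1 \<and>
     (\<forall>v. (\<Sum>i\<le>k. fst (ms ! i) v) = fst m v) \<and>
     (\<Union>i\<le>k. snd (ms ! i)) = snd m \<and>
     (\<forall>i\<le>k. \<forall>j\<le>k. i \<noteq> j \<longrightarrow> snd (ms ! i) \<inter> snd (ms ! j) = {})}"

definition super_mult :: "nat \<Rightarrow> 'k::comm_ring_1 wc_tensor \<Rightarrow> 'k wc" where
  "super_mult k t m = (\<Sum>ms\<in>factorizations k m. sort_sign ms * t ms)"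

text \<open>
  The product of the Weyl--Clifford algebra, transported to (super) power series by (super)
  symmetrization; it has \<open>[p\<^sub>l, q\<^sub>l] = \<hbar>\<close> and \<open>v\<^sup>2 = \<hbar> Q(v)\<close> for odd linear \<open>v\<close>.
\<close>

definition star :: "nat \<Rightarrow> nat \<Rightarrow> nat \<Rightarrow> 'k::field_char_0 wc \<Rightarrow> 'k wc \<Rightarrow> 'k wc" where
  "star n a b f g = super_mult 1 (exp_pair_op n a b 1 (\<lambda>_ _. 1) (tensor [f, g]))"

subsection \<open>The Lie algebra, its adjoint group and the map \<open>\<Phi>\<close>\<close>

type_synonym 'k lie = "'k mat \<times> 'k mat \<times> 'k"

definition symp_form :: "nat \<Rightarrow> 'k::comm_ring_1 mat" where
  "symp_form n = mat (2 * n) (2 * n) (\<lambda>(i, j). if i < n \<and> j = n + i then 1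
                                              else if j < n \<and> i = n + j then -1 else 0)"

definition Q_form :: "nat \<Rightarrow> nat \<Rightarrow> 'k::field_char_0 mat" where
  "Q_form a b = mat (a + b) (a + b) (\<lambda>(u, w). h_form a b u w / 2)"

definition sp_lie :: "nat \<Rightarrow> 'k::comm_ring_1 mat set" where
  "sp_lie n = {X \<in> carrier_mat (2 * n) (2 * n).
     transpose_mat X * symp_form n + symp_form n * X = 0\<^sub>m (2 * n) (2 * n)}"

definition so_lie :: "nat \<Rightarrow> nat \<Rightarrow> 'k::field_char_0 mat set" where
  "so_lie a b = {Y \<in> carrier_mat (a + b) (a + b).
     transpose_mat Y * Q_form a b + Q_form a b * Y = 0\<^sub>m (a + b) (a + b)}"

definition lie_alg :: "nat \<Rightarrow> nat \<Rightarrow> nat \<Rightarrow> 'k::field_char_0 lie set" where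
  "lie_alg n a b = sp_lie n \<times> so_lie a b \<times> UNIV"

definition Sp_group :: "nat \<Rightarrow> 'k::comm_ring_1 mat set" where
  "Sp_group n = {g \<in> carrier_mat (2 * n) (2 * n). transpose_mat g * symp_form n * g = symp_form n}"

definition SO_group :: "nat \<Rightarrow> nat \<Rightarrow> 'k::field_char_0 mat set" where
  "SO_group a b = {h \<in> carrier_mat (a + b) (a + b).
     transpose_mat h * Q_form a b * h = Q_form a b \<and> Determinant.det h = 1}"

definition adj_group :: "nat \<Rightarrow> nat \<Rightarrow> nat \<Rightarrow> 'k::field_char_0 lie set" where
  "adj_group n a b = Sp_group n \<times> SO_group a b \<times> {u. u \<noteq> 0}"

definition mat_inv :: "'k::comm_ring_1 mat \<Rightarrow> 'k mat" where
  "mat_inv A = (THE B. B \<in> carrier_mat (dim_row A) (dim_row A) \<and>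
     A * B = 1\<^sub>m (dim_row A) \<and> B * A = 1\<^sub>m (dim_row A))"

fun Ad :: "'k::comm_ring_1 lie \<Rightarrow> 'k lie \<Rightarrow> 'k lie" where
  "Ad (g, h, u) (X, Y, z) = (g * X * mat_inv g, h * Y * mat_inv h, z)"

definition const_elem :: "'k::comm_ring_1 \<Rightarrow> 'k wc" where
  "const_elem z = (\<lambda>(e, S). if e = (\<lambda>_. 0) \<and> S = {} then fps_const z else 0)"

definition linear_elem :: "nat \<Rightarrow> nat \<Rightarrow> nat \<Rightarrow> 'k::comm_ring_1 Matrix.vec \<Rightarrow> 'k Matrix.vec \<Rightarrow> 'k wc" where
  "linear_elem n a b v u = (\<lambda>(e, S).
     (\<Sum>i<2 * n. if e = (\<lambda>_. 0)(i := 1) \<and> S = {} then fps_const (vec_index v i) else 0) +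
     (\<Sum>j<a + b. if e = (\<lambda>_. 0) \<and> S = {j} then fps_const (vec_index u j) else 0))"

definition quadratic_elems :: "nat \<Rightarrow> nat \<Rightarrow> nat \<Rightarrow> 'k::comm_ring_1 wc set" where
  "quadratic_elems n a b =
     {f \<in> wc_carrier n a b. \<forall>e S. f (e, S) \<noteq> 0 \<longrightarrow> (\<Sum>i<2 * n. e i) + card S = 2}"

definition Phi_quad :: "nat \<Rightarrow> nat \<Rightarrow> nat \<Rightarrow> 'k::field_char_0 mat \<Rightarrow> 'k mat \<Rightarrow> 'k wc" where
  "Phi_quad n a b X Y = (THE w. w \<in> quadratic_elems n a b \<and>
     (\<forall>v \<in> carrier_vec (2 * n). \<forall>u \<in> carrier_vec (a + b). \<forall>m.
        star n a b w (linear_elem n a b v u) m - star n a b (linear_elem n a b v u) w m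
        = fps_X * linear_elem n a b (X *\<^sub>v v) (Y *\<^sub>v u) m))"

fun Phi :: "nat \<Rightarrow> nat \<Rightarrow> nat \<Rightarrow> 'k::field_char_0 lie \<Rightarrow> 'k wc" where
  "Phi n a b (X, Y, z) = (\<lambda>m. Phi_quad n a b X Y m + const_elem z m)"

subsection \<open>The cochain \<open>P\<^sub>n\<close>\<close>

definition psi :: "real \<Rightarrow> real" where
  "psi v = 2 * frac v - 1"

lemma psi_periodic: "psi (v + 1) = psi v"
  by (simp add: psi_def frac_1_eq)

lemma psi_eq: "-1 \<le> v \<Longrightarrow> v < 0 \<Longrightarrow> psi v = 2 * v + 1"
proof -
  assume "-1 \<le> v" "v < 0"
  then have "\<lfloor>v\<rfloor> = -1" by linarith
  then show ?thesis by (simp add: psi_def frac_def)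
qed

definition omega_op ::
    "nat \<Rightarrow> nat \<Rightarrow> nat \<Rightarrow> (nat \<Rightarrow> real) \<Rightarrow> 'k::{real_normed_field} wc_tensor \<Rightarrow> 'k wc_tensor" where
  "omega_op n a b v = exp_pair_op n a b n (\<lambda>i j. of_real (psi ((v(0 := 0)) i - (v(0 := 0)) j)))"

definition cube_integral ::
    "nat \<Rightarrow> ((nat \<Rightarrow> real) \<Rightarrow> 'k::{real_normed_field, euclidean_space} wc_tensor) \<Rightarrow> 'k wc_tensor" where
  "cube_integral n F ms = Abs_fps (\<lambda>N.
     set_lebesgue_integral (PiM {1..n} (\<lambda>_. lborel)) (PiE {1..n} (\<lambda>_. {0..1}))
       (\<lambda>v. fps_nth (F v ms) N))"

text \<open>
  The iterated Berezin integral \<open>\<integral> f d\<theta>\<^sub>i\<^sub>1 d\<theta>\<^sub>i\<^sub>2 \<cdots>\<close>. The differentials are odd and stand to the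
  right of the integrand, so that the innermost one is the first of the list and each
  \<open>\<integral> \<dots> d\<theta>\<^sub>i\<close> is the right derivative, with \<open>\<integral> \<theta>\<^sub>i d\<theta>\<^sub>i = 1\<close>.
\<close>

fun berezin :: "nat list \<Rightarrow> (nat set \<Rightarrow> 'k::comm_ring_1 fps) \<Rightarrow> nat set \<Rightarrow> 'k fps" where
  "berezin [] f = f"
| "berezin (i # is) f =
     berezin is (\<lambda>S. if i \<in> S then 0 else (-1) ^ card {u \<in> S. i < u} * f (insert i S))"

definition Theta :: "nat \<Rightarrow> nat \<Rightarrow> 'k::comm_ring_1 wc" where
  "Theta a b = (\<lambda>(e, S). if e = (\<lambda>_. 0) \<and> S = {..<a + b} then 1 else 0)"

text \<open>
  The measure \<open>d\<Theta>\<close> with \<open>\<integral> \<Theta> d\<Theta> = 1\<close> is \<open>d\<theta>\<^sub>m \<cdots> d\<theta>\<^sub>1\<close>, where \<open>m = a + b\<close>. The integral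
  over \<open>d\<theta>\<^sub>1 \<cdots> d\<theta>\<^sub>m\<close> used in \<open>\<Upsilon>\<close> differs from it by the sign of the reversal.
\<close>

lemma berezin_rev_upt:
  assumes "finite S"  "\<And>u. u \<in> S \<Longrightarrow> m \<le> u" 
  shows "berezin (rev [0..<m]) f S = (-1) ^ (m * card S) * f ({..<m} \<union> S)"
  using assms
proof (induction m arbitrary: f)
  case 0
  then show ?case by simp
next
  case (Suc m)
  have *: "\<And>u. u \<in> S \<Longrightarrow> m \<le> u" using Suc.prems by force
  have **: "{u. (u < m \<or> u \<in> S) \<and> m < u} = S" using Suc.prems(2) by force
  have "m \<notin> S" using Suc.prems(2) by force
  then show ?case
    by (simp add: Suc.IH[OF Suc.prems(1) *] ** lessThan_Suc power_add mult.assoc mult.left_commute)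
qed

lemma berezin_upt:
  assumes "finite S" "\<And>u. u \<in> S \<Longrightarrow> m \<le> u" "k \<le> m"
  shows "berezin [k..<m] f S = (-1) ^ ((m - k) * card S + (m - k) * (m - k - 1) div 2) * f ({k..<m} \<union> S)"
  using assms
proof (induction "m - k" arbitrary: k f)
  case 0
  then have "m = k" by simp
  then show ?case by simp
next
  case (Suc d)
  then have "k < m" by simp
  then have e: "[k..<m] = k # [Suc k..<m]" by (simp add: upt_conv_Cons)
  have i: "insert k {Suc k..<m} = {k..<m}" using \<open>k < m\<close> by auto
  have **: "{u. (Suc k \<le> u \<and> u < m \<or> u \<in> S) \<and> k < u} = {Suc k..<m} \<union> S" using Suc.prems(2) \<open>k<m\<close> by force
  have c: "card ({Suc k..<m} \<union> S) = d + card S"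
  proof -
    have "{Suc k..<m} \<inter> S = {}" using Suc.prems(2) by force
    then show ?thesis using Suc by (simp add: card_Un_disjoint)
  qed
  have ni: "k \<notin> S" using Suc.prems(2) \<open>k < m\<close> by force
  have d: "d = m - Suc k" "m - k = Suc d" using Suc by auto
  have "d * (d - 1) div 2 + d = (Suc d) * d div 2"
    by (cases d) auto
  then have *: "d * card S + d * (d - 1) div 2 + (d + card S) = (Suc d) * card S + Suc d * (Suc d - 1) div 2"
    by simp
  have "berezin [k..<m] f S = berezin [Suc k..<m] (\<lambda>S. if k \<in> S then 0 else (-1) ^ card {u \<in> S. k < u} * f (insert k S)) S"
    by (simp add: e)
  also have "\<dots> = (-1) ^ (d * card S + d * (d - 1) div 2) * ((-1) ^ (d + card S) * f (insert k ({Suc k..<m} \<union> S)))"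
    using ni \<open>k < m\<close> by (subst Suc.hyps(1)) (auto simp: d(1)[symmetric] ** c Suc.prems)
  also have "\<dots> = (-1) ^ (d * card S + d * (d - 1) div 2 + (d + card S)) * f (insert k ({Suc k..<m} \<union> S))"
    by (simp only: power_add mult.assoc)
  also have "\<dots> = (-1) ^ ((m - k) * card S + (m - k) * (m - k - 1) div 2) * f ({k..<m} \<union> S)"
    unfolding * d(2) by (simp only: i[symmetric] Un_insert_left)
  finally show ?case .
qed

lemma berezin_normalized:
  "berezin (rev [0..<a + b]) (\<lambda>S. Theta a b (\<lambda>_. 0, S)) {} = (1 :: 'k::comm_ring_1 fps)"
  by (subst berezin_rev_upt) (auto simp: Theta_def)

lemma berezin_Theta:
  assumes "a \<le> b"
  shows "berezin [0..<a + b] (\<lambda>S. Theta a b (\<lambda>_. 0, S)) {} = ((-1) ^ (a + (b - a) div 2) :: 'k::comm_ring_1 fps)"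
proof -
  define s where "s = a + (b - a) div 2"
  consider "a + b = 2 * s" | "a + b = Suc (2 * s)"
  proof -
    have "2 * s = 2 * a + 2 * ((b - a) div 2)" by (simp add: s_def)
    moreover have "2 * ((b - a) div 2) = b - a \<or> Suc (2 * ((b - a) div 2)) = b - a" by presburger
    ultimately show ?thesis using that assms by linarith
  qed
  then have "even ((a + b) * (a + b - 1) div 2) \<longleftrightarrow> even s"
  proof cases
    case 1
    have "(a + b) * (a + b - 1) div 2 = s * (2 * s - 1)" by (simp add: 1 mult.assoc)
    then show ?thesis by (cases s) simp_all
  next
    case 2
    have "(a + b) * (a + b - 1) div 2 = Suc (2 * s) * (2 * s) div 2" by (simp only: 2 diff_Suc_1)
    also have "\<dots> = Suc (2 * s) * s" by simp
    finally show ?thesis by simp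
  qed
  then have "(-1) ^ ((a + b) * (a + b - 1) div 2) = ((-1) ^ s :: 'k fps)"
    by (auto simp: minus_one_power_iff)
  then show ?thesis
    by (subst berezin_upt) (auto simp: Theta_def lessThan_atLeast0 s_def)
qed

definition Upsilon :: "nat \<Rightarrow> nat \<Rightarrow> nat \<Rightarrow> 'k::comm_ring_1 wc_tensor \<Rightarrow> 'k fps" where
  "Upsilon a b k t = berezin [0..<a + b] (\<lambda>S. super_mult k t (\<lambda>_. 0, S)) {}"

definition P_form :: "nat \<Rightarrow> nat \<Rightarrow> nat \<Rightarrow> 'k::{real_normed_field, euclidean_space} lie list \<Rightarrow> 'k fps" where
  "P_form n a b xs =
     Upsilon a b n (cube_integral n (\<lambda>v. omega_op n a b v (tensor (Theta a b # map (Phi n a b) xs))))"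

subsection \<open>Averaging\<close>

text \<open>
  The average over a set \<open>\<Gamma>\<close> of transformations of \<open>A\<close>: the \<open>\<Gamma>\<close>-invariant function in the convex
  hull of the orbit of \<open>P\<close>. For a finite group this is \<open>(1/|\<Gamma>|) \<Sum>\<^sub>\<gamma> P \<circ> \<gamma>\<close> (lemma
  \<open>average_finite\<close>); this form also makes sense for the non-compact groups acting here.
\<close>

definition is_average ::
    "'x set \<Rightarrow> ('x \<Rightarrow> 'x) set \<Rightarrow> ('x \<Rightarrow> 'k::real_normed_field fps) \<Rightarrow> ('x \<Rightarrow> 'k fps) \<Rightarrow> bool" where
  "is_average A \<Gamma> P R \<longleftrightarrow>
     (\<exists>F w. finite F \<and> F \<subseteq> \<Gamma> \<and> (\<forall>\<gamma>\<in>F. w \<gamma> \<ge> (0::real)) \<and> sum w F = 1 \<and>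
        (\<forall>x\<in>A. R x = (\<Sum>\<gamma>\<in>F. fps_const (of_real (w \<gamma>)) * P (\<gamma> x)))) \<and>
     (\<forall>\<gamma>\<in>\<Gamma>. \<forall>x\<in>A. R (\<gamma> x) = R x)"

definition average ::
    "'x set \<Rightarrow> ('x \<Rightarrow> 'x) set \<Rightarrow> ('x \<Rightarrow> 'k::real_normed_field fps) \<Rightarrow> 'x \<Rightarrow> 'k fps" where
  "average A \<Gamma> P x = (THE r. \<exists>R. is_average A \<Gamma> P R \<and> r = R x)"

lemma average_finite:
  fixes P :: "'x \<Rightarrow> 'k::real_normed_field fps"
  assumes fin: "finite \<Gamma>" "\<Gamma> \<noteq> {}" and A: "\<And>\<gamma> x. \<gamma> \<in> \<Gamma> \<Longrightarrow> x \<in> A \<Longrightarrow> \<gamma> x \<in> A"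
    and grp: "\<And>\<delta>. \<delta> \<in> \<Gamma> \<Longrightarrow> (\<lambda>\<gamma>. \<gamma> \<circ> \<delta>) ` \<Gamma> = \<Gamma>" "\<And>\<delta>. \<delta> \<in> \<Gamma> \<Longrightarrow> (\<lambda>\<gamma>. \<delta> \<circ> \<gamma>) ` \<Gamma> = \<Gamma>"
    and x: "x \<in> A"
  shows "average A \<Gamma> P x = fps_const (1 / of_nat (card \<Gamma>)) * (\<Sum>\<gamma>\<in>\<Gamma>. P (\<gamma> x))"
proof -
  define U where "U = (\<lambda>x. fps_const (1 / of_nat (card \<Gamma>)) * (\<Sum>\<gamma>\<in>\<Gamma>. P (\<gamma> x)))"
  have c: "card \<Gamma> \<noteq> 0" using fin by simp
  have r1: "(\<Sum>\<gamma>\<in>\<Gamma>. P (\<gamma> (\<delta> y))) = (\<Sum>\<gamma>\<in>\<Gamma>. P (\<gamma> y))" if "\<delta> \<in> \<Gamma>" for \<delta> y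
  proof -
    have "inj_on (\<lambda>\<gamma>. \<gamma> \<circ> \<delta>) \<Gamma>" using grp(1)[OF that] fin by (simp add: eq_card_imp_inj_on)
    then have "(\<Sum>\<gamma>\<in>(\<lambda>\<gamma>. \<gamma> \<circ> \<delta>) ` \<Gamma>. P (\<gamma> y)) = (\<Sum>\<gamma>\<in>\<Gamma>. P (\<gamma> (\<delta> y)))"
      by (subst sum.reindex) auto
    then show ?thesis using grp(1)[OF that] by simp
  qed
  have r2: "(\<Sum>\<gamma>\<in>\<Gamma>. P (\<delta> (\<gamma> y))) = (\<Sum>\<gamma>\<in>\<Gamma>. P (\<gamma> y))" if "\<delta> \<in> \<Gamma>" for \<delta> y
  proof -
    have "inj_on (\<lambda>\<gamma>. \<delta> \<circ> \<gamma>) \<Gamma>" using grp(2)[OF that] fin by (simp add: eq_card_imp_inj_on)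
    then have "(\<Sum>\<gamma>\<in>(\<lambda>\<gamma>. \<delta> \<circ> \<gamma>) ` \<Gamma>. P (\<gamma> y)) = (\<Sum>\<gamma>\<in>\<Gamma>. P (\<delta> (\<gamma> y)))"
      by (subst sum.reindex) auto
    then show ?thesis using grp(2)[OF that] by simp
  qed
  have U: "is_average A \<Gamma> P U"
    unfolding is_average_def
  proof (intro conjI exI[of _ \<Gamma>] exI[of _ "\<lambda>_. 1 / real (card \<Gamma>)"] ballI)
    show "U x = (\<Sum>\<gamma>\<in>\<Gamma>. fps_const (of_real (1 / real (card \<Gamma>))) * P (\<gamma> x))" for x
      by (simp add: U_def sum_distrib_left)
    show "U (\<gamma> x) = U x" if "\<gamma> \<in> \<Gamma>" for \<gamma> x
      by (simp add: U_def r1[OF that])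
  qed (use fin c in auto)
  have un: "R x = U x" if avg: "is_average A \<Gamma> P R" for R
  proof -
    have inv: "\<forall>\<gamma>\<in>\<Gamma>. \<forall>x\<in>A. R (\<gamma> x) = R x"
      using avg unfolding is_average_def by (rule conjunct2)
    have "\<exists>F w. finite F \<and> F \<subseteq> \<Gamma> \<and> (\<forall>\<gamma>\<in>F. w \<gamma> \<ge> (0::real)) \<and> sum w F = 1 \<and>
        (\<forall>x\<in>A. R x = (\<Sum>\<gamma>\<in>F. fps_const (of_real (w \<gamma>)) * P (\<gamma> x)))"
      using avg unfolding is_average_def by (rule conjunct1)
    then obtain F w where F: "finite F" "F \<subseteq> \<Gamma>" "sum w F = (1::real)"
      and R: "\<forall>x\<in>A. R x = (\<Sum>\<gamma>\<in>F. fps_const (of_real (w \<gamma>)) * P (\<gamma> x))"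
      by (elim exE conjE)
    have "of_nat (card \<Gamma>) * R x = (\<Sum>\<delta>\<in>\<Gamma>. R (\<delta> x))"
      using inv x by simp
    also have "\<dots> = (\<Sum>\<delta>\<in>\<Gamma>. \<Sum>\<gamma>\<in>F. fps_const (of_real (w \<gamma>)) * P (\<gamma> (\<delta> x)))"
      using R A x by (intro sum.cong) auto
    also have "\<dots> = (\<Sum>\<gamma>\<in>F. fps_const (of_real (w \<gamma>)) * (\<Sum>\<delta>\<in>\<Gamma>. P (\<gamma> (\<delta> x))))"
      by (subst sum.swap) (simp add: sum_distrib_left)
    also have "\<dots> = (\<Sum>\<gamma>\<in>F. fps_const (of_real (w \<gamma>)) * (\<Sum>\<delta>\<in>\<Gamma>. P (\<delta> x)))"
      using r2 F by (intro sum.cong) auto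
    also have "\<dots> = (\<Sum>\<gamma>\<in>F. fps_const (of_real (w \<gamma>))) * (\<Sum>\<delta>\<in>\<Gamma>. P (\<delta> x))"
      by (simp add: sum_distrib_right)
    also have "(\<Sum>\<gamma>\<in>F. fps_const (of_real (w \<gamma>))) = (fps_const (of_real (sum w F)) :: 'k fps)"
      by (simp add: fps_eq_iff fps_sum_nth)
    finally have e: "of_nat (card \<Gamma>) * R x = (\<Sum>\<delta>\<in>\<Gamma>. P (\<delta> x))" using F by simp
    have "U x = fps_const (1 / of_nat (card \<Gamma>)) * (fps_const (of_nat (card \<Gamma>)) * R x)"
      unfolding U_def e[symmetric] by (simp add: fps_of_nat)
    also have "\<dots> = R x" using c by (simp add: mult.assoc[symmetric])
    finally show ?thesis by simp
  qed
  have "average A \<Gamma> P x = U x"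
    unfolding average_def
  proof (rule the_equality)
    show "\<exists>R. is_average A \<Gamma> P R \<and> U x = R x" using U by (intro exI[of _ U]) simp
  next
    fix r assume "\<exists>R. is_average A \<Gamma> P R \<and> r = R x"
    then show "r = U x" using un by (elim exE conjE) simp
  qed
  then show ?thesis by (simp add: U_def)
qed

definition ad_average ::
    "nat \<Rightarrow> nat \<Rightarrow> nat \<Rightarrow> nat \<Rightarrow> ('k::real_normed_field lie list \<Rightarrow> 'k fps) \<Rightarrow> 'k lie list \<Rightarrow> 'k fps" where
  "ad_average n a b k = average {xs. length xs = k \<and> set xs \<subseteq> lie_alg n a b}
                                ((\<lambda>g. map (Ad g)) ` adj_group n a b)"

subsection \<open>The right-hand side\<close>

definition A_series :: "'k::field_char_0 fps" where
  "A_series = (fps_const (1/2) * fps_X) / (fps_const (1/2) * (fps_exp (1/2) - fps_exp (-(1/2))))"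

definition cosh_series :: "'k::field_char_0 fps" where
  "cosh_series = fps_const (1/2) * (fps_exp (1/2) + fps_exp (-(1/2)))"

text \<open>
  Power series in \<open>x\<close> are represented by their restriction to the ray \<open>\<tau> x\<close>, as series in a second
  formal variable \<open>\<tau>\<close> with coefficients in \<open>'k fps\<close>. Accordingly \<open>scaled f c\<close> is \<open>f(\<hbar> \<tau> c)\<close>,
  and \<open>scaled_mat f X\<close> is the matrix \<open>f(\<hbar> \<tau> X)\<close>.
\<close>

definition scaled :: "'k::comm_ring_1 fps \<Rightarrow> 'k \<Rightarrow> 'k fps fps" where
  "scaled f c = Abs_fps (\<lambda>k. fps_const (fps_nth f k * c ^ k) * fps_X ^ k)"

definition scaled_mat :: "'k::comm_ring_1 fps \<Rightarrow> 'k mat \<Rightarrow> 'k fps fps mat" where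
  "scaled_mat f X = mat (dim_row X) (dim_row X)
     (\<lambda>ij. Abs_fps (\<lambda>k. fps_const (fps_nth f k * (X ^\<^sub>m k) $$ ij) * fps_X ^ k))"

definition sqrt_series :: "'r::comm_ring_1 fps \<Rightarrow> 'r fps" where
  "sqrt_series f = (THE s. fps_nth s 0 = 1 \<and> s * s = f)"

definition scaled_exp :: "'k::field_char_0 \<Rightarrow> 'k fps fps" where
  "scaled_exp z = Abs_fps (\<lambda>k. fps_const (z ^ k / fact k))"

text \<open>
  On the chosen Cartan subalgebra \<open>y\<close> has eigenvalues \<open>\<plusminus>\<lambda>\<^sub>i\<close>, \<open>\<plusminus>\<i> \<kappa>\<^sub>i\<close> (and 0), so that
  \<open>cosh (\<hbar> y / 2)\<close> accounts for both kinds of factors of the \<open>BC\<close> genus: see lemmas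
  \<open>genus_cartan\<close> and \<open>genus_Ad\<close>.
\<close>

fun genus :: "'k::field_char_0 lie \<Rightarrow> 'k fps fps" where
  "genus (X, Y, z) = sqrt_series (Determinant.det (scaled_mat A_series X) *
                                  Determinant.det (scaled_mat cosh_series Y)) * scaled_exp z"

text \<open>
  The element \<open>x\<close> with \<open>\<Phi>(x) = \<Sum>\<^sub>i \<gamma>\<^sub>i q\<^sub>i p\<^sub>i + \<Sum>\<^sub>i l\<^sub>i \<eta>\<^sub>i \<zeta>\<^sub>i - \<Sum>\<^sub>i \<kappa>\<^sub>i \<xi>\<^sub>i \<mu>\<^sub>i + z\<close>,
  written as matrices of its action on the linear generators.
\<close>

fun cartan_elem ::
    "nat \<Rightarrow> nat \<Rightarrow> nat \<Rightarrow> (nat \<Rightarrow> 'k) \<Rightarrow> (nat \<Rightarrow> 'k) \<Rightarrow> (nat \<Rightarrow> 'k) \<Rightarrow> 'k \<Rightarrow> 'k::comm_ring_1 lie" where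
  "cartan_elem n a b \<gamma> l \<kappa> z =
     (mat (2 * n) (2 * n) (\<lambda>(i, j). if i \<noteq> j then 0 else if i < n then - \<gamma> i else \<gamma> (i - n)),
      mat (a + b) (a + b) (\<lambda>(u, w).
        if u < 2 * a then (if u \<noteq> w then 0 else if even u then - l (u div 2) else l (u div 2))
        else if even u \<and> w = u + 1 then \<kappa> ((u - 2 * a) div 2)
        else if odd u \<and> u = w + 1 then - \<kappa> ((u - 2 * a) div 2)
        else 0),
      z)"

lemma A_series_mult: "A_series * (fps_exp (1/2) - fps_exp (-(1/2))) = (fps_X :: 'k::field_char_0 fps)"
proof -
  let ?D = "fps_exp (1/2) - fps_exp (-(1/2)) :: 'k fps"
  have D1: "fps_nth ?D 1 = 1" by (simp add: fps_exp_def)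
  have "?D \<noteq> 0" using D1 by (metis fps_zero_nth zero_neq_one)
  moreover have "subdegree ?D = 1"
    by (rule subdegreeI) (use D1 in \<open>auto simp: fps_exp_def\<close>)
  ultimately have "(fps_const (1/2) * ?D) dvd (fps_const (1/2) * fps_X)"
    by (simp add: fps_dvd_iff)
  then have "A_series * (fps_const (1/2) * ?D) = fps_const (1/2) * fps_X"
    unfolding A_series_def by (rule dvd_div_mult_self)
  then have "fps_const (1/2) * (A_series * ?D) = fps_const (1/2) * fps_X"
    by (simp add: mult.left_commute)
  then show ?thesis by simp
qed

lemma A_series_0: "fps_nth A_series 0 = (1 :: 'k::field_char_0)"
proof -
  have "fps_nth (A_series * (fps_exp (1/2) - fps_exp (-(1/2)))) 1 = fps_nth (fps_X :: 'k fps) 1"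
    by (simp only: A_series_mult)
  then show ?thesis by (simp add: fps_mult_nth fps_exp_def)
qed

lemma A_series_odd: "odd k \<Longrightarrow> fps_nth A_series k = (0 :: 'k::field_char_0)"
proof -
  assume k: "odd k"
  let ?D = "fps_exp (1/2) - fps_exp (-(1/2)) :: 'k fps"
  define B :: "'k fps" where "B = A_series oo (- fps_X)"
  have Dm: "?D oo (- fps_X) = - ?D"
    by (rule fps_ext) (auto simp: fps_compose_uminus' fps_exp_def power_minus[of "1/2"] minus_one_power_iff)
  have "B * (?D oo (- fps_X)) = (fps_X oo (- fps_X))"
    unfolding B_def by (subst fps_compose_mult_distrib[symmetric]) (simp_all add: A_series_mult)
  then have "B * (- ?D) = - fps_X" unfolding Dm by simp
  then have "B * ?D = A_series * ?D"
    unfolding A_series_mult[where 'k='k] by (simp only: mult_minus_right neg_equal_iff_equal)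
  moreover have "?D \<noteq> 0"
    using A_series_mult[where 'k='k] by auto
  ultimately have "B = A_series" by simp
  then have "fps_nth B k = fps_nth A_series k" by simp
  moreover have "fps_nth B k = - fps_nth A_series k"
    using k by (simp add: B_def fps_compose_uminus')
  ultimately have "2 * fps_nth A_series k = (0 :: 'k)" by simp
  then show ?thesis by simp
qed

lemma cosh_series_nth: "fps_nth cosh_series k = (if even k then (1/2) ^ k / fact k else (0 :: 'k::field_char_0))"
  by (auto simp: cosh_series_def fps_exp_def power_minus[of "1/2"])

lemma scaled_even_power:
  fixes X :: "'k::comm_ring_1 mat"
  assumes X: "X \<in> carrier_mat m m" and sq: "X * X = mat_diag m d"
  shows "X ^\<^sub>m (2 * k) = mat_diag m (\<lambda>i. d i ^ k)"
proof (induction k)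
  case 0
  then show ?case using X by simp
next
  case (Suc k)
  have "X ^\<^sub>m (2 * Suc k) = X ^\<^sub>m (2 * k) * X * X" by simp
  also have "\<dots> = X ^\<^sub>m (2 * k) * (X * X)"
    using X by (intro assoc_mult_mat) auto
  also have "\<dots> = mat_diag m (\<lambda>i. d i ^ Suc k)"
    unfolding Suc.IH sq by (simp add: mult.commute)
  finally show ?case .
qed

lemma det_scaled_even:
  fixes X :: "'k::field_char_0 mat"
  assumes X: "X \<in> carrier_mat m m" and sq: "X * X = mat_diag m d"
    and f: "\<And>k. odd k \<Longrightarrow> fps_nth f k = 0"
  shows "Determinant.det (scaled_mat f X) =
    (\<Prod>i<m. Abs_fps (\<lambda>k. fps_const (fps_nth f k * d i ^ (k div 2)) * fps_X ^ k))"
proof -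
  have ent: "fps_nth f k * (X ^\<^sub>m k) $$ (i, j) = (if i = j then fps_nth f k * d i ^ (k div 2) else 0)"
    if "i < m" "j < m" for i j k
  proof (cases "even k")
    case True
    then obtain l where l: "k = 2 * l" by blast
    show ?thesis unfolding l scaled_even_power[OF X sq] using that by (simp add: mat_diag_def)
  qed (simp add: f)
  have S: "scaled_mat f X = mat_diag m (\<lambda>i. Abs_fps (\<lambda>k. fps_const (fps_nth f k * d i ^ (k div 2)) * fps_X ^ k))"
    using X by (intro eq_matI) (auto simp: scaled_mat_def mat_diag_def ent fps_eq_iff)
  have "upper_triangular (scaled_mat f X)" unfolding S upper_triangular_def mat_diag_def by auto
  then have "Determinant.det (scaled_mat f X) = prod_list (diag_mat (scaled_mat f X))"
    by (rule det_upper_triangular[of _ m]) (simp add: S)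
  then show ?thesis
    unfolding S by (simp add: prod_list_diag_prod mat_diag_def lessThan_atLeast0)
qed

lemma sqrt_series_unique:
  fixes s :: "'r::idom fps"
  assumes s: "fps_nth s 0 = 1" "s * s = f" and two: "(2::'r) \<noteq> 0"
  shows "sqrt_series f = s"
  unfolding sqrt_series_def
proof (rule the_equality)
  fix r assume r: "fps_nth r 0 = 1 \<and> r * r = f"
  then have "(r - s) * (r + s) = 0" using s by (simp add: algebra_simps)
  moreover have "fps_nth (r + s) 0 \<noteq> 0" using r s two by simp
  then have "r + s \<noteq> 0" by (metis fps_zero_nth)
  ultimately show "r = s" by simp
qed (use s in simp)

lemma prod_double: "(\<Prod>i<2 * m. f (i div 2)) = (\<Prod>i<m. f i) * (\<Prod>i<m. f i :: 'r::comm_ring_1)" for m :: nat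
  by (induction m) (auto simp: algebra_simps)

lemma prod_split: "(\<Prod>i<k + m. f i) = (\<Prod>i<k. f i) * (\<Prod>i<m. f (k + i) :: 'r::comm_ring_1)" for k m :: nat
  by (induction m) (auto simp: algebra_simps)

lemma genus_cartan:
  fixes \<gamma> l \<kappa> :: "nat \<Rightarrow> 'k::field_char_0"
  assumes "a \<le> b" and "c = (b - a) div 2"
  shows "genus (cartan_elem n a b \<gamma> l \<kappa> z) =
    scaled_exp z * (\<Prod>i<n. scaled A_series (\<gamma> i)) *
    (\<Prod>i<a. scaled cosh_series (l i)) * (\<Prod>i<c. scaled (fps_cos (1/2)) (\<kappa> i))"
proof -
  obtain X Y where XY: "cartan_elem n a b \<gamma> l \<kappa> z = (X, Y, z)" by simp
  have X: "X \<in> carrier_mat (2 * n) (2 * n)" and Y: "Y \<in> carrier_mat (a + b) (a + b)"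
    using XY by auto
  have X2: "X * X = mat_diag (2 * n) (\<lambda>i. if i < n then \<gamma> i ^ 2 else \<gamma> (i - n) ^ 2)"
  proof -
    have "X = mat_diag (2 * n) (\<lambda>i. if i < n then - \<gamma> i else \<gamma> (i - n))"
      using XY by (intro eq_matI) (auto simp: mat_diag_def)
    then show ?thesis
      by (simp add: if_distrib power2_eq_square cong: if_cong)
  qed
  have Y2: "Y * Y = mat_diag (a + b) (\<lambda>u. if u < 2 * a then l (u div 2) ^ 2
       else if u < 2 * a + 2 * c then - (\<kappa> ((u - 2 * a) div 2) ^ 2) else 0)"
  proof (rule eq_matI)
    define p where "p u = (if u < 2 * a then u else if even u then u + 1 else u - 1)" for u :: nat
    define y where "y u = (if u < 2 * a then (if even u then - l (u div 2) else l (u div 2))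
        else if even u then \<kappa> ((u - 2 * a) div 2) else - \<kappa> ((u - 2 * a) div 2))" for u :: nat
    have Yu: "Y $$ (u, w) = (if w = p u then y u else 0)" if "u < a + b" "w < a + b" for u w
      using XY that by (auto simp: p_def y_def elim!: oddE)
    have sum: "(Y * Y) $$ (u, w) = (if p u < a + b \<and> w = p (p u) then y u * y (p u) else 0)"
      if "u < a + b" "w < a + b" for u w
    proof -
      have "(Y * Y) $$ (u, w) = (\<Sum>k<a + b. Y $$ (u, k) * Y $$ (k, w))"
        using Y that by (simp add: scalar_prod_def lessThan_atLeast0)
      also have "\<dots> = (\<Sum>k<a + b. if k = p u then y u * (if w = p k then y k else 0) else 0)"
        using that by (intro sum.cong) (auto simp: Yu)
      also have "\<dots> = (if p u < a + b then y u * (if w = p (p u) then y (p u) else 0) else 0)"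
        by simp
      finally show ?thesis by simp
    qed
    have pp: "p (p u) = u" for u
      by (auto simp: p_def elim!: oddE)
    have pu: "p u < a + b \<longleftrightarrow> u < 2 * a + 2 * c" if "u < a + b" for u
      using assms that by (auto simp: p_def elim!: oddE evenE) presburger+
    have yy: "y u * y (p u) = (if u < 2 * a then l (u div 2) ^ 2 else - (\<kappa> ((u - 2 * a) div 2) ^ 2))" for u
    proof (cases "u < 2 * a")
      case False
      then obtain k where "u = 2 * a + k" using le_Suc_ex not_less by blast
      then show ?thesis
        by (cases "even k") (auto simp: y_def p_def power2_eq_square elim!: oddE evenE)
    qed (auto simp: y_def p_def power2_eq_square)
    fix u w assume "u < dim_row (mat_diag (a + b) (\<lambda>u. if u < 2 * a then l (u div 2) ^ 2
       else if u < 2 * a + 2 * c then - (\<kappa> ((u - 2 * a) div 2) ^ 2) else 0))"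
     "w < dim_col (mat_diag (a + b) (\<lambda>u. if u < 2 * a then l (u div 2) ^ 2
       else if u < 2 * a + 2 * c then - (\<kappa> ((u - 2 * a) div 2) ^ 2) else 0))"
    then have uw: "u < a + b" "w < a + b" by (auto simp: mat_diag_def)
    show "(Y * Y) $$ (u, w) = mat_diag (a + b) (\<lambda>u. if u < 2 * a then l (u div 2) ^ 2
       else if u < 2 * a + 2 * c then - (\<kappa> ((u - 2 * a) div 2) ^ 2) else 0) $$ (u, w)"
      unfolding sum[OF uw] pp pu[OF uw(1)] yy using uw by (auto simp: mat_diag_def)
  qed (use Y in \<open>auto simp: mat_diag_def\<close>)
  define PA where "PA = (\<Prod>i<n. scaled A_series (\<gamma> i))"
  define PB where "PB = (\<Prod>i<a. scaled cosh_series (l i))"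
  define PC where "PC = (\<Prod>i<c. scaled (fps_cos (1/2)) (\<kappa> i))"
  have sc: "Abs_fps (\<lambda>k. fps_const (fps_nth f k * (x ^ 2) ^ (k div 2)) * fps_X ^ k) = scaled f x"
    if "\<And>k. odd k \<Longrightarrow> fps_nth f k = 0" for f and x :: 'k
  proof -
    have "fps_nth f k * (x ^ 2) ^ (k div 2) = fps_nth f k * x ^ k" for k
      using that[of k] by (cases "even k") (auto simp flip: power_mult)
    then show ?thesis unfolding scaled_def by (simp only:)
  qed
  have sco: "Abs_fps (\<lambda>k. fps_const (fps_nth cosh_series k * (- (x ^ 2)) ^ (k div 2)) * fps_X ^ k) =
     scaled (fps_cos (1/2)) x" for x :: 'k
  proof -
    have "fps_nth cosh_series k * (- (x ^ 2)) ^ (k div 2) = fps_nth (fps_cos (1/2)) k * x ^ k" for k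
      by (auto simp: cosh_series_nth fps_cos_def power_minus[of "x^2"] simp flip: power_mult)
    then show ?thesis unfolding scaled_def by (simp only:)
  qed
  have s0: "Abs_fps (\<lambda>k. fps_const (fps_nth cosh_series k * 0 ^ (k div 2)) * fps_X ^ k) = (1 :: 'k fps fps)"
  proof (rule fps_ext)
    fix k show "fps_nth (Abs_fps (\<lambda>k. fps_const (fps_nth cosh_series k * 0 ^ (k div 2)) * fps_X ^ k)) k = fps_nth (1 :: 'k fps fps) k"
      by (cases "k = 0"; cases "k = 1") (auto simp: cosh_series_nth power_0_left div_eq_0_iff)
  qed
  have dA: "Determinant.det (scaled_mat A_series X) = PA * PA"
  proof -
    define E where "E i = Abs_fps (\<lambda>k. fps_const (fps_nth A_series k *
      (if i < n then \<gamma> i ^ 2 else \<gamma> (i - n) ^ 2) ^ (k div 2)) * fps_X ^ k)" for i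
    have "Determinant.det (scaled_mat A_series X) = (\<Prod>i<n + n. E i)"
      unfolding E_def mult_2[symmetric] by (rule det_scaled_even[OF X X2]) (rule A_series_odd)
    also have "\<dots> = (\<Prod>i<n. E i) * (\<Prod>i<n. E (n + i))"
      by (rule prod_split)
    also have "(\<Prod>i<n. E i) = PA"
      unfolding PA_def by (intro prod.cong) (auto simp: E_def sc[OF A_series_odd])
    also have "(\<Prod>i<n. E (n + i)) = PA"
      unfolding PA_def by (intro prod.cong) (auto simp: E_def sc[OF A_series_odd])
    finally show ?thesis .
  qed
  have dB: "Determinant.det (scaled_mat cosh_series Y) = PB * PB * (PC * PC)"
  proof -
    define r where "r = a + b - (2 * a + 2 * c)"
    have ab: "a + b = 2 * a + (2 * c + r)" using assms by (simp add: r_def)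
    let ?d = "\<lambda>u. if u < 2 * a then l (u div 2) ^ 2
       else if u < 2 * a + 2 * c then - (\<kappa> ((u - 2 * a) div 2) ^ 2) else 0"
    define E where "E u = Abs_fps (\<lambda>k. fps_const (fps_nth cosh_series k * ?d u ^ (k div 2)) * fps_X ^ k)" for u
    have o: "odd k \<Longrightarrow> fps_nth cosh_series k = (0 :: 'k)" for k by (simp add: cosh_series_nth)
    have "Determinant.det (scaled_mat cosh_series Y) = (\<Prod>u<2 * a + (2 * c + r). E u)"
      unfolding E_def ab[symmetric] by (rule det_scaled_even[OF Y Y2]) (rule o)
    also have "\<dots> = (\<Prod>u<2 * a. E u) * ((\<Prod>u<2 * c. E (2 * a + u)) * (\<Prod>u<r. E (2 * a + (2 * c + u))))"
      by (simp only: prod_split)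
    also have "(\<Prod>u<2 * a. E u) = (\<Prod>u<2 * a. scaled cosh_series (l (u div 2)))"
      by (intro prod.cong) (auto simp: E_def sc[OF o])
    also have "\<dots> = PB * PB" unfolding PB_def by (rule prod_double)
    also have "(\<Prod>u<2 * c. E (2 * a + u)) = (\<Prod>u<2 * c. scaled (fps_cos (1/2)) (\<kappa> (u div 2)))"
      by (intro prod.cong) (auto simp: E_def sco)
    also have "\<dots> = PC * PC" unfolding PC_def by (rule prod_double)
    also have "(\<Prod>u<r. E (2 * a + (2 * c + u))) = 1"
      by (intro prod.neutral) (auto simp: E_def s0)
    finally show ?thesis by simp
  qed
  have p0: "fps_nth (\<Prod>i<m. F i) 0 = (\<Prod>i<m. fps_nth (F i) 0)" for m and F :: "nat \<Rightarrow> 'k fps fps"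
    by (induction m) simp_all
  have n0: "fps_nth PA 0 = 1" "fps_nth PB 0 = 1" "fps_nth PC 0 = 1"
    by (auto simp: PA_def PB_def PC_def p0 scaled_def A_series_0 cosh_series_nth fps_cos_def)
  have "sqrt_series (PA * PA * (PB * PB * (PC * PC))) = PA * PB * PC"
    by (rule sqrt_series_unique) (auto simp: n0 mult_ac)
  then show ?thesis
    unfolding XY genus.simps dA dB PA_def[symmetric] PB_def[symmetric] PC_def[symmetric] by (simp add: mult_ac)
qed


lemma mat_inv:
  fixes A :: "'k::field mat"
  assumes A: "A \<in> carrier_mat m m" and d: "Determinant.det A \<noteq> 0"
  shows "mat_inv A \<in> carrier_mat m m" "A * mat_inv A = 1\<^sub>m m" "mat_inv A * A = 1\<^sub>m m"
proof -
  have "A \<in> Units (ring_mat TYPE('k) m ())" by (rule det_non_zero_imp_unit[OF A d])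
  then obtain B where B: "B \<in> carrier_mat m m" "A * B = 1\<^sub>m m" "B * A = 1\<^sub>m m"
    by (auto simp: Units_def ring_mat_def)
  have "mat_inv A = B"
    unfolding mat_inv_def
  proof (rule the_equality)
    fix C assume "C \<in> carrier_mat (dim_row A) (dim_row A) \<and> A * C = 1\<^sub>m (dim_row A) \<and> C * A = 1\<^sub>m (dim_row A)"
    then have C: "C \<in> carrier_mat m m" "C * A = 1\<^sub>m m" using A by auto
    have "C = C * (A * B)" unfolding B(2) using C(1) by simp
    also have "\<dots> = C * A * B" by (rule assoc_mult_mat[symmetric]) (use A B C in auto)
    also have "\<dots> = B" unfolding C(2) using B(1) by simp
    finally show "C = B" .
  qed (use A B in auto)
  then show "mat_inv A \<in> carrier_mat m m" "A * mat_inv A = 1\<^sub>m m" "mat_inv A * A = 1\<^sub>m m"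
    using B by auto
qed

lemma mat_mult_entry:
  assumes "A \<in> carrier_mat m m" "B \<in> carrier_mat m m" "i < m" "j < m"
  shows "(A * B) $$ (i, j) = (\<Sum>q<m. A $$ (i, q) * B $$ (q, j))"
  using assms by (simp add: scalar_prod_def lessThan_atLeast0)

lemma det_scaled_conj:
  fixes g X :: "'k::field_char_0 mat"
  assumes g: "g \<in> carrier_mat m m" "g' \<in> carrier_mat m m" "g * g' = 1\<^sub>m m" "g' * g = 1\<^sub>m m"
    and X: "X \<in> carrier_mat m m"
  shows "Determinant.det (scaled_mat f (g * X * g')) = Determinant.det (scaled_mat f X)"
proof -
  interpret h: comm_ring_hom "\<lambda>x::'k. fps_const (fps_const x)"
    by unfold_locales simp_all
  let ?h = "map_mat (\<lambda>x::'k. fps_const (fps_const x))"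
  have sim: "similar_mat_wit (g * X * g') X g g'"
    using g X by (intro similar_mat_witI[of _ _ m]) auto
  have pow: "(g * X * g') ^\<^sub>m k = g * X ^\<^sub>m k * g'" for k
    by (rule similar_mat_wit_pow_id[OF sim])
  have S: "scaled_mat f X \<in> carrier_mat m m" using X by (simp add: scaled_mat_def)
  have "scaled_mat f (g * X * g') = ?h g * scaled_mat f X * ?h g'"
  proof (rule eq_matI)
    fix i j assume "i < dim_row (?h g * scaled_mat f X * ?h g')" "j < dim_col (?h g * scaled_mat f X * ?h g')"
    then have ij: "i < m" "j < m" using g by auto
    have P: "X ^\<^sub>m k \<in> carrier_mat m m" for k using X by simp
    have e: "(g * X ^\<^sub>m k * g') $$ (i, j) = (\<Sum>q<m. (\<Sum>p<m. g $$ (i, p) * (X ^\<^sub>m k) $$ (p, q)) * g' $$ (q, j))" for k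
      by (subst mat_mult_entry[of _ m]) (use g P[of k] ij in \<open>auto simp: mat_mult_entry[of _ m] simp del: index_mult_mat(1)\<close>)
    have "(?h g * scaled_mat f X * ?h g') $$ (i, j) =
      (\<Sum>q<m. (\<Sum>p<m. fps_const (fps_const (g $$ (i, p))) * scaled_mat f X $$ (p, q)) * fps_const (fps_const (g' $$ (q, j))))"
      by (subst mat_mult_entry[of _ m]) (use g S ij in \<open>auto simp: mat_mult_entry[of _ m] simp del: index_mult_mat(1)\<close>)
    also have "\<dots> = scaled_mat f (g * X * g') $$ (i, j)"
    proof (intro fps_ext)
      fix k n
      have "fps_nth (fps_nth (\<Sum>q<m. (\<Sum>p<m. fps_const (fps_const (g $$ (i, p))) * scaled_mat f X $$ (p, q)) * fps_const (fps_const (g' $$ (q, j)))) k) n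
        = (\<Sum>q<m. (\<Sum>p<m. g $$ (i, p) * (fps_nth f k * (X ^\<^sub>m k) $$ (p, q) * (if n = k then 1 else 0))) * g' $$ (q, j))"
        using X by (auto simp: fps_sum_nth scaled_mat_def fps_X_power_nth intro!: sum.cong)
      also have "\<dots> = fps_nth f k * (\<Sum>q<m. (\<Sum>p<m. g $$ (i, p) * (X ^\<^sub>m k) $$ (p, q)) * g' $$ (q, j)) * (if n = k then 1 else 0)"
        by (auto simp: sum_distrib_left sum_distrib_right mult_ac)
      also have "\<dots> = fps_nth (fps_nth (scaled_mat f (g * X * g') $$ (i, j)) k) n"
        using g ij by (simp add: scaled_mat_def pow e fps_X_power_nth)
      finally show "fps_nth (fps_nth (\<Sum>q<m. (\<Sum>p<m. fps_const (fps_const (g $$ (i, p))) * scaled_mat f X $$ (p, q)) * fps_const (fps_const (g' $$ (q, j)))) k) n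
        = fps_nth (fps_nth (scaled_mat f (g * X * g') $$ (i, j)) k) n" .
    qed
    finally show "scaled_mat f (g * X * g') $$ (i, j) = (?h g * scaled_mat f X * ?h g') $$ (i, j)" ..
  qed (use g X in \<open>auto simp: scaled_mat_def\<close>)
  then have "Determinant.det (scaled_mat f (g * X * g')) =
     Determinant.det (?h g) * Determinant.det (scaled_mat f X) * Determinant.det (?h g')"
    using g S by (simp add: det_mult[of _ m])
  moreover have "Determinant.det (?h g) * Determinant.det (?h g') = 1"
  proof -
    have "Determinant.det g * Determinant.det g' = 1"
      using g det_mult[of g m g'] by simp
    then show ?thesis by (simp add: h.hom_det)
  qed
  ultimately show ?thesis by (simp add: mult_ac)
qed

lemma symp_form_square: "symp_form n * symp_form n = (- 1\<^sub>m (2 * n) :: 'k::comm_ring_1 mat)"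
proof (rule eq_matI)
  fix i j assume "i < dim_row (- 1\<^sub>m (2 * n) :: 'k mat)" "j < dim_col (- 1\<^sub>m (2 * n) :: 'k mat)"
  then have ij: "i < 2 * n" "j < 2 * n" by auto
  define p where "p i = (if i < n then n + i else i - n)" for i
  have J: "symp_form n $$ (i, k) = (if k = p i then (if i < n then 1 else -1) else (0::'k))" if "i < 2 * n" "k < 2 * n" for i k
    using that by (auto simp: symp_form_def p_def)
  have p: "p i < 2 * n" "p (p i) = i" "p i < n \<longleftrightarrow> \<not> i < n" using ij by (auto simp: p_def)
  have "(symp_form n * symp_form n) $$ (i, j) = (\<Sum>k<2 * n. symp_form n $$ (i, k) * (symp_form n $$ (k, j) :: 'k))"
    using ij by (simp add: symp_form_def scalar_prod_def lessThan_atLeast0)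
  also have "\<dots> = (\<Sum>k<2 * n. if k = p i then (if i < n then 1 else -1) * symp_form n $$ (k, j) else 0)"
    using ij by (intro sum.cong) (auto simp: J)
  also have "\<dots> = (if i < n then 1 else -1) * symp_form n $$ (p i, j)"
    using p by simp
  also have "\<dots> = (- 1\<^sub>m (2 * n)) $$ (i, j)"
    using p ij by (auto simp: J)
  finally show "(symp_form n * symp_form n) $$ (i, j) = (- 1\<^sub>m (2 * n) :: 'k mat) $$ (i, j)" .
qed (auto simp: symp_form_def)

lemma Sp_det:
  fixes g :: "'k::field mat"
  assumes "g \<in> Sp_group n"
  shows "Determinant.det g \<noteq> 0"
proof
  assume d: "Determinant.det g = 0"
  have J: "symp_form n \<in> carrier_mat (2 * n) (2 * n)" by (simp add: symp_form_def)
  have g: "g \<in> carrier_mat (2 * n) (2 * n)" "transpose_mat g * symp_form n * g = symp_form n"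
    using assms by (auto simp: Sp_group_def)
  have "Determinant.det (transpose_mat g * symp_form n * g) = 0"
    by (subst det_mult[of _ "2 * n"]) (use g(1) J d in \<open>auto intro!: mult_carrier_mat\<close>)
  then have "Determinant.det (symp_form n :: 'k mat) = 0" using g(2) by simp
  then have "Determinant.det (- 1\<^sub>m (2 * n) :: 'k mat) = 0"
    unfolding symp_form_square[symmetric] by (subst det_mult[OF J J]) simp
  moreover have "(- 1\<^sub>m (2 * n) :: 'k mat) * (- 1\<^sub>m (2 * n)) = 1\<^sub>m (2 * n)"
    by simp
  then have "Determinant.det (- 1\<^sub>m (2 * n) :: 'k mat) * Determinant.det (- 1\<^sub>m (2 * n) :: 'k mat) = 1"
    by (metis det_mult det_one one_carrier_mat uminus_carrier_iff_mat)
  ultimately show False by simp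
qed

lemma genus_Ad:
  assumes "g \<in> adj_group n a b" and "x \<in> lie_alg n a b"
  shows "genus (Ad g x) = genus x"
proof -
  obtain g1 g2 g3 X Y z where gx: "g = (g1, g2, g3)" "x = (X, Y, z)" by (metis prod_cases3)
  have g1: "g1 \<in> carrier_mat (2 * n) (2 * n)" "Determinant.det g1 \<noteq> 0"
    and g2: "g2 \<in> carrier_mat (a + b) (a + b)" "Determinant.det g2 \<noteq> 0"
    and X: "X \<in> carrier_mat (2 * n) (2 * n)" and Y: "Y \<in> carrier_mat (a + b) (a + b)"
    using assms Sp_det by (auto simp: gx adj_group_def lie_alg_def Sp_group_def SO_group_def sp_lie_def so_lie_def)
  show ?thesis
    unfolding gx Ad.simps genus.simps det_scaled_conj[OF g1(1) mat_inv[OF g1] X] det_scaled_conj[OF g2(1) mat_inv[OF g2] Y] ..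
qed

text \<open>
  The homogeneous piece of degree \<open>n\<close>. As usual in Chern--Weil theory it is regarded as an element of
  the \<open>n\<close>-th symmetric power of the dual of the Lie algebra, that is, as the symmetric \<open>n\<close>-linear form
  \<open>F\<^sub>n\<close> with \<open>F(x) = \<Sum>\<^sub>n F\<^sub>n(x, \<dots>, x) / n!\<close>; \<open>degree_form n F\<close> is the value
  \<open>F\<^sub>n(x, \<dots>, x)\<close> for the series \<open>F(\<tau> x)\<close> in \<open>\<tau>\<close>. With this normalization the piece of
  \<open>e\<^sup>x\<close> is \<open>x\<^sup>n\<close>.
\<close>

definition degree_form :: "nat \<Rightarrow> 'r::comm_ring_1 fps \<Rightarrow> 'r" where
  "degree_form n F = of_nat (fact n) * fps_nth F n"

end

theory Submission
  imports Defs "HOL-Library.Function_Algebras"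
begin

text \<open>
  The functional \<open>t \<mapsto> \<Upsilon> (exp (\<Sum> \<hbar> \<psi> (\<alpha> + g)) t)\<close> satisfies Wick's theorem: multiplication by a
  linear generator in slot \<open>x\<close> may be replaced by derivatives in the other slots, weighted by a
  propagator. Since every \<open>\<Phi>(x)\<close> is quadratic plus constant, the expression expands into closed loops
  that involve the Lie algebra elements only through traces of products. These are invariant under
  conjugation, so averaging does nothing. On the diagonal each loop of length \<open>m\<close> contributes
  \<open>tr (X\<^sup>m)\<close> times an \<open>m\<close>-fold convolution of the propagator on the circle. The even propagator is a
  Bernoulli kernel, the odd one a sign (Euler) kernel; with \<open>\<sigma> = 1\<close> resp. \<open>\<sigma> = -1\<close> both convolution powers
  are given by \<open>z e\<^sup>x\<^sup>z / (e\<^sup>z - \<sigma>)\<close>, and their values at 0 are, up to sign, the Taylor coefficients of the logarithmic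
  derivatives of \<open>(t/2) / sinh (t/2)\<close> and \<open>cosh (t/2)\<close>. Opening the loop through one vertex gives the
  recursion that Jacobi's formula for the derivative of a determinant yields for the genus.
\<close>

text \<open>As simp rules these turn \<open>f + g\<close> into \<open>\<lambda>x. f x + g x\<close> under binders and destroy the linear structure.\<close>

declare plus_fun_apply [simp del] zero_fun_apply [simp del] minus_apply [simp del] uminus_apply [simp del]

subsection \<open>Creation and annihilation operators\<close>

text \<open>No graph is ever enumerated. Two mutually recursive families carry the argument: the
  value \<open>Wx\<close> of a list of vertices, and the value \<open>Te\<close> or
  \<open>To\<close> of an open chain between two slots while some vertices are still free.
  Dependence on traces only, boundedness and measurability in the integration variables, locality in
  them, and finally the integral itself are all read off from the same recursions by induction on
  the number of free vertices. For this the number of slots and the list of vertices present are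
  kept apart: removing a vertex changes neither the slots nor the propagators. The exponent pairs
  distinct slots only, so no vertex is contracted with itself and loops have length at least two.
  The obstacle is the odd sector: slot 0 holds \<open>Theta\<close>, and the Berezin integral does
  not annihilate multiplication by an odd generator, so the plain Wick rule fails there and the
  propagator must be corrected. The sign \<open>(-1) ^ (a + c)\<close> arises from the empty list of
  vertices alone, the factorial from the orders in which vertices can be inserted into a
  chain.\<close>

definition fin_mono :: "mono \<Rightarrow> bool" where
  "fin_mono m \<longleftrightarrow> finite {v. fst m v \<noteq> 0} \<and> finite (snd m)"

definition good :: "nat \<Rightarrow> mono list \<Rightarrow> bool" where
  "good k ms \<longleftrightarrow> length ms = Suc k \<and> (\<forall>i\<le>k. fin_mono (ms ! i))"

text \<open>The relations below are proved on these tensors only. \<open>card\<close> of an infinite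
  set is 0, which would spoil the Koszul signs; a monomial with infinitely many exponents may have
  infinitely many factorizations, over which a sum is 0 by default; and an update beyond the last
  slot does nothing.\<close>

definition tens :: "nat \<Rightarrow> 'k::comm_ring_1 wc_tensor set" where
  "tens k = {t. \<forall>ms. \<not> good k ms \<longrightarrow> t ms = 0}"

definition sc :: "'k::comm_ring_1 fps \<Rightarrow> 'k wc_tensor \<Rightarrow> 'k wc_tensor" where
  "sc c t = (\<lambda>ms. c * t ms)"

definition expo :: "nat \<Rightarrow> nat \<Rightarrow> mono list \<Rightarrow> nat" where
  "expo i v ms = fst (ms ! i) v"

definition inc :: "nat \<Rightarrow> nat \<Rightarrow> mono list \<Rightarrow> mono list" where
  "inc i v ms = ms[i := ((fst (ms ! i))(v := fst (ms ! i) v + 1), snd (ms ! i))]"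

definition dec :: "nat \<Rightarrow> nat \<Rightarrow> mono list \<Rightarrow> mono list" where
  "dec i v ms = ms[i := ((fst (ms ! i))(v := fst (ms ! i) v - 1), snd (ms ! i))]"

definition occ :: "nat \<Rightarrow> nat \<Rightarrow> mono list \<Rightarrow> bool" where
  "occ i u ms \<longleftrightarrow> u \<in> snd (ms ! i)"

text \<open>Inserting and deleting a generator form one involution. Thus \<open>m_odd\<close> and
  \<open>d_odd\<close> share their index map and their sign, and a single table of sign changes,
  \<open>kos_tog\<close>, settles all the odd relations.\<close>

definition toggle :: "nat \<Rightarrow> nat set \<Rightarrow> nat set" where
  "toggle u S = (if u \<in> S then S - {u} else insert u S)"

definition tog :: "nat \<Rightarrow> nat \<Rightarrow> mono list \<Rightarrow> mono list" where
  "tog i u ms = ms[i := (fst (ms ! i), toggle u (snd (ms ! i)))]"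

definition kos :: "nat \<Rightarrow> nat \<Rightarrow> mono list \<Rightarrow> 'k::comm_ring_1 fps" where
  "kos i u ms = (-1) ^ ((\<Sum>j<i. card (snd (ms ! j))) + card {w \<in> snd (ms ! i). w < u})"

definition m_even :: "nat \<Rightarrow> nat \<Rightarrow> 'k::comm_ring_1 wc_tensor \<Rightarrow> 'k wc_tensor" where
  "m_even i v t ms = (if expo i v ms = 0 then 0 else t (dec i v ms))"

definition m_odd :: "nat \<Rightarrow> nat \<Rightarrow> 'k::comm_ring_1 wc_tensor \<Rightarrow> 'k wc_tensor" where
  "m_odd i u t ms = (if occ i u ms then kos i u ms * t (tog i u ms) else 0)"

lemma d_even_eq: "d_even i v t ms = of_nat (expo i v ms + 1) * t (inc i v ms)"
  by (simp add: d_even_def expo_def inc_def Let_def case_prod_beta)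

lemma d_odd_eq: "d_odd i u t ms = (if occ i u ms then 0 else kos i u ms * t (tog i u ms))"
  by (simp add: d_odd_def occ_def kos_def tog_def toggle_def Let_def case_prod_beta)

lemma sc_apply: "sc c t ms = c * t ms"
  by (simp add: sc_def)

lemma sum_fun_apply: "(\<Sum>x\<in>X. f x) y = (\<Sum>x\<in>X. f x y)"
  by (induction X rule: infinite_finite_induct) (auto simp: plus_fun_apply zero_fun_apply)

lemmas pointwise = plus_fun_apply zero_fun_apply minus_apply uminus_apply sc_apply sum_fun_apply

lemma sc_add_right: "sc c (s + t) = sc c s + sc c t"
  and sc_add_left: "sc (c + c') t = sc c t + sc c' t"
  and sc_sc [simp]: "sc c (sc c' t) = sc (c * c') t"
  and sc_one [simp]: "sc 1 t = t"
  and sc_zero [simp]: "sc 0 t = 0" "sc c 0 = 0"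
  and sc_sum: "sc c (\<Sum>x\<in>X. f x) = (\<Sum>x\<in>X. sc c (f x))"
  and sc_diff_right: "sc c (s - t) = sc c s - sc c t"
  and sc_minus_right: "sc c (- t) = - sc c t"
  and sc_minus_left: "sc (- c) t = - sc c t"
  by (auto simp: fun_eq_iff pointwise algebra_simps sum_distrib_left)

lemma length_ops [simp]:
  "length (inc i v ms) = length ms" "length (dec i v ms) = length ms" "length (tog i u ms) = length ms"
  by (auto simp: inc_def dec_def tog_def)

lemma fin_mono_upd: "fin_mono ((fst m)(v := x), snd m) \<longleftrightarrow> fin_mono m"
proof -
  have "{w. ((fst m)(v := x)) w \<noteq> 0} \<subseteq> insert v {w. fst m w \<noteq> 0}"
    "{w. fst m w \<noteq> 0} \<subseteq> insert v {w. ((fst m)(v := x)) w \<noteq> 0}"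
    by auto
  then have "finite {w. ((fst m)(v := x)) w \<noteq> 0} \<longleftrightarrow> finite {w. fst m w \<noteq> 0}"
    by (meson finite_insert finite_subset)
  then show ?thesis by (simp add: fin_mono_def)
qed

lemma fin_mono_toggle: "fin_mono (fst m, toggle u (snd m)) \<longleftrightarrow> fin_mono m"
  by (simp add: fin_mono_def toggle_def)

lemma good_ops [simp]:
  assumes "i \<le> k"
  shows "good k (inc i v ms) \<longleftrightarrow> good k ms" "good k (dec i v ms) \<longleftrightarrow> good k ms"
    "good k (tog i u ms) \<longleftrightarrow> good k ms"
proof -
  have "good k (ms[i := m]) \<longleftrightarrow> good k ms" if "fin_mono m \<longleftrightarrow> fin_mono (ms ! i)" for m
    using that assms unfolding good_def
    by (metis length_list_update less_Suc_eq_le nth_list_update_eq nth_list_update_neq)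
  then show "good k (inc i v ms) \<longleftrightarrow> good k ms" "good k (dec i v ms) \<longleftrightarrow> good k ms"
    "good k (tog i u ms) \<longleftrightarrow> good k ms"
    by (auto simp: inc_def dec_def tog_def fin_mono_upd fin_mono_toggle)
qed

lemma tensI: "(\<And>ms. \<not> good k ms \<Longrightarrow> t ms = 0) \<Longrightarrow> t \<in> tens k"
  by (simp add: tens_def)

lemma tensD: "t \<in> tens k \<Longrightarrow> \<not> good k ms \<Longrightarrow> t ms = 0"
  by (simp add: tens_def)

lemma tens_eqI:
  assumes "s \<in> tens k" "t \<in> tens k" "\<And>ms. good k ms \<Longrightarrow> s ms = t ms"
  shows "s = t"
  using assms by (intro ext) (metis tensD)

lemma tens_ops [intro, simp]:
  assumes "t \<in> tens k" "i \<le> k"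
  shows "d_even i v t \<in> tens k" "m_even i v t \<in> tens k" "d_odd i u t \<in> tens k" "m_odd i u t \<in> tens k"
  using assms by (auto intro!: tensI simp: d_even_eq m_even_def d_odd_eq m_odd_def tensD)

lemma tens_lin [intro, simp]:
  "s \<in> tens k \<Longrightarrow> t \<in> tens k \<Longrightarrow> s + t \<in> tens k"
  "s \<in> tens k \<Longrightarrow> t \<in> tens k \<Longrightarrow> s - t \<in> tens k"
  "s \<in> tens k \<Longrightarrow> - s \<in> tens k"
  "s \<in> tens k \<Longrightarrow> sc c s \<in> tens k"
  "0 \<in> tens k"
  by (auto simp: tens_def pointwise)

lemma tens_sum [intro]: "(\<And>x. x \<in> X \<Longrightarrow> f x \<in> tens k) \<Longrightarrow> (\<Sum>x\<in>X. f x) \<in> tens k"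
  by (auto simp: tens_def pointwise)

section \<open>Operators that are linear over the power series ring\<close>

definition linop :: "('k::comm_ring_1 wc_tensor \<Rightarrow> 'k wc_tensor) \<Rightarrow> bool" where
  "linop F \<longleftrightarrow> (\<forall>s t. F (s + t) = F s + F t) \<and> (\<forall>c t. F (sc c t) = sc c (F t))"

lemma linopI: "(\<And>s t. F (s + t) = F s + F t) \<Longrightarrow> (\<And>c t. F (sc c t) = sc c (F t)) \<Longrightarrow> linop F"
  by (simp add: linop_def)

lemma linopD:
  assumes "linop F"
  shows "F (s + t) = F s + F t" "F (sc c t) = sc c (F t)" "F 0 = 0" "F (s - t) = F s - F t"
    "F (- t) = - F t" "F (\<Sum>x\<in>X. f x) = (\<Sum>x\<in>X. F (f x))"
proof -
  show a: "F (s + t) = F s + F t" and b: "F (sc c t) = sc c (F t)" for s t c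
    using assms by (auto simp: linop_def)
  show z: "F 0 = 0" using b[of 0 0] by simp
  show m: "F (- t) = - F t" for t using b[of "-1" t] by (simp add: sc_minus_left)
  show "F (s - t) = F s - F t" using a[of s "- t"] m by simp
  show "F (\<Sum>x\<in>X. f x) = (\<Sum>x\<in>X. F (f x))"
    by (induction X rule: infinite_finite_induct) (simp_all only: sum.infinite sum.empty sum.insert a z not_False_eq_True)
qed

lemma linop_basic [intro, simp]:
  "linop (d_even i v)" "linop (m_even i v)" "linop (d_odd i u)" "linop (m_odd i u)"
  "linop (sc c)" "linop (\<lambda>t. t)"
  by (intro linopI ext; simp add: d_even_eq m_even_def d_odd_eq m_odd_def pointwise algebra_simps)+

lemma linop_comb:
  "linop F \<Longrightarrow> linop G \<Longrightarrow> linop (\<lambda>t. F (G t))"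
  "linop F \<Longrightarrow> linop G \<Longrightarrow> linop (\<lambda>t. F t + G t)"
  "linop F \<Longrightarrow> linop G \<Longrightarrow> linop (\<lambda>t. F t - G t)"
  "linop F \<Longrightarrow> linop (\<lambda>t. sc c (F t))"
  by (simp_all only: linop_def sc_add_right sc_diff_right sc_sc mult.commute[of _ c] add_ac)
     (simp_all add: algebra_simps sc_add_right)

lemma linop_sum: "(\<And>x. x \<in> X \<Longrightarrow> linop (F x)) \<Longrightarrow> linop (\<lambda>t. \<Sum>x\<in>X. F x t)"
  by (intro linopI) (simp_all only: linopD(1,2) sum.distrib sc_sum cong: sum.cong)

subsection \<open>Commutation relations\<close>

lemma nth_ops:
  assumes "i < length ms"
  shows "inc i v ms ! j = (if i = j then ((fst (ms ! i))(v := fst (ms ! i) v + 1), snd (ms ! i)) else ms ! j)"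
    "dec i v ms ! j = (if i = j then ((fst (ms ! i))(v := fst (ms ! i) v - 1), snd (ms ! i)) else ms ! j)"
    "tog i u ms ! j = (if i = j then (fst (ms ! i), toggle u (snd (ms ! i))) else ms ! j)"
  using assms by (auto simp: inc_def dec_def tog_def)

lemma toggle_simps [simp]:
  "toggle u (toggle u S) = S"
  "w \<in> toggle u S \<longleftrightarrow> (if w = u then u \<notin> S else w \<in> S)"
  by (auto simp: toggle_def)

lemma toggle_commute: "toggle u (toggle w S) = toggle w (toggle u S)"
  by (auto simp: toggle_def)

lemma expo_ops:
  assumes "j < length ms"
  shows "expo i v (inc j w ms) = expo i v ms + (if i = j \<and> v = w then 1 else 0)"
    "expo i v (dec j w ms) = expo i v ms - (if i = j \<and> v = w then 1 else 0)"
    "expo i v (tog j u ms) = expo i v ms"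
    "occ i u (inc j w ms) = occ i u ms" "occ i u (dec j w ms) = occ i u ms"
    "occ i u (tog j w ms) \<longleftrightarrow> (if i = j \<and> u = w then \<not> occ i u ms else occ i u ms)"
  using assms by (auto simp: expo_def occ_def nth_ops)

lemma ops_commute:
  assumes "i < length ms" "j < length ms"
  shows "inc i v (inc j w ms) = inc j w (inc i v ms)"
    "dec i v (dec j w ms) = dec j w (dec i v ms)"
    "i \<noteq> j \<or> v \<noteq> w \<Longrightarrow> dec i v (inc j w ms) = inc j w (dec i v ms)"
    "inc i v (tog j u ms) = tog j u (inc i v ms)"
    "dec i v (tog j u ms) = tog j u (dec i v ms)"
    "tog i u (tog j u' ms) = tog j u' (tog i u ms)"
  using assms by (auto intro!: nth_equalityI simp: nth_ops toggle_commute fun_upd_twist)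

lemma ops_inverse:
  assumes "i < length ms"
  shows "dec i v (inc i v ms) = ms" "expo i v ms \<noteq> 0 \<Longrightarrow> inc i v (dec i v ms) = ms" "tog i u (tog i u ms) = ms"
  using assms by (auto intro!: nth_equalityI simp: nth_ops expo_def)

lemma minus_one_card_toggle:
  assumes "finite S"
  shows "(-1) ^ card (toggle u S) = - ((-1) ^ card S :: 'a::comm_ring_1)"
proof (cases "u \<in> S")
  case True
  then have "card S = Suc (card (S - {u}))" using assms by (metis card.remove)
  then have "(-1) ^ card S = - ((-1) ^ card (S - {u}) :: 'a)" by (simp only: power_Suc mult_minus1)
  then show ?thesis using True by (simp only: toggle_def if_True minus_minus)
qed (use assms in \<open>simp add: toggle_def\<close>)

lemma kos_inc_dec:
  assumes "j < length ms"
  shows "kos i u (inc j w ms) = kos i u ms" "kos i u (dec j w ms) = kos i u ms"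
proof -
  have "snd (inc j w ms ! i) = snd (ms ! i)" "snd (dec j w ms ! i) = snd (ms ! i)" for i
    using assms by (auto simp: nth_ops)
  then show "kos i u (inc j w ms) = kos i u ms" "kos i u (dec j w ms) = kos i u ms"
    by (auto simp: kos_def)
qed

text \<open>Order the pairs (slot, generator) lexicographically. The sign of \<open>(i, u)\<close>
  counts the generators present before that pair, so it changes exactly when a smaller pair is
  toggled. Of two distinct pairs exactly one precedes the other, which is the source of all
  anticommutation.\<close>

lemma kos_tog:
  assumes "good k ms" "i \<le> k" "j \<le> k"
  shows "kos i u (tog j w ms) = (if j < i \<or> (j = i \<and> w < u) then - kos i u ms else (kos i u ms :: 'a::comm_ring_1 fps))"
proof -
  have fin: "finite (snd (ms ! l))" if "l \<le> k" for l using assms that by (auto simp: good_def fin_mono_def)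
  have len: "j < length ms" using assms by (auto simp: good_def)
  have kos: "kos i u ms = (\<Prod>l<i. (-1) ^ card (snd (ms ! l))) * ((-1) ^ card {w \<in> snd (ms ! i). w < u} :: 'a fps)" for ms
    by (simp add: kos_def power_add power_sum)
  have s: "snd (tog j w ms ! l) = (if j = l then toggle w (snd (ms ! l)) else snd (ms ! l))" for l
    using len by (auto simp: nth_ops)
  consider "j < i" | "j = i" | "i < j" by linarith
  then show ?thesis
  proof cases
    case 1
    have "(\<Prod>l<i. (-1) ^ card (snd (tog j w ms ! l))) = - (\<Prod>l<i. (-1) ^ card (snd (ms ! l)) :: 'a fps)"
      using 1 assms fin[of j] by (simp add: prod.remove[of _ j] s minus_one_card_toggle)
    then show ?thesis using 1 by (simp add: kos s)
  next
    case 2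
    have "(\<Prod>l<i. (-1) ^ card (snd (tog j w ms ! l))) = (\<Prod>l<i. (-1) ^ card (snd (ms ! l)) :: 'a fps)"
      by (intro prod.cong refl) (use 2 s in auto)
    moreover have "{w' \<in> toggle w (snd (ms ! i)). w' < u} =
        (if w < u then toggle w {w' \<in> snd (ms ! i). w' < u} else {w' \<in> snd (ms ! i). w' < u})"
      by (auto simp: toggle_def)
    moreover have "snd (tog j w ms ! i) = toggle w (snd (ms ! i))" using s[of i] 2 by simp
    ultimately show ?thesis using 2 fin[of i] assms
      by (simp add: kos minus_one_card_toggle del: toggle_simps)
  next
    case 3
    have "(\<Prod>l<i. (-1) ^ card (snd (tog j w ms ! l))) = (\<Prod>l<i. (-1) ^ card (snd (ms ! l)) :: 'a fps)"
      using 3 by (intro prod.cong) (auto simp: s)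
    then show ?thesis using 3 by (simp add: kos s)
  qed
qed

lemma kos_square [simp]: "kos i u ms * kos i u ms = 1" "kos i u ms * (kos i u ms * x) = x"
proof -
  show "kos i u ms * kos i u ms = 1" by (simp add: kos_def flip: power_mult_distrib)
  then show "kos i u ms * (kos i u ms * x) = x" by (metis mult.assoc mult_1)
qed

lemma good_length: "good k ms \<Longrightarrow> i \<le> k \<Longrightarrow> i < length ms"
  by (simp add: good_def)

context
  fixes k i j :: nat and t :: "'k::comm_ring_1 wc_tensor"
  assumes t: "t \<in> tens k" and ij: "i \<le> k" "j \<le> k"
begin

lemma d_even_commute: "d_even i v (d_even j w t) = d_even j w (d_even i v t)"
proof (rule tens_eqI)
  fix ms assume "good k ms"
  then show "d_even i v (d_even j w t) ms = d_even j w (d_even i v t) ms"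
    using ij by (cases "i = j \<and> v = w") (auto simp: pointwise d_even_eq expo_ops ops_commute good_length)
qed (use t ij in auto)

lemma m_even_commute: "m_even i v (m_even j w t) = m_even j w (m_even i v t)"
proof (rule tens_eqI)
  fix ms assume "good k ms"
  then show "m_even i v (m_even j w t) ms = m_even j w (m_even i v t) ms"
    using ij by (cases "i = j \<and> v = w") (auto simp: m_even_def expo_ops ops_commute good_length)
qed (use t ij in auto)

lemma d_even_m_even:
  "d_even i v (m_even j w t) = (if i = j \<and> v = w then t else 0) + m_even j w (d_even i v t)"
proof (rule tens_eqI)
  fix ms assume g: "good k ms"
  show "d_even i v (m_even j w t) ms = ((if i = j \<and> v = w then t else 0) + m_even j w (d_even i v t)) ms"
  proof (cases "i = j \<and> v = w")
    case True
    then show ?thesis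
      using ij g by (auto simp: pointwise d_even_eq m_even_def expo_ops ops_inverse good_length algebra_simps)
  next
    case False
    then have "dec j w (inc i v ms) = inc i v (dec j w ms)"
      using g ij by (intro ops_commute) (auto simp: good_length)
    then show ?thesis
      using False ij g by (auto simp: pointwise d_even_eq m_even_def expo_ops good_length)
  qed
qed (use t ij in auto)

lemma d_odd_anticommute: "d_odd i u (d_odd j w t) = - d_odd j w (d_odd i u t)"
proof (rule tens_eqI)
  fix ms assume g: "good k ms"
  then show "d_odd i u (d_odd j w t) ms = (- d_odd j w (d_odd i u t)) ms"
    using ij by (cases i j rule: linorder_cases; cases u w rule: linorder_cases)
      (auto simp: pointwise d_odd_eq expo_ops ops_commute kos_tog[OF g] good_length)
qed (use t ij in auto)

lemma m_odd_anticommute: "m_odd i u (m_odd j w t) = - m_odd j w (m_odd i u t)"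
proof (rule tens_eqI)
  fix ms assume g: "good k ms"
  then show "m_odd i u (m_odd j w t) ms = (- m_odd j w (m_odd i u t)) ms"
    using ij by (cases i j rule: linorder_cases; cases u w rule: linorder_cases)
      (auto simp: pointwise m_odd_def expo_ops ops_commute kos_tog[OF g] good_length)
qed (use t ij in auto)

lemma d_odd_m_odd:
  "d_odd i u (m_odd j w t) = (if i = j \<and> u = w then t else 0) - m_odd j w (d_odd i u t)"
proof (rule tens_eqI)
  fix ms assume g: "good k ms"
  then show "d_odd i u (m_odd j w t) ms = ((if i = j \<and> u = w then t else 0) - m_odd j w (d_odd i u t)) ms"
    using ij by (cases i j rule: linorder_cases; cases u w rule: linorder_cases)
      (auto simp: pointwise d_odd_eq m_odd_def expo_ops ops_commute ops_inverse kos_tog[OF g] good_length)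
qed (use t ij in auto)

lemma even_odd_commute:
  "d_even i v (d_odd j u t) = d_odd j u (d_even i v t)"
  "d_even i v (m_odd j u t) = m_odd j u (d_even i v t)"
  "m_even i v (d_odd j u t) = d_odd j u (m_even i v t)"
  "m_even i v (m_odd j u t) = m_odd j u (m_even i v t)"
proof -
  have *: "d_even i v (d_odd j u t) ms = d_odd j u (d_even i v t) ms"
    "d_even i v (m_odd j u t) ms = m_odd j u (d_even i v t) ms"
    "m_even i v (d_odd j u t) ms = d_odd j u (m_even i v t) ms"
    "m_even i v (m_odd j u t) ms = m_odd j u (m_even i v t) ms" if "good k ms" for ms
    using that ij by (auto simp: pointwise d_even_eq m_even_def d_odd_eq m_odd_def expo_ops ops_commute kos_inc_dec good_length)
  show "d_even i v (d_odd j u t) = d_odd j u (d_even i v t)"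
    "d_even i v (m_odd j u t) = m_odd j u (d_even i v t)"
    "m_even i v (d_odd j u t) = d_odd j u (m_even i v t)"
    "m_even i v (m_odd j u t) = m_odd j u (m_even i v t)"
    by (rule tens_eqI[of _ k]; use t ij * in auto)+
qed

end

subsection \<open>Wick's theorem\<close>

abbreviation cst :: "'k::comm_ring_1 \<Rightarrow> 'k fps" where "cst \<equiv> fps_const"

text \<open>Only constants are required to come out. \<open>gauss\<close> cuts the exponential
  series at the power \<open>N\<close> in the coefficient of \<open>fps_X ^ N\<close>, and for a
  general operator this cut does not commute with multiplication by \<open>fps_X\<close>.\<close>

definition linfun :: "('k::comm_ring_1 wc_tensor \<Rightarrow> 'k fps) \<Rightarrow> bool" where
  "linfun U \<longleftrightarrow> (\<forall>s t. U (s + t) = U s + U t) \<and> (\<forall>c t. U (sc (cst c) t) = cst c * U t)"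

lemma linfunD:
  assumes "linfun U"
  shows "U (s + t) = U s + U t" "U (sc (cst c) t) = cst c * U t" "U 0 = 0" "U (- t) = - U t"
    "U (s - t) = U s - U t" "U (\<Sum>x\<in>X. f x) = (\<Sum>x\<in>X. U (f x))"
proof -
  show a: "U (s + t) = U s + U t" and b: "U (sc (cst c) t) = cst c * U t" for s t c
    using assms by (auto simp: linfun_def)
  show z: "U 0 = 0" using b[of 0 0] by simp
  show m: "U (- t) = - U t" for t
    using b[of "-1" t] by (simp add: sc_minus_left flip: fps_const_neg)
  show "U (s - t) = U s - U t" using a[of s "- t"] m by simp
  show "U (\<Sum>x\<in>X. f x) = (\<Sum>x\<in>X. U (f x))"
    by (induction X rule: infinite_finite_induct) (simp_all only: sum.infinite sum.empty sum.insert a z not_False_eq_True)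
qed

text \<open>The functional \<open>U\<close> applied to \<open>exp D t\<close>. The cut
  \<open>q \<le> N\<close> is copied from \<open>exp_op\<close>; it loses nothing when
  \<open>D\<close> is divisible by \<open>fps_X\<close>.\<close>

definition gauss :: "('k::field_char_0 wc_tensor \<Rightarrow> 'k fps) \<Rightarrow> ('k wc_tensor \<Rightarrow> 'k wc_tensor) \<Rightarrow> 'k wc_tensor \<Rightarrow> 'k fps" where
  "gauss U D t = Abs_fps (\<lambda>N. \<Sum>q\<le>N. fps_nth (U ((D ^^ q) t)) N / fact q)"

lemma funpow_linop: "linop D \<Longrightarrow> linop (D ^^ q)"
  by (induction q) (auto simp: linop_def)

lemma linfun_gauss:
  assumes "linfun U" "linop D"
  shows "linfun (gauss U D)"
  unfolding linfun_def
  by (auto simp: fps_eq_iff gauss_def linfunD[OF assms(1)] linopD[OF funpow_linop[OF assms(2)]]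
      sum.distrib add_divide_distrib sum_distrib_left)

text \<open>The commutator of \<open>D\<close> and \<open>m\<close> is \<open>c B\<close>, and
  \<open>B\<close> commutes with \<open>D\<close>. Hence each of the \<open>Suc q\<close> factors of
  the power contributes the same commutator term once. The identities are available on
  \<open>V\<close> only.\<close>

lemma funpow_commutator:
  assumes lin: "linop D" and D: "\<And>s. s \<in> V \<Longrightarrow> D s \<in> V"
    and m: "\<And>s. s \<in> V \<Longrightarrow> D (m s) = m (D s) + sc c (B s)"
    and B: "\<And>s. s \<in> V \<Longrightarrow> D (B s) = B (D s)" and t: "t \<in> V"
  shows "(D ^^ Suc q) (m t) = m ((D ^^ Suc q) t) + sc (of_nat (Suc q) * c) ((D ^^ q) (B t))"
proof -
  have V: "(D ^^ q) t \<in> V" for q using D t by (induction q) auto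
  have DB: "B ((D ^^ q) t) = (D ^^ q) (B t)" for q
    by (induction q) (simp_all add: B[OF V, symmetric])
  show ?thesis
  proof (induction q)
    case (Suc q)
    have "(D ^^ Suc (Suc q)) (m t) = D (m ((D ^^ Suc q) t)) + sc (of_nat (Suc q) * c) (D ((D ^^ q) (B t)))"
      by (simp only: funpow.simps(2)[of "Suc q"] comp_apply Suc.IH linopD[OF lin])
    also have "D (m ((D ^^ Suc q) t)) = m ((D ^^ Suc (Suc q)) t) + sc c ((D ^^ Suc q) (B t))"
      by (simp only: m[OF V] DB funpow.simps(2)[of "Suc q"] comp_apply)
    also have "\<dots> + sc (of_nat (Suc q) * c) (D ((D ^^ q) (B t))) =
        m ((D ^^ Suc (Suc q)) t) + sc (of_nat (Suc (Suc q)) * c) ((D ^^ Suc q) (B t))"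
      by (simp only: add.assoc funpow.simps(2) comp_apply of_nat_Suc sc_add_left[symmetric] distrib_right mult_1_left)
    finally show ?case .
  qed (simp add: m[OF t])
qed

text \<open>This is \<open>exp D m = (m + fps_X B) exp D\<close>, whose first term is killed by
  \<open>U\<close>. The cut in \<open>gauss\<close> is respected because the commutator term loses
  one power of \<open>D\<close> and gains one factor \<open>fps_X\<close> at the same time.\<close>

lemma gauss_wick:
  assumes lin: "linop D" and U: "linfun U" and D: "\<And>s. s \<in> V \<Longrightarrow> D s \<in> V"
    and m: "\<And>s. s \<in> V \<Longrightarrow> D (m s) = m (D s) + sc fps_X (B s)"
    and B: "\<And>s. s \<in> V \<Longrightarrow> D (B s) = B (D s)" and t: "t \<in> V"
    and Um: "\<And>s. s \<in> V \<Longrightarrow> U (m s) = 0" and UX: "\<And>s. U (sc fps_X s) = fps_X * U s"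
  shows "gauss U D (m t) = fps_X * gauss U D (B t)"
proof (rule fps_ext)
  fix N
  have V: "(D ^^ q) t \<in> V" for q using D t by (induction q) auto
  have S: "U ((D ^^ Suc q) (m t)) = of_nat (Suc q) * (fps_X * U ((D ^^ q) (B t)))" for q
  proof -
    have e: "(D ^^ Suc q) (m t) = m ((D ^^ Suc q) t) + sc (of_nat (Suc q) * fps_X) ((D ^^ q) (B t))"
      by (rule funpow_commutator[of D V m fps_X B t, OF lin D m B t])
    have "U ((D ^^ Suc q) (m t)) = U (m ((D ^^ Suc q) t)) + U (sc (cst (of_nat (Suc q))) (sc fps_X ((D ^^ q) (B t))))"
      by (simp only: e linfunD(1)[OF U] sc_sc fps_of_nat)
    also have "\<dots> = of_nat (Suc q) * (fps_X * U ((D ^^ q) (B t)))"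
      by (subst linfunD(2)[OF U]) (simp only: Um[OF V] UX fps_of_nat add_0)
    finally show ?thesis .
  qed
  show "fps_nth (gauss U D (m t)) N = fps_nth (fps_X * gauss U D (B t)) N"
  proof (cases N)
    case 0
    then show ?thesis using Um[OF t] by (simp add: gauss_def)
  next
    case (Suc M)
    have "fps_nth (gauss U D (m t)) N = (\<Sum>q\<le>M. fps_nth (U ((D ^^ Suc q) (m t))) (Suc M) / fact (Suc q))"
      unfolding Suc gauss_def fps_nth_Abs_fps sum.atMost_Suc_shift using Um[OF t] by simp
    also have "\<dots> = (\<Sum>q\<le>M. fps_nth (U ((D ^^ q) (B t))) M / fact q)"
    proof (rule sum.cong[OF refl])
      fix q
      have "fps_nth (U ((D ^^ Suc q) (m t))) (Suc M) = of_nat (Suc q) * fps_nth (U ((D ^^ q) (B t))) M"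
        by (simp only: S fps_of_nat[symmetric] fps_mult_left_const_nth fps_X_mult_nth nat.distinct if_False diff_Suc_1)
      then show "fps_nth (U ((D ^^ Suc q) (m t))) (Suc M) / fact (Suc q) = fps_nth (U ((D ^^ q) (B t))) M / fact q"
        by (simp add: field_simps del: of_nat_Suc)
    qed
    finally show ?thesis by (simp add: Suc gauss_def)
  qed
qed

text \<open>Coefficients are given for \<open>i < j\<close> only. The contraction of two slots
  changes sign when the slots are exchanged, for even and for odd generators alike, so the
  antisymmetric extension is the propagator that a fixed slot sees.\<close>

definition skew :: "(nat \<Rightarrow> nat \<Rightarrow> 'k::ab_group_add) \<Rightarrow> nat \<Rightarrow> nat \<Rightarrow> 'k" where
  "skew c i j = (if i < j then c i j else if j < i then - c j i else 0)"

text \<open>Only pairs containing \<open>x\<close> survive. The partner becomes the new index, and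
  the sign for a smaller partner is the one built into \<open>skew\<close>.\<close>

lemma sum_pairs_single:
  fixes F G :: "nat \<Rightarrow> nat \<Rightarrow> 'a::ab_group_add"
  assumes "x \<le> k"
  shows "(\<Sum>j\<le>k. \<Sum>i<j. (if i = x then F i j else 0) - (if j = x then G i j else 0)) =
    (\<Sum>j\<le>k. if x < j then F x j else if j < x then - G j x else 0)"
proof -
  have 1: "(\<Sum>i<j. if i = x then F i j else 0) = (if x < j then F x j else 0)" for j
    by (simp add: sum.delta)
  have "(\<Sum>j\<le>k. \<Sum>i<j. if j = x then G i j else 0) = (\<Sum>j\<le>k. if j = x then \<Sum>i<j. G i j else 0)"
    by (intro sum.cong) auto
  also have "\<dots> = (\<Sum>i<x. G i x)" using assms by (simp add: sum.delta)
  also have "\<dots> = (\<Sum>j\<in>{..k} \<inter> {j. j < x}. G j x)" using assms by (intro sum.cong) auto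
  also have "\<dots> = (\<Sum>j\<le>k. if j < x then G j x else 0)" by (simp add: sum.inter_restrict)
  finally have 2: "(\<Sum>j\<le>k. \<Sum>i<j. if j = x then G i j else 0) = (\<Sum>j\<le>k. if j < x then G j x else 0)" .
  show ?thesis
    unfolding sum_subtractf 1 2 by (auto simp flip: sum_subtractf intro!: sum.cong)
qed

text \<open>One proof for both parities: \<open>\<sigma> = 1\<close> gives commutators and
  \<open>\<sigma> = -1\<close> anticommutators. The rule for \<open>H B A\<close> makes the form
  antisymmetric for even and symmetric for odd generators.\<close>

locale mode =
  fixes k N :: nat and \<sigma> :: "'k::field_char_0" and H :: "nat \<Rightarrow> nat \<Rightarrow> 'k"
    and d m :: "nat \<Rightarrow> nat \<Rightarrow> 'k wc_tensor \<Rightarrow> 'k wc_tensor"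
  assumes sigma: "\<sigma> * \<sigma> = 1"
    and lin: "linop (d i A)" "linop (m i A)"
    and closed: "t \<in> tens k \<Longrightarrow> i \<le> k \<Longrightarrow> d i A t \<in> tens k"
      "t \<in> tens k \<Longrightarrow> i \<le> k \<Longrightarrow> m i A t \<in> tens k"
    and dd: "t \<in> tens k \<Longrightarrow> i \<le> k \<Longrightarrow> j \<le> k \<Longrightarrow> d i A (d j B t) = sc (cst \<sigma>) (d j B (d i A t))"
    and mm: "t \<in> tens k \<Longrightarrow> i \<le> k \<Longrightarrow> j \<le> k \<Longrightarrow> m i A (m j B t) = sc (cst \<sigma>) (m j B (m i A t))"
    and dm: "t \<in> tens k \<Longrightarrow> i \<le> k \<Longrightarrow> j \<le> k \<Longrightarrow>
      d i A (m j B t) = (if i = j \<and> A = B then t else 0) + sc (cst \<sigma>) (m j B (d i A t))"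
    and H: "H B A = - \<sigma> * H A B"
begin

definition con :: "nat \<Rightarrow> nat \<Rightarrow> 'k wc_tensor \<Rightarrow> 'k wc_tensor" where
  "con i j t = (\<Sum>A<N. \<Sum>B<N. sc (cst (H A B)) (d j B (d i A t)))"

definition Hd :: "nat \<Rightarrow> nat \<Rightarrow> 'k wc_tensor \<Rightarrow> 'k wc_tensor" where
  "Hd j A t = (\<Sum>B<N. sc (cst (H A B)) (d j B t))"

lemma lin_con: "linop (con i j)" and lin_Hd: "linop (Hd j A)"
  unfolding con_def Hd_def by (intro linop_sum linop_comb(4) lin linop_comb(1)[OF lin(1) lin(1)])+

lemma closed_con [intro]: "t \<in> tens k \<Longrightarrow> i \<le> k \<Longrightarrow> j \<le> k \<Longrightarrow> con i j t \<in> tens k"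
  and closed_Hd [intro]: "t \<in> tens k \<Longrightarrow> j \<le> k \<Longrightarrow> Hd j A t \<in> tens k"
  unfolding con_def Hd_def using closed by (auto intro!: tens_sum)

lemma con_d:
  assumes "t \<in> tens k" "i \<le> k" "j \<le> k" "x \<le> k"
  shows "con i j (d x A t) = d x A (con i j t)"
proof -
  have "d j B (d i A' (d x A t)) = d x A (d j B (d i A' t))" for A' B
    using assms
    by (simp add: dd[of t i x] dd[of "d i A' t" j x] linopD(2)[OF lin(1)] closed sigma)
  then show ?thesis by (simp add: con_def linopD[OF lin(1)])
qed

text \<open>Each of the two derivatives may absorb the multiplication. The outer one meets it after
  it has passed the inner one, which costs \<open>\<sigma>\<close>; together with
  \<open>H A' A = - \<sigma> * H A A'\<close> this gives the minus sign of the second term.\<close>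

lemma con_m:
  assumes "t \<in> tens k" "i \<le> k" "j \<le> k" "x \<le> k" "A < N"
  shows "con i j (m x A t) = m x A (con i j t) + ((if i = x then Hd j A t else 0) - (if j = x then Hd i A t else 0))"
proof -
  have dz: "d i A (if b then t else 0) = (if b then d i A t else 0)" for i A b t
    by (simp add: linopD(3)[OF lin(1)])
  have e: "d j B (d i A' (m x A t)) =
      (if i = x \<and> A' = A then d j B t else 0) + (sc (cst \<sigma>) (if j = x \<and> B = A then d i A' t else 0)
       + m x A (d j B (d i A' t)))" for A' B
    using assms
    by (simp add: dm closed linopD[OF lin(1)] dz sc_add_right sigma)
  have "con i j (m x A t) = (\<Sum>A'<N. \<Sum>B<N. sc (cst (H A' B)) (if i = x \<and> A' = A then d j B t else 0))
     + ((\<Sum>A'<N. \<Sum>B<N. sc (cst (H A' B)) (sc (cst \<sigma>) (if j = x \<and> B = A then d i A' t else 0))) + m x A (con i j t))"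
    by (simp only: con_def e sc_add_right sum.distrib linopD[OF lin(2)])
  also have "(\<Sum>A'<N. \<Sum>B<N. sc (cst (H A' B)) (if i = x \<and> A' = A then d j B t else 0)) =
     (\<Sum>A'<N. if A' = A then (if i = x then Hd j A t else 0) else 0)"
    by (intro sum.cong) (auto simp: Hd_def)
  also have "\<dots> = (if i = x then Hd j A t else 0)"
    using assms by (simp add: sum.delta)
  also have "(\<Sum>A'<N. \<Sum>B<N. sc (cst (H A' B)) (sc (cst \<sigma>) (if j = x \<and> B = A then d i A' t else 0))) =
     (\<Sum>A'<N. \<Sum>B<N. if B = A then (if j = x then sc (cst (H A' A * \<sigma>)) (d i A' t) else 0) else 0)"
    by (intro sum.cong refl) auto
  also have "\<dots> = (if j = x then - Hd i A t else 0)"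
  proof -
    have *: "sc (cst (H B A * \<sigma>)) s = - sc (cst (H A B)) s" for B s
      using sigma by (simp add: H[of B A] algebra_simps sc_minus_left flip: fps_const_neg)
        (simp add: mult.assoc[symmetric])
    show ?thesis using assms by (simp add: sum.delta Hd_def * sum_negf)
  qed
  finally show ?thesis by simp
qed

end

text \<open>\<open>R\<close> is the contraction of the generators of the other parity. It belongs to
  the exponent but is inert in the Wick rule of this mode.\<close>

locale two_modes = mode +
  fixes R :: "nat \<Rightarrow> nat \<Rightarrow> 'a wc_tensor \<Rightarrow> 'a wc_tensor"
  assumes R_lin: "linop (R i j)"
    and R_closed: "t \<in> tens k \<Longrightarrow> i \<le> k \<Longrightarrow> j \<le> k \<Longrightarrow> R i j t \<in> tens k"
    and R_m: "t \<in> tens k \<Longrightarrow> i \<le> k \<Longrightarrow> j \<le> k \<Longrightarrow> x \<le> k \<Longrightarrow> R i j (m x A t) = m x A (R i j t)"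
    and R_d: "t \<in> tens k \<Longrightarrow> i \<le> k \<Longrightarrow> j \<le> k \<Longrightarrow> x \<le> k \<Longrightarrow> R i j (d x A t) = d x A (R i j t)"
begin

definition contr :: "(nat \<Rightarrow> nat \<Rightarrow> 'a) \<Rightarrow> 'a wc_tensor \<Rightarrow> 'a wc_tensor" where
  "contr c t = (\<Sum>j\<le>k. \<Sum>i<j. sc (fps_X * cst (c i j / 2)) (con i j t + R i j t))"

definition grad :: "(nat \<Rightarrow> nat \<Rightarrow> 'a) \<Rightarrow> nat \<Rightarrow> nat \<Rightarrow> 'a wc_tensor \<Rightarrow> 'a wc_tensor" where
  "grad c x A t = (\<Sum>j\<le>k. sc (cst (skew c x j / 2)) (Hd j A t))"

lemma lin_contr: "linop (contr c)"
  unfolding contr_def by (intro linop_sum linop_comb(4) linop_comb(2) lin_con R_lin)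

lemma closed_contr: "t \<in> tens k \<Longrightarrow> contr c t \<in> tens k"
  unfolding contr_def by (intro tens_sum tens_lin closed_con R_closed) auto

lemma contr_d:
  assumes "t \<in> tens k" "x \<le> k"
  shows "contr c (d x A t) = d x A (contr c t)"
proof -
  have "contr c (d x A t) = (\<Sum>j\<le>k. \<Sum>i<j. sc (fps_X * cst (c i j / 2)) (d x A (con i j t + R i j t)))"
    unfolding contr_def using assms
    by (intro sum.cong refl) (simp add: con_d R_d linopD[OF lin(1)])
  then show ?thesis by (simp add: contr_def linopD[OF lin(1)])
qed

lemma contr_m:
  assumes "t \<in> tens k" "x \<le> k" "A < N"
  shows "contr c (m x A t) = m x A (contr c t) + sc fps_X (grad c x A t)"
proof -
  have "contr c (m x A t) = (\<Sum>j\<le>k. \<Sum>i<j. sc (fps_X * cst (c i j / 2)) (m x A (con i j t + R i j t)) +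
     ((if i = x then sc (fps_X * cst (c i j / 2)) (Hd j A t) else 0) - (if j = x then sc (fps_X * cst (c i j / 2)) (Hd i A t) else 0)))"
    unfolding contr_def using assms
    by (intro sum.cong refl) (simp add: con_m R_m linopD[OF lin(2)] sc_add_right sc_diff_right)
  also have "\<dots> = m x A (contr c t) + (\<Sum>j\<le>k. \<Sum>i<j. (if i = x then sc (fps_X * cst (c i j / 2)) (Hd j A t) else 0) - (if j = x then sc (fps_X * cst (c i j / 2)) (Hd i A t) else 0))"
    by (simp only: sum.distrib contr_def linopD[OF lin(2)])
  also have "(\<Sum>j\<le>k. \<Sum>i<j. (if i = x then sc (fps_X * cst (c i j / 2)) (Hd j A t) else 0) - (if j = x then sc (fps_X * cst (c i j / 2)) (Hd i A t) else 0))
     = sc fps_X (grad c x A t)"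
    unfolding sum_pairs_single[OF assms(2)] grad_def sc_sum
    by (intro sum.cong refl)
      (auto simp: skew_def sc_minus_left simp flip: fps_const_neg)
  finally show ?thesis .
qed

end

subsection \<open>The supercommutative product\<close>

lemma finite_below_finsupp:
  fixes e :: "nat \<Rightarrow> nat"
  assumes "finite {v. e v \<noteq> 0}"
  shows "finite {e'. \<forall>v. e' v \<le> e v}"
proof (rule finite_subset)
  let ?A = "{v. e v \<noteq> 0}"
  show "finite {e'. \<forall>v. (v \<in> ?A \<longrightarrow> e' v \<in> {..Max (e ` ?A)}) \<and> (v \<notin> ?A \<longrightarrow> e' v = 0)}"
    using assms by (intro finite_set_of_finite_funs) auto
  show "{e'. \<forall>v. e' v \<le> e v} \<subseteq> {e'. \<forall>v. (v \<in> ?A \<longrightarrow> e' v \<in> {..Max (e ` ?A)}) \<and> (v \<notin> ?A \<longrightarrow> e' v = 0)}"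
  proof (intro subsetI CollectI allI conjI impI)
    fix e' v assume le: "e' \<in> {e'. \<forall>v. e' v \<le> e v}"
    have "e v \<le> Max (e ` ?A)" if "v \<in> ?A" using assms that by (intro Max_ge) auto
    then show "e' v \<in> {..Max (e ` ?A)}" if "v \<in> ?A" using le that by (auto intro: le_trans)
    show "e' v = 0" if "v \<notin> ?A" using le that by (metis (mono_tags) le_zero_eq mem_Collect_eq)
  qed
qed

lemma factorizationsD:
  assumes "ms \<in> factorizations k (e, S)"
  shows "length ms = Suc k" "(\<Sum>i\<le>k. expo i v ms) = e v" "i \<le> k \<Longrightarrow> expo i v ms \<le> e v"
    "i \<le> k \<Longrightarrow> snd (ms ! i) \<subseteq> S" "(\<Union>i\<le>k. snd (ms ! i)) = S"
    "i \<le> k \<Longrightarrow> j \<le> k \<Longrightarrow> occ i u ms \<Longrightarrow> occ j u ms \<Longrightarrow> i = j"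
    "u \<in> S \<Longrightarrow> \<exists>i\<le>k. occ i u ms"
proof -
  show sum: "(\<Sum>i\<le>k. expo i v ms) = e v" using assms by (simp add: factorizations_def expo_def)
  show "expo i v ms \<le> e v" if "i \<le> k"
    using that unfolding sum[symmetric] by (intro member_le_sum) auto
qed (use assms in \<open>auto simp: factorizations_def occ_def\<close>)

lemma finite_factorizations:
  assumes "fin_mono m"
  shows "finite (factorizations k m)"
proof (rule finite_subset)
  define e S where "e = fst m" and "S = snd m"
  then have m: "m = (e, S)" by simp
  let ?M = "{e'. \<forall>v. e' v \<le> e v} \<times> Pow S"
  show "finite {ms. set ms \<subseteq> ?M \<and> length ms = Suc k}"
    using assms by (intro finite_lists_length_eq finite_cartesian_product finite_below_finsupp)
      (auto simp: fin_mono_def m)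
  show "factorizations k m \<subseteq> {ms. set ms \<subseteq> ?M \<and> length ms = Suc k}"
  proof
    fix ms assume ms: "ms \<in> factorizations k m"
    then have nth: "ms ! i \<in> ?M" if "i \<le> k" for i
      using factorizationsD(3,4)[OF ms[unfolded m], of i] that by (auto simp: mem_Times_iff expo_def)
    have len: "length ms = Suc k" using ms by (simp add: factorizations_def)
    have "m' \<in> ?M" if m': "m' \<in> set ms" for m'
    proof -
      obtain i where "i < length ms" "ms ! i = m'" using m' by (auto simp: in_set_conv_nth)
      then show ?thesis using nth[of i] len by simp
    qed
    then show "ms \<in> {ms. set ms \<subseteq> ?M \<and> length ms = Suc k}" using len by blast
  qed
qed

lemma factorizations_good:
  assumes "ms \<in> factorizations k m"
  shows "good k ms \<longleftrightarrow> fin_mono m"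
proof -
  obtain e S where m: "m = (e, S)" by (cases m)
  note D = factorizationsD[OF assms[unfolded m]]
  show ?thesis
  proof
    assume g: "good k ms"
    have "{v. e v \<noteq> 0} \<subseteq> (\<Union>i\<le>k. {v. fst (ms ! i) v \<noteq> 0})"
    proof
      fix v assume "v \<in> {v. e v \<noteq> 0}"
      then have "(\<Sum>i\<le>k. expo i v ms) \<noteq> 0" using D(2)[of v] by simp
      then show "v \<in> (\<Union>i\<le>k. {v. fst (ms ! i) v \<noteq> 0})"
        by (auto simp: expo_def)
    qed
    moreover have "finite (\<Union>i\<le>k. {v. fst (ms ! i) v \<noteq> 0})"
      using g by (auto simp: good_def fin_mono_def)
    moreover have "finite (\<Union>i\<le>k. snd (ms ! i))" using g by (auto simp: good_def fin_mono_def)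
    ultimately show "fin_mono m" using D(5) by (auto simp: fin_mono_def m intro: finite_subset)
  next
    assume f: "fin_mono m"
    have "fin_mono (ms ! i)" if "i \<le> k" for i
    proof -
      have "{v. fst (ms ! i) v \<noteq> 0} \<subseteq> {v. e v \<noteq> 0}"
        using D(3)[OF that] by (auto simp: expo_def) (meson less_le_trans)
      then show ?thesis using f D(4)[OF that] by (auto simp: fin_mono_def m intro: finite_subset)
    qed
    then show "good k ms" using D(1) by (simp add: good_def)
  qed
qed

lemma super_mult_not_fin: "t \<in> tens k \<Longrightarrow> \<not> fin_mono m \<Longrightarrow> super_mult k t m = 0"
  by (auto simp: super_mult_def factorizations_good tensD intro!: sum.neutral)

lemma super_mult_add: "super_mult k (s + t) m = super_mult k s m + super_mult k t m"
  and super_mult_sc: "super_mult k (sc c t) m = c * super_mult k t m"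
  by (auto simp: super_mult_def pointwise algebra_simps sum.distrib sum_distrib_left)

lemma super_mult_sum: "super_mult k (\<Sum>x\<in>X. f x) m = (\<Sum>x\<in>X. super_mult k (f x) m)"
  by (simp add: super_mult_def pointwise sum_distrib_left) (rule sum.swap)

lemma factorizations_dec:
  assumes "i \<le> k" "e v \<noteq> 0"
  shows "bij_betw (dec i v) {ms \<in> factorizations k (e, S). expo i v ms \<noteq> 0}
    (factorizations k (e(v := e v - 1), S))"
proof (rule bij_betwI[where g = "inc i v"])
  have *: "(\<Sum>j\<le>k. expo j w ms - (if j = i \<and> w = v then 1 else 0)) =
      (\<Sum>j\<le>k. expo j w ms) - (if w = v then 1 else 0)" if "expo i v ms \<noteq> 0" for ms w
    using assms that by (cases "w = v") (auto simp: sum.remove[of _ i])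
  have **: "(\<Sum>j\<le>k. expo j w ms + (if j = i \<and> w = v then 1 else 0)) =
      (\<Sum>j\<le>k. expo j w ms) + (if w = v then 1 else 0)" for ms w
    using assms by (cases "w = v") (auto simp: sum.remove[of _ i])
  have sd: "snd (dec i v ms ! j) = snd (ms ! j)" "snd (inc i v ms ! j) = snd (ms ! j)" if "length ms = Suc k" for ms j
    using that assms by (auto simp: nth_ops)
  show "dec i v \<in> {ms \<in> factorizations k (e, S). expo i v ms \<noteq> 0} \<rightarrow> factorizations k (e(v := e v - 1), S)"
  proof (intro funcsetI)
    fix ms assume "ms \<in> {ms \<in> factorizations k (e, S). expo i v ms \<noteq> 0}"
    then show "dec i v ms \<in> factorizations k (e(v := e v - 1), S)"
      using assms *[of ms] by (auto simp: factorizations_def sd expo_ops simp flip: expo_def)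
  qed
  show "inc i v \<in> factorizations k (e(v := e v - 1), S) \<rightarrow> {ms \<in> factorizations k (e, S). expo i v ms \<noteq> 0}"
  proof (intro funcsetI)
    fix ms assume "ms \<in> factorizations k (e(v := e v - 1), S)"
    then show "inc i v ms \<in> {ms \<in> factorizations k (e, S). expo i v ms \<noteq> 0}"
      using assms **[of _ ms] by (auto simp: factorizations_def sd expo_ops simp flip: expo_def)
  qed
qed (use assms in \<open>auto simp: ops_inverse factorizations_def\<close>)

lemma sort_sign_dec:
  "length ms = Suc k \<Longrightarrow> i \<le> k \<Longrightarrow> sort_sign (dec i v ms) = sort_sign ms"
proof -
  assume "length ms = Suc k" "i \<le> k"
  then have "snd (dec i v ms ! j) = snd (ms ! j)" for j by (auto simp: nth_ops)
  then show ?thesis by (simp add: sort_sign_def)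
qed

text \<open>Removing one copy of the generator from slot \<open>i\<close> is a bijection between
  factorizations that preserves the sorting sign. Multiplication in any slot is therefore
  multiplication of the product.\<close>

lemma super_mult_m_even:
  assumes "fin_mono (e, S)" "i \<le> k"
  shows "super_mult k (m_even i v t) (e, S) = (if e v = 0 then 0 else super_mult k t (e(v := e v - 1), S))"
proof (cases "e v = 0")
  case True
  then have "expo i v ms = 0" if "ms \<in> factorizations k (e, S)" for ms
    using factorizationsD(3)[OF that assms(2), of v] by simp
  then show ?thesis using True by (simp add: super_mult_def m_even_def)
next
  case False
  have "super_mult k (m_even i v t) (e, S) =
      (\<Sum>ms\<in>{ms \<in> factorizations k (e, S). expo i v ms \<noteq> 0}. sort_sign (dec i v ms) * t (dec i v ms))"
    unfolding super_mult_def using assms finite_factorizations[OF assms(1)]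
    by (intro sum.mono_neutral_cong_right) (auto simp: m_even_def sort_sign_dec factorizationsD(1))
  also have "\<dots> = super_mult k t (e(v := e v - 1), S)"
    unfolding super_mult_def by (rule sum.reindex_bij_betw[OF factorizations_dec[of i k e v S]]) (use assms False in auto)
  finally show ?thesis using False by simp
qed

lemma factorizations_tog:
  assumes "i \<le> k" "u \<in> S"
  shows "bij_betw (tog i u) {ms \<in> factorizations k (e, S). occ i u ms} (factorizations k (e, S - {u}))"
proof (rule bij_betwI[where g = "tog i u"])
  have sd: "snd (tog i u ms ! j) = (if j = i then toggle u (snd (ms ! j)) else snd (ms ! j))"
    "fst (tog i u ms ! j) = fst (ms ! j)" if "length ms = Suc k" for ms j
    using that assms by (auto simp: nth_ops)
  show "tog i u \<in> {ms \<in> factorizations k (e, S). occ i u ms} \<rightarrow> factorizations k (e, S - {u})"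
  proof (intro funcsetI)
    fix ms assume "ms \<in> {ms \<in> factorizations k (e, S). occ i u ms}"
    then have ms: "ms \<in> factorizations k (e, S)" and u: "u \<in> snd (ms ! i)" by (auto simp: occ_def)
    have nu: "u \<notin> snd (ms ! j)" if "j \<le> k" "j \<noteq> i" for j
      using factorizationsD(6)[OF ms that(1) assms(1), of u] u that by (auto simp: occ_def)
    have sn: "snd (tog i u ms ! j) = snd (ms ! j) - {u}" if "j \<le> k" for j
      using nu[OF that] u ms by (auto simp: sd factorizations_def toggle_def)
    have un: "(\<Union>j\<le>k. snd (tog i u ms ! j)) = (\<Union>j\<le>k. snd (ms ! j)) - {u}"
      by (auto simp: sn)
    show "tog i u ms \<in> factorizations k (e, S - {u})"
      using ms unfolding factorizations_def mem_Collect_eq fst_conv snd_conv un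
      by (auto simp: sn sd(2))
  qed
  show "tog i u \<in> factorizations k (e, S - {u}) \<rightarrow> {ms \<in> factorizations k (e, S). occ i u ms}"
  proof (intro funcsetI)
    fix ms assume ms: "ms \<in> factorizations k (e, S - {u})"
    have nu: "u \<notin> snd (ms ! j)" if "j \<le> k" for j
      using factorizationsD(4)[OF ms that] by auto
    have sn: "snd (tog i u ms ! j) = (if j = i then insert u (snd (ms ! j)) else snd (ms ! j))" if "j \<le> k" for j
      using nu[OF that] ms by (auto simp: sd factorizations_def toggle_def)
    have un: "(\<Union>j\<le>k. snd (tog i u ms ! j)) = insert u (\<Union>j\<le>k. snd (ms ! j))"
      using assms by (auto simp: sn)
    show "tog i u ms \<in> {ms \<in> factorizations k (e, S). occ i u ms}"
      using ms assms nu unfolding factorizations_def mem_Collect_eq fst_conv snd_conv un occ_def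
      by (auto simp: sn sd(2))
  qed
qed (use assms in \<open>auto simp: ops_inverse factorizations_def\<close>)

lemma sum_factorizations_occ:
  assumes "fin_mono (e, S)" "i \<le> k" "u \<in> S"
  shows "(\<Sum>ms\<in>factorizations k (e, S). if occ i u ms then F ms else 0) =
    (\<Sum>b\<in>factorizations k (e, S - {u}). F (tog i u b))"
proof -
  have "(\<Sum>ms\<in>factorizations k (e, S). if occ i u ms then F ms else 0) =
      (\<Sum>ms\<in>{ms \<in> factorizations k (e, S). occ i u ms}. F (tog i u (tog i u ms)))"
    using finite_factorizations[OF assms(1)] assms(2)
    by (intro sum.mono_neutral_cong_right) (auto simp: ops_inverse factorizationsD(1))
  also have "\<dots> = (\<Sum>b\<in>factorizations k (e, S - {u}). F (tog i u b))"
    by (rule sum.reindex_bij_betw[OF factorizations_tog[OF assms(2,3)]])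
  finally show ?thesis .
qed

text \<open>The sign of moving the generator \<open>u\<close> from the far left of the whole product
  to its sorted place.\<close>

definition low_sign :: "nat \<Rightarrow> nat \<Rightarrow> mono list \<Rightarrow> 'k::comm_ring_1 fps" where
  "low_sign k u ms = (-1) ^ (\<Sum>j\<le>k. card {w \<in> snd (ms ! j). w < u})"

text \<open>Inserting \<open>u\<close> in slot \<open>i\<close> creates inversions with the larger
  generators to the left and the smaller ones to the right. \<open>kos\<close> counts all generators
  to the left and the smaller ones in slot \<open>i\<close>, \<open>low_sign\<close> all smaller
  ones; modulo 2 the two counts add up to the number of new inversions.\<close>

lemma sort_sign_tog:
  assumes g: "good k ms" and i: "i \<le> k" and nu: "\<And>j. j \<le> k \<Longrightarrow> u \<notin> snd (ms ! j)"
  shows "sort_sign (tog i u ms) = sort_sign ms * (kos i u ms * low_sign k u ms :: 'k::comm_ring_1 fps)"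
proof -
  define S where "S j = snd (ms ! j)" for j
  define L where "L j = card {w \<in> S j. w < u}" for j
  define G where "G j = card {w \<in> S j. u < w}" for j
  have fin: "finite (S j)" if "j \<le> k" for j using g that by (auto simp: good_def fin_mono_def S_def)
  have len: "length ms = Suc k" using g by (simp add: good_def)
  have sn: "snd (tog i u ms ! j) = (if j = i then insert u (S j) else S j)" if "j \<le> k" for j
    using nu[OF that] len i by (auto simp: nth_ops S_def toggle_def)
  define I where "I = {(i, j, u, w). i < j \<and> j < length ms \<and> u \<in> snd (ms ! i) \<and> w \<in> snd (ms ! j) \<and> w < u}"
  \<comment> \<open>\<open>I\<close> holds the old inversions. In \<open>A\<close> the new generator
    is the larger entry on the left, in \<open>B\<close> the smaller entry on the right.\<close>
  define A where "A = (\<lambda>(j, w). (i, j, u, w)) ` (SIGMA j:{i<..k}. {w \<in> S j. w < u})"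
  define B where "B = (\<lambda>(j, w). (j, i, w, u)) ` (SIGMA j:{..<i}. {w \<in> S j. u < w})"
  have I': "I = {(i, j, u, w). i < j \<and> j \<le> k \<and> u \<in> S i \<and> w \<in> S j \<and> w < u}"
    by (auto simp: I_def len S_def)
  have "I \<subseteq> {..k} \<times> {..k} \<times> (\<Union>j\<le>k. S j) \<times> (\<Union>j\<le>k. S j)"
    unfolding I' by (auto; meson atMost_iff less_imp_le le_trans)
  then have fI: "finite I" by (rule finite_subset) (use fin in auto)
  have fL: "finite {w \<in> S j. w < u}" "finite {w \<in> S j. u < w}" if "j \<le> k" for j
    using fin[OF that] by auto
  have fA: "finite A" "finite B"
    unfolding A_def B_def using fL i by (intro finite_imageI finite_SigmaI; simp)+
  have cA: "card A = (\<Sum>j\<in>{i<..k}. L j)"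
    unfolding A_def L_def using fL by (subst card_image) (auto simp: inj_on_def)
  have cB: "card B = (\<Sum>j<i. G j)"
    unfolding B_def G_def using fL i by (subst card_image) (auto simp: inj_on_def)
  have nu': "u \<notin> S j" if "j \<le> k" for j using nu[OF that] by (simp add: S_def)
  have "{(i', j, u', w). i' < j \<and> j < length (tog i u ms) \<and> u' \<in> snd (tog i u ms ! i') \<and> w \<in> snd (tog i u ms ! j) \<and> w < u'}
     = {(i', j, u', w). i' < j \<and> j \<le> k \<and> u' \<in> (if i' = i then insert u (S i') else S i') \<and> w \<in> (if j = i then insert u (S j) else S j) \<and> w < u'}"
    by (auto simp: len sn less_Suc_eq_le)
  also have "\<dots> = I \<union> (A \<union> B)"
    using i nu' unfolding I' A_def B_def by (auto simp: image_iff split: if_splits)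
  finally have inv: "{(i', j, u', w). i' < j \<and> j < length (tog i u ms) \<and> u' \<in> snd (tog i u ms ! i') \<and> w \<in> snd (tog i u ms ! j) \<and> w < u'} = I \<union> (A \<union> B)" .
  have dj: "I \<inter> (A \<union> B) = {}" "A \<inter> B = {}"
    using i nu' unfolding I' A_def B_def by auto
  have card: "card (I \<union> (A \<union> B)) = card I + ((\<Sum>j\<in>{i<..k}. L j) + (\<Sum>j<i. G j))"
    using fI fA dj by (simp add: card_Un_disjoint cA cB)
  have cS: "card (S j) = L j + G j" if "j \<le> k" for j
  proof -
    have "S j = {w \<in> S j. w < u} \<union> {w \<in> S j. u < w}" using nu'[OF that] by (auto; metis linorder_neqE_nat)
    then have "card (S j) = card ({w \<in> S j. w < u} \<union> {w \<in> S j. u < w})" by simp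
    also have "\<dots> = L j + G j" unfolding L_def G_def using fin[OF that] by (intro card_Un_disjoint) auto
    finally show ?thesis .
  qed
  have kos: "kos i u ms = ((-1) ^ ((\<Sum>j<i. L j + G j) + L i) :: 'k fps)"
    unfolding kos_def using i cS by (simp add: L_def S_def)
  have split: "{..k} = {..<i} \<union> {i} \<union> {i<..k}" using i by auto
  have "(\<Sum>j\<le>k. L j) = (\<Sum>j\<in>{..<i} \<union> {i}. L j) + (\<Sum>j\<in>{i<..k}. L j)"
    unfolding split by (intro sum.union_disjoint) auto
  also have "(\<Sum>j\<in>{..<i} \<union> {i}. L j) = (\<Sum>j<i. L j) + L i" by (subst sum.union_disjoint) auto
  finally have sumL: "(\<Sum>j\<le>k. L j) = (\<Sum>j<i. L j) + L i + (\<Sum>j\<in>{i<..k}. L j)" .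
  have low: "low_sign k u ms = ((-1) ^ ((\<Sum>j<i. L j) + L i + (\<Sum>j\<in>{i<..k}. L j)) :: 'k fps)"
    by (simp only: low_sign_def sumL[symmetric]) (simp only: L_def S_def)
  have "sort_sign (tog i u ms) = ((-1) ^ (card I + ((\<Sum>j\<in>{i<..k}. L j) + (\<Sum>j<i. G j))) :: 'k fps)"
    unfolding sort_sign_def inv card ..
  \<comment> \<open>An even number is added so that the exponent splits into those of
    \<open>kos\<close> and \<open>low_sign\<close>.\<close>
  also have "\<dots> = (-1) ^ (card I + ((\<Sum>j\<in>{i<..k}. L j) + (\<Sum>j<i. G j)) + 2 * ((\<Sum>j<i. L j) + L i))"
    by (simp add: power_add power_mult)
  also have "\<dots> = (-1) ^ card I * ((-1) ^ ((\<Sum>j<i. L j + G j) + L i) * (-1) ^ ((\<Sum>j<i. L j) + L i + (\<Sum>j\<in>{i<..k}. L j)))"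
    unfolding power_add[symmetric] by (rule arg_cong[where f = "(^) (-1)"]) (simp add: sum.distrib)
  finally show ?thesis unfolding kos low by (simp add: sort_sign_def I_def)
qed

text \<open>The slot cancels between the Koszul sign and the sorting sign, and the right-hand side
  no longer mentions \<open>i\<close>. Under the product an odd generator can therefore be moved to
  any other slot.\<close>

lemma super_mult_m_odd:
  assumes "fin_mono (e, S)" "i \<le> k"
  shows "super_mult k (m_odd i u t) (e, S) =
    (if u \<in> S then \<Sum>b\<in>factorizations k (e, S - {u}). sort_sign b * low_sign k u b * t b else 0)"
proof (cases "u \<in> S")
  case False
  then have "\<not> occ i u ms" if "ms \<in> factorizations k (e, S)" for ms
    using factorizationsD(4)[OF that assms(2)] by (auto simp: occ_def)
  then show ?thesis using False by (simp add: super_mult_def m_odd_def)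
next
  case True
  have f: "fin_mono (e, S - {u})" using assms by (simp add: fin_mono_def)
  have "super_mult k (m_odd i u t) (e, S) = (\<Sum>ms\<in>factorizations k (e, S).
      if occ i u ms then sort_sign ms * (kos i u ms * t (tog i u ms)) else 0)"
    unfolding super_mult_def by (intro sum.cong) (auto simp: m_odd_def)
  also have "\<dots> = (\<Sum>b\<in>factorizations k (e, S - {u}). sort_sign (tog i u b) * (kos i u (tog i u b) * t (tog i u (tog i u b))))"
    by (rule sum_factorizations_occ[OF assms(1,2) True])
  also have "\<dots> = (\<Sum>b\<in>factorizations k (e, S - {u}). sort_sign b * low_sign k u b * t b)"
  proof (rule sum.cong[OF refl])
    fix b assume b: "b \<in> factorizations k (e, S - {u})"
    have g: "good k b" using factorizations_good[OF b] f by simp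
    have "u \<notin> snd (b ! j)" if "j \<le> k" for j using factorizationsD(4)[OF b that] by auto
    note s = sort_sign_tog[OF g assms(2) this]
    show "sort_sign (tog i u b) * (kos i u (tog i u b) * t (tog i u (tog i u b))) = sort_sign b * low_sign k u b * t b"
      using assms factorizationsD(1)[OF b] by (simp add: s kos_tog[OF g] ops_inverse mult_ac)
  qed
  finally show ?thesis using True by simp
qed

lemma sum_antisymmetric:
  fixes g :: "nat \<Rightarrow> nat \<Rightarrow> 'k::field_char_0 fps"
  assumes "\<And>i j. i \<le> k \<Longrightarrow> j \<le> k \<Longrightarrow> g i j = - g j i"
  shows "(\<Sum>i\<le>k. \<Sum>j\<le>k. g i j) = 0"
proof -
  have "(\<Sum>i\<le>k. \<Sum>j\<le>k. g i j) = (\<Sum>i\<le>k. \<Sum>j\<le>k. - g j i)"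
    by (intro sum.cong refl assms) simp_all
  also have "\<dots> = - (\<Sum>i\<le>k. \<Sum>j\<le>k. g i j)"
    by (subst sum.swap) (simp add: sum_negf)
  finally have "2 * (\<Sum>i\<le>k. \<Sum>j\<le>k. g i j) = 0" by simp
  then have "cst 2 * (\<Sum>i\<le>k. \<Sum>j\<le>k. g i j) = 0" by (simp add: numeral_fps_const)
  then show ?thesis by (metis fps_const_eq_0_iff mult_eq_0_iff zero_neq_numeral)
qed

text \<open>By the Leibniz rule the sum is the derivative of the product by the generator
  \<open>u\<close>, so no monomial of it contains \<open>u\<close>. Combinatorially,
  \<open>u\<close> already sits in one slot \<open>i0\<close> and the derivative refers to the
  coefficient with \<open>u\<close> in another slot \<open>i\<close> as well; exchanging
  \<open>i\<close> and \<open>i0\<close> reverses the sign.\<close>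

lemma super_mult_d_odd_sum:
  fixes t :: "'k::field_char_0 wc_tensor"
  assumes fin: "fin_mono (e, S)" and u: "u \<in> S"
  shows "(\<Sum>i\<le>k. super_mult k (d_odd i u t) (e, S)) = 0"
proof -
  have f: "fin_mono (e, S - {u})" using fin by (simp add: fin_mono_def)
  define F where "F i ms = sort_sign ms * d_odd i u t ms" for i ms
  define g where "g b i i0 = (if i = i0 then 0 else
    (sort_sign b * low_sign k u b) * (kos i0 u b * (if i0 < i then - kos i u b else kos i u b) * t (tog i u (tog i0 u b))))" for b i i0
  have one: "F i ms = (\<Sum>i0\<le>k. if occ i0 u ms then F i ms else 0)" if ms: "ms \<in> factorizations k (e, S)" for i ms
  proof -
    obtain i1 where i1: "i1 \<le> k" "occ i1 u ms" using factorizationsD(7)[OF ms u] by blast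
    have "occ x u ms \<longleftrightarrow> x = i1" if "x \<le> k" for x
      using factorizationsD(6)[OF ms that i1(1), of u] i1 by blast
    then have "(\<Sum>i0\<le>k. if occ i0 u ms then F i ms else 0) = (\<Sum>i0\<le>k. if i0 = i1 then F i ms else 0)"
      by (intro sum.cong) auto
    then show ?thesis using i1 by simp
  qed
  have tb: "F i (tog i0 u b) = g b i i0" if b: "b \<in> factorizations k (e, S - {u})" and i: "i \<le> k" "i0 \<le> k" for b i i0
  proof -
    have gd: "good k b" using factorizations_good[OF b] f by simp
    have nu: "u \<notin> snd (b ! j)" if "j \<le> k" for j using factorizationsD(4)[OF b that] by auto
    have o: "occ i u (tog i0 u b) \<longleftrightarrow> i = i0"
      using nu[OF i(1)] i factorizationsD(1)[OF b] by (auto simp: occ_def nth_ops)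
    show ?thesis
      using i by (auto simp: F_def g_def d_odd_eq o sort_sign_tog[OF gd i(2) nu] kos_tog[OF gd] mult_ac)
  qed
  have "(\<Sum>i\<le>k. super_mult k (d_odd i u t) (e, S)) = (\<Sum>i\<le>k. \<Sum>ms\<in>factorizations k (e, S). \<Sum>i0\<le>k. if occ i0 u ms then F i ms else 0)"
    unfolding super_mult_def F_def[symmetric] by (intro sum.cong refl one)
  also have "\<dots> = (\<Sum>i\<le>k. \<Sum>i0\<le>k. \<Sum>ms\<in>factorizations k (e, S). if occ i0 u ms then F i ms else 0)"
    by (intro sum.cong refl sum.swap)
  also have "\<dots> = (\<Sum>i\<le>k. \<Sum>i0\<le>k. \<Sum>b\<in>factorizations k (e, S - {u}). F i (tog i0 u b))"
    by (intro sum.cong refl sum_factorizations_occ[OF fin _ u]) auto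
  also have "\<dots> = (\<Sum>i\<le>k. \<Sum>i0\<le>k. \<Sum>b\<in>factorizations k (e, S - {u}). g b i i0)"
    by (intro sum.cong refl) (simp add: tb)
  also have "\<dots> = (\<Sum>b\<in>factorizations k (e, S - {u}). \<Sum>i\<le>k. \<Sum>i0\<le>k. g b i i0)"
    by (subst sum.swap[of _ _ "factorizations k (e, S - {u})"]) (intro sum.cong refl sum.swap)
  also have "\<dots> = 0"
  proof (rule sum.neutral, rule ballI, rule sum_antisymmetric)
    fix b i j assume b: "b \<in> factorizations k (e, S - {u})" and "i \<le> k" "j \<le> k"
    then have "tog i u (tog j u b) = tog j u (tog i u b)"
      using factorizationsD(1)[OF b] by (intro ops_commute) auto
    then show "g b i j = - g b j i"
      by (auto simp: g_def mult_ac)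
  qed
  finally show ?thesis .
qed

subsection \<open>Tensors of monomials\<close>

definition unit_wc :: "'k::comm_ring_1 wc" where
  "unit_wc = const_elem 1"

lemma unit_wc: "unit_wc m = (if m = (\<lambda>_. 0, {}) then 1 else 0)"
  by (cases m) (auto simp: unit_wc_def const_elem_def)

definition fin_supp :: "'k::zero wc \<Rightarrow> bool" where
  "fin_supp f \<longleftrightarrow> (\<forall>m. f m \<noteq> 0 \<longrightarrow> fin_mono m)"

definition m_even1 :: "nat \<Rightarrow> 'k::comm_ring_1 wc \<Rightarrow> 'k wc" where
  "m_even1 v f = (\<lambda>(e, S). if e v = 0 then 0 else f (e(v := e v - 1), S))"

definition d_even1 :: "nat \<Rightarrow> 'k::comm_ring_1 wc \<Rightarrow> 'k wc" where
  "d_even1 v f = (\<lambda>(e, S). of_nat (e v + 1) * f (e(v := e v + 1), S))"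

definition m_odd1 :: "nat \<Rightarrow> 'k::comm_ring_1 wc \<Rightarrow> 'k wc" where
  "m_odd1 u f = (\<lambda>(e, S). if u \<in> S then (-1) ^ card {w \<in> S. w < u} * f (e, S - {u}) else 0)"

definition d_odd1 :: "nat \<Rightarrow> 'k::comm_ring_1 wc \<Rightarrow> 'k wc" where
  "d_odd1 u f = (\<lambda>(e, S). if u \<in> S then 0 else (-1) ^ card {w \<in> S. w < u} * f (e, insert u S))"

definition left_sign :: "nat \<Rightarrow> mono list \<Rightarrow> 'k::comm_ring_1 fps" where
  "left_sign i ms = (-1) ^ (\<Sum>j<i. card (snd (ms ! j)))"

lemma left_sign_square: "left_sign i ms * (left_sign i ms * x) = x"
  by (simp add: left_sign_def flip: mult.assoc power_mult_distrib)

lemma tensor_upd: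
  assumes "i < length fs"
  shows "tensor (fs[i := g]) ms =
    (if length ms = length fs then g (ms ! i) * (\<Prod>j\<in>{..<length fs} - {i}. (fs ! j) (ms ! j)) else 0)"
proof -
  have "(\<Prod>j<length fs. (fs[i := g] ! j) (ms ! j)) = g (ms ! i) * (\<Prod>j\<in>{..<length fs} - {i}. (fs[i := g] ! j) (ms ! j))"
    using assms by (subst prod.remove[of _ i]) auto
  also have "(\<Prod>j\<in>{..<length fs} - {i}. (fs[i := g] ! j) (ms ! j)) = (\<Prod>j\<in>{..<length fs} - {i}. (fs ! j) (ms ! j))"
    by (intro prod.cong) auto
  finally show ?thesis by (simp add: tensor_def)
qed

lemma tensor_remove:
  assumes "i < length fs"
  shows "tensor fs ms =
    (if length ms = length fs then (fs ! i) (ms ! i) * (\<Prod>j\<in>{..<length fs} - {i}. (fs ! j) (ms ! j)) else 0)"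
  using tensor_upd[OF assms, of "fs ! i" ms] by simp

lemma tensor_remove_upd:
  assumes "i < length fs"
  shows "tensor fs (ms[i := m]) =
    (if length ms = length fs then (fs ! i) m * (\<Prod>j\<in>{..<length fs} - {i}. (fs ! j) (ms ! j)) else 0)"
proof -
  have "(\<Prod>j\<in>{..<length fs} - {i}. (fs ! j) (ms[i := m] ! j)) = (\<Prod>j\<in>{..<length fs} - {i}. (fs ! j) (ms ! j))"
    by (intro prod.cong) auto
  then show ?thesis using assms by (simp add: tensor_remove)
qed

lemma ops_tensor:
  fixes fs :: "'k::comm_ring_1 wc list"
  assumes "i < length fs"
  shows "m_even i v (tensor fs) = tensor (fs[i := m_even1 v (fs ! i)])"
    "d_even i v (tensor fs) = tensor (fs[i := d_even1 v (fs ! i)])"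
    "m_odd i u (tensor fs) ms = left_sign i ms * tensor (fs[i := m_odd1 u (fs ! i)]) ms"
    "d_odd i u (tensor fs) ms = left_sign i ms * tensor (fs[i := d_odd1 u (fs ! i)]) ms"
  using assms
  by (auto simp: fun_eq_iff m_even_def d_even_eq m_odd_def d_odd_eq expo_def occ_def dec_def inc_def tog_def
    toggle_def tensor_upd tensor_remove_upd m_even1_def d_even1_def m_odd1_def d_odd1_def kos_def left_sign_def
    power_add case_prod_beta mult_ac)

text \<open>Two odd generators pass the slots on the left with the same sign twice. Quadratic
  vertices can thus be placed to the right of \<open>Theta\<close> whatever the parity of
  \<open>a + b\<close>.\<close>

lemma m_odd_m_odd_tensor:
  fixes fs :: "'k::comm_ring_1 wc list"
  assumes "i < length fs"
  shows "m_odd i u (m_odd i w (tensor fs)) = tensor (fs[i := m_odd1 u (m_odd1 w (fs ! i))])"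
proof
  fix ms
  have L: "left_sign i (tog i u ms) = left_sign i ms"
    by (simp add: left_sign_def tog_def)
  define t' where "t' = tensor (fs[i := m_odd1 w (fs ! i)])"
  have "m_odd i u (m_odd i w (tensor fs)) ms = left_sign i ms * m_odd i u t' ms"
    by (simp add: m_odd_def[of i u] ops_tensor[OF assms] L t'_def)
  also have "m_odd i u t' ms = left_sign i ms * tensor (fs[i := m_odd1 u (m_odd1 w (fs ! i))]) ms"
    unfolding t'_def using assms by (subst ops_tensor) auto
  finally show "m_odd i u (m_odd i w (tensor fs)) ms = tensor (fs[i := m_odd1 u (m_odd1 w (fs ! i))]) ms"
    by (simp add: left_sign_square)
qed

definition even_supp :: "'k::zero wc \<Rightarrow> bool" where
  "even_supp f \<longleftrightarrow> (\<forall>e S. f (e, S) \<noteq> 0 \<longrightarrow> even (card S))"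

lemma odd_ops_tensor_even:
  fixes fs :: "'k::comm_ring_1 wc list"
  assumes i: "i < length fs" and ev: "\<And>j. j < i \<Longrightarrow> even_supp (fs ! j)"
  shows "m_odd i u (tensor fs) = tensor (fs[i := m_odd1 u (fs ! i)])"
    "d_odd i u (tensor fs) = tensor (fs[i := d_odd1 u (fs ! i)])"
proof -
  have *: "left_sign i ms * tensor (fs[i := g]) ms = tensor (fs[i := g]) ms" for g ms
  proof (cases "\<forall>j<i. (fs ! j) (ms ! j) \<noteq> 0")
    case True
    then have "even (card (snd (ms ! j)))" if "j < i" for j
      using ev[OF that] that unfolding even_supp_def by (metis prod.collapse)
    then have "even (\<Sum>j<i. card (snd (ms ! j)))" by (intro dvd_sum) auto
    then show ?thesis by (simp add: left_sign_def)
  next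
    case False
    then obtain j where "j < i" "(fs ! j) (ms ! j) = 0" by blast
    then have "(\<Prod>j\<in>{..<length fs} - {i}. (fs ! j) (ms ! j)) = 0"
      using i by (intro prod_zero) auto
    then show ?thesis by (simp add: tensor_upd[OF i])
  qed
  show "m_odd i u (tensor fs) = tensor (fs[i := m_odd1 u (fs ! i)])"
    "d_odd i u (tensor fs) = tensor (fs[i := d_odd1 u (fs ! i)])"
    by (simp_all add: fun_eq_iff ops_tensor[OF i] *)
qed

lemma tensor_in_tens:
  assumes "length fs = Suc k" "\<And>i. i \<le> k \<Longrightarrow> fin_supp (fs ! i)"
  shows "tensor fs \<in> tens k"
proof (rule tensI)
  fix ms assume "\<not> good k ms"
  then consider "length ms \<noteq> Suc k" | i where "i \<le> k" "\<not> fin_mono (ms ! i)" by (auto simp: good_def)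
  then show "tensor fs ms = 0"
  proof cases
    case 2
    then have "(fs ! i) (ms ! i) = 0" using assms(2)[OF 2(1)] unfolding fin_supp_def by blast
    then show ?thesis using 2 assms by (subst tensor_remove[of i]) auto
  qed (use assms in \<open>simp add: tensor_def\<close>)
qed

context
  notes replicate_Suc [simp del]
begin

text \<open>The factors \<open>unit_wc\<close> force the empty monomial in every slot but
  \<open>i\<close>, so a single factorization contributes, and it has no inversions.\<close>

lemma super_mult_tensor_unit:
  fixes f :: "'k::comm_ring_1 wc"
  assumes i: "i \<le> k" and m: "fin_mono m"
  shows "super_mult k (tensor ((replicate (Suc k) unit_wc)[i := f])) m = f m"
proof -
  define ms0 where "ms0 = (replicate (Suc k) (\<lambda>_::nat. 0::nat, {}::nat set))[i := m]"
  have nth0: "ms0 ! j = (if j = i then m else (\<lambda>_. 0, {}))" if "j \<le> k" for j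
    using that i by (auto simp: ms0_def nth_list_update)
  have t: "tensor ((replicate (Suc k) unit_wc)[i := f]) ms =
    (if length ms = Suc k then f (ms ! i) * (\<Prod>j\<in>{..<Suc k} - {i}. unit_wc (ms ! j)) else 0)" for ms
    using i by (subst tensor_upd) (auto intro!: arg_cong2[where f = "(*)"] prod.cong)
  have mem: "ms0 \<in> factorizations k m"
  proof -
    have "(\<Sum>j\<le>k. fst (ms0 ! j) v) = (\<Sum>j\<le>k. if j = i then fst m v else 0)" for v
      by (intro sum.cong) (auto simp: nth0)
    moreover have "(\<Union>j\<le>k. snd (ms0 ! j)) = snd m" using i by (auto simp: nth0 split: if_splits)
    ultimately show ?thesis using i by (auto simp: factorizations_def nth0) (simp add: ms0_def)
  qed
  have uniq: "ms = ms0" if ms: "ms \<in> factorizations k m" and nz: "tensor ((replicate (Suc k) unit_wc)[i := f]) ms \<noteq> 0" for ms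
  proof -
    have len: "length ms = Suc k" using ms by (simp add: factorizations_def)
    have z: "ms ! j = (\<lambda>_. 0, {})" if "j \<le> k" "j \<noteq> i" for j
    proof (rule ccontr)
      assume "\<not> ?thesis"
      then have "(\<Prod>j\<in>{..<Suc k} - {i}. unit_wc (ms ! j) :: 'k fps) = 0"
        using that by (intro prod_zero) (auto simp: unit_wc intro!: bexI[of _ j])
      then show False using nz unfolding t by (metis mult_zero_right)
    qed
    have "fst (ms ! i) v = fst m v" for v
    proof -
      have "fst m v = (\<Sum>j\<le>k. fst (ms ! j) v)" using ms by (simp add: factorizations_def)
      also have "\<dots> = (\<Sum>j\<le>k. if j = i then fst (ms ! i) v else 0)" by (intro sum.cong) (auto simp: z)
      finally show ?thesis using i by simp
    qed
    moreover have "snd (ms ! i) = snd m"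
    proof -
      have "snd m = (\<Union>j\<le>k. snd (ms ! j))" using ms by (simp add: factorizations_def)
      also have "\<dots> = snd (ms ! i)" using i z by (auto; metis empty_iff snd_conv)
      finally show ?thesis ..
    qed
    ultimately have "ms ! i = m" by (simp add: prod_eq_iff fun_eq_iff)
    then have "ms ! j = ms0 ! j" if "j \<le> k" for j using z[OF that] nth0[OF that] by (cases "j = i") auto
    moreover have "length ms0 = Suc k" by (simp add: ms0_def)
    ultimately show ?thesis using len by (intro nth_equalityI) (auto simp: less_Suc_eq_le)
  qed
  have "super_mult k (tensor ((replicate (Suc k) unit_wc)[i := f])) m = (\<Sum>ms\<in>{ms0}. sort_sign ms * tensor ((replicate (Suc k) unit_wc)[i := f]) ms)"
    unfolding super_mult_def
  proof (rule sum.mono_neutral_right[OF finite_factorizations[OF m]])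
    show "\<forall>ms\<in>factorizations k m - {ms0}. sort_sign ms * tensor ((replicate (Suc k) unit_wc)[i := f]) ms = 0"
      using uniq by (metis Diff_iff insert_iff mult_zero_right)
  qed (use mem in simp)
  also have "\<dots> = sort_sign ms0 * f m"
  proof -
    have "(\<Prod>j\<in>{..<Suc k} - {i}. unit_wc (ms0 ! j) :: 'k fps) = 1"
      by (intro prod.neutral) (auto simp: nth0 unit_wc less_Suc_eq_le)
    moreover have "ms0 ! i = m" "length ms0 = Suc k" using i by (auto simp: ms0_def)
    ultimately show ?thesis by (simp add: t)
  qed
  also have "sort_sign ms0 = (1 :: 'k fps)"
  proof -
    have "{(i, j, u, w). i < j \<and> j < length ms0 \<and> u \<in> snd (ms0 ! i) \<and> w \<in> snd (ms0 ! j) \<and> w < u} = {}"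
    proof -
      have len: "length ms0 = Suc k" by (simp add: ms0_def)
      show ?thesis unfolding len by (auto simp: nth0 less_Suc_eq_le split: if_splits)
    qed
    then show ?thesis by (simp only: sort_sign_def card.empty power_0)
  qed
  finally show ?thesis by simp
qed

end

subsection \<open>The functional \<open>\<Upsilon> \<circ> \<omega>\<close>\<close>

definition symp_entry :: "nat \<Rightarrow> nat \<Rightarrow> nat \<Rightarrow> 'k::comm_ring_1" where
  "symp_entry n A B = (if A < n \<and> B = n + A then 1 else if B < n \<and> A = n + B then -1 else 0)"

lemma mode_even: "mode k (1 :: 'k::field_char_0) (symp_entry n) d_even m_even"
proof unfold_locales
  fix t :: "'k wc_tensor" and i j A B assume *: "t \<in> tens k" "i \<le> k" "j \<le> k"
  show "d_even i A (d_even j B t) = sc (cst 1) (d_even j B (d_even i A t))"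
    using d_even_commute[OF *] by simp
  show "m_even i A (m_even j B t) = sc (cst 1) (m_even j B (m_even i A t))"
    using m_even_commute[OF *] by simp
  show "d_even i A (m_even j B t) = (if i = j \<and> A = B then t else 0) + sc (cst 1) (m_even j B (d_even i A t))"
    using d_even_m_even[OF *] by simp
qed (auto simp: symp_entry_def)

lemma mode_odd: "mode k (-1 :: 'k::field_char_0) (h_form a b) d_odd m_odd"
proof unfold_locales
  have m: "sc (cst (-1)) t = - t" for t :: "'k wc_tensor"
    by (simp add: sc_minus_left flip: fps_const_neg)
  fix t :: "'k wc_tensor" and i j A B assume *: "t \<in> tens k" "i \<le> k" "j \<le> k"
  show "d_odd i A (d_odd j B t) = sc (cst (- 1)) (d_odd j B (d_odd i A t))"
    unfolding m by (rule d_odd_anticommute[OF *])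
  show "m_odd i A (m_odd j B t) = sc (cst (- 1)) (m_odd j B (m_odd i A t))"
    unfolding m by (rule m_odd_anticommute[OF *])
  show "d_odd i A (m_odd j B t) = (if i = j \<and> A = B then t else 0) + sc (cst (- 1)) (m_odd j B (d_odd i A t))"
    unfolding m using d_odd_m_odd[OF *, of A B] by simp
qed (auto simp: h_form_def)

abbreviation "con_even n \<equiv> mode.con (2 * n) (symp_entry n) d_even"
abbreviation "con_odd a b \<equiv> mode.con (a + b) (h_form a b) d_odd"

lemma two_modes_even: "two_modes k (1 :: 'k::field_char_0) (symp_entry n) d_even m_even (con_odd a b)"
proof -
  interpret o: mode k "a + b" "-1 :: 'k" "h_form a b" d_odd m_odd by (rule mode_odd)
  interpret e: mode k "2 * n" "1 :: 'k" "symp_entry n" d_even m_even by (rule mode_even)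
  show ?thesis
  proof unfold_locales
    fix t :: "'k wc_tensor" and i j x A assume *: "t \<in> tens k" "i \<le> k" "j \<le> k" "x \<le> k"
    have "d_odd j B (d_odd i A' (m_even x A t)) = m_even x A (d_odd j B (d_odd i A' t))"
      "d_odd j B (d_odd i A' (d_even x A t)) = d_even x A (d_odd j B (d_odd i A' t))" for A' B
      using * by (simp_all add: even_odd_commute[of _ k, symmetric])
    then show "o.con i j (m_even x A t) = m_even x A (o.con i j t)" "o.con i j (d_even x A t) = d_even x A (o.con i j t)"
      by (simp_all add: o.con_def linopD[OF linop_basic(1)] linopD[OF linop_basic(2)])
  qed (auto simp: o.lin_con)
qed

lemma two_modes_odd: "two_modes k (-1 :: 'k::field_char_0) (h_form a b) d_odd m_odd (con_even n)"
proof -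
  interpret o: mode k "a + b" "-1 :: 'k" "h_form a b" d_odd m_odd by (rule mode_odd)
  interpret e: mode k "2 * n" "1 :: 'k" "symp_entry n" d_even m_even by (rule mode_even)
  show ?thesis
  proof unfold_locales
    fix t :: "'k wc_tensor" and i j x A assume *: "t \<in> tens k" "i \<le> k" "j \<le> k" "x \<le> k"
    have "d_even j B (d_even i A' (m_odd x A t)) = m_odd x A (d_even j B (d_even i A' t))"
      "d_even j B (d_even i A' (d_odd x A t)) = d_odd x A (d_even j B (d_even i A' t))" for A' B
      using * by (simp_all add: even_odd_commute[of _ k])
    then show "e.con i j (m_odd x A t) = m_odd x A (e.con i j t)" "e.con i j (d_odd x A t) = d_odd x A (e.con i j t)"
      by (simp_all add: e.con_def linopD[OF linop_basic(3)] linopD[OF linop_basic(4)])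
  qed (auto simp: e.lin_con)
qed

lemma sum_symp:
  "(\<Sum>A<2 * n. \<Sum>B<2 * n. cst (symp_entry n A B) * F A B) = (\<Sum>l<n. F l (n + l) - F (n + l) l :: 'k::comm_ring_1 fps)"
proof -
  have split: "(\<Sum>A<2 * n. g A) = (\<Sum>l<n. g l) + (\<Sum>l<n. g (n + l))" for g :: "nat \<Rightarrow> 'k fps"
    by (simp add: mult_2 sum.nat_group lessThan_atLeast0 sum.atLeastLessThan_concat[symmetric, of 0 n "n + n"]
        sum.shift_bounds_nat_ivl[of g 0 n n, simplified] add.commute)
  have 1: "(\<Sum>B<2 * n. cst (symp_entry n l B) * F l B) = F l (n + l)" if "l < n" for l
  proof -
    have "(\<Sum>B<2 * n. cst (symp_entry n l B) * F l B) = (\<Sum>B<2 * n. if B = n + l then F l (n + l) else 0)"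
      using that by (intro sum.cong) (auto simp: symp_entry_def)
    then show ?thesis using that by simp
  qed
  have 2: "(\<Sum>B<2 * n. cst (symp_entry n (n + l) B) * F (n + l) B) = - F (n + l) l" if "l < n" for l
  proof -
    have "(\<Sum>B<2 * n. cst (symp_entry n (n + l) B) * F (n + l) B) = (\<Sum>B<2 * n. if B = l then - F (n + l) l else 0)"
      using that by (intro sum.cong) (auto simp: symp_entry_def simp flip: fps_const_neg)
    then show ?thesis using that by simp
  qed
  show ?thesis unfolding split[of "\<lambda>A. \<Sum>B<2 * n. cst (symp_entry n A B) * F A B"]
    by (simp add: 1 2 sum_subtractf sum_negf)
qed

section \<open>The exponent as a sum of contractions\<close>

definition Dop :: "nat \<Rightarrow> nat \<Rightarrow> nat \<Rightarrow> nat \<Rightarrow> (nat \<Rightarrow> nat \<Rightarrow> 'k) \<Rightarrow> 'k::field_char_0 wc_tensor \<Rightarrow> 'k wc_tensor" where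
  "Dop n a b k c = (\<lambda>t ms. \<Sum>j\<le>k. \<Sum>i<j. fps_X * cst (c i j) * (alpha_op n i j t ms + g_op a b i j t ms))"

lemma exp_pair_op_eq: "exp_pair_op n a b k c = exp_op (Dop n a b k c)"
  by (simp add: exp_pair_op_def Dop_def)

lemma linop_Dop: "linop (Dop n a b k c)"
proof -
  have "Dop n a b k c = (\<lambda>t. \<Sum>j\<le>k. \<Sum>i<j. sc (fps_X * cst (c i j)) (sc (cst (1/2))
      (\<Sum>l<n. d_even i l (d_even j (n + l) t) - d_even i (n + l) (d_even j l t)) +
      sc (cst (1/2)) (\<Sum>u<a + b. \<Sum>w<a + b. sc (cst (h_form a b u w)) (d_odd j w (d_odd i u t)))))"
    by (intro ext) (simp add: Dop_def alpha_op_def g_op_def pointwise)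
  then show ?thesis
    by (simp only:) (intro linop_sum linop_comb(2-4) linop_basic linop_comb(1)[OF linop_basic(1) linop_basic(1)]
        linop_comb(1)[OF linop_basic(3) linop_basic(3)])
qed

lemma g_op_con: "g_op a b i j t ms = cst (1/2) * con_odd a b i j t ms"
  for t :: "'k::field_char_0 wc_tensor"
  by (simp add: g_op_def mode.con_def[OF mode_odd] pointwise)

lemma alpha_op_con:
  fixes t :: "'k::field_char_0 wc_tensor"
  assumes "t \<in> tens k" "i \<le> k" "j \<le> k"
  shows "alpha_op n i j t ms = cst (1/2) * con_even n i j t ms"
proof -
  have "con_even n i j t ms = (\<Sum>A<2 * n. \<Sum>B<2 * n. cst (symp_entry n A B) * d_even i A (d_even j B t) ms)"
    using assms by (simp add: mode.con_def[OF mode_even] pointwise d_even_commute[of t k j i])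
  then show ?thesis by (simp add: alpha_op_def sum_symp)
qed

lemma Dop_even:
  fixes t :: "'k::field_char_0 wc_tensor"
  assumes "t \<in> tens k"
  shows "Dop n a b k c t = two_modes.contr k (2 * n) (symp_entry n) d_even (con_odd a b) c t"
proof
  fix ms
  have h: "cst (c i j / 2) = cst (c i j) * cst (1/2)" for i j by simp
  show "Dop n a b k c t ms = two_modes.contr k (2 * n) (symp_entry n) d_even (con_odd a b) c t ms"
    unfolding Dop_def two_modes.contr_def[OF two_modes_even] pointwise h using assms
    by (intro sum.cong refl, subst alpha_op_con[of t k]) (auto simp only: g_op_con distrib_left mult.assoc atMost_iff lessThan_iff)
qed

text \<open>The exponent is symmetric in the two kinds of contraction. Reading it with the even
  contraction inert instead of the odd one makes both Wick rules apply to the same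
  exponential.\<close>

lemma Dop_odd:
  fixes t :: "'k::field_char_0 wc_tensor"
  assumes "t \<in> tens k"
  shows "Dop n a b k c t = two_modes.contr k (a + b) (h_form a b) d_odd (con_even n) c t"
  unfolding Dop_even[OF assms] two_modes.contr_def[OF two_modes_even] two_modes.contr_def[OF two_modes_odd]
  by (simp add: add.commute)

lemma Dop_closed: "t \<in> tens k \<Longrightarrow> Dop n a b k c t \<in> tens k" for t :: "'k::field_char_0 wc_tensor"
  by (simp add: Dop_even two_modes.closed_contr[OF two_modes_even])

definition grad_even :: "nat \<Rightarrow> nat \<Rightarrow> (nat \<Rightarrow> nat \<Rightarrow> 'k::field_char_0) \<Rightarrow> nat \<Rightarrow> nat \<Rightarrow> 'k wc_tensor \<Rightarrow> 'k wc_tensor" where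
  "grad_even n k c x A t = (\<Sum>j\<le>k. sc (cst (skew c x j / 2)) (\<Sum>B<2 * n. sc (cst (symp_entry n A B)) (d_even j B t)))"

definition grad_odd :: "nat \<Rightarrow> nat \<Rightarrow> nat \<Rightarrow> (nat \<Rightarrow> nat \<Rightarrow> 'k::field_char_0) \<Rightarrow> nat \<Rightarrow> nat \<Rightarrow> 'k wc_tensor \<Rightarrow> 'k wc_tensor" where
  "grad_odd a b k c x u t = (\<Sum>j\<le>k. sc (cst (skew c x j / 2)) (\<Sum>w<a + b. sc (cst (h_form a b u w)) (d_odd j w t)))"

context
  fixes n a b k :: nat and c :: "nat \<Rightarrow> nat \<Rightarrow> 'k::field_char_0" and t :: "'k wc_tensor"
  assumes t: "t \<in> tens k"
begin

lemma Dop_m_even: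
  assumes "x \<le> k" "A < 2 * n"
  shows "Dop n a b k c (m_even x A t) = m_even x A (Dop n a b k c t) + sc fps_X (grad_even n k c x A t)"
  unfolding Dop_even[OF t] Dop_even[OF tens_ops(2)[OF t assms(1)]] two_modes.contr_m[OF two_modes_even t assms]
  by (simp add: grad_even_def two_modes.grad_def[OF two_modes_even] mode.Hd_def[OF mode_even])

lemma Dop_m_odd:
  assumes "x \<le> k" "u < a + b"
  shows "Dop n a b k c (m_odd x u t) = m_odd x u (Dop n a b k c t) + sc fps_X (grad_odd a b k c x u t)"
  unfolding Dop_odd[OF t] Dop_odd[OF tens_ops(4)[OF t assms(1)]] two_modes.contr_m[OF two_modes_odd t assms]
  by (simp add: grad_odd_def two_modes.grad_def[OF two_modes_odd] mode.Hd_def[OF mode_odd])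

lemma Dop_d_odd: "x \<le> k \<Longrightarrow> Dop n a b k c (d_odd x u t) = d_odd x u (Dop n a b k c t)"
  using t by (simp add: Dop_odd two_modes.contr_d[OF two_modes_odd])

lemma Dop_d_even: "x \<le> k \<Longrightarrow> Dop n a b k c (d_even x u t) = d_even x u (Dop n a b k c t)"
  using t by (simp add: Dop_even two_modes.contr_d[OF two_modes_even])

lemma Dop_grad_even: "Dop n a b k c (grad_even n k c' x A t) = grad_even n k c' x A (Dop n a b k c t)"
  unfolding grad_even_def linopD[OF linop_Dop]
  by (intro sum.cong refl) (simp add: linopD[OF linop_Dop] Dop_d_even)

lemma Dop_grad_odd: "Dop n a b k c (grad_odd a b k c' x u t) = grad_odd a b k c' x u (Dop n a b k c t)"
  unfolding grad_odd_def linopD[OF linop_Dop]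
  by (intro sum.cong refl) (simp add: linopD[OF linop_Dop] Dop_d_odd)

end

section \<open>The Berezin integral as a top coefficient\<close>

definition top_mono :: "nat \<Rightarrow> nat \<Rightarrow> mono" where
  "top_mono a b = (\<lambda>_. 0, {..<a + b})"

lemma fin_top_mono: "fin_mono (top_mono a b)"
  by (simp add: top_mono_def fin_mono_def)

definition berezin_sign :: "nat \<Rightarrow> nat \<Rightarrow> 'k::comm_ring_1" where
  "berezin_sign a b = (-1) ^ ((a + b) * (a + b - 1) div 2)"

lemma minus_one_power_cst: "(-1) ^ q = cst ((-1) ^ q :: 'k::comm_ring_1)"
  by (induction q) (auto simp flip: fps_const_neg)

lemma Upsilon_eq: "Upsilon a b k t = cst (berezin_sign a b) * super_mult k t (top_mono a b)"
  unfolding Upsilon_def top_mono_def berezin_sign_def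
  by (subst berezin_upt) (auto simp: lessThan_atLeast0 minus_one_power_cst)

lemma linfun_Upsilon: "linfun (Upsilon a b k)"
  by (simp add: linfun_def Upsilon_eq super_mult_add super_mult_sc algebra_simps)

lemma Upsilon_X: "Upsilon a b k (sc fps_X s) = fps_X * Upsilon a b k s"
  by (simp add: Upsilon_eq super_mult_sc)

lemma Upsilon_m_even: "i \<le> k \<Longrightarrow> Upsilon a b k (m_even i v t) = 0"
  using fin_top_mono[of a b] by (simp add: Upsilon_eq top_mono_def super_mult_m_even)

lemma Upsilon_m_odd: "i \<le> k \<Longrightarrow> j \<le> k \<Longrightarrow> Upsilon a b k (m_odd i u t) = Upsilon a b k (m_odd j u t)"
  using fin_top_mono[of a b] by (simp add: Upsilon_eq top_mono_def super_mult_m_odd)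

lemma Upsilon_d_odd:
  fixes t :: "'k::field_char_0 wc_tensor"
  assumes "u < a + b"
  shows "(\<Sum>i\<le>k. Upsilon a b k (d_odd i u t)) = 0"
proof -
  have "(\<Sum>i\<le>k. Upsilon a b k (d_odd i u t)) = cst (berezin_sign a b) * (\<Sum>i\<le>k. super_mult k (d_odd i u t) (top_mono a b))"
    by (simp add: Upsilon_eq sum_distrib_left)
  also have "(\<Sum>i\<le>k. super_mult k (d_odd i u t) (top_mono a b)) = 0"
    unfolding top_mono_def using fin_top_mono[of a b] assms
    by (intro super_mult_d_odd_sum) (auto simp: top_mono_def)
  finally show ?thesis by simp
qed

lemma sort_sign_cst: "sort_sign ms = cst (sort_sign ms :: 'k::comm_ring_1)"
  by (simp add: sort_sign_def minus_one_power_cst)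

lemma Upsilon_nth:
  "fps_nth (Upsilon a b k t) N =
    (\<Sum>ms\<in>factorizations k (top_mono a b). berezin_sign a b * sort_sign ms * fps_nth (t ms) N)"
  unfolding Upsilon_eq super_mult_def
  by (simp add: sort_sign_cst[where 'k = 'a] fps_sum_nth sum_distrib_left mult.assoc)

definition expect :: "nat \<Rightarrow> nat \<Rightarrow> nat \<Rightarrow> nat \<Rightarrow> (nat \<Rightarrow> nat \<Rightarrow> 'k) \<Rightarrow> 'k::field_char_0 wc_tensor \<Rightarrow> 'k fps" where
  "expect n a b k c = gauss (Upsilon a b k) (Dop n a b k c)"

lemma Upsilon_exp_pair_op: "Upsilon a b k (exp_pair_op n a b k c t) = expect n a b k c t"
proof (rule fps_ext)
  fix N
  have "fps_nth (Upsilon a b k (exp_pair_op n a b k c t)) N =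
    (\<Sum>ms\<in>factorizations k (top_mono a b). \<Sum>q\<le>N. berezin_sign a b * sort_sign ms * fps_nth ((Dop n a b k c ^^ q) t ms) N / fact q)"
    by (simp add: Upsilon_nth exp_pair_op_eq exp_op_def sum_distrib_left)
  also have "\<dots> = (\<Sum>q\<le>N. (\<Sum>ms\<in>factorizations k (top_mono a b). berezin_sign a b * sort_sign ms * fps_nth ((Dop n a b k c ^^ q) t ms) N) / fact q)"
    by (subst sum.swap) (simp add: sum_divide_distrib)
  also have "\<dots> = fps_nth (expect n a b k c t) N"
    by (simp add: expect_def gauss_def Upsilon_nth)
  finally show "fps_nth (Upsilon a b k (exp_pair_op n a b k c t)) N = fps_nth (expect n a b k c t) N" .
qed

lemma linfun_expect: "linfun (expect n a b k c)"
  unfolding expect_def by (intro linfun_gauss linfun_Upsilon linop_Dop)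

lemma funpow_Dop_closed: "t \<in> tens k \<Longrightarrow> (Dop n a b k c ^^ q) t \<in> tens k" for t :: "'k::field_char_0 wc_tensor"
  by (induction q) (auto simp: Dop_closed)

text \<open>The exponent commutes with every derivative, so the vanishing of the integral of a total
  derivative passes through the exponential.\<close>

lemma expect_d_odd_sum:
  fixes t :: "'k::field_char_0 wc_tensor"
  assumes t: "t \<in> tens k" and u: "u < a + b"
  shows "(\<Sum>i\<le>k. expect n a b k c (d_odd i u t)) = 0"
proof -
  have pw: "(Dop n a b k c ^^ q) (d_odd i u t) = d_odd i u ((Dop n a b k c ^^ q) t)" if "i \<le> k" for q i
    using that by (induction q) (simp_all add: Dop_d_odd[OF funpow_Dop_closed[OF t]])
  have "(\<Sum>i\<le>k. expect n a b k c (d_odd i u t)) = expect n a b k c (\<Sum>i\<le>k. d_odd i u t)"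
    by (simp add: linfunD[OF linfun_expect])
  also have "\<dots> = 0"
  proof (rule fps_ext)
    fix N
    have "Upsilon a b k ((Dop n a b k c ^^ q) (\<Sum>i\<le>k. d_odd i u t)) = 0" for q
    proof -
      have "Upsilon a b k ((Dop n a b k c ^^ q) (\<Sum>i\<le>k. d_odd i u t)) =
          (\<Sum>i\<le>k. Upsilon a b k (d_odd i u ((Dop n a b k c ^^ q) t)))"
        unfolding linopD[OF funpow_linop[OF linop_Dop]] linfunD[OF linfun_Upsilon]
        by (intro sum.cong refl) (simp add: pw)
      then show ?thesis by (simp add: Upsilon_d_odd[OF u])
    qed
    then show "fps_nth (expect n a b k c (\<Sum>i\<le>k. d_odd i u t)) N = fps_nth 0 N"
      by (simp add: expect_def gauss_def)
  qed
  finally show ?thesis .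
qed

text \<open>Setting \<open>p = q = 0\<close> annihilates multiplication by an even generator, so
  \<open>gauss_wick\<close> applies directly.\<close>

lemma wick_even:
  fixes t :: "'k::field_char_0 wc_tensor"
  assumes t: "t \<in> tens k" and x: "x \<le> k" and A: "A < 2 * n"
  shows "expect n a b k c (m_even x A t) =
    fps_X * (\<Sum>j\<le>k. cst (skew c x j / 2) * (\<Sum>B<2 * n. cst (symp_entry n A B) * expect n a b k c (d_even j B t)))"
proof -
  have "expect n a b k c (m_even x A t) = fps_X * expect n a b k c (grad_even n k c x A t)"
    unfolding expect_def
    by (rule gauss_wick[where V = "tens k"])
      (use t x A in \<open>auto intro: linop_Dop linfun_Upsilon Dop_closed Dop_m_even Dop_grad_even Upsilon_m_even Upsilon_X\<close>)
  then show ?thesis by (simp add: grad_even_def linfunD[OF linfun_expect])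
qed

text \<open>The three terms have three sources: the propagator from \<open>x\<close>; the propagator
  from slot 0, because only the difference of the multiplications in \<open>x\<close> and in 0 is
  annihilated by the integral; and \<open>- skew c x 0\<close>, because the derivative in slot 0 is
  minus the sum of the other derivatives.\<close>

definition odd_prop :: "(nat \<Rightarrow> nat \<Rightarrow> 'k::ab_group_add) \<Rightarrow> nat \<Rightarrow> nat \<Rightarrow> 'k" where
  "odd_prop c x j = skew c x j - skew c 0 j + skew c 0 x"

text \<open>
  The odd generators in slot \<open>0\<close> are traded for those of the other slots: multiplication by
  \<open>\<theta>\<^sub>u\<close> may be moved between the slots under the product, and the Berezin integral of a derivative
  vanishes.
\<close>

lemma wick_odd:
  fixes t :: "'k::field_char_0 wc_tensor"
  assumes t: "t \<in> tens k" and x: "x \<le> k" and u: "u < a + b" and vac: "m_odd 0 u t = 0"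
  shows "expect n a b k c (m_odd x u t) =
    fps_X * (\<Sum>j\<in>{1..k}. cst (odd_prop c x j / 2) * (\<Sum>w<a + b. cst (h_form a b u w) * expect n a b k c (d_odd j w t)))"
proof -
  let ?E = "expect n a b k c"
  let ?h = "\<lambda>j. \<Sum>w<a + b. cst (h_form a b u w) * ?E (d_odd j w t)"
  have split: "(\<Sum>j\<le>k. g j) = g 0 + (\<Sum>j\<in>{1..k}. g j)" for g :: "nat \<Rightarrow> 'k fps"
    by (simp add: atMost_atLeast0 sum.atLeast_Suc_atMost)
  \<comment> \<open>The multiplication in slot \<open>x\<close> alone is not annihilated by
    \<open>Upsilon\<close>; the difference is, since both products agree. The subtracted term
    vanishes by \<open>vac\<close>.\<close>
  have "?E (m_odd x u t - m_odd 0 u t) = fps_X * ?E (grad_odd a b k c x u t - grad_odd a b k c 0 u t)"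
    unfolding expect_def
    by (rule gauss_wick[where V = "tens k" and m = "\<lambda>t. m_odd x u t - m_odd 0 u t"
          and B = "\<lambda>t. grad_odd a b k c x u t - grad_odd a b k c 0 u t"])
      (use t x u in \<open>auto intro: linop_Dop linfun_Upsilon Dop_closed Upsilon_X
        simp: linopD[OF linop_Dop] Dop_m_odd Dop_grad_odd sc_diff_right linfunD[OF linfun_Upsilon] Upsilon_m_odd[of x k 0]\<close>)
  then have "?E (m_odd x u t) = fps_X * (\<Sum>j\<le>k. (cst (skew c x j / 2) - cst (skew c 0 j / 2)) * ?h j)"
    by (simp add: vac grad_odd_def linfunD[OF linfun_expect] left_diff_distrib sum_subtractf del: fps_const_sub)
  also have "(\<Sum>j\<le>k. (cst (skew c x j / 2) - cst (skew c 0 j / 2)) * ?h j) =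
     cst (skew c x 0 / 2) * ?h 0 + (\<Sum>j\<in>{1..k}. (cst (skew c x j / 2) - cst (skew c 0 j / 2)) * ?h j)"
    unfolding split by (simp add: skew_def)
  also have "?h 0 = - (\<Sum>j\<in>{1..k}. ?h j)"
  proof -
    have "?E (d_odd 0 w t) = - (\<Sum>j\<in>{1..k}. ?E (d_odd j w t))" if "w < a + b" for w
      using expect_d_odd_sum[OF t that, of n c] unfolding split by (simp add: eq_neg_iff_add_eq_0)
    then have "?h 0 = (\<Sum>w<a + b. - (\<Sum>j\<in>{1..k}. cst (h_form a b u w) * ?E (d_odd j w t)))"
      by (intro sum.cong) (auto simp: sum_distrib_left)
    then show ?thesis by (simp add: sum_negf sum.swap[of _ "{..<a + b}"])
  qed
  also have "cst (skew c x 0 / 2) * - (\<Sum>j\<in>{1..k}. ?h j) + (\<Sum>j\<in>{1..k}. (cst (skew c x j / 2) - cst (skew c 0 j / 2)) * ?h j)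
     = (\<Sum>j\<in>{1..k}. cst (odd_prop c x j / 2) * ?h j)"
  proof -
    have "skew c x 0 = - skew c 0 x" by (simp add: skew_def)
    then have e: "cst (odd_prop c x j / 2) = cst (skew c x j / 2) - cst (skew c 0 j / 2) - cst (skew c x 0 / 2)" for j
      by (simp add: odd_prop_def diff_divide_distrib add_divide_distrib)
    define hh where "hh j = ?h j" for j
    show ?thesis unfolding hh_def[symmetric] e
      by (simp only: left_diff_distrib sum_subtractf sum_distrib_left[symmetric] mult_minus_right) simp
  qed
  finally show ?thesis .
qed

subsection \<open>The map \<open>\<Phi>\<close>\<close>

lemma (in mode) con_zero:
  assumes "t \<in> tens k" "i \<le> k" "j \<le> k" "(\<forall>A. d i A t = 0) \<or> (\<forall>A. d j A t = 0)"
  shows "con i j t = 0"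
proof -
  have "d j B (d i A t) = 0" for A B
    using assms(4)
  proof
    assume "\<forall>A. d j A t = 0"
    then show ?thesis using dd[OF assms(1,3,2), of B A] by (simp add: linopD(3)[OF lin(1)])
  qed (simp add: linopD(3)[OF lin(1)])
  then show ?thesis by (simp add: con_def)
qed

text \<open>A contraction differentiates both slots of its pair, so one constant slot in every pair
  is enough.\<close>

lemma Dop_zero:
  fixes t :: "'k::field_char_0 wc_tensor"
  assumes t: "t \<in> tens k"
    and z: "\<And>i j. i < j \<Longrightarrow> j \<le> k \<Longrightarrow> \<exists>l\<in>{i, j}. (\<forall>v. d_even l v t = 0) \<and> (\<forall>u. d_odd l u t = 0)"
  shows "Dop n a b k c t = 0"
proof -
  have "con_even n i j t = 0" "con_odd a b i j t = 0" if "i < j" "j \<le> k" for i j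
    using z[OF that] t that
    by (auto intro!: mode.con_zero[OF mode_even] mode.con_zero[OF mode_odd])
  then show ?thesis
    unfolding Dop_even[OF t] two_modes.contr_def[OF two_modes_even]
    by (intro sum.neutral ballI) (simp add: sum.neutral)
qed

text \<open>Divisibility of \<open>D t\<close> by \<open>fps_X\<close> is what settles the
  coefficient \<open>N = 0\<close>, where \<open>exp_op\<close> retains the power 0 only.\<close>

lemma exp_op_two:
  assumes "D t = sc fps_X s" "D (D t) = 0" "linop D"
  shows "exp_op D t = t + D t"
proof
  fix ms
  have z: "(D ^^ q) t = 0" if "q \<ge> 2" for q
    using that
  proof (induction q rule: dec_induct)
    case (step q)
    then show ?case by (simp add: linopD(3)[OF assms(3)])
  qed (simp add: assms(2) numeral_2_eq_2)
  show "exp_op D t ms = (t + D t) ms"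
  proof (rule fps_ext)
    fix N
    show "fps_nth (exp_op D t ms) N = fps_nth ((t + D t) ms) N"
    proof (cases N)
      case 0
      then show ?thesis by (simp add: exp_op_def pointwise assms(1))
    next
      case (Suc M)
      have "fps_nth (exp_op D t ms) N = (\<Sum>q\<in>{0, 1}. fps_nth ((D ^^ q) t ms) N / fact q)"
        unfolding exp_op_def fps_nth_Abs_fps using Suc
        by (intro sum.mono_neutral_right) (auto simp: z pointwise not_less_eq_eq numeral_2_eq_2)
      then show ?thesis by (simp add: pointwise)
    qed
  qed
qed

lemma single_slot: "tensor [f] [m] = f m"
  by (simp add: tensor_def)

lemma fin_supp_tens: "fin_supp f \<Longrightarrow> tensor [f] \<in> tens 0"
  by (intro tensor_in_tens) auto

lemma single_slot_ops:
  "m_even 0 v (tensor [f]) = tensor [m_even1 v f]" "d_even 0 v (tensor [f]) = tensor [d_even1 v f]"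
  "m_odd 0 u (tensor [f]) = tensor [m_odd1 u f]" "d_odd 0 u (tensor [f]) = tensor [d_odd1 u f]"
  by (simp_all add: ops_tensor odd_ops_tensor_even)

text \<open>Relations for the operators on a single power series are the tensor relations with one
  slot.\<close>

lemma d_even1_m_even1:
  assumes "fin_supp f"
  shows "d_even1 v (m_even1 w f) m = (if v = w then f m else 0) + m_even1 w (d_even1 v f) m"
proof -
  have "d_even 0 v (m_even 0 w (tensor [f])) [m] =
      ((if v = w then tensor [f] else 0) + m_even 0 w (d_even 0 v (tensor [f]))) [m]"
    using d_even_m_even[OF fin_supp_tens[OF assms], of 0 0 v w] by simp
  then show ?thesis by (cases "v = w") (simp_all add: single_slot_ops single_slot pointwise)
qed

lemma d_odd1_m_odd1:
  assumes "fin_supp f"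
  shows "d_odd1 u (m_odd1 w f) m = (if u = w then f m else 0) - m_odd1 w (d_odd1 u f) m"
proof -
  have "d_odd 0 u (m_odd 0 w (tensor [f])) [m] =
      ((if u = w then tensor [f] else 0) - m_odd 0 w (d_odd 0 u (tensor [f]))) [m]"
    using d_odd_m_odd[OF fin_supp_tens[OF assms], of 0 0 u w] by simp
  then show ?thesis by (cases "u = w") (simp_all add: single_slot_ops single_slot pointwise)
qed

lemma cross1:
  assumes "fin_supp f"
  shows "d_even1 v (m_odd1 u f) = m_odd1 u (d_even1 v f)" "d_odd1 u (m_even1 v f) = m_even1 v (d_odd1 u f)"
proof -
  note c = even_odd_commute[OF fin_supp_tens[OF assms], of 0 0 v u, simplified, unfolded single_slot_ops]
  show "d_even1 v (m_odd1 u f) = m_odd1 u (d_even1 v f)"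
    using fun_cong[OF c(2)] by (intro ext) (metis single_slot)
  show "d_odd1 u (m_even1 v f) = m_even1 v (d_odd1 u f)"
    using fun_cong[OF c(3)] by (intro ext) (metis single_slot)
qed

lemma fin_supp_unit [simp]: "fin_supp unit_wc"
  by (auto simp: fin_supp_def unit_wc fin_mono_def)

lemma fin_supp_ops1 [simp]:
  assumes "fin_supp f"
  shows "fin_supp (m_even1 v f)" "fin_supp (d_even1 v f)" "fin_supp (m_odd1 u f)" "fin_supp (d_odd1 u f)"
proof -
  have e: "fin_mono (e(v := x), S) \<longleftrightarrow> fin_mono (e, S)" for e v x S using fin_mono_upd[of "(e, S)"] by simp
  have f: "f (e, S) = 0" if "\<not> fin_mono (e, S)" for e S using assms that unfolding fin_supp_def by blast
  have "m_even1 v f (e, S) = 0 \<and> d_even1 v f (e, S) = 0 \<and> m_odd1 u f (e, S) = 0 \<and> d_odd1 u f (e, S) = 0"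
    if nf: "\<not> fin_mono (e, S)" for e S
  proof -
    have "\<not> fin_mono (e, S - {u})" "\<not> fin_mono (e, insert u S)" using nf by (auto simp: fin_mono_def)
    then show ?thesis using nf by (simp add: m_even1_def d_even1_def m_odd1_def d_odd1_def f e)
  qed
  then show "fin_supp (m_even1 v f)" "fin_supp (d_even1 v f)" "fin_supp (m_odd1 u f)" "fin_supp (d_odd1 u f)"
    unfolding fin_supp_def by (metis surj_pair)+
qed

lemma d_unit [simp]: "d_even1 v unit_wc = (\<lambda>_. 0)" "d_odd1 u unit_wc = (\<lambda>_. 0)"
  by (auto simp: d_even1_def d_odd1_def unit_wc fun_eq_iff)

lemma m_zero [simp]: "m_even1 v (\<lambda>_. 0) = (\<lambda>_. 0)" "m_odd1 u (\<lambda>_. 0) = (\<lambda>_. 0)"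
  by (auto simp: m_even1_def m_odd1_def case_prod_beta)

lemma tensor_zero [simp]: "tensor [f, \<lambda>_. 0] = 0" "tensor [\<lambda>_. 0, f] = 0"
  by (auto simp: tensor_def fun_eq_iff pointwise lessThan_Suc)

lemma even_supp_unit [simp]: "even_supp unit_wc"
  by (auto simp: even_supp_def unit_wc)

lemma fin_suppD: "fin_supp f \<Longrightarrow> \<not> fin_mono m \<Longrightarrow> f m = 0"
  unfolding fin_supp_def by blast

lemma odd_ops_two_slots:
  "even_supp f \<Longrightarrow> m_odd 1 u (tensor [f, g]) = tensor [f, m_odd1 u g]"
  "even_supp f \<Longrightarrow> d_odd 1 u (tensor [f, g]) = tensor [f, d_odd1 u g]"
  "m_odd 0 u (tensor [f, g]) = tensor [m_odd1 u f, g]"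
  "d_odd 0 u (tensor [f, g]) = tensor [d_odd1 u f, g]"
  using odd_ops_tensor_even[of 1 "[f, g]" u] odd_ops_tensor_even[of 0 "[f, g]" u] by simp_all

lemma even_ops_two_slots:
  "m_even 1 u (tensor [f, g]) = tensor [f, m_even1 u g]"
  "d_even 1 u (tensor [f, g]) = tensor [f, d_even1 u g]"
  "m_even 0 u (tensor [f, g]) = tensor [m_even1 u f, g]"
  "d_even 0 u (tensor [f, g]) = tensor [d_even1 u f, g]"
  using ops_tensor(1,2)[of 1 "[f, g]" u] ops_tensor(1,2)[of 0 "[f, g]" u] by simp_all

lemma d_odd_unit_slot: "d_odd 1 u (tensor [f, unit_wc]) = 0"
  using ops_tensor(4)[of 1 "[f, unit_wc]" u] by (simp add: fun_eq_iff pointwise)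

section \<open>Brackets with the linear generators\<close>

context
  fixes n a b :: nat
  notes One_nat_def [simp del]
begin

definition bracket :: "'k::field_char_0 wc \<Rightarrow> 'k wc \<Rightarrow> 'k wc" where
  "bracket f g = (\<lambda>m. star n a b f g m - star n a b g f m)"

context
  fixes w :: "'k::field_char_0 wc"
  assumes w: "fin_supp w"
begin

lemma pair_tens: "tensor [w, unit_wc] \<in> tens 1" "tensor [unit_wc, w] \<in> tens 1"
  using w by (auto intro!: tensor_in_tens simp: nth_Cons split: nat.splits)

lemma d_pair:
  "d_even 1 v (tensor [w, unit_wc]) = 0" "d_odd 1 u (tensor [w, unit_wc]) = 0"
  "d_even 0 v (tensor [unit_wc, w]) = 0" "d_odd 0 u (tensor [unit_wc, w]) = 0"
  "d_even 0 v (tensor [w, unit_wc]) = tensor [d_even1 v w, unit_wc]"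
  "d_odd 0 u (tensor [w, unit_wc]) = tensor [d_odd1 u w, unit_wc]"
  "d_even 1 v (tensor [unit_wc, w]) = tensor [unit_wc, d_even1 v w]"
  "d_odd 1 u (tensor [unit_wc, w]) = tensor [unit_wc, d_odd1 u w]"
  by (simp_all add: odd_ops_two_slots even_ops_two_slots d_odd_unit_slot)

lemma super_mult_pair:
  assumes "fin_mono m"
  shows "super_mult 1 (tensor [f, unit_wc]) m = f m" "super_mult 1 (tensor [unit_wc, f]) m = f m"
  using super_mult_tensor_unit[of 0 1 m f] super_mult_tensor_unit[of 1 1 m f] assms by (simp_all add: One_nat_def)

lemma Dop_pair: "Dop n a b 1 c (tensor [w, unit_wc]) = 0" "Dop n a b 1 c (tensor [unit_wc, w]) = 0"
proof -
  have ij: "i = 0 \<and> j = 1" if "i < j" "j \<le> 1" for i j :: nat using that by auto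
  show "Dop n a b 1 c (tensor [w, unit_wc]) = 0"
    by (rule Dop_zero[OF pair_tens(1)]) (use ij d_pair(1,2) in blast)
  show "Dop n a b 1 c (tensor [unit_wc, w]) = 0"
    by (rule Dop_zero[OF pair_tens(2)]) (use ij d_pair(3,4) in blast)
qed

text \<open>Nothing can be contracted in \<open>t\<close> itself, one factor being the unit. After
  multiplication by a generator exactly one contraction is possible, so the exponential stops after
  its linear term.\<close>

lemma exp_even:
  assumes "t = tensor [w, unit_wc] \<or> t = tensor [unit_wc, w]" "x \<le> 1" "A < 2 * n"
  shows "exp_pair_op n a b 1 c (m_even x A t) = m_even x A t + sc fps_X (grad_even n 1 c x A t)"
proof -
  have t: "t \<in> tens 1" and z: "Dop n a b 1 c t = 0" using assms(1) pair_tens Dop_pair by auto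
  have D: "Dop n a b 1 c (m_even x A t) = sc fps_X (grad_even n 1 c x A t)"
    using Dop_m_even[OF t assms(2,3), of a b c] by (simp add: z linopD(3)[OF linop_basic(2)])
  have "Dop n a b 1 c (Dop n a b 1 c (m_even x A t)) = 0"
    unfolding D linopD[OF linop_Dop] Dop_grad_even[OF t] z
    by (simp add: grad_even_def linopD(3)[OF linop_basic(1)])
  then show ?thesis unfolding exp_pair_op_eq using exp_op_two[OF D _ linop_Dop] D by simp
qed

lemma exp_odd:
  assumes "t = tensor [w, unit_wc] \<or> t = tensor [unit_wc, w]" "x \<le> 1" "u < a + b"
  shows "exp_pair_op n a b 1 c (m_odd x u t) = m_odd x u t + sc fps_X (grad_odd a b 1 c x u t)"
proof -
  have t: "t \<in> tens 1" and z: "Dop n a b 1 c t = 0" using assms(1) pair_tens Dop_pair by auto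
  have D: "Dop n a b 1 c (m_odd x u t) = sc fps_X (grad_odd a b 1 c x u t)"
    using Dop_m_odd[OF t assms(2,3), of n c] by (simp add: z linopD(3)[OF linop_basic(4)])
  have "Dop n a b 1 c (Dop n a b 1 c (m_odd x u t)) = 0"
    unfolding D linopD[OF linop_Dop] Dop_grad_odd[OF t] z
    by (simp add: grad_odd_def linopD(3)[OF linop_basic(3)])
  then show ?thesis unfolding exp_pair_op_eq using exp_op_two[OF D _ linop_Dop] D by simp
qed

lemma pair_m:
  "tensor [w, m_even1 A unit_wc] = m_even 1 A (tensor [w, unit_wc])"
  "tensor [m_even1 A unit_wc, w] = m_even 0 A (tensor [unit_wc, w])"
  "tensor [m_odd1 u unit_wc, w] = m_odd 0 u (tensor [unit_wc, w])"
  "even_supp w \<Longrightarrow> tensor [w, m_odd1 u unit_wc] = m_odd 1 u (tensor [w, unit_wc])"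
  by (simp_all add: odd_ops_two_slots even_ops_two_slots)

lemma grad_pair:
  "grad_even n 1 (\<lambda>_ _. 1) 1 A (tensor [w, unit_wc]) = sc (cst (-(1/2))) (\<Sum>B<2 * n. sc (cst (symp_entry n A B)) (tensor [d_even1 B w, unit_wc]))"
  "grad_even n 1 (\<lambda>_ _. 1) 0 A (tensor [unit_wc, w]) = sc (cst (1/2)) (\<Sum>B<2 * n. sc (cst (symp_entry n A B)) (tensor [unit_wc, d_even1 B w]))"
  "grad_odd a b 1 (\<lambda>_ _. 1) 1 u (tensor [w, unit_wc]) = sc (cst (-(1/2))) (\<Sum>B<a + b. sc (cst (h_form a b u B)) (tensor [d_odd1 B w, unit_wc]))"
  "grad_odd a b 1 (\<lambda>_ _. 1) 0 u (tensor [unit_wc, w]) = sc (cst (1/2)) (\<Sum>B<a + b. sc (cst (h_form a b u B)) (tensor [unit_wc, d_odd1 B w]))"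
proof -
  have s: "(\<Sum>j\<le>1. g j) = g 0 + g 1" for g :: "nat \<Rightarrow> 'k wc_tensor"
    by (simp add: One_nat_def)
  show "grad_even n 1 (\<lambda>_ _. 1) 1 A (tensor [w, unit_wc]) = sc (cst (-(1/2))) (\<Sum>B<2 * n. sc (cst (symp_entry n A B)) (tensor [d_even1 B w, unit_wc]))"
    "grad_even n 1 (\<lambda>_ _. 1) 0 A (tensor [unit_wc, w]) = sc (cst (1/2)) (\<Sum>B<2 * n. sc (cst (symp_entry n A B)) (tensor [unit_wc, d_even1 B w]))"
    "grad_odd a b 1 (\<lambda>_ _. 1) 1 u (tensor [w, unit_wc]) = sc (cst (-(1/2))) (\<Sum>B<a + b. sc (cst (h_form a b u B)) (tensor [d_odd1 B w, unit_wc]))"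
    "grad_odd a b 1 (\<lambda>_ _. 1) 0 u (tensor [unit_wc, w]) = sc (cst (1/2)) (\<Sum>B<a + b. sc (cst (h_form a b u B)) (tensor [unit_wc, d_odd1 B w]))"
    by (simp_all add: grad_even_def grad_odd_def s skew_def d_pair)
qed

lemma pair_tens_d:
  "tensor [d_even1 B w, unit_wc] \<in> tens 1" "tensor [unit_wc, d_even1 B w] \<in> tens 1"
  "tensor [d_odd1 B w, unit_wc] \<in> tens 1" "tensor [unit_wc, d_odd1 B w] \<in> tens 1"
  using w by (auto intro!: tensor_in_tens simp: nth_Cons split: nat.splits simp: One_nat_def)

lemma half_sum: "fps_X * (cst (-(1/2)) * s) - fps_X * (cst (1/2) * s) = - fps_X * s" for s :: "'k fps"
proof -
  have "cst (-(1/2)) * s - cst (1/2) * s = cst (- (1/2) - 1/2) * s"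
    by (simp only: fps_const_sub[symmetric] left_diff_distrib)
  also have "\<dots> = - s" by (simp flip: fps_const_neg)
  finally show ?thesis by (simp only: right_diff_distrib[symmetric] mult_minus_right mult_minus_left)
qed

text \<open>Both orders have the same supercommutative product and differ in the single contraction,
  which has coefficient \<open>-1/2\<close> with the generator on the right and \<open>1/2\<close>
  with the generator on the left. What remains is the Poisson bracket.\<close>

lemma bracket_even:
  assumes A: "A < 2 * n"
  shows "bracket w (m_even1 A unit_wc) m = - fps_X * (\<Sum>B<2 * n. cst (symp_entry n A B) * d_even1 B w m)"
proof -
  have 1: "exp_pair_op n a b 1 (\<lambda>_ _. 1) (tensor [w, m_even1 A unit_wc]) = m_even 1 A (tensor [w, unit_wc]) +
      sc fps_X (sc (cst (-(1/2))) (\<Sum>B<2 * n. sc (cst (symp_entry n A B)) (tensor [d_even1 B w, unit_wc])))"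
    unfolding pair_m grad_pair[symmetric] using A by (intro exp_even) auto
  have 2: "exp_pair_op n a b 1 (\<lambda>_ _. 1) (tensor [m_even1 A unit_wc, w]) = m_even 0 A (tensor [unit_wc, w]) +
      sc fps_X (sc (cst (1/2)) (\<Sum>B<2 * n. sc (cst (symp_entry n A B)) (tensor [unit_wc, d_even1 B w])))"
    unfolding pair_m grad_pair[symmetric] using A by (intro exp_even) auto
  show ?thesis
  proof (cases "fin_mono m")
    case True
    obtain e S where m: "m = (e, S)" by (cases m)
    have f: "fin_mono (e(A := e A - 1), S)" using True fin_mono_upd[of m] by (simp add: m)
    have "super_mult 1 (m_even 1 A (tensor [w, unit_wc])) m = super_mult 1 (m_even 0 A (tensor [unit_wc, w])) m"
      unfolding m using True by (simp add: m super_mult_m_even super_mult_pair[OF f])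
    then show ?thesis
      unfolding bracket_def star_def 1 2 super_mult_add super_mult_sc super_mult_sum super_mult_pair[OF True]
      using half_sum[of "\<Sum>B<2 * n. cst (symp_entry n A B) * d_even1 B w m"] by simp
  next
    case False
    have "star n a b w (m_even1 A unit_wc) m = 0" "star n a b (m_even1 A unit_wc) w m = 0"
      unfolding star_def 1 2 by (rule super_mult_not_fin[OF _ False]; intro tens_lin tens_sum tens_ops pair_tens pair_tens_d; simp)+
    moreover have "d_even1 B w m = 0" "d_odd1 B w m = 0" for B
      using False w by (auto intro!: fin_suppD)
    ultimately show ?thesis by (simp add: bracket_def)
  qed
qed

text \<open>As for even generators. The parity of \<open>w\<close> lets the generator in slot 1 pass
  \<open>w\<close> without a sign, so that the plain commutator is the supercommutator.\<close>

lemma bracket_odd: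
  assumes u: "u < a + b" and ev: "even_supp w"
  shows "bracket w (m_odd1 u unit_wc) m = - fps_X * (\<Sum>B<a + b. cst (h_form a b u B) * d_odd1 B w m)"
proof -
  have 1: "exp_pair_op n a b 1 (\<lambda>_ _. 1) (tensor [w, m_odd1 u unit_wc]) = m_odd 1 u (tensor [w, unit_wc]) +
      sc fps_X (sc (cst (-(1/2))) (\<Sum>B<a + b. sc (cst (h_form a b u B)) (tensor [d_odd1 B w, unit_wc])))"
    unfolding pair_m(4)[OF ev] grad_pair[symmetric] using u by (intro exp_odd) auto
  have 2: "exp_pair_op n a b 1 (\<lambda>_ _. 1) (tensor [m_odd1 u unit_wc, w]) = m_odd 0 u (tensor [unit_wc, w]) +
      sc fps_X (sc (cst (1/2)) (\<Sum>B<a + b. sc (cst (h_form a b u B)) (tensor [unit_wc, d_odd1 B w])))"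
    unfolding pair_m grad_pair[symmetric] using u by (intro exp_odd) auto
  show ?thesis
  proof (cases "fin_mono m")
    case True
    obtain e S where m: "m = (e, S)" by (cases m)
    have "super_mult 1 (m_odd 1 u (tensor [w, unit_wc])) m = super_mult 1 (m_odd 0 u (tensor [w, unit_wc])) m"
      unfolding m using True by (simp add: m super_mult_m_odd)
    also have "\<dots> = m_odd1 u w m"
      using True by (simp add: odd_ops_two_slots super_mult_pair)
    also have "\<dots> = super_mult 1 (m_odd 1 u (tensor [unit_wc, w])) m"
      using True by (simp add: odd_ops_two_slots super_mult_pair)
    also have "\<dots> = super_mult 1 (m_odd 0 u (tensor [unit_wc, w])) m"
      unfolding m using True by (simp add: m super_mult_m_odd)
    finally show ?thesis
      unfolding bracket_def star_def 1 2 super_mult_add super_mult_sc super_mult_sum super_mult_pair[OF True]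
      using half_sum[of "\<Sum>B<a + b. cst (h_form a b u B) * d_odd1 B w m"] by simp
  next
    case False
    have "star n a b w (m_odd1 u unit_wc) m = 0" "star n a b (m_odd1 u unit_wc) w m = 0"
      unfolding star_def 1 2 by (rule super_mult_not_fin[OF _ False]; intro tens_lin tens_sum tens_ops pair_tens pair_tens_d; simp)+
    moreover have "d_even1 B w m = 0" "d_odd1 B w m = 0" for B
      using False w by (auto intro!: fin_suppD)
    ultimately show ?thesis by (simp add: bracket_def)
  qed
qed

end

lemma exp_op_linear:
  assumes "linop D"
  shows "exp_op D (\<Sum>x\<in>X. sc (cst (c x)) (f x)) ms = (\<Sum>x\<in>X. cst (c x) * exp_op D (f x) ms)"
  by (rule fps_ext)
    (simp add: exp_op_def linopD[OF funpow_linop[OF assms]] pointwise fps_sum_nth sum_divide_distrib sum_distrib_left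
      sum.swap[of _ X])

lemma star_linear:
  fixes g :: "'x \<Rightarrow> 'k::field_char_0 wc"
  shows "star n a b f (\<lambda>m. \<Sum>x\<in>X. cst (c x) * g x m) m = (\<Sum>x\<in>X. cst (c x) * star n a b f (g x) m)"
    "star n a b (\<lambda>m. \<Sum>x\<in>X. cst (c x) * g x m) f m = (\<Sum>x\<in>X. cst (c x) * star n a b (g x) f m)"
proof -
  have t: "tensor [f, \<lambda>m. \<Sum>x\<in>X. cst (c x) * g x m] = (\<Sum>x\<in>X. sc (cst (c x)) (tensor [f, g x]))"
    "tensor [\<lambda>m. \<Sum>x\<in>X. cst (c x) * g x m, f] = (\<Sum>x\<in>X. sc (cst (c x)) (tensor [g x, f]))"
    by (auto simp: fun_eq_iff pointwise tensor_def lessThan_Suc sum_distrib_left sum_distrib_right mult_ac numeral_2_eq_2 intro!: sum.cong)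
  have e: "exp_pair_op n a b 1 (\<lambda>_ _. 1) (\<Sum>x\<in>X. sc (cst (c x)) (h x)) =
      (\<Sum>x\<in>X. sc (cst (c x)) (exp_pair_op n a b 1 (\<lambda>_ _. 1) (h x)))" for h :: "'x \<Rightarrow> 'k wc_tensor"
    by (simp add: fun_eq_iff pointwise exp_pair_op_eq exp_op_linear[OF linop_Dop])
  show "star n a b f (\<lambda>m. \<Sum>x\<in>X. cst (c x) * g x m) m = (\<Sum>x\<in>X. cst (c x) * star n a b f (g x) m)"
    "star n a b (\<lambda>m. \<Sum>x\<in>X. cst (c x) * g x m) f m = (\<Sum>x\<in>X. cst (c x) * star n a b (g x) f m)"
    unfolding star_def t e super_mult_sum super_mult_sc by (rule refl)+
qed

lemma star_add:
  fixes g :: "'k::field_char_0 wc"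
  shows "star n a b f (\<lambda>m. g m + h m) m = star n a b f g m + star n a b f h m"
    "star n a b (\<lambda>m. g m + h m) f m = star n a b g f m + star n a b h f m"
  using star_linear[where X = UNIV and c = "\<lambda>_. 1" and g = "\<lambda>x::bool. if x then g else h" and f = f and m = m]
  by (simp_all add: UNIV_bool add.commute)

lemma linear_elem_eq:
  "linear_elem n a b v u m = (\<Sum>i<2 * n. cst (vec_index v i) * m_even1 i unit_wc m) + (\<Sum>j<a + b. cst (vec_index u j) * m_odd1 j unit_wc m)"
proof -
  obtain e S where m: "m = (e, S)" by (cases m)
  have 1: "m_even1 i unit_wc (e, S) = (if e = (\<lambda>_. 0)(i := 1) \<and> S = {} then 1 else (0 :: 'a fps))" for i
  proof (cases "e i = 0")
    case False
    have "e(i := e i - 1) = (\<lambda>_. 0) \<longleftrightarrow> e = (\<lambda>_. 0)(i := 1)"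
    proof
      assume h: "e(i := e i - 1) = (\<lambda>_. 0)"
      show "e = (\<lambda>_. 0)(i := 1)"
      proof
        fix j show "e j = ((\<lambda>_. 0)(i := 1)) j"
          using fun_cong[OF h, of j] False by (cases "j = i") auto
      qed
    qed auto
    then show ?thesis using False by (auto simp: m_even1_def unit_wc)
  qed (auto simp: m_even1_def fun_upd_def)
  have 2: "m_odd1 j unit_wc (e, S) = (if e = (\<lambda>_. 0) \<and> S = {j} then 1 else (0 :: 'a fps))" for j
  proof (cases "S = {j}")
    case True
    have "{w \<in> {j}. w < j} = {}" by blast
    then show ?thesis unfolding m_odd1_def True by (simp add: unit_wc del: Collect_empty_eq)
  next
    case False
    then have "S - {j} \<noteq> {}" if "j \<in> S" using that by blast
    then show ?thesis using False by (simp add: m_odd1_def unit_wc)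
  qed
  show ?thesis unfolding m linear_elem_def prod.case 1 2 by (intro arg_cong2[where f = "(+)"] sum.cong refl) simp_all
qed


definition quad :: "(nat \<Rightarrow> nat \<Rightarrow> 'k::field_char_0) \<Rightarrow> (nat \<Rightarrow> nat \<Rightarrow> 'k) \<Rightarrow> 'k wc" where
  "quad S T m = (\<Sum>A<2 * n. \<Sum>B<2 * n. cst (S A B / 2) * m_even1 A (m_even1 B unit_wc) m) +
    (\<Sum>u<a + b. \<Sum>w<a + b. cst (T u w / 2) * m_odd1 u (m_odd1 w unit_wc) m)"

lemma d1_linear:
  "d_even1 v (\<lambda>m. f m + g m) m = d_even1 v f m + d_even1 v g m"
  "d_odd1 v (\<lambda>m. f m + g m) m = d_odd1 v f m + d_odd1 v g m"
  "d_even1 v (\<lambda>m. \<Sum>x\<in>X. h x m) m = (\<Sum>x\<in>X. d_even1 v (h x) m)"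
  "d_odd1 v (\<lambda>m. \<Sum>x\<in>X. h x m) m = (\<Sum>x\<in>X. d_odd1 v (h x) m)"
  "d_even1 v (\<lambda>m. r * f m) m = r * d_even1 v f m"
  "d_odd1 v (\<lambda>m. r * f m) m = r * d_odd1 v f m"
  by (auto simp: d_even1_def d_odd1_def case_prod_beta algebra_simps sum_distrib_left sum_distrib_right)

lemma d_quad_even:
  assumes S: "\<And>A B. A < 2 * n \<Longrightarrow> B < 2 * n \<Longrightarrow> S B A = S A B" and D: "D < 2 * n"
  shows "d_even1 D (quad S T) m = (\<Sum>A<2 * n. cst (S D A) * m_even1 A unit_wc m)"
proof -
  have u: "d_even1 D (m_even1 B unit_wc) = (\<lambda>m. if D = B then unit_wc m else 0)" for B
    by (rule ext) (simp add: d_even1_m_even1)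
  have 1: "d_even1 D (m_even1 A (m_even1 B unit_wc)) m =
      (if A = D then m_even1 B unit_wc m else 0) + (if B = D then m_even1 A unit_wc m else 0)" for A B
    by (auto simp: d_even1_m_even1 u)
  have 2: "d_even1 D (m_odd1 A (m_odd1 B unit_wc)) m = 0" for A B
    by (simp add: cross1)
  have h: "cst (x / 2) * y + cst (x / 2) * y = cst x * y" for x :: 'a and y
    by (simp flip: distrib_right)
  have i: "r * (if P then y else 0) = (if P then r * y else 0)" for r y :: "'a fps" and P
    by simp
  have "d_even1 D (quad S T) m = (\<Sum>A<2 * n. \<Sum>B<2 * n. if A = D then cst (S A B / 2) * m_even1 B unit_wc m else 0)
     + (\<Sum>A<2 * n. \<Sum>B<2 * n. if B = D then cst (S A B / 2) * m_even1 A unit_wc m else 0)"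
    unfolding quad_def[abs_def] d1_linear 1 2 by (simp only: distrib_left i sum.distrib mult_zero_right sum.neutral_const add_0_right)
  also have "(\<Sum>A<2 * n. \<Sum>B<2 * n. if A = D then cst (S A B / 2) * m_even1 B unit_wc m else 0) =
      (\<Sum>A<2 * n. if A = D then \<Sum>B<2 * n. cst (S A B / 2) * m_even1 B unit_wc m else 0)"
    by (intro sum.cong) auto
  also have "\<dots> + (\<Sum>A<2 * n. \<Sum>B<2 * n. if B = D then cst (S A B / 2) * m_even1 A unit_wc m else 0) =
     (\<Sum>A<2 * n. cst (S D A / 2) * m_even1 A unit_wc m + cst (S A D / 2) * m_even1 A unit_wc m)"
    using D by (simp add: sum.distrib)
  also have "\<dots> = (\<Sum>A<2 * n. cst (S D A) * m_even1 A unit_wc m)"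
    using S D by (intro sum.cong) (auto simp: h simp del: fps_const_add)
  finally show ?thesis .
qed

lemma d_quad_odd:
  assumes T: "\<And>A B. A < a + b \<Longrightarrow> B < a + b \<Longrightarrow> T B A = - T A B" and D: "D < a + b"
  shows "d_odd1 D (quad S T) m = (\<Sum>A<a + b. cst (T D A) * m_odd1 A unit_wc m)"
proof -
  have u: "d_odd1 D (m_odd1 B unit_wc) = (\<lambda>m. if D = B then unit_wc m else 0)" for B
    by (rule ext) (simp add: d_odd1_m_odd1)
  have 1: "d_odd1 D (m_odd1 A (m_odd1 B unit_wc)) m =
      (if A = D then m_odd1 B unit_wc m else 0) - (if B = D then m_odd1 A unit_wc m else 0)" for A B
    by (auto simp: d_odd1_m_odd1 u)
  have 2: "d_odd1 D (m_even1 A (m_even1 B unit_wc)) m = 0" for A B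
    by (simp add: cross1)
  have h: "cst (x / 2) * y + cst (x / 2) * y = cst x * y" for x :: 'a and y
    by (simp flip: distrib_right)
  have i: "r * (if P then y else 0) = (if P then r * y else 0)" for r y :: "'a fps" and P
    by simp
  have "d_odd1 D (quad S T) m = (\<Sum>A<a + b. \<Sum>B<a + b. if A = D then cst (T A B / 2) * m_odd1 B unit_wc m else 0)
     - (\<Sum>A<a + b. \<Sum>B<a + b. if B = D then cst (T A B / 2) * m_odd1 A unit_wc m else 0)"
    unfolding quad_def[abs_def] d1_linear 1 2
    by (simp only: right_diff_distrib i sum_subtractf mult_zero_right sum.neutral_const add_0_left)
  also have "(\<Sum>A<a + b. \<Sum>B<a + b. if A = D then cst (T A B / 2) * m_odd1 B unit_wc m else 0) =
      (\<Sum>A<a + b. if A = D then \<Sum>B<a + b. cst (T A B / 2) * m_odd1 B unit_wc m else 0)"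
    by (intro sum.cong) auto
  also have "\<dots> - (\<Sum>A<a + b. \<Sum>B<a + b. if B = D then cst (T A B / 2) * m_odd1 A unit_wc m else 0) =
     (\<Sum>A<a + b. cst (T D A / 2) * m_odd1 A unit_wc m - cst (T A D / 2) * m_odd1 A unit_wc m)"
    using D by (simp add: sum_subtractf)
  also have "\<dots> = (\<Sum>A<a + b. cst (T D A) * m_odd1 A unit_wc m)"
  proof (rule sum.cong[OF refl])
    fix A assume "A \<in> {..<a + b}"
    then have "cst (T A D / 2) = - cst (T D A / 2)" using T[OF D, of A] by simp
    then show "cst (T D A / 2) * m_odd1 A unit_wc m - cst (T A D / 2) * m_odd1 A unit_wc m = cst (T D A) * m_odd1 A unit_wc m"
      using h[of "T D A" "m_odd1 A unit_wc m"] by (simp only: mult_minus_left diff_minus_eq_add)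
  qed
  finally show ?thesis .
qed

lemma m_even1_unit_nz:
  assumes "m_even1 A (m_even1 B unit_wc) (e, U) \<noteq> 0" "A < N" "B < N"
  shows "U = {}" "(\<Sum>i<N. e i) = 2" "\<And>i. i \<ge> N \<Longrightarrow> e i = 0"
proof -
  define f where "f = e(A := e A - 1)"
  have nz: "e A \<noteq> 0" "f B \<noteq> 0" "f(B := f B - 1) = (\<lambda>_. 0)" "U = {}"
    using assms by (auto simp: m_even1_def unit_wc f_def split: if_splits)
  then show "U = {}" by simp
  have f: "f = (\<lambda>i. if i = B then 1 else 0)"
  proof
    fix i show "f i = (if i = B then 1 else 0)" using fun_cong[OF nz(3), of i] nz(2) by (auto split: if_splits)
  qed
  have e: "e i = f i + (if i = A then 1 else 0)" for i using nz(1) by (auto simp: f_def)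
  show "(\<Sum>i<N. e i) = 2" unfolding e f using assms by (simp add: sum.distrib)
  show "\<And>i. i \<ge> N \<Longrightarrow> e i = 0" unfolding e f using assms by auto
qed

lemma m_odd1_unit_nz:
  assumes "m_odd1 A (m_odd1 B unit_wc) (e, U) \<noteq> 0" "A < N" "B < N"
  shows "e = (\<lambda>_. 0)" "card U = 2" "U \<subseteq> {..<N}"
proof -
  have "A \<in> U" "B \<in> U - {A}" "U - {A} - {B} = {}" and e: "e = (\<lambda>_. 0)"
    using assms by (auto simp: m_odd1_def unit_wc split: if_splits)
  then have "U = {A, B}" "A \<noteq> B" by auto
  then show "e = (\<lambda>_. 0)" "card U = 2" "U \<subseteq> {..<N}" using assms e by auto
qed

lemma quad_nz:
  assumes "quad S T (e, U) \<noteq> 0"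
  shows "(\<forall>i\<ge>2 * n. e i = 0) \<and> U \<subseteq> {..<a + b} \<and> (\<Sum>i<2 * n. e i) + card U = 2 \<and> even (card U)"
proof -
  consider A B where "A < 2 * n" "B < 2 * n" "m_even1 A (m_even1 B unit_wc :: 'a wc) (e, U) \<noteq> 0"
    | A B where "A < a + b" "B < a + b" "m_odd1 A (m_odd1 B unit_wc :: 'a wc) (e, U) \<noteq> 0"
  proof -
    assume *: "\<And>A B. A < 2 * n \<Longrightarrow> B < 2 * n \<Longrightarrow> m_even1 A (m_even1 B unit_wc :: 'a wc) (e, U) \<noteq> 0 \<Longrightarrow> thesis"
      "\<And>A B. A < a + b \<Longrightarrow> B < a + b \<Longrightarrow> m_odd1 A (m_odd1 B unit_wc :: 'a wc) (e, U) \<noteq> 0 \<Longrightarrow> thesis"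
    show thesis
    proof (rule ccontr)
      assume "\<not> thesis"
      then have "m_even1 A (m_even1 B unit_wc :: 'a wc) (e, U) = 0" if "A < 2 * n" "B < 2 * n" for A B using * that by blast
      moreover have "m_odd1 A (m_odd1 B unit_wc :: 'a wc) (e, U) = 0" if "A < a + b" "B < a + b" for A B
        using * that \<open>\<not> thesis\<close> by blast
      ultimately have "quad S T (e, U) = 0" by (simp add: quad_def)
      then show False using assms by simp
    qed
  qed
  then show ?thesis
  proof cases
    case 1
    show ?thesis using m_even1_unit_nz[OF 1(3) 1(1,2)] by auto
  next
    case 2
    show ?thesis using m_odd1_unit_nz[OF 2(3) 2(1,2)] by auto
  qed
qed

lemma quad_quadratic: "quad S T \<in> quadratic_elems n a b" and even_supp_quad: "even_supp (quad S T)"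
  using quad_nz[of S T] by (auto simp: quadratic_elems_def wc_carrier_def even_supp_def)

lemma quadratic_fin_supp: "w \<in> quadratic_elems n a b \<Longrightarrow> fin_supp w"
  unfolding fin_supp_def
proof (intro allI impI)
  fix m assume w: "w \<in> quadratic_elems n a b" "w m \<noteq> 0"
  obtain e U where m: "m = (e, U)" by (cases m)
  have e: "\<forall>i\<ge>2 * n. e i = 0" and U: "U \<subseteq> {..<a + b}" using w by (auto simp: quadratic_elems_def wc_carrier_def m)
  have "{v. e v \<noteq> 0} \<subseteq> {..<2 * n}"
  proof
    fix v assume "v \<in> {v. e v \<noteq> 0}"
    then have "\<not> 2 * n \<le> v" using e by auto
    then show "v \<in> {..<2 * n}" by simp
  qed
  moreover have "finite U" using U by (rule finite_subset) simp
  ultimately show "fin_mono m" by (auto simp: fin_mono_def m intro: finite_subset)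
qed

end

section \<open>Gram matrices and the Lie algebras they define\<close>

lemma cst_sum: "cst (\<Sum>x\<in>X. f x) = (\<Sum>x\<in>X. cst (f x))"
  by (induction X rule: infinite_finite_induct) (simp_all flip: fps_const_add)

lemma cst_linear_comb:
  "(\<Sum>i<N. cst (v i) * (fps_X * (\<Sum>A<N. cst (M A i) * f A))) = fps_X * (\<Sum>A<N. cst (\<Sum>i<N. M A i * v i) * f A)"
  for f :: "nat \<Rightarrow> 'k::comm_ring_1 fps"
proof -
  have "(\<Sum>i<N. cst (v i) * (fps_X * (\<Sum>A<N. cst (M A i) * f A))) = (\<Sum>i<N. \<Sum>A<N. fps_X * (cst (M A i * v i) * f A))"
    unfolding sum_distrib_left by (intro sum.cong refl) (simp only: fps_const_mult[symmetric] mult_ac)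
  also have "\<dots> = (\<Sum>A<N. \<Sum>i<N. fps_X * (cst (M A i * v i) * f A))" by (rule sum.swap)
  also have "\<dots> = fps_X * (\<Sum>A<N. cst (\<Sum>i<N. M A i * v i) * f A)"
    by (simp only: sum_distrib_left sum_distrib_right cst_sum)
  finally show ?thesis .
qed

text \<open>Both Gram matrices are signed permutation matrices of an involution: it exchanges
  \<open>p\<close> and \<open>q\<close> in the even case, and in the odd case exchanges
  \<open>\<zeta>\<close> and \<open>\<eta>\<close> and fixes the remaining generators. The rule for
  \<open>\<epsilon> (p A)\<close> encodes the symmetry type of \<open>H\<close> and yields
  \<open>H^2 = - \<sigma>\<close>, which makes the inverse explicit.\<close>

locale form =
  fixes N :: nat and \<sigma> :: "'k::field_char_0" and H :: "nat \<Rightarrow> nat \<Rightarrow> 'k" and p :: "nat \<Rightarrow> nat" and \<epsilon> :: "nat \<Rightarrow> 'k"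
  assumes p: "A < N \<Longrightarrow> p A < N" "A < N \<Longrightarrow> p (p A) = A"
    and eps: "\<epsilon> A * \<epsilon> A = 1" "A < N \<Longrightarrow> \<epsilon> (p A) = - \<sigma> * \<epsilon> A"
    and sigma: "\<sigma> * \<sigma> = 1"
    and H_eq: "A < N \<Longrightarrow> B < N \<Longrightarrow> H A B = (if B = p A then \<epsilon> A else 0)"
begin

definition lie :: "'k mat \<Rightarrow> bool" where
  "lie X \<longleftrightarrow> X \<in> carrier_mat N N \<and>
    (\<forall>A<N. \<forall>B<N. (\<Sum>C<N. X $$ (C, A) * H C B) + (\<Sum>C<N. H A C * X $$ (C, B)) = 0)"

text \<open>This is \<open>X H^-1\<close> with \<open>H^-1 = - \<sigma> H\<close>: the coefficients
  of the quadratic element whose bracket acts on linear elements by \<open>X\<close>.\<close>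

definition S :: "'k mat \<Rightarrow> nat \<Rightarrow> nat \<Rightarrow> 'k" where
  "S X A B = \<epsilon> B * X $$ (A, p B)"

lemma sum_H_left: "A < N \<Longrightarrow> (\<Sum>C<N. H A C * f C) = \<epsilon> A * f (p A)" for f :: "nat \<Rightarrow> 'k"
proof -
  assume A: "A < N"
  then have "(\<Sum>C<N. H A C * f C) = (\<Sum>C<N. if C = p A then \<epsilon> A * f (p A) else 0)"
    by (intro sum.cong) (auto simp: H_eq)
  then show ?thesis using p(1)[OF A] by simp
qed

lemma sum_H_right: "B < N \<Longrightarrow> (\<Sum>C<N. f C * H C B) = - \<sigma> * \<epsilon> B * f (p B)" for f :: "nat \<Rightarrow> 'k"
proof -
  assume B: "B < N"
  have "B = p C \<longleftrightarrow> C = p B" if "C < N" for C using p B that by metis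
  then have "(\<Sum>C<N. f C * H C B) = (\<Sum>C<N. if C = p B then f (p B) * \<epsilon> (p B) else 0)"
    using B by (intro sum.cong) (auto simp: H_eq)
  then show ?thesis using p(1)[OF B] eps(2)[OF B] by (simp add: mult_ac)
qed

lemma sum_H_left_cst: "A < N \<Longrightarrow> (\<Sum>C<N. cst (H A C) * f C) = cst (\<epsilon> A) * f (p A)"
proof -
  assume A: "A < N"
  then have "(\<Sum>C<N. cst (H A C) * f C) = (\<Sum>C<N. if C = p A then cst (\<epsilon> A) * f (p A) else 0)"
    by (intro sum.cong) (auto simp: H_eq)
  then show ?thesis using p(1)[OF A] by simp
qed

lemma eps_nz: "cst (\<epsilon> A) \<noteq> 0"
  using eps(1)[of A] by (auto simp: fps_const_eq_0_iff)

text \<open>The relation \<open>X^T H + H X = 0\<close> multiplied by \<open>H^-1\<close> from both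
  sides, which amounts to evaluating it at the permuted indices \<open>p B\<close> and
  \<open>p A\<close>.\<close>

lemma S_sym:
  assumes X: "lie X" and AB: "A < N" "B < N"
  shows "S X B A = \<sigma> * S X A B"
proof -
  have "(\<Sum>C<N. X $$ (C, p B) * H C (p A)) + (\<Sum>C<N. H (p B) C * X $$ (C, p A)) = 0"
    using X p(1)[OF AB(1)] p(1)[OF AB(2)] by (auto simp: lie_def)
  then have "- \<sigma> * \<epsilon> (p A) * X $$ (A, p B) + \<epsilon> (p B) * X $$ (B, p A) = 0"
    using AB by (simp add: sum_H_left sum_H_right p)
  then have e: "(\<sigma> * \<sigma>) * \<epsilon> A * X $$ (A, p B) = \<sigma> * \<epsilon> B * X $$ (B, p A)"
    using AB by (simp add: eps(2) algebra_simps)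
  have "\<sigma> * S X A B = \<sigma> * \<epsilon> B * (\<epsilon> A * \<epsilon> A) * X $$ (A, p B)" by (simp add: S_def eps(1))
  also have "\<dots> = \<sigma> * \<epsilon> B * \<epsilon> A * ((\<sigma> * \<sigma>) * \<epsilon> A * X $$ (A, p B))" by (simp add: sigma)
  also have "\<dots> = (\<sigma> * \<sigma>) * (\<epsilon> B * \<epsilon> B) * \<epsilon> A * X $$ (B, p A)" unfolding e by (simp add: mult_ac)
  finally show ?thesis by (simp add: S_def sigma eps(1))
qed

text \<open>In matrix form \<open>H X H^-1 = - X^T\<close>, again the defining relation of the Lie
  algebra.\<close>

lemma H_S:
  assumes X: "lie X" and AD: "A < N" "D < N"
  shows "(\<Sum>B<N. H D B * S X B A) = - X $$ (A, D)"
proof -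
  have "(\<Sum>B<N. H D B * S X B A) = \<epsilon> D * (\<sigma> * S X A (p D))"
    using AD p(1)[OF AD(2)] S_sym[OF X AD(1) p(1)[OF AD(2)]] by (simp add: sum_H_left)
  also have "\<dots> = - (\<sigma> * \<sigma>) * (\<epsilon> D * \<epsilon> D) * X $$ (A, D)"
    using AD by (simp add: S_def p eps(2))
  finally show ?thesis by (simp add: sigma eps(1))
qed

end

definition pE :: "nat \<Rightarrow> nat \<Rightarrow> nat" where "pE n A = (if A < n then n + A else A - n)"
definition eE :: "nat \<Rightarrow> nat \<Rightarrow> 'k::field_char_0" where "eE n A = (if A < n then 1 else -1)"
definition pO :: "nat \<Rightarrow> nat \<Rightarrow> nat" where "pO a u = (if u < 2 * a then (if even u then u + 1 else u - 1) else u)"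
definition eO :: "nat \<Rightarrow> nat \<Rightarrow> 'k::field_char_0" where "eO a u = (if u < 2 * a then 1 else -1)"

lemma form_even: "form (2 * n) (1 :: 'k::field_char_0) (symp_entry n) (pE n) (eE n)"
  by unfold_locales (auto simp: pE_def eE_def symp_entry_def)

lemma form_odd:
  assumes "a \<le> b"
  shows "form (a + b) (-1 :: 'k::field_char_0) (h_form a b) (pO a) (eO a)"
proof unfold_locales
  have lt: "pO a A < 2 * a \<longleftrightarrow> A < 2 * a" for A
  proof -
    have "Suc A < 2 * a" if "even A" "A < 2 * a" using that by presburger
    then show ?thesis by (auto simp: pO_def)
  qed
  show "pO a A < a + b" if "A < a + b" for A
    using that assms lt[of A] by (cases "A < 2 * a") (auto simp: pO_def)
  show "pO a (pO a A) = A" for A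
  proof (cases "A < 2 * a")
    case True
    then show ?thesis using lt[of A] by (auto simp: pO_def odd_pos)
  qed (simp add: pO_def)
  show "eO a (pO a A) = - (- 1 :: 'k) * eO a A" for A using lt[of A] by (simp add: eO_def)
  show "h_form a b A B = (if B = pO a A then eO a A else (0 :: 'k))" if "A < a + b" "B < a + b" for A B
  proof (cases "A < 2 * a")
    case True
    have "(B < 2 * a \<and> A div 2 = B div 2 \<and> A \<noteq> B) \<longleftrightarrow> B = pO a A"
    proof (cases "even A")
      case ev: True
      then have "(A div 2 = B div 2 \<and> A \<noteq> B) \<longleftrightarrow> B = A + 1" by presburger
      then show ?thesis using True ev lt[of A] unfolding pO_def by auto
    next
      case od: False
      then have "(A div 2 = B div 2 \<and> A \<noteq> B) \<longleftrightarrow> B = A - 1" by presburger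
      then show ?thesis using True od lt[of A] unfolding pO_def by auto
    qed
    then show ?thesis using True by (auto simp: h_form_def eO_def)
  next
    case False
    then show ?thesis using that by (auto simp: h_form_def eO_def pO_def)
  qed
qed (auto simp: eO_def)

lemma lie_even:
  assumes "X \<in> sp_lie n"
  shows "form.lie (2 * n) (symp_entry n) (X :: 'k::field_char_0 mat)"
proof -
  have X: "X \<in> carrier_mat (2 * n) (2 * n)" and z: "transpose_mat X * symp_form n + symp_form n * X = 0\<^sub>m (2 * n) (2 * n)"
    using assms by (auto simp: sp_lie_def)
  have J: "(symp_form n :: 'k mat) \<in> carrier_mat (2 * n) (2 * n)" by (simp add: symp_form_def)
  have Je: "symp_form n $$ (A, B) = (symp_entry n A B :: 'k)" if "A < 2 * n" "B < 2 * n" for A B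
    using that by (simp add: symp_form_def symp_entry_def)
  show ?thesis unfolding form.lie_def[OF form_even]
  proof (intro conjI X allI impI)
    fix A B assume AB: "A < 2 * n" "B < 2 * n"
    have "(transpose_mat X * symp_form n + symp_form n * X) $$ (A, B) = 0" using AB unfolding z by simp
    then have "(transpose_mat X * symp_form n) $$ (A, B) + (symp_form n * X) $$ (A, B) = 0"
      by (subst (asm) index_add_mat(1)) (use AB X J in auto)
    then show "(\<Sum>C<2 * n. X $$ (C, A) * symp_entry n C B) + (\<Sum>C<2 * n. symp_entry n A C * X $$ (C, B)) = 0"
      using AB X J by (simp add: mat_mult_entry[of _ "2 * n"] Je del: index_mult_mat(1))
  qed
qed

lemma lie_odd:
  assumes ab: "a \<le> b" and "Y \<in> so_lie a b"
  shows "form.lie (a + b) (h_form a b) (Y :: 'k::field_char_0 mat)"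
proof -
  have Y: "Y \<in> carrier_mat (a + b) (a + b)" and z: "transpose_mat Y * Q_form a b + Q_form a b * Y = 0\<^sub>m (a + b) (a + b)"
    using assms by (auto simp: so_lie_def)
  have J: "(Q_form a b :: 'k mat) \<in> carrier_mat (a + b) (a + b)" by (simp add: Q_form_def)
  have Je: "Q_form a b $$ (A, B) = (h_form a b A B / 2 :: 'k)" if "A < a + b" "B < a + b" for A B
    using that by (simp add: Q_form_def)
  show ?thesis unfolding form.lie_def[OF form_odd[OF ab]]
  proof (intro conjI Y allI impI)
    fix A B assume AB: "A < a + b" "B < a + b"
    have "(transpose_mat Y * Q_form a b + Q_form a b * Y) $$ (A, B) = 0" using AB unfolding z by simp
    then have "(transpose_mat Y * Q_form a b) $$ (A, B) + (Q_form a b * Y) $$ (A, B) = 0"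
      by (subst (asm) index_add_mat(1)) (use AB Y J in auto)
    then have "(\<Sum>C<a + b. Y $$ (C, A) * (h_form a b C B / 2)) + (\<Sum>C<a + b. (h_form a b A C / 2) * Y $$ (C, B)) = 0"
      using AB Y J by (simp add: mat_mult_entry[of _ "a + b"] Je del: index_mult_mat(1))
    then have "((\<Sum>C<a + b. Y $$ (C, A) * h_form a b C B) + (\<Sum>C<a + b. h_form a b A C * Y $$ (C, B))) / 2 = 0"
      by (simp add: add_divide_distrib sum_divide_distrib)
    then show "(\<Sum>C<a + b. Y $$ (C, A) * h_form a b C B) + (\<Sum>C<a + b. h_form a b A C * Y $$ (C, B)) = 0"
      by simp
  qed
qed

abbreviation "SE n \<equiv> form.S (pE n) (eE n)"
abbreviation "SO a \<equiv> form.S (pO a) (eO a)"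

context
  fixes n a b :: nat and X Y :: "'k::field_char_0 mat"
  assumes ab: "a \<le> b" and X: "X \<in> sp_lie n" and Y: "Y \<in> so_lie a b"
begin

interpretation e: form "2 * n" "1 :: 'k" "symp_entry n" "pE n" "eE n" by (rule form_even)
interpretation o: form "a + b" "-1 :: 'k" "h_form a b" "pO a" "eO a" by (rule form_odd[OF ab])

lemma S_sym_even: "A < 2 * n \<Longrightarrow> B < 2 * n \<Longrightarrow> SE n X B A = SE n X A B"
  using e.S_sym[OF lie_even[OF X]] by simp

lemma S_sym_odd: "A < a + b \<Longrightarrow> B < a + b \<Longrightarrow> SO a Y B A = - SO a Y A B"
  by (subst o.S_sym[OF lie_odd[OF ab Y]]) simp_all

abbreviation "w0 \<equiv> quad n a b (SE n X) (SO a Y)"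

lemma bracket_quad_even:
  assumes D: "D < 2 * n"
  shows "bracket n a b w0 (m_even1 D unit_wc) m = fps_X * (\<Sum>A<2 * n. cst (X $$ (A, D)) * m_even1 A unit_wc m)"
proof -
  have "(\<Sum>B<2 * n. cst (symp_entry n D B) * d_even1 B w0 m) =
      (\<Sum>B<2 * n. \<Sum>A<2 * n. cst (symp_entry n D B * SE n X B A) * m_even1 A unit_wc m)"
    by (intro sum.cong refl) (simp add: d_quad_even[OF S_sym_even] sum_distrib_left mult.assoc[symmetric])
  also have "\<dots> = (\<Sum>A<2 * n. cst (\<Sum>B<2 * n. symp_entry n D B * SE n X B A) * m_even1 A unit_wc m)"
    by (subst sum.swap) (simp only: sum_distrib_right cst_sum)
  also have "\<dots> = - (\<Sum>A<2 * n. cst (X $$ (A, D)) * m_even1 A unit_wc m)"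
    using D by (simp add: e.H_S[OF lie_even[OF X]] flip: sum_negf fps_const_neg)
  finally have e: "(\<Sum>B<2 * n. cst (symp_entry n D B) * d_even1 B w0 m) = - (\<Sum>A<2 * n. cst (X $$ (A, D)) * m_even1 A unit_wc m)" .
  show ?thesis unfolding bracket_even[OF quadratic_fin_supp[OF quad_quadratic] D] e by simp
qed

lemma bracket_quad_odd:
  assumes D: "D < a + b"
  shows "bracket n a b w0 (m_odd1 D unit_wc) m = fps_X * (\<Sum>A<a + b. cst (Y $$ (A, D)) * m_odd1 A unit_wc m)"
proof -
  have "(\<Sum>B<a + b. cst (h_form a b D B) * d_odd1 B w0 m) =
      (\<Sum>B<a + b. \<Sum>A<a + b. cst (h_form a b D B * SO a Y B A) * m_odd1 A unit_wc m)"
    by (intro sum.cong refl) (simp add: d_quad_odd[OF S_sym_odd] sum_distrib_left mult.assoc[symmetric])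
  also have "\<dots> = (\<Sum>A<a + b. cst (\<Sum>B<a + b. h_form a b D B * SO a Y B A) * m_odd1 A unit_wc m)"
    by (subst sum.swap) (simp only: sum_distrib_right cst_sum)
  also have "\<dots> = - (\<Sum>A<a + b. cst (Y $$ (A, D)) * m_odd1 A unit_wc m)"
    using D by (simp add: o.H_S[OF lie_odd[OF ab Y]] flip: sum_negf fps_const_neg)
  finally have e: "(\<Sum>B<a + b. cst (h_form a b D B) * d_odd1 B w0 m) = - (\<Sum>A<a + b. cst (Y $$ (A, D)) * m_odd1 A unit_wc m)" .
  show ?thesis unfolding bracket_odd[OF quadratic_fin_supp[OF quad_quadratic] D even_supp_quad] e by simp
qed

lemma bracket_linear_elem:
  assumes v: "v \<in> carrier_vec (2 * n)" and u: "u \<in> carrier_vec (a + b)"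
  shows "bracket n a b w0 (linear_elem n a b v u) m = fps_X * linear_elem n a b (X *\<^sub>v v) (Y *\<^sub>v u) m"
proof -
  have Xc: "X \<in> carrier_mat (2 * n) (2 * n)" and Yc: "Y \<in> carrier_mat (a + b) (a + b)"
    using X Y by (auto simp: sp_lie_def so_lie_def)
  have l: "linear_elem n a b v u = (\<lambda>m. (\<Sum>i<2 * n. cst (vec_index v i) * m_even1 i unit_wc m) + (\<Sum>j<a + b. cst (vec_index u j) * m_odd1 j unit_wc m))"
    by (rule ext) (rule linear_elem_eq)
  have "bracket n a b w0 (linear_elem n a b v u) m =
      (\<Sum>i<2 * n. cst (vec_index v i) * bracket n a b w0 (m_even1 i unit_wc) m) + (\<Sum>j<a + b. cst (vec_index u j) * bracket n a b w0 (m_odd1 j unit_wc) m)"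
    unfolding l bracket_def star_add star_linear by (simp add: right_diff_distrib sum_subtractf)
  also have "(\<Sum>i<2 * n. cst (vec_index v i) * bracket n a b w0 (m_even1 i unit_wc) m) =
      fps_X * (\<Sum>A<2 * n. cst (\<Sum>i<2 * n. X $$ (A, i) * vec_index v i) * m_even1 A unit_wc m)"
    unfolding cst_linear_comb[symmetric] by (intro sum.cong refl) (simp add: bracket_quad_even)
  also have "(\<Sum>j<a + b. cst (vec_index u j) * bracket n a b w0 (m_odd1 j unit_wc) m) =
      fps_X * (\<Sum>A<a + b. cst (\<Sum>i<a + b. Y $$ (A, i) * vec_index u i) * m_odd1 A unit_wc m)"
    unfolding cst_linear_comb[symmetric] by (intro sum.cong refl) (simp add: bracket_quad_odd)
  finally have main: "bracket n a b w0 (linear_elem n a b v u) m =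
      fps_X * (\<Sum>A<2 * n. cst (\<Sum>i<2 * n. X $$ (A, i) * vec_index v i) * m_even1 A unit_wc m) +
      fps_X * (\<Sum>A<a + b. cst (\<Sum>i<a + b. Y $$ (A, i) * vec_index u i) * m_odd1 A unit_wc m)" .
  have "vec_index (X *\<^sub>v v) A = (\<Sum>i<2 * n. X $$ (A, i) * vec_index v i)" if "A < 2 * n" for A
    using Xc v that by (simp add: scalar_prod_def lessThan_atLeast0)
  then have 1: "(\<Sum>A<2 * n. cst (vec_index (X *\<^sub>v v) A) * m_even1 A unit_wc m) =
      (\<Sum>A<2 * n. cst (\<Sum>i<2 * n. X $$ (A, i) * vec_index v i) * m_even1 A unit_wc m)"
    by (intro sum.cong refl) (simp only: lessThan_iff)
  have "vec_index (Y *\<^sub>v u) A = (\<Sum>i<a + b. Y $$ (A, i) * vec_index u i)" if "A < a + b" for A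
    using Yc u that by (simp add: scalar_prod_def lessThan_atLeast0)
  then have 2: "(\<Sum>A<a + b. cst (vec_index (Y *\<^sub>v u) A) * m_odd1 A unit_wc m) =
      (\<Sum>A<a + b. cst (\<Sum>i<a + b. Y $$ (A, i) * vec_index u i) * m_odd1 A unit_wc m)"
    by (intro sum.cong refl) (simp only: lessThan_iff)
  show ?thesis
    unfolding linear_elem_eq[where v = "X *\<^sub>v v" and u = "Y *\<^sub>v u" and m = m] 1 2 distrib_left by (rule main)
qed

text \<open>For uniqueness: the form is invertible, so the brackets with the generators determine
  all first derivatives, and every monomial of degree 2 contains a generator by which to
  differentiate. The even derivatives come first, because they give the parity of \<open>w\<close>
  that the odd bracket formula presupposes.\<close>

lemma Phi_quad_eq: "Phi_quad n a b X Y = w0"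
  unfolding Phi_quad_def
proof (rule the_equality)
  show "w0 \<in> quadratic_elems n a b \<and> (\<forall>v \<in> carrier_vec (2 * n). \<forall>u \<in> carrier_vec (a + b). \<forall>m.
        star n a b w0 (linear_elem n a b v u) m - star n a b (linear_elem n a b v u) w0 m
        = fps_X * linear_elem n a b (X *\<^sub>v v) (Y *\<^sub>v u) m)"
    using quad_quadratic bracket_linear_elem unfolding bracket_def by blast
next
  fix w :: "'k wc"
  assume w: "w \<in> quadratic_elems n a b \<and> (\<forall>v \<in> carrier_vec (2 * n). \<forall>u \<in> carrier_vec (a + b). \<forall>m.
        star n a b w (linear_elem n a b v u) m - star n a b (linear_elem n a b v u) w m
        = fps_X * linear_elem n a b (X *\<^sub>v v) (Y *\<^sub>v u) m)"
  have br: "bracket n a b w (linear_elem n a b v u) m = bracket n a b w0 (linear_elem n a b v u) m"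
    if "v \<in> carrier_vec (2 * n)" "u \<in> carrier_vec (a + b)" for v u m
  proof -
    have "bracket n a b w (linear_elem n a b v u) m = fps_X * linear_elem n a b (X *\<^sub>v v) (Y *\<^sub>v u) m"
      using w that unfolding bracket_def by blast
    then show ?thesis using bracket_linear_elem[OF that] by simp
  qed
  note fw = quadratic_fin_supp[OF conjunct1[OF w]] and fw0 = quadratic_fin_supp[OF quad_quadratic, of n a b "SE n X" "SO a Y"]
  have wq: "(\<forall>i\<ge>2 * n. e i = 0) \<and> U \<subseteq> {..<a + b} \<and> (\<Sum>i<2 * n. e i) + card U = 2" if "w (e, U) \<noteq> 0" for e U
    using w that by (auto simp: quadratic_elems_def wc_carrier_def)
  have lev: "linear_elem n a b (unit_vec (2 * n) D) (0\<^sub>v (a + b)) = m_even1 D (unit_wc :: 'k wc)" if "D < 2 * n" for D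
  proof
    fix m
    have "(\<Sum>i<2 * n. cst (vec_index (unit_vec (2 * n) D :: 'k Matrix.vec) i) * m_even1 i unit_wc m) = (\<Sum>i<2 * n. if i = D then m_even1 D unit_wc m else 0)"
      using that by (intro sum.cong) auto
    then show "linear_elem n a b (unit_vec (2 * n) D) (0\<^sub>v (a + b)) m = m_even1 D (unit_wc :: 'k wc) m"
      using that by (simp add: linear_elem_eq)
  qed
  have lod: "linear_elem n a b (0\<^sub>v (2 * n)) (unit_vec (a + b) D) = m_odd1 D (unit_wc :: 'k wc)" if "D < a + b" for D
  proof
    fix m
    have "(\<Sum>i<a + b. cst (vec_index (unit_vec (a + b) D :: 'k Matrix.vec) i) * m_odd1 i unit_wc m) = (\<Sum>i<a + b. if i = D then m_odd1 D unit_wc m else 0)"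
      using that by (intro sum.cong) auto
    then show "linear_elem n a b (0\<^sub>v (2 * n)) (unit_vec (a + b) D) m = m_odd1 D (unit_wc :: 'k wc) m"
      using that by (simp add: linear_elem_eq)
  qed
  have dev: "d_even1 B w m = d_even1 B w0 m" if B: "B < 2 * n" for B m
  proof -
    have D: "pE n B < 2 * n" by (rule e.p(1)[OF B])
    have "bracket n a b w (m_even1 (pE n B) unit_wc) m = bracket n a b w0 (m_even1 (pE n B) unit_wc) m"
      unfolding lev[OF D, symmetric] by (rule br) auto
    then show ?thesis
      using D e.eps_nz[of "pE n B"] by (simp add: bracket_even[OF fw] bracket_even[OF fw0] e.sum_H_left_cst e.p(2)[OF B])
  qed
  have eqe: "w (e, U) = w0 (e, U)" if "e B \<noteq> 0" "B < 2 * n" for e U B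
  proof -
    have "d_even1 B w (e(B := e B - 1), U) = d_even1 B w0 (e(B := e B - 1), U)" by (rule dev[OF that(2)])
    moreover have "(e(B := e B - 1))(B := Suc (e B - 1)) = e" using that(1) by auto
    ultimately have "of_nat (Suc (e B - 1)) * w (e, U) = of_nat (Suc (e B - 1)) * w0 (e, U)"
      by (simp add: d_even1_def)
    then show ?thesis by (metis mult_left_cancel of_nat_neq_0)
  qed
  \<comment> \<open>A monomial with an even generator already agrees with \<open>w0\<close>; one
    without has exactly two odd generators.\<close>
  have evw: "even_supp w"
    unfolding even_supp_def
  proof (intro allI impI)
    fix e U assume nz: "w (e, U) \<noteq> 0"
    show "even (card U)"
    proof (cases "\<exists>B<2 * n. e B \<noteq> 0")
      case True
      then show ?thesis using nz eqe[of e _ U] even_supp_quad[of n a b "SE n X" "SO a Y"] unfolding even_supp_def by metis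
    next
      case False
      then have "(\<Sum>i<2 * n. e i) = 0" by simp
      then show ?thesis using wq[OF nz] by simp
    qed
  qed
  have dod: "d_odd1 B w m = d_odd1 B w0 m" if B: "B < a + b" for B m
  proof -
    have D: "pO a B < a + b" by (rule o.p(1)[OF B])
    have "bracket n a b w (m_odd1 (pO a B) unit_wc) m = bracket n a b w0 (m_odd1 (pO a B) unit_wc) m"
      unfolding lod[OF D, symmetric] by (rule br) auto
    then show ?thesis
      using D o.eps_nz[of "pO a B"]
      by (simp add: bracket_odd[OF fw _ evw] bracket_odd[OF fw0 _ even_supp_quad] o.sum_H_left_cst o.p(2)[OF B])
  qed
  have eqo: "w (e, U) = w0 (e, U)" if "u \<in> U" "u < a + b" for e U u
  proof -
    have "d_odd1 u w (e, U - {u}) = d_odd1 u w0 (e, U - {u})" by (rule dod[OF that(2)])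
    then show ?thesis using that(1) by (simp add: d_odd1_def insert_absorb)
  qed
  show "w = w0"
  proof
    fix m :: mono
    obtain e U where m: "m = (e, U)" by (cases m)
    show "w m = w0 m"
    proof (rule ccontr)
      assume ne: "w m \<noteq> w0 m"
      then have "w (e, U) \<noteq> 0 \<or> w0 (e, U) \<noteq> 0" by (auto simp: m)
      then have q: "U \<subseteq> {..<a + b}" "(\<Sum>i<2 * n. e i) + card U = 2"
        using wq[of e U] quad_nz[of n a b "SE n X" "SO a Y" e U] by blast+
      have "e B = 0" if "B < 2 * n" for B using eqe[of e B U] that ne m by blast
      then have "card U = 2" using q(2) by simp
      then obtain u where "u \<in> U" by fastforce
      then show False using eqo[of u U e] q(1) ne m by blast
    qed
  qed
qed

lemma Phi_eq: "Phi n a b (X, Y, z) = (\<lambda>m. w0 m + cst z * unit_wc m)"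
  unfolding Phi.simps Phi_quad_eq
  by (rule ext) (simp add: const_elem_def unit_wc case_prod_beta prod_eq_iff)

end

subsection \<open>Expansion into loops\<close>

definition mtr :: "nat \<Rightarrow> 'k::comm_ring_1 mat \<Rightarrow> 'k" where
  "mtr N M = (\<Sum>i<N. M $$ (i, i))"

lemma sum_swap3: "(\<Sum>A\<in>X. \<Sum>B\<in>Y. \<Sum>r\<in>Z. f A B r) = (\<Sum>r\<in>Z. \<Sum>A\<in>X. \<Sum>B\<in>Y. f A B r)"
proof -
  have "(\<Sum>A\<in>X. \<Sum>B\<in>Y. \<Sum>r\<in>Z. f A B r) = (\<Sum>A\<in>X. \<Sum>r\<in>Z. \<Sum>B\<in>Y. f A B r)"
    by (intro sum.cong refl sum.swap)
  also have "\<dots> = (\<Sum>r\<in>Z. \<Sum>A\<in>X. \<Sum>B\<in>Y. f A B r)" by (rule sum.swap)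
  finally show ?thesis .
qed

lemma sum_rev3: "(\<Sum>A\<in>X. \<Sum>B\<in>Y. \<Sum>r\<in>Z. f A B r) = (\<Sum>r\<in>Z. \<Sum>B\<in>Y. \<Sum>A\<in>X. f A B r)"
  unfolding sum_swap3[of f] by (intro sum.cong refl sum.swap)

text \<open>The Wick rule for legs of one parity in the vertex slots. \<open>wop r\<close> is the
  complete vertex, but by \<open>dw\<close> a derivative of this parity sees only the quadratic part
  with coefficients \<open>S r\<close>. \<open>HS\<close> says that contracting a leg into a vertex
  acts on its index by the matrix \<open>Xm r\<close>, and \<open>C_diag\<close> rules out
  self-contraction.\<close>

locale wick_chain = mode k N \<sigma> H d m
  for k N :: nat and \<sigma> :: "'k::field_char_0" and H :: "nat \<Rightarrow> nat \<Rightarrow> 'k"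
    and d m :: "nat \<Rightarrow> nat \<Rightarrow> 'k wc_tensor \<Rightarrow> 'k wc_tensor" +
  fixes E :: "'k wc_tensor \<Rightarrow> 'k fps" and V :: "'k wc_tensor set" and C :: "nat \<Rightarrow> nat \<Rightarrow> 'k"
    and S :: "nat \<Rightarrow> nat \<Rightarrow> nat \<Rightarrow> 'k" and Xm :: "nat \<Rightarrow> 'k mat"
    and wop :: "nat \<Rightarrow> 'k wc_tensor \<Rightarrow> 'k wc_tensor" and vac :: "'k wc_tensor"
  assumes linE: "linfun E"
    and V_tens: "t \<in> V \<Longrightarrow> t \<in> tens k"
    and V_m: "t \<in> V \<Longrightarrow> x \<in> {1..k} \<Longrightarrow> m x A t \<in> V"
    and V_wop: "t \<in> V \<Longrightarrow> x \<in> {1..k} \<Longrightarrow> wop x t \<in> V"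
    and vacV: "vac \<in> V"
    and d_vac: "x \<in> {1..k} \<Longrightarrow> d x B vac = 0"
    and wick: "t \<in> V \<Longrightarrow> x \<in> {1..k} \<Longrightarrow> A < N \<Longrightarrow>
      E (m x A t) = fps_X * (\<Sum>j\<in>{1..k}. cst (C x j / 2) * (\<Sum>B<N. cst (H A B) * E (d j B t)))"
    and lin_wop: "linop (wop r)"
    and dw: "t \<in> tens k \<Longrightarrow> x \<in> {1..k} \<Longrightarrow> r \<in> {1..k} \<Longrightarrow> B < N \<Longrightarrow>
      d x B (wop r t) = wop r (d x B t) + (if x = r then \<Sum>D<N. sc (cst (S r B D)) (m r D t) else 0)"
    and mw: "t \<in> tens k \<Longrightarrow> x \<in> {1..k} \<Longrightarrow> r \<in> {1..k} \<Longrightarrow> m x A (wop r t) = wop r (m x A t)"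
    and S_sym: "r \<in> {1..k} \<Longrightarrow> A < N \<Longrightarrow> B < N \<Longrightarrow> S r B A = \<sigma> * S r A B"
    and HS: "r \<in> {1..k} \<Longrightarrow> A < N \<Longrightarrow> F < N \<Longrightarrow> (\<Sum>D<N. H A D * S r D F) = - Xm r $$ (F, A)"
    and Xm: "r \<in> {1..k} \<Longrightarrow> Xm r \<in> carrier_mat N N"
    and C_diag: "C x x = 0"
begin

definition P :: "nat list \<Rightarrow> 'k wc_tensor" where
  "P rs = foldr wop rs vac"

definition W :: "nat list \<Rightarrow> 'k fps" where
  "W rs = E (P rs)"

definition G :: "nat \<Rightarrow> nat \<Rightarrow> nat \<Rightarrow> nat \<Rightarrow> nat list \<Rightarrow> 'k fps" where
  "G x A y B rs = E (m x A (m y B (P rs)))"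

text \<open>
  An open chain of contractions from \<open>x\<close> to \<open>y\<close>; the matrix \<open>Z\<close> accumulates the product of the vertices
  already absorbed, while the vertices \<open>rs\<close> are still free.
\<close>

definition T :: "nat \<Rightarrow> nat \<Rightarrow> nat list \<Rightarrow> 'k mat \<Rightarrow> 'k fps" where
  "T x y rs Z = (\<Sum>A<N. \<Sum>B<N. cst (\<Sum>D<N. S y D B * Z $$ (A, D)) * G x A y B rs)"

lemma P_Cons [simp]: "P (r # rs) = wop r (P rs)"
  by (simp add: P_def)

lemma P_V: "set rs \<subseteq> {1..k} \<Longrightarrow> P rs \<in> V"
  by (induction rs) (auto simp: P_def vacV V_wop)

text \<open>A slot holds at most one vertex. The derivative consumes that vertex and leaves its
  second leg behind.\<close>

lemma d_P:
  assumes "distinct rs" "set rs \<subseteq> {1..k}" "j \<in> {1..k}" "B < N"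
  shows "d j B (P rs) = (if j \<in> set rs then \<Sum>D<N. sc (cst (S j B D)) (m j D (P (remove1 j rs))) else 0)"
  using assms(1,2)
proof (induction rs)
  case Nil
  then show ?case using assms by (simp add: P_def d_vac)
next
  case (Cons r rs)
  have r: "r \<in> {1..k}" and rs: "set rs \<subseteq> {1..k}" using Cons.prems by auto
  have t: "P rs \<in> tens k" "P (remove1 j rs) \<in> tens k"
    using V_tens[OF P_V] rs set_remove1_subset[of j rs] by blast+
  have IH: "d j B (P rs) = (if j \<in> set rs then \<Sum>D<N. sc (cst (S j B D)) (m j D (P (remove1 j rs))) else 0)"
    using Cons rs by auto
  show ?case
  proof (cases "j = r")
    case True
    then have "j \<notin> set rs" using Cons.prems by auto
    then show ?thesis using True IH dw[OF t(1) assms(3) r assms(4)] by (simp add: linopD(3)[OF lin_wop])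
  next
    case False
    then show ?thesis using IH dw[OF t(1) assms(3) r assms(4)]
      by (simp add: linopD[OF lin_wop] mw[OF t(2) assms(3) r])
  qed
qed

lemma sum_delta_pair:
  assumes "y \<in> {1..k}" "B < N"
  shows "(\<Sum>j\<in>{1..k}. c j * (\<Sum>D<N. h D * (if j = y \<and> D = B then p else 0))) = (c y * (h B * p) :: 'k fps)"
proof -
  have "(\<Sum>D<N. h D * (if j = y \<and> D = B then p else 0)) = (if j = y then h B * p else 0)" for j
  proof -
    have "(\<Sum>D<N. h D * (if j = y \<and> D = B then p else 0)) = (\<Sum>D<N. if D = B then (if j = y then h B * p else 0) else 0)"
      by (intro sum.cong) auto
    then show ?thesis using assms by simp
  qed
  then have "(\<Sum>j\<in>{1..k}. c j * (\<Sum>D<N. h D * (if j = y \<and> D = B then p else 0))) = (\<Sum>j\<in>{1..k}. if j = y then c y * (h B * p) else 0)"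
    by (intro sum.cong) auto
  then show ?thesis using assms by simp
qed

text \<open>The leg at \<open>x\<close> is contracted either with the leg at \<open>y\<close>, which
  ends the chain, or with a free vertex \<open>r\<close>, whose other leg takes over. The minus sign
  in the second case is that of \<open>HS\<close>.\<close>

lemma G_rec:
  assumes rs: "distinct rs" "set rs \<subseteq> {1..k}" and x: "x \<in> {1..k}" and y: "y \<in> {1..k}" and AB: "A < N" "B < N"
  shows "G x A y B rs = fps_X * (cst (C x y / 2 * H A B) * W rs +
    (\<Sum>r\<in>set rs. cst (- (C x r / 2)) * (\<Sum>F<N. cst (Xm r $$ (F, A)) * G r F y B (remove1 r rs))))"
proof -
  have PV: "P rs \<in> V" and Pt: "P rs \<in> tens k" using P_V[OF rs(2)] V_tens by auto
  have yk: "y \<le> k" using y by auto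
  have e: "E (d j D (m y B (P rs))) = (if j = y \<and> D = B then W rs else 0) +
      (if j \<in> set rs then \<Sum>F<N. cst (S j D F) * G j F y B (remove1 j rs) else 0)" if j: "j \<in> {1..k}" and D: "D < N" for j D
  proof -
    have jk: "j \<le> k" using j by auto
    have Pr: "P (remove1 j rs) \<in> tens k"
      using V_tens[OF P_V] rs set_remove1_subset[of j rs] by blast
    \<comment> \<open>The leg at \<open>y\<close> is passed once by the derivative and once by the
      leg it releases, so \<open>\<sigma>\<close> occurs twice and disappears.\<close>
    have "sc (cst \<sigma>) (m y B (d j D (P rs))) = (if j \<in> set rs then \<Sum>F<N. sc (cst (S j D F)) (m j F (m y B (P (remove1 j rs)))) else 0)"
    proof (cases "j \<in> set rs")
      case True
      have "sc (cst \<sigma>) (m y B (d j D (P rs))) = (\<Sum>F<N. sc (cst \<sigma>) (sc (cst (S j D F)) (sc (cst \<sigma>) (m j F (m y B (P (remove1 j rs)))))))"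
        using True by (simp only: d_P[OF rs j D] if_True linopD[OF lin(2)] sc_sum mm[OF Pr yk jk])
      also have "\<dots> = (\<Sum>F<N. sc (cst (S j D F)) (m j F (m y B (P (remove1 j rs)))))"
      proof (intro sum.cong refl)
        fix F
        have "\<sigma> * (S j D F * \<sigma>) = S j D F" using sigma by (metis mult.assoc mult.commute mult_1)
        then show "sc (cst \<sigma>) (sc (cst (S j D F)) (sc (cst \<sigma>) (m j F (m y B (P (remove1 j rs)))))) = sc (cst (S j D F)) (m j F (m y B (P (remove1 j rs))))"
          by (simp only: sc_sc fps_const_mult)
      qed
      finally show ?thesis using True by simp
    qed (simp add: d_P[OF rs j D] linopD(3)[OF lin(2)])
    then show ?thesis
      unfolding dm[OF Pt jk yk] by (simp add: linfunD[OF linE] G_def W_def)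
  qed
  have "G x A y B rs = fps_X * (\<Sum>j\<in>{1..k}. cst (C x j / 2) * (\<Sum>D<N. cst (H A D) * E (d j D (m y B (P rs)))))"
    unfolding G_def by (rule wick[OF V_m[OF PV y] x AB(1)])
  also have "(\<Sum>j\<in>{1..k}. cst (C x j / 2) * (\<Sum>D<N. cst (H A D) * E (d j D (m y B (P rs))))) =
     (\<Sum>j\<in>{1..k}. cst (C x j / 2) * (\<Sum>D<N. cst (H A D) * (if j = y \<and> D = B then W rs else 0))) +
     (\<Sum>j\<in>{1..k}. cst (C x j / 2) * (\<Sum>D<N. cst (H A D) * (if j \<in> set rs then \<Sum>F<N. cst (S j D F) * G j F y B (remove1 j rs) else 0)))"
    by (simp add: e distrib_left sum.distrib)
  also have "(\<Sum>j\<in>{1..k}. cst (C x j / 2) * (\<Sum>D<N. cst (H A D) * (if j = y \<and> D = B then W rs else 0))) = cst (C x y / 2 * H A B) * W rs"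
    unfolding sum_delta_pair[OF y AB(2)] by (simp add: mult.assoc[symmetric])
  also have "(\<Sum>j\<in>{1..k}. cst (C x j / 2) * (\<Sum>D<N. cst (H A D) * (if j \<in> set rs then \<Sum>F<N. cst (S j D F) * G j F y B (remove1 j rs) else 0))) =
      (\<Sum>j\<in>set rs. cst (C x j / 2) * (\<Sum>D<N. cst (H A D) * (\<Sum>F<N. cst (S j D F) * G j F y B (remove1 j rs))))"
    using rs(2) by (intro sum.mono_neutral_cong_right) auto
  also have "\<dots> = (\<Sum>r\<in>set rs. cst (- (C x r / 2)) * (\<Sum>F<N. cst (Xm r $$ (F, A)) * G r F y B (remove1 r rs)))"
  proof (intro sum.cong refl)
    fix r assume "r \<in> set rs"
    then have r: "r \<in> {1..k}" using rs by auto
    have "(\<Sum>D<N. cst (H A D) * (\<Sum>F<N. cst (S r D F) * G r F y B (remove1 r rs))) =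
       (\<Sum>F<N. \<Sum>D<N. cst (H A D * S r D F) * G r F y B (remove1 r rs))"
      unfolding sum_distrib_left by (subst sum.swap) (simp add: mult.assoc[symmetric])
    also have "\<dots> = (\<Sum>F<N. cst (- Xm r $$ (F, A)) * G r F y B (remove1 r rs))"
      using AB by (intro sum.cong refl) (simp add: HS[OF r, symmetric] cst_sum sum_distrib_right)
    also have "\<dots> = - (\<Sum>F<N. cst (Xm r $$ (F, A)) * G r F y B (remove1 r rs))"
      by (simp add: sum_negf flip: fps_const_neg)
    finally show "cst (C x r / 2) * (\<Sum>D<N. cst (H A D) * (\<Sum>F<N. cst (S r D F) * G r F y B (remove1 r rs))) =
       cst (- (C x r / 2)) * (\<Sum>F<N. cst (Xm r $$ (F, A)) * G r F y B (remove1 r rs))"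
      by (simp flip: fps_const_neg)
  qed
  finally show ?thesis .
qed

text \<open>\<open>G_rec\<close> summed against the matrix \<open>Z S_y\<close>. The closing
  contraction pairs \<open>H\<close> with \<open>S_y\<close> and leaves a trace, with
  \<open>\<sigma>\<close> from the symmetry of \<open>S_y\<close>; a further vertex multiplies
  \<open>Z\<close> by its matrix from the left.\<close>

lemma T_rec:
  assumes rs: "distinct rs" "set rs \<subseteq> {1..k}" and x: "x \<in> {1..k}" and y: "y \<in> {1..k}" and Z: "Z \<in> carrier_mat N N"
  shows "T x y rs Z = fps_X * (cst (- (\<sigma> * C x y / 2) * mtr N (Z * Xm y)) * W rs +
    (\<Sum>r\<in>set rs. cst (- (C x r / 2)) * T r y (remove1 r rs) (Xm r * Z)))"
proof -
  define g where "g A B = (\<Sum>D<N. S y D B * Z $$ (A, D))" for A B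
  have "T x y rs Z = (\<Sum>A<N. \<Sum>B<N. cst (g A B) * (fps_X * (cst (C x y / 2 * H A B) * W rs +
    (\<Sum>r\<in>set rs. cst (- (C x r / 2)) * (\<Sum>F<N. cst (Xm r $$ (F, A)) * G r F y B (remove1 r rs))))))"
    unfolding T_def g_def[symmetric] by (intro sum.cong refl) (simp add: G_rec[OF rs x y])
  also have "\<dots> = (\<Sum>A<N. \<Sum>B<N. fps_X * (cst (g A B * (C x y / 2 * H A B)) * W rs +
    (\<Sum>r\<in>set rs. cst (g A B) * (cst (- (C x r / 2)) * (\<Sum>F<N. cst (Xm r $$ (F, A)) * G r F y B (remove1 r rs))))))"
  proof (intro sum.cong refl)
    fix A B
    have e: "c * (fps_X * (u * w + (\<Sum>r\<in>set rs. h r))) = fps_X * ((c * u) * w + (\<Sum>r\<in>set rs. c * h r))" for c u w :: "'k fps" and h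
      by (simp add: algebra_simps sum_distrib_left)
    show "cst (g A B) * (fps_X * (cst (C x y / 2 * H A B) * W rs +
      (\<Sum>r\<in>set rs. cst (- (C x r / 2)) * (\<Sum>F<N. cst (Xm r $$ (F, A)) * G r F y B (remove1 r rs))))) =
      fps_X * (cst (g A B * (C x y / 2 * H A B)) * W rs +
      (\<Sum>r\<in>set rs. cst (g A B) * (cst (- (C x r / 2)) * (\<Sum>F<N. cst (Xm r $$ (F, A)) * G r F y B (remove1 r rs)))))"
      unfolding e fps_const_mult ..
  qed
  also have "\<dots> = fps_X * ((\<Sum>A<N. \<Sum>B<N. cst (g A B * (C x y / 2 * H A B)) * W rs) +
    (\<Sum>A<N. \<Sum>B<N. \<Sum>r\<in>set rs. cst (g A B) * (cst (- (C x r / 2)) * (\<Sum>F<N. cst (Xm r $$ (F, A)) * G r F y B (remove1 r rs)))))"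
    by (simp only: sum_distrib_left[of fps_X, symmetric] sum.distrib)
  also have "(\<Sum>A<N. \<Sum>B<N. cst (g A B * (C x y / 2 * H A B)) * W rs) = cst (- (\<sigma> * C x y / 2) * mtr N (Z * Xm y)) * W rs"
  proof -
    have "(\<Sum>A<N. \<Sum>B<N. g A B * (C x y / 2 * H A B)) = (\<Sum>A<N. \<Sum>D<N. C x y / 2 * \<sigma> * Z $$ (A, D) * (\<Sum>B<N. H A B * S y B D))"
    proof (rule sum.cong[OF refl])
      fix A assume "A \<in> {..<N}"
      have "(\<Sum>B<N. g A B * (C x y / 2 * H A B)) = (\<Sum>B<N. \<Sum>D<N. C x y / 2 * \<sigma> * Z $$ (A, D) * (H A B * S y B D))"
        unfolding g_def sum_distrib_right
      proof (intro sum.cong refl)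
        fix B D assume "B \<in> {..<N}" "D \<in> {..<N}"
        then have e: "S y D B = \<sigma> * S y B D" using S_sym[OF y, of B D] by simp
        show "S y D B * Z $$ (A, D) * (C x y / 2 * H A B) = C x y / 2 * \<sigma> * Z $$ (A, D) * (H A B * S y B D)"
          unfolding e by (simp only: mult_ac)
      qed
      also have "\<dots> = (\<Sum>D<N. \<Sum>B<N. C x y / 2 * \<sigma> * Z $$ (A, D) * (H A B * S y B D))" by (rule sum.swap)
      finally show "(\<Sum>B<N. g A B * (C x y / 2 * H A B)) = (\<Sum>D<N. C x y / 2 * \<sigma> * Z $$ (A, D) * (\<Sum>B<N. H A B * S y B D))"
        by (simp only: sum_distrib_left)
    qed
    also have "\<dots> = (\<Sum>A<N. \<Sum>D<N. - (\<sigma> * C x y / 2) * (Z $$ (A, D) * Xm y $$ (D, A)))"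
      by (intro sum.cong refl) (simp add: HS[OF y])
    also have "\<dots> = - (\<sigma> * C x y / 2) * mtr N (Z * Xm y)"
      unfolding mtr_def sum_distrib_left[symmetric] using Z Xm[OF y]
      by (intro arg_cong2[where f = "(*)"] refl sum.cong) (simp add: mat_mult_entry[of _ N] del: index_mult_mat(1))
    finally show ?thesis by (simp only: cst_sum[symmetric] sum_distrib_right[symmetric])
  qed
  also have "(\<Sum>A<N. \<Sum>B<N. \<Sum>r\<in>set rs. cst (g A B) * (cst (- (C x r / 2)) * (\<Sum>F<N. cst (Xm r $$ (F, A)) * G r F y B (remove1 r rs)))) =
     (\<Sum>r\<in>set rs. cst (- (C x r / 2)) * T r y (remove1 r rs) (Xm r * Z))"
  proof -
    have "(\<Sum>A<N. \<Sum>B<N. cst (g A B) * (\<Sum>F<N. cst (Xm r $$ (F, A)) * G r F y B (remove1 r rs))) = T r y (remove1 r rs) (Xm r * Z)"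
      if "r \<in> set rs" for r
    proof -
      have r: "r \<in> {1..k}" using that rs by auto
      have "(\<Sum>A<N. \<Sum>B<N. cst (g A B) * (\<Sum>F<N. cst (Xm r $$ (F, A)) * G r F y B (remove1 r rs))) =
         (\<Sum>A<N. \<Sum>B<N. \<Sum>F<N. cst (g A B * Xm r $$ (F, A)) * G r F y B (remove1 r rs))"
        by (simp only: sum_distrib_left fps_const_mult[symmetric] mult.assoc)
      also have "\<dots> = (\<Sum>F<N. \<Sum>B<N. \<Sum>A<N. cst (g A B * Xm r $$ (F, A)) * G r F y B (remove1 r rs))"
        by (rule sum_rev3)
      also have "\<dots> = (\<Sum>F<N. \<Sum>B<N. cst (\<Sum>D<N. S y D B * (Xm r * Z) $$ (F, D)) * G r F y B (remove1 r rs))"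
      proof (intro sum.cong refl)
        fix F B assume F: "F \<in> {..<N}"
        have "(\<Sum>A<N. g A B * Xm r $$ (F, A)) = (\<Sum>D<N. \<Sum>A<N. S y D B * (Xm r $$ (F, A) * Z $$ (A, D)))"
          unfolding g_def sum_distrib_right by (subst sum.swap) (simp add: mult_ac)
        also have "\<dots> = (\<Sum>D<N. S y D B * (Xm r * Z) $$ (F, D))"
          using F Z Xm[OF r] by (intro sum.cong refl) (simp add: mat_mult_entry[of _ N] sum_distrib_left del: index_mult_mat(1))
        finally show "(\<Sum>A<N. cst (g A B * Xm r $$ (F, A)) * G r F y B (remove1 r rs)) =
           cst (\<Sum>D<N. S y D B * (Xm r * Z) $$ (F, D)) * G r F y B (remove1 r rs)"
          by (simp only: cst_sum[symmetric] sum_distrib_right[symmetric])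
      qed
      finally show ?thesis by (simp only: T_def)
    qed
    note t = this
    have "(\<Sum>A<N. \<Sum>B<N. \<Sum>r\<in>set rs. cst (g A B) * (cst (- (C x r / 2)) * (\<Sum>F<N. cst (Xm r $$ (F, A)) * G r F y B (remove1 r rs)))) =
       (\<Sum>r\<in>set rs. \<Sum>A<N. \<Sum>B<N. cst (- (C x r / 2)) * (cst (g A B) * (\<Sum>F<N. cst (Xm r $$ (F, A)) * G r F y B (remove1 r rs))))"
      by (subst sum_swap3, intro sum.cong refl) (rule mult.left_commute)
    also have "\<dots> = (\<Sum>r\<in>set rs. cst (- (C x r / 2)) * T r y (remove1 r rs) (Xm r * Z))"
      unfolding sum_distrib_left[symmetric] by (intro sum.cong refl) (simp only: t)
    finally show ?thesis .
  qed
  finally show ?thesis .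
qed

text \<open>The two legs of the vertex \<open>y\<close> are not contracted with each other, as
  \<open>C y y = 0\<close>. One of them runs to another vertex \<open>r\<close>, and the rest of the
  loop is an open chain from \<open>r\<close> back to \<open>y\<close>. The factor
  \<open>1/4\<close> is \<open>1/2\<close> from the quadratic form times \<open>1/2\<close> from the
  contraction.\<close>

lemma self_rec:
  assumes rs: "distinct rs" "set rs \<subseteq> {1..k}" and y: "y \<in> {1..k}"
  shows "(\<Sum>A<N. \<Sum>B<N. cst (S y A B / 2) * E (m y A (m y B (P rs)))) =
    fps_X * (\<Sum>r\<in>set rs. cst (- (C y r / 4)) * T r y (remove1 r rs) (Xm r))"
proof -
  have "(\<Sum>A<N. \<Sum>B<N. cst (S y A B / 2) * E (m y A (m y B (P rs)))) =
     (\<Sum>A<N. \<Sum>B<N. fps_X * (\<Sum>r\<in>set rs. cst (- (C y r / 4)) * (\<Sum>F<N. cst (S y A B * Xm r $$ (F, A)) * G r F y B (remove1 r rs))))"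
  proof (intro sum.cong refl)
    fix A B assume AB: "A \<in> {..<N}" "B \<in> {..<N}"
    have "cst (S y A B / 2) * E (m y A (m y B (P rs))) = cst (S y A B / 2) * (fps_X *
       (\<Sum>r\<in>set rs. cst (- (C y r / 2)) * (\<Sum>F<N. cst (Xm r $$ (F, A)) * G r F y B (remove1 r rs))))"
      using G_rec[OF rs y y, of A B] AB by (simp add: C_diag G_def[of y])
    also have "\<dots> = fps_X * (\<Sum>r\<in>set rs. \<Sum>F<N. cst (S y A B / 2 * (- (C y r / 2)) * Xm r $$ (F, A)) * G r F y B (remove1 r rs))"
      by (simp only: sum_distrib_left fps_const_mult[symmetric] mult_ac)
    also have "\<dots> = fps_X * (\<Sum>r\<in>set rs. cst (- (C y r / 4)) * (\<Sum>F<N. cst (S y A B * Xm r $$ (F, A)) * G r F y B (remove1 r rs)))"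
    proof -
      have "S y A B / 2 * (- (C y r / 2)) * z = - (C y r / 4) * (S y A B * z)" for r z by (simp add: field_simps)
      then have "cst (S y A B / 2 * (- (C y r / 2)) * z) = cst (- (C y r / 4)) * cst (S y A B * z)" for r z
        by (simp only: fps_const_mult)
      then show ?thesis by (simp only: sum_distrib_left mult.assoc)
    qed
    finally show "cst (S y A B / 2) * E (m y A (m y B (P rs))) = fps_X * (\<Sum>r\<in>set rs. cst (- (C y r / 4)) * (\<Sum>F<N. cst (S y A B * Xm r $$ (F, A)) * G r F y B (remove1 r rs)))" .
  qed
  also have "\<dots> = fps_X * (\<Sum>r\<in>set rs. cst (- (C y r / 4)) * (\<Sum>A<N. \<Sum>B<N. \<Sum>F<N. cst (S y A B * Xm r $$ (F, A)) * G r F y B (remove1 r rs)))"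
    unfolding sum_distrib_left[of fps_X, symmetric] by (subst sum_swap3) (simp only: sum_distrib_left)
  also have "\<dots> = fps_X * (\<Sum>r\<in>set rs. cst (- (C y r / 4)) * T r y (remove1 r rs) (Xm r))"
  proof -
    have "(\<Sum>A<N. \<Sum>B<N. \<Sum>F<N. cst (S y A B * Xm r $$ (F, A)) * G r F y B (remove1 r rs)) = T r y (remove1 r rs) (Xm r)" for r
    proof -
      have "(\<Sum>A<N. \<Sum>B<N. \<Sum>F<N. cst (S y A B * Xm r $$ (F, A)) * G r F y B (remove1 r rs)) =
        (\<Sum>F<N. \<Sum>B<N. \<Sum>A<N. cst (S y A B * Xm r $$ (F, A)) * G r F y B (remove1 r rs))"
        by (rule sum_rev3)
      then show ?thesis by (simp only: T_def cst_sum sum_distrib_right)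
    qed
    then show ?thesis by simp
  qed
  finally show ?thesis .
qed

end

section \<open>Vertices as quadratic multiplication operators\<close>

context mode
begin

definition qm :: "(nat \<Rightarrow> nat \<Rightarrow> 'k) \<Rightarrow> nat \<Rightarrow> 'k wc_tensor \<Rightarrow> 'k wc_tensor" where
  "qm S r t = (\<Sum>A<N. \<Sum>B<N. sc (cst (S A B / 2)) (m r A (m r B t)))"

lemma lin_qm: "linop (qm S r)"
  unfolding qm_def by (intro linop_sum linop_comb(4) linop_comb(1)[OF lin(2) lin(2)])

lemma m_qm:
  assumes "t \<in> tens k" "x \<le> k" "r \<le> k"
  shows "m x A (qm S r t) = qm S r (m x A t)"
proof -
  have "m x A (m r B (m r B' t)) = m r B (m r B' (m x A t))" for B B'
    using assms by (simp add: mm[of "m r B' t" x r A B] mm[of t x r A B'] closed linopD(2)[OF lin(2)] sigma)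
  then show ?thesis by (simp add: qm_def linopD[OF lin(2)])
qed

text \<open>By the symmetry of \<open>S\<close> both legs contribute equally, which cancels the
  factor \<open>1/2\<close>.\<close>

lemma d_qm:
  assumes t: "t \<in> tens k" "x \<le> k" "r \<le> k" and D: "D < N"
    and S: "\<And>A B. A < N \<Longrightarrow> B < N \<Longrightarrow> S B A = \<sigma> * S A B"
  shows "d x D (qm S r t) = qm S r (d x D t) + (if x = r then \<Sum>B<N. sc (cst (S D B)) (m r B t) else 0)"
proof -
  have i: "sc c (if b then u else 0) = (if b then sc c u else 0)" "m r A (if b then u else 0) = (if b then m r A u else 0)"
    for c b u and A by (simp_all add: linopD(3)[OF lin(2)])
  have e: "d x D (m r A (m r B t)) = (if A = D then (if x = r then m r B t else 0) else 0) +
      (if B = D then (if x = r then sc (cst \<sigma>) (m r A t) else 0) else 0) + m r A (m r B (d x D t))" for A B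
    using t by (auto simp: dm[of _ x r] closed linopD[OF lin(2)] i sc_add_right sigma add.assoc)
  have "d x D (qm S r t) = (\<Sum>A<N. \<Sum>B<N. if A = D then (if x = r then sc (cst (S A B / 2)) (m r B t) else 0) else 0) +
     (\<Sum>A<N. \<Sum>B<N. if B = D then (if x = r then sc (cst (S A B / 2)) (sc (cst \<sigma>) (m r A t)) else 0) else 0) + qm S r (d x D t)"
    unfolding qm_def linopD[OF lin(1)] e sc_add_right sum.distrib i ..
  also have "(\<Sum>A<N. \<Sum>B<N. if A = D then (if x = r then sc (cst (S A B / 2)) (m r B t) else 0) else 0) =
     (\<Sum>A<N. if A = D then (\<Sum>B<N. if x = r then sc (cst (S D B / 2)) (m r B t) else 0) else 0)"
    by (intro sum.cong) auto
  also have "\<dots> = (\<Sum>B<N. if x = r then sc (cst (S D B / 2)) (m r B t) else 0)"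
    using D by simp
  also have "(\<Sum>A<N. \<Sum>B<N. if B = D then (if x = r then sc (cst (S A B / 2)) (sc (cst \<sigma>) (m r A t)) else 0) else 0) =
     (\<Sum>A<N. if x = r then sc (cst (S D A / 2)) (m r A t) else 0)"
  proof (intro sum.cong refl)
    fix A assume A: "A \<in> {..<N}"
    have "S A D / 2 * \<sigma> = \<sigma> * \<sigma> * S D A / 2" using S[OF D, of A] A by simp
    then have "S A D / 2 * \<sigma> = S D A / 2" by (simp add: sigma)
    then show "(\<Sum>B<N. if B = D then (if x = r then sc (cst (S A B / 2)) (sc (cst \<sigma>) (m r A t)) else 0) else 0) =
       (if x = r then sc (cst (S D A / 2)) (m r A t) else 0)"
      using D by (simp only: sum.delta finite_lessThan lessThan_iff if_True sc_sc fps_const_mult)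
  qed
  also have "(\<Sum>B<N. if x = r then sc (cst (S D B / 2)) (m r B t) else 0) + (\<Sum>A<N. if x = r then sc (cst (S D A / 2)) (m r A t) else 0) =
     (if x = r then \<Sum>B<N. sc (cst (S D B)) (m r B t) else 0)"
  proof -
    have "sc (cst (z / 2)) u + sc (cst (z / 2)) u = sc (cst z) u" for z :: 'k and u
      by (simp flip: sc_add_left)
    then show ?thesis by (simp flip: sum.distrib)
  qed
  finally show ?thesis by (simp add: add.commute)
qed

end

abbreviation "qe n \<equiv> mode.qm (2 * n) m_even"
abbreviation "qo a b \<equiv> mode.qm (a + b) m_odd"

lemma cross_quadratic:
  fixes t :: "'k::field_char_0 wc_tensor"
  assumes t: "t \<in> tens k" and xr: "x \<le> k" "r \<le> k"
  shows "d_even x A (qo a b S r t) = qo a b S r (d_even x A t)" "m_even x A (qo a b S r t) = qo a b S r (m_even x A t)"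
    "d_odd x A (qe n S' r t) = qe n S' r (d_odd x A t)" "m_odd x A (qe n S' r t) = qe n S' r (m_odd x A t)"
proof -
  note q = mode.qm_def[OF mode_even] mode.qm_def[OF mode_odd]
  have "d_even x A (m_odd r B (m_odd r B' t)) = m_odd r B (m_odd r B' (d_even x A t))"
    "m_even x A (m_odd r B (m_odd r B' t)) = m_odd r B (m_odd r B' (m_even x A t))"
    "d_odd x A (m_even r B (m_even r B' t)) = m_even r B (m_even r B' (d_odd x A t))"
    "m_odd x A (m_even r B (m_even r B' t)) = m_even r B (m_even r B' (m_odd x A t))" for B B'
    using assms even_odd_commute[of "m_odd r B' t" k x r] even_odd_commute[of t k x r]
      even_odd_commute[of "m_even r B' t" k r x] even_odd_commute[of t k r x] by simp_all
  then show "d_even x A (qo a b S r t) = qo a b S r (d_even x A t)" "m_even x A (qo a b S r t) = qo a b S r (m_even x A t)"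
    "d_odd x A (qe n S' r t) = qe n S' r (d_odd x A t)" "m_odd x A (qe n S' r t) = qe n S' r (m_odd x A t)"
    unfolding q by (simp_all add: linopD[OF linop_basic(1)] linopD[OF linop_basic(2)] linopD[OF linop_basic(3)] linopD[OF linop_basic(4)])
qed

section \<open>The vacuum and the tensors reached from it\<close>

definition vacuum :: "nat \<Rightarrow> nat \<Rightarrow> nat \<Rightarrow> 'k::comm_ring_1 wc_tensor" where
  "vacuum a b k = tensor (Theta a b # replicate k unit_wc)"

text \<open>What survives of the fact that slot 0 holds exactly \<open>Theta\<close> when vertices
  act in the other slots: even derivatives vanish there, and one more odd generator gives 0. Under
  these two conditions slot 0 leaves both Wick rules.\<close>

definition admissible :: "nat \<Rightarrow> nat \<Rightarrow> nat \<Rightarrow> 'k::comm_ring_1 wc_tensor set" where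
  "admissible a b k = {t \<in> tens k. (\<forall>A. d_even 0 A t = 0) \<and> (\<forall>u<a + b. m_odd 0 u t = 0)}"

lemma admissible_tens: "t \<in> admissible a b k \<Longrightarrow> t \<in> tens k"
  by (simp add: admissible_def)

lemma tensor_upd_zero: "i < length fs \<Longrightarrow> tensor (fs[i := (\<lambda>_. 0)]) = 0"
  by (simp add: fun_eq_iff pointwise tensor_upd)

lemma Theta_ops:
  "d_even1 v (Theta a b) = (\<lambda>_. 0)" "u < a + b \<Longrightarrow> m_odd1 u (Theta a b) = (\<lambda>_. 0)" "fin_supp (Theta a b)"
proof -
  have "e(v := Suc (e v)) \<noteq> (\<lambda>_. 0)" for e :: "nat \<Rightarrow> nat" by (metis fun_upd_same nat.distinct(1))
  then show "d_even1 v (Theta a b) = (\<lambda>_. 0)" by (auto simp: d_even1_def Theta_def fun_eq_iff)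
  show "m_odd1 u (Theta a b) = (\<lambda>_. 0)" if "u < a + b"
  proof -
    have "S - {u} \<noteq> {..<a + b}" for S using that by blast
    then show ?thesis by (auto simp: m_odd1_def Theta_def fun_eq_iff)
  qed
  show "fin_supp (Theta a b)" by (auto simp: fin_supp_def Theta_def fin_mono_def split: if_splits)
qed

lemma vacuum_tens: "vacuum a b k \<in> tens k"
  unfolding vacuum_def by (rule tensor_in_tens) (auto simp: nth_Cons Theta_ops split: nat.splits)

lemma d_vacuum:
  assumes "j \<in> {1..k}"
  shows "d_even j v (vacuum a b k :: 'k::comm_ring_1 wc_tensor) = 0" "d_odd j v (vacuum a b k :: 'k wc_tensor) = 0"
proof -
  have j: "j < length (Theta a b # replicate k (unit_wc :: 'k wc))"
    and n: "(Theta a b # replicate k (unit_wc :: 'k wc)) ! j = unit_wc" using assms by (auto simp: nth_Cons split: nat.splits)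
  show "d_even j v (vacuum a b k) = (0 :: 'k wc_tensor)"
    unfolding vacuum_def ops_tensor(2)[OF j] n d_unit by (rule tensor_upd_zero[OF j])
  show "d_odd j v (vacuum a b k) = (0 :: 'k wc_tensor)"
    unfolding vacuum_def fun_eq_iff ops_tensor(4)[OF j] n d_unit tensor_upd_zero[OF j] by (simp add: pointwise)
qed

lemma vacuum_admissible: "(vacuum a b k :: 'k::comm_ring_1 wc_tensor) \<in> admissible a b k"
proof -
  have z: "0 < length (Theta a b # replicate k (unit_wc :: 'k wc))" by simp
  have "d_even 0 A (vacuum a b k) = (0 :: 'k wc_tensor)" for A
    unfolding vacuum_def ops_tensor(2)[OF z] using tensor_upd_zero[OF z] by (simp add: Theta_ops)
  moreover have "m_odd 0 u (vacuum a b k) = (0 :: 'k wc_tensor)" if "u < a + b" for u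
    unfolding vacuum_def using odd_ops_tensor_even(1)[OF z] tensor_upd_zero[OF z] that by (simp add: Theta_ops)
  ultimately show ?thesis using vacuum_tens by (simp add: admissible_def)
qed

lemma admissible_lin:
  "s \<in> admissible a b k \<Longrightarrow> t \<in> admissible a b k \<Longrightarrow> s + t \<in> admissible a b k"
  "s \<in> admissible a b k \<Longrightarrow> sc c s \<in> admissible a b k"
  "(\<And>x. x \<in> X \<Longrightarrow> f x \<in> admissible a b k) \<Longrightarrow> (\<Sum>x\<in>X. f x) \<in> admissible a b k"
  by (auto simp: admissible_def linopD[OF linop_basic(1)] linopD[OF linop_basic(4)])

lemma admissible_m:
  assumes t: "t \<in> admissible a b k" and x: "x \<in> {1..k}"
  shows "m_even x A t \<in> admissible a b k" "m_odd x A t \<in> admissible a b k"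
proof -
  have tt: "t \<in> tens k" and x': "x \<le> k" "x \<noteq> 0" using t x by (auto simp: admissible_def)
  have z: "d_even 0 B t = 0" "u < a + b \<Longrightarrow> m_odd 0 u t = 0" for B u using t by (auto simp: admissible_def)
  have "m_odd 0 u (m_even x A t) = 0" if "u < a + b" for u
    using even_odd_commute(4)[OF tt x'(1), of 0 A u] z(2)[OF that] by (simp add: linopD(3)[OF linop_basic(2)])
  then show "m_even x A t \<in> admissible a b k"
    using tt x' z d_even_m_even[OF tt _ x'(1), of 0]
    by (auto simp: admissible_def linopD(3)[OF linop_basic(2)])
  show "m_odd x A t \<in> admissible a b k"
    using tt x' z even_odd_commute(2)[OF tt _ x'(1), of 0] m_odd_anticommute[OF tt _ x'(1), of 0]
    by (auto simp: admissible_def linopD(3)[OF linop_basic(4)])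
qed

lemma admissible_qm:
  fixes t :: "'k::field_char_0 wc_tensor"
  assumes "t \<in> admissible a b k" "r \<in> {1..k}"
  shows "qe n S r t \<in> admissible a b k" "qo a b S r t \<in> admissible a b k"
  unfolding mode.qm_def[OF mode_even] mode.qm_def[OF mode_odd]
  using assms by (auto intro!: admissible_lin admissible_m)

context
  fixes n a b k :: nat and c :: "nat \<Rightarrow> nat \<Rightarrow> 'k::field_char_0" and x :: "nat \<Rightarrow> 'k lie"
  assumes ab: "a \<le> b" and x: "\<And>r. r \<in> {1..k} \<Longrightarrow> x r \<in> lie_alg n a b"
begin

definition Xv :: "nat \<Rightarrow> 'k mat" where "Xv r = fst (x r)"
definition Yv :: "nat \<Rightarrow> 'k mat" where "Yv r = fst (snd (x r))"
definition zv :: "nat \<Rightarrow> 'k" where "zv r = snd (snd (x r))"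

definition wop :: "nat \<Rightarrow> 'k wc_tensor \<Rightarrow> 'k wc_tensor" where
  "wop r t = sc (cst (zv r)) t + (qe n (SE n (Xv r)) r t + qo a b (SO a (Yv r)) r t)"

interpretation e: mode k "2 * n" "1 :: 'k" "symp_entry n" d_even m_even by (rule mode_even)
interpretation o: mode k "a + b" "-1 :: 'k" "h_form a b" d_odd m_odd by (rule mode_odd)
interpretation fe: form "2 * n" "1 :: 'k" "symp_entry n" "pE n" "eE n" by (rule form_even)
interpretation fo: form "a + b" "-1 :: 'k" "h_form a b" "pO a" "eO a" by (rule form_odd[OF ab])

lemma XY_lie: "r \<in> {1..k} \<Longrightarrow> fe.lie (Xv r)" "r \<in> {1..k} \<Longrightarrow> fo.lie (Yv r)"
  using x[of r] lie_even[of "Xv r" n] lie_odd[OF ab, of "Yv r"] by (auto simp: lie_alg_def Xv_def Yv_def mem_Times_iff)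

lemma XY_carrier: "r \<in> {1..k} \<Longrightarrow> Xv r \<in> carrier_mat (2 * n) (2 * n)" "r \<in> {1..k} \<Longrightarrow> Yv r \<in> carrier_mat (a + b) (a + b)"
  using XY_lie by (auto simp: fe.lie_def fo.lie_def)

lemma lin_wop: "linop (wop r)"
  unfolding wop_def by (intro linop_comb(2) linop_basic e.lin_qm o.lin_qm)

lemma wop_admissible: "t \<in> admissible a b k \<Longrightarrow> r \<in> {1..k} \<Longrightarrow> wop r t \<in> admissible a b k"
  unfolding wop_def by (intro admissible_lin admissible_qm)

lemma wick_chain_even:
  "wick_chain k (2 * n) (1 :: 'k) (symp_entry n) d_even m_even (expect n a b k c) (admissible a b k)
    (skew c) (\<lambda>r. SE n (Xv r)) Xv wop (vacuum a b k)"
proof unfold_locales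
  fix t :: "'k wc_tensor" and y r A B assume t: "t \<in> tens k" and y: "y \<in> {1..k}" and r: "r \<in> {1..k}"
  have yr: "y \<le> k" "r \<le> k" using y r by auto
  show "d_even y B (wop r t) = wop r (d_even y B t) + (if y = r then \<Sum>D<2 * n. sc (cst (SE n (Xv r) B D)) (m_even r D t) else 0)" if "B < 2 * n"
  proof -
    have q: "d_even y B (qe n (SE n (Xv r)) r t) = qe n (SE n (Xv r)) r (d_even y B t) +
        (if y = r then \<Sum>D<2 * n. sc (cst (SE n (Xv r) B D)) (m_even r D t) else 0)"
      by (rule e.d_qm[OF t yr that]) (rule fe.S_sym[OF XY_lie(1)[OF r]])
    show ?thesis
      unfolding wop_def linopD[OF linop_basic(1)] cross_quadratic[OF t yr] q by (simp only: add_ac)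
  qed
  show "m_even y A (wop r t) = wop r (m_even y A t)"
    unfolding wop_def linopD[OF linop_basic(2)] cross_quadratic[OF t yr] e.m_qm[OF t yr] ..
next
  fix t :: "'k wc_tensor" and y A assume t: "t \<in> admissible a b k" and y: "y \<in> {1..k}" and A: "A < 2 * n"
  have "(\<Sum>j\<le>k. cst (skew c y j / 2) * (\<Sum>B<2 * n. cst (symp_entry n A B) * expect n a b k c (d_even j B t))) =
     (\<Sum>j\<in>{1..k}. cst (skew c y j / 2) * (\<Sum>B<2 * n. cst (symp_entry n A B) * expect n a b k c (d_even j B t)))"
    using t by (intro sum.mono_neutral_right)
      (auto simp: admissible_def linfunD(3)[OF linfun_expect] not_less_eq_eq)
  then show "expect n a b k c (m_even y A t) = fps_X * (\<Sum>j\<in>{1..k}. cst (skew c y j / 2) * (\<Sum>B<2 * n. cst (symp_entry n A B) * expect n a b k c (d_even j B t)))"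
    using wick_even[of t k y A n a b c] t y A by (simp add: admissible_def)
qed (rule linfun_expect admissible_tens admissible_m wop_admissible vacuum_admissible d_vacuum lin_wop
      fe.S_sym[OF XY_lie(1)] fe.H_S[OF XY_lie(1)] XY_carrier | assumption | simp add: skew_def)+

lemma wick_chain_odd:
  "wick_chain k (a + b) (-1 :: 'k) (h_form a b) d_odd m_odd (expect n a b k c) (admissible a b k)
    (odd_prop c) (\<lambda>r. SO a (Yv r)) Yv wop (vacuum a b k)"
proof unfold_locales
  fix t :: "'k wc_tensor" and y r A B assume t: "t \<in> tens k" and y: "y \<in> {1..k}" and r: "r \<in> {1..k}"
  have yr: "y \<le> k" "r \<le> k" using y r by auto
  show "d_odd y B (wop r t) = wop r (d_odd y B t) + (if y = r then \<Sum>D<a + b. sc (cst (SO a (Yv r) B D)) (m_odd r D t) else 0)" if "B < a + b"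
  proof -
    have q: "d_odd y B (qo a b (SO a (Yv r)) r t) = qo a b (SO a (Yv r)) r (d_odd y B t) +
        (if y = r then \<Sum>D<a + b. sc (cst (SO a (Yv r) B D)) (m_odd r D t) else 0)"
      by (rule o.d_qm[OF t yr that]) (rule fo.S_sym[OF XY_lie(2)[OF r]])
    show ?thesis
      unfolding wop_def linopD[OF linop_basic(3)] cross_quadratic[OF t yr] q by (simp only: add_ac)
  qed
  show "m_odd y A (wop r t) = wop r (m_odd y A t)"
    unfolding wop_def linopD[OF linop_basic(4)] cross_quadratic[OF t yr] o.m_qm[OF t yr] ..
next
  fix t :: "'k wc_tensor" and y A assume t: "t \<in> admissible a b k" and y: "y \<in> {1..k}" and A: "A < a + b"
  then show "expect n a b k c (m_odd y A t) = fps_X * (\<Sum>j\<in>{1..k}. cst (odd_prop c y j / 2) * (\<Sum>B<a + b. cst (h_form a b A B) * expect n a b k c (d_odd j B t)))"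
    by (intro wick_odd) (auto simp: admissible_def)
qed (rule linfun_expect admissible_tens admissible_m wop_admissible vacuum_admissible d_vacuum lin_wop
      fo.S_sym[OF XY_lie(2)] fo.H_S[OF XY_lie(2)] XY_carrier | assumption | simp add: odd_prop_def skew_def)+

definition Wx :: "nat list \<Rightarrow> 'k fps" where
  "Wx rs = expect n a b k c (foldr wop rs (vacuum a b k))"

definition Te :: "nat \<Rightarrow> nat \<Rightarrow> nat list \<Rightarrow> 'k mat \<Rightarrow> 'k fps" where
  "Te = wick_chain.T (2 * n) m_even (expect n a b k c) (\<lambda>r. SE n (Xv r)) wop (vacuum a b k)"

definition To :: "nat \<Rightarrow> nat \<Rightarrow> nat list \<Rightarrow> 'k mat \<Rightarrow> 'k fps" where
  "To = wick_chain.T (a + b) m_odd (expect n a b k c) (\<lambda>r. SO a (Yv r)) wop (vacuum a b k)"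

lemma Te_rec:
  assumes "distinct rs" "set rs \<subseteq> {1..k}" "y \<in> {1..k}" "w \<in> {1..k}" "Z \<in> carrier_mat (2 * n) (2 * n)"
  shows "Te y w rs Z = fps_X * (cst (- (skew c y w / 2) * mtr (2 * n) (Z * Xv w)) * Wx rs +
    (\<Sum>r\<in>set rs. cst (- (skew c y r / 2)) * Te r w (remove1 r rs) (Xv r * Z)))"
  using wick_chain.T_rec[OF wick_chain_even assms]
  by (simp add: Te_def Wx_def wick_chain.W_def[OF wick_chain_even] wick_chain.P_def[OF wick_chain_even])

lemma To_rec:
  assumes "distinct rs" "set rs \<subseteq> {1..k}" "y \<in> {1..k}" "w \<in> {1..k}" "Z \<in> carrier_mat (a + b) (a + b)"
  shows "To y w rs Z = fps_X * (cst (odd_prop c y w / 2 * mtr (a + b) (Z * Yv w)) * Wx rs +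
    (\<Sum>r\<in>set rs. cst (- (odd_prop c y r / 2)) * To r w (remove1 r rs) (Yv r * Z)))"
  using wick_chain.T_rec[OF wick_chain_odd assms]
  by (simp add: To_def Wx_def wick_chain.W_def[OF wick_chain_odd] wick_chain.P_def[OF wick_chain_odd])

text \<open>The first vertex is split into its scalar, even and odd summands. Each quadratic summand
  opens a loop of its own kind, while the free vertices stay complete and supply the other
  loops.\<close>

lemma Wx_rec:
  assumes rs: "distinct rs" "set rs \<subseteq> {1..k}" and y: "y \<in> {1..k}"
  shows "Wx (y # rs) = cst (zv y) * Wx rs +
    (fps_X * (\<Sum>r\<in>set rs. cst (- (skew c y r / 4)) * Te r y (remove1 r rs) (Xv r)) +
     fps_X * (\<Sum>r\<in>set rs. cst (- (odd_prop c y r / 4)) * To r y (remove1 r rs) (Yv r)))"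
  using wick_chain.self_rec[OF wick_chain_even rs y] wick_chain.self_rec[OF wick_chain_odd rs y]
  by (simp add: Wx_def wop_def[of y] linfunD[OF linfun_expect] e.qm_def o.qm_def Te_def To_def
      wick_chain.P_def[OF wick_chain_even] wick_chain.P_def[OF wick_chain_odd])

lemma Dop_vacuum: "Dop n a b k c (vacuum a b k) = 0"
  by (rule Dop_zero[OF vacuum_tens]) (auto simp: d_vacuum)

text \<open>Without vertices nothing can be contracted, and the Berezin integral of
  \<open>Theta\<close> in the order of \<open>Upsilon\<close> remains. This is the global sign of
  the theorem.\<close>

lemma Wx_Nil: "Wx [] = (-1) ^ (a + (b - a) div 2)"
proof -
  have p: "(Dop n a b k c ^^ q) (vacuum a b k) = (if q = 0 then vacuum a b k else 0)" for q
    by (induction q) (auto simp: Dop_vacuum linopD(3)[OF linop_Dop])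
  have "Wx [] = Upsilon a b k (vacuum a b k)"
  proof (rule fps_ext)
    fix N
    have "fps_nth (Wx []) N = (\<Sum>q\<in>{0}. fps_nth (Upsilon a b k ((Dop n a b k c ^^ q) (vacuum a b k))) N / fact q)"
      unfolding Wx_def expect_def gauss_def fps_nth_Abs_fps foldr.simps id_apply
      by (intro sum.mono_neutral_right) (auto simp: p linfunD(3)[OF linfun_Upsilon])
    then show "fps_nth (Wx []) N = fps_nth (Upsilon a b k (vacuum a b k)) N" by simp
  qed
  also have "\<dots> = berezin [0..<a + b] (\<lambda>S. Theta a b (\<lambda>_. 0, S)) {}"
  proof -
    have v: "vacuum a b k = tensor ((replicate (Suc k) unit_wc)[0 := Theta a b])" by (simp add: vacuum_def)
    have "super_mult k (vacuum a b k) (top_mono a b) = (Theta a b (top_mono a b) :: 'k fps)"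
      unfolding v by (rule super_mult_tensor_unit) (auto simp: fin_top_mono)
    then show ?thesis
      unfolding Upsilon_eq by (subst berezin_upt) (auto simp: lessThan_atLeast0 minus_one_power_cst top_mono_def berezin_sign_def)
  qed
  also have "\<dots> = (-1) ^ (a + (b - a) div 2)" by (rule berezin_Theta[OF ab])
  finally show ?thesis .
qed

definition vert :: "nat \<Rightarrow> 'k wc" where
  "vert r = (\<lambda>m. quad n a b (SE n (Xv r)) (SO a (Yv r)) m + cst (zv r) * unit_wc m)"

lemma wop_tensor:
  assumes "r < length fs" "fs ! r = unit_wc"
  shows "wop r (tensor fs) = tensor (fs[r := vert r])"
proof
  fix ms
  have me: "m_even r A (m_even r B (tensor fs)) = tensor (fs[r := m_even1 A (m_even1 B unit_wc)])" for A B
    using assms by (simp add: ops_tensor(1))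
  have mo: "m_odd r A (m_odd r B (tensor fs)) = tensor (fs[r := m_odd1 A (m_odd1 B unit_wc)])" for A B
    using assms by (simp add: m_odd_m_odd_tensor)
  show "wop r (tensor fs) ms = tensor (fs[r := vert r]) ms"
    unfolding wop_def e.qm_def o.qm_def me mo pointwise tensor_upd[OF assms(1)] vert_def quad_def
    using assms by (simp add: tensor_remove[OF assms(1), of ms] algebra_simps sum_distrib_left sum_distrib_right)
qed

definition slots :: "nat list \<Rightarrow> 'k wc list" where
  "slots rs = map (\<lambda>i. if i = 0 then Theta a b else if i \<in> set rs then vert i else unit_wc) [0..<Suc k]"

lemma foldr_wop: "distinct rs \<Longrightarrow> set rs \<subseteq> {1..k} \<Longrightarrow> foldr wop rs (vacuum a b k) = tensor (slots rs)"
proof (induction rs)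
  case Nil
  have "slots [] = Theta a b # replicate k unit_wc"
    by (rule nth_equalityI) (auto simp: slots_def nth_Cons simp del: upt_Suc split: nat.splits)
  then show ?case by (simp add: vacuum_def)
next
  case (Cons r rs)
  have r: "r < length (slots rs)" "slots rs ! r = unit_wc"
    using Cons.prems by (auto simp: slots_def simp del: upt_Suc)
  have "(slots rs)[r := vert r] = slots (r # rs)"
    using Cons.prems by (intro nth_equalityI) (auto simp: slots_def nth_list_update simp del: upt_Suc)
  then show ?case using Cons wop_tensor[OF r] by simp
qed

lemma Upsilon_Phi:
  assumes "xs = map x [1..<Suc k]"
  shows "Upsilon a b k (exp_pair_op n a b k c (tensor (Theta a b # map (Phi n a b) xs))) = Wx [1..<Suc k]"
proof -
  have P: "Phi n a b (x r) = vert r" if "r \<in> {1..k}" for r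
  proof -
    have "x r = (Xv r, Yv r, zv r)" "Xv r \<in> sp_lie n" "Yv r \<in> so_lie a b"
      using x[OF that] by (auto simp: Xv_def Yv_def zv_def lie_alg_def)
    then show ?thesis using Phi_eq[OF ab, of "Xv r" n "Yv r" "zv r"] by (simp add: vert_def)
  qed
  have "Theta a b # map (Phi n a b) xs = slots [1..<Suc k]"
    unfolding assms by (rule nth_equalityI) (auto simp: slots_def nth_Cons P simp del: upt_Suc split: nat.splits)
  then show ?thesis
    unfolding Upsilon_exp_pair_op Wx_def by (subst foldr_wop) auto
qed

end

subsection \<open>Invariance\<close>

lemma mtr_commute:
  assumes "A \<in> carrier_mat N N" "B \<in> carrier_mat N N"
  shows "mtr N (A * B) = mtr N (B * A)"
proof -
  have "mtr N (A * B) = (\<Sum>i<N. \<Sum>j<N. A $$ (i, j) * B $$ (j, i))"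
    unfolding mtr_def using assms by (intro sum.cong refl) (simp add: mat_mult_entry[of _ N] del: index_mult_mat(1))
  also have "\<dots> = (\<Sum>j<N. \<Sum>i<N. B $$ (j, i) * A $$ (i, j))"
    by (subst sum.swap) (simp add: mult.commute)
  also have "\<dots> = mtr N (B * A)"
    unfolding mtr_def using assms by (intro sum.cong refl) (simp add: mat_mult_entry[of _ N] del: index_mult_mat(1))
  finally show ?thesis .
qed

definition conj_by :: "nat \<Rightarrow> 'k::comm_ring_1 mat \<Rightarrow> 'k mat \<Rightarrow> bool" where
  "conj_by N g g' \<longleftrightarrow> g \<in> carrier_mat N N \<and> g' \<in> carrier_mat N N \<and> g * g' = 1\<^sub>m N \<and> g' * g = 1\<^sub>m N"

lemma conj_mult:
  assumes c: "conj_by N g g'" and A: "A \<in> carrier_mat N N" and B: "B \<in> carrier_mat N N"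
  shows "(g * A * g') * (g * B * g') = g * (A * B) * g'"
proof -
  note C = c[unfolded conj_by_def]
  have "(g * A * g') * (g * B * g') = g * A * (g' * (g * B * g'))"
    by (rule assoc_mult_mat[of _ N N _ N _ N]) (use C A B in auto)
  also have "g' * (g * B * g') = g' * (g * (B * g'))"
    by (subst assoc_mult_mat[of g N N B N g' N]) (use C A B in auto)
  also have "\<dots> = (g' * g) * (B * g')"
    by (rule assoc_mult_mat[symmetric, of _ N N _ N _ N]) (use C A B in auto)
  also have "\<dots> = B * g'" using C B by simp
  also have "g * A * (B * g') = g * A * B * g'"
    by (rule assoc_mult_mat[symmetric, of _ N N _ N _ N]) (use C A B in auto)
  also have "g * A * B = g * (A * B)"
    by (rule assoc_mult_mat[of _ N N _ N _ N]) (use C A B in auto)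
  finally show ?thesis .
qed

lemma mtr_conj:
  assumes c: "conj_by N g g'" and A: "A \<in> carrier_mat N N"
  shows "mtr N (g * A * g') = mtr N A"
proof -
  note C = c[unfolded conj_by_def]
  have "mtr N (g * A * g') = mtr N (g' * (g * A))" by (rule mtr_commute) (use C A in auto)
  also have "g' * (g * A) = (g' * g) * A"
    by (rule assoc_mult_mat[symmetric, of _ N N _ N _ N]) (use C A in auto)
  finally show ?thesis using C A by simp
qed

text \<open>In the recursions the matrices enter only through products and traces of products, and
  the propagators only between slots in use. The lemma serves three purposes: invariance under the
  adjoint group, dependence on the positions of the slots in \<open>R\<close> only, and exchange of
  vertex assignments that agree on \<open>R\<close>. The three statements need each other and are
  proved in one induction.\<close>

lemma Wx_cong:
  fixes x x' :: "nat \<Rightarrow> 'k::field_char_0 lie" and c c' :: "nat \<Rightarrow> nat \<Rightarrow> 'k"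
  assumes ab: "a \<le> b"
    and x: "\<And>r. r \<in> {1..k} \<Longrightarrow> x r \<in> lie_alg n a b" and x': "\<And>r. r \<in> {1..k} \<Longrightarrow> x' r \<in> lie_alg n a b"
    and R: "R \<subseteq> {1..k}"
    and c: "\<And>i j. i \<in> R \<Longrightarrow> j \<in> R \<Longrightarrow> skew c' i j = skew c i j"
      "\<And>i j. i \<in> R \<Longrightarrow> j \<in> R \<Longrightarrow> odd_prop c' i j = odd_prop c i j"
    and g: "conj_by (2 * n) g g'" and h: "conj_by (a + b) h h'"
    and conj: "\<And>r. r \<in> R \<Longrightarrow> Xv x' r = g * Xv x r * g'" "\<And>r. r \<in> R \<Longrightarrow> Yv x' r = h * Yv x r * h'"
      "\<And>r. r \<in> R \<Longrightarrow> zv x' r = zv x r"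
  shows "distinct rs \<Longrightarrow> set rs \<subseteq> R \<Longrightarrow> Wx n a b k c' x' rs = Wx n a b k c x rs \<and>
    (\<forall>y\<in>R. \<forall>w\<in>R. \<forall>Z\<in>carrier_mat (2 * n) (2 * n). Te n a b k c' x' y w rs (g * Z * g') = Te n a b k c x y w rs Z) \<and>
    (\<forall>y\<in>R. \<forall>w\<in>R. \<forall>Z\<in>carrier_mat (a + b) (a + b). To n a b k c' x' y w rs (h * Z * h') = To n a b k c x y w rs Z)"
proof (induction "length rs" arbitrary: rs rule: less_induct)
  case less
  note rs = less.prems
  have rsk: "set rs \<subseteq> {1..k}" using rs R by blast
  have inR: "r \<in> {1..k}" if "r \<in> R" for r using that R by blast
  note gc = g[unfolded conj_by_def] and hc = h[unfolded conj_by_def]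
  have Xc: "Xv x r \<in> carrier_mat (2 * n) (2 * n)" "Yv x r \<in> carrier_mat (a + b) (a + b)" if "r \<in> R" for r
    using XY_carrier[OF ab x inR[OF that]] by auto
  have IH: "Wx n a b k c' x' qs = Wx n a b k c x qs"
    "\<And>y w Z. y \<in> R \<Longrightarrow> w \<in> R \<Longrightarrow> Z \<in> carrier_mat (2 * n) (2 * n) \<Longrightarrow> Te n a b k c' x' y w qs (g * Z * g') = Te n a b k c x y w qs Z"
    "\<And>y w Z. y \<in> R \<Longrightarrow> w \<in> R \<Longrightarrow> Z \<in> carrier_mat (a + b) (a + b) \<Longrightarrow> To n a b k c' x' y w qs (h * Z * h') = To n a b k c x y w qs Z"
    if "length qs < length rs" "distinct qs" "set qs \<subseteq> R" for qs
    using less.hyps[OF that] by auto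
  have rem: "length (remove1 r qs) < length qs" "distinct (remove1 r qs)" "set (remove1 r qs) \<subseteq> R"
    if "r \<in> set qs" "distinct qs" "set qs \<subseteq> R" for r and qs :: "nat list"
    using that set_remove1_subset[of r qs] length_pos_if_in_set[OF that(1)] by (auto simp: length_remove1)
  have W: "Wx n a b k c' x' rs = Wx n a b k c x rs"
  proof (cases rs)
    case Nil
    then show ?thesis using Wx_Nil[OF ab, of k x n c] Wx_Nil[OF ab, of k x' n c'] x x' by simp
  next
    case (Cons y qs)
    have q: "distinct qs" "set qs \<subseteq> R" "set qs \<subseteq> {1..k}" "y \<in> R" "y \<in> {1..k}" "length qs < length rs" "distinct rs"
      using rs rsk Cons by auto
    have T: "Te n a b k c' x' r y (remove1 r qs) (Xv x' r) = Te n a b k c x r y (remove1 r qs) (Xv x r)"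
      "To n a b k c' x' r y (remove1 r qs) (Yv x' r) = To n a b k c x r y (remove1 r qs) (Yv x r)" if r: "r \<in> set qs" for r
    proof -
      have rR: "r \<in> R" using q r by auto
      note m = rem[OF r q(1,2)]
      have l: "length (remove1 r qs) < length rs" using m(1) q(6) by simp
      show "Te n a b k c' x' r y (remove1 r qs) (Xv x' r) = Te n a b k c x r y (remove1 r qs) (Xv x r)"
        unfolding conj(1)[OF rR] by (rule IH(2)[OF l m(2,3) rR q(4) Xc(1)[OF rR]])
      show "To n a b k c' x' r y (remove1 r qs) (Yv x' r) = To n a b k c x r y (remove1 r qs) (Yv x r)"
        unfolding conj(2)[OF rR] by (rule IH(3)[OF l m(2,3) rR q(4) Xc(2)[OF rR]])
    qed
    have "(\<Sum>r\<in>set qs. cst (- (skew c' y r / 4)) * Te n a b k c' x' r y (remove1 r qs) (Xv x' r)) =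
        (\<Sum>r\<in>set qs. cst (- (skew c y r / 4)) * Te n a b k c x r y (remove1 r qs) (Xv x r))"
      using q c(1)[OF q(4)] T by (intro sum.cong refl) (metis subsetD)
    moreover have "(\<Sum>r\<in>set qs. cst (- (odd_prop c' y r / 4)) * To n a b k c' x' r y (remove1 r qs) (Yv x' r)) =
        (\<Sum>r\<in>set qs. cst (- (odd_prop c y r / 4)) * To n a b k c x r y (remove1 r qs) (Yv x r))"
      using q c(2)[OF q(4)] T by (intro sum.cong refl) (metis subsetD)
    ultimately show ?thesis
      unfolding Cons using Wx_rec[of a b k x n qs y c] Wx_rec[of a b k x' n qs y c'] ab x x' q(1,3,5)
      by (simp add: conj(3)[OF q(4)] IH(1)[OF q(6,1,2)])
  qed
  have "Te n a b k c' x' y w rs (g * Z * g') = Te n a b k c x y w rs Z"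
    if y: "y \<in> R" and w: "w \<in> R" and Z: "Z \<in> carrier_mat (2 * n) (2 * n)" for y w Z
  proof -
    have Z': "g * Z * g' \<in> carrier_mat (2 * n) (2 * n)" using gc Z by auto
    have "(\<Sum>r\<in>set rs. cst (- (skew c' y r / 2)) * Te n a b k c' x' r w (remove1 r rs) (Xv x' r * (g * Z * g'))) =
        (\<Sum>r\<in>set rs. cst (- (skew c y r / 2)) * Te n a b k c x r w (remove1 r rs) (Xv x r * Z))"
    proof (intro sum.cong refl)
      fix r assume r: "r \<in> set rs"
      have rR: "r \<in> R" using rs r by auto
      note m = rem[OF r rs]
      have "Te n a b k c' x' r w (remove1 r rs) (Xv x' r * (g * Z * g')) = Te n a b k c x r w (remove1 r rs) (Xv x r * Z)"
        unfolding conj(1)[OF rR] conj_mult[OF g Xc(1)[OF rR] Z]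
        by (rule IH(2)[OF m rR w]) (use Xc(1)[OF rR] Z in auto)
      then show "cst (- (skew c' y r / 2)) * Te n a b k c' x' r w (remove1 r rs) (Xv x' r * (g * Z * g')) =
        cst (- (skew c y r / 2)) * Te n a b k c x r w (remove1 r rs) (Xv x r * Z)"
        using c(1)[OF y rR] by simp
    qed
    moreover have "mtr (2 * n) ((g * Z * g') * Xv x' w) = mtr (2 * n) (Z * Xv x w)"
      unfolding conj(1)[OF w] conj_mult[OF g Z Xc(1)[OF w]] by (rule mtr_conj[OF g]) (use Xc(1)[OF w] Z in auto)
    ultimately show ?thesis
      using Te_rec[of a b k x n rs y w Z c] Te_rec[of a b k x' n rs y w "g * Z * g'" c'] ab x x' rs(1) rsk inR[OF y] inR[OF w] Z Z'
      by (simp add: W c(1)[OF y w])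
  qed
  moreover have "To n a b k c' x' y w rs (h * Z * h') = To n a b k c x y w rs Z"
    if y: "y \<in> R" and w: "w \<in> R" and Z: "Z \<in> carrier_mat (a + b) (a + b)" for y w Z
  proof -
    have Z': "h * Z * h' \<in> carrier_mat (a + b) (a + b)" using hc Z by auto
    have "(\<Sum>r\<in>set rs. cst (- (odd_prop c' y r / 2)) * To n a b k c' x' r w (remove1 r rs) (Yv x' r * (h * Z * h'))) =
        (\<Sum>r\<in>set rs. cst (- (odd_prop c y r / 2)) * To n a b k c x r w (remove1 r rs) (Yv x r * Z))"
    proof (intro sum.cong refl)
      fix r assume r: "r \<in> set rs"
      have rR: "r \<in> R" using rs r by auto
      note m = rem[OF r rs]
      have "To n a b k c' x' r w (remove1 r rs) (Yv x' r * (h * Z * h')) = To n a b k c x r w (remove1 r rs) (Yv x r * Z)"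
        unfolding conj(2)[OF rR] conj_mult[OF h Xc(2)[OF rR] Z]
        by (rule IH(3)[OF m rR w]) (use Xc(2)[OF rR] Z in auto)
      then show "cst (- (odd_prop c' y r / 2)) * To n a b k c' x' r w (remove1 r rs) (Yv x' r * (h * Z * h')) =
        cst (- (odd_prop c y r / 2)) * To n a b k c x r w (remove1 r rs) (Yv x r * Z)"
        using c(2)[OF y rR] by simp
    qed
    moreover have "mtr (a + b) ((h * Z * h') * Yv x' w) = mtr (a + b) (Z * Yv x w)"
      unfolding conj(2)[OF w] conj_mult[OF h Z Xc(2)[OF w]] by (rule mtr_conj[OF h]) (use Xc(2)[OF w] Z in auto)
    ultimately show ?thesis
      using To_rec[of a b k x n rs y w Z c] To_rec[of a b k x' n rs y w "h * Z * h'" c'] ab x x' rs(1) rsk inR[OF y] inR[OF w] Z Z'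
      by (simp add: W c(2)[OF y w])
  qed
  ultimately show ?case using W by blast
qed

section \<open>The adjoint group and the average\<close>

lemma conj_by_one: "conj_by N (1\<^sub>m N) (1\<^sub>m N)"
  by (simp add: conj_by_def)

text \<open>Invariance of the form moves \<open>g\<close> across it: \<open>B g = h B\<close> and
  \<open>g^T B = B g'\<close> with \<open>h\<close> the transpose of \<open>g'\<close>. Both
  summands then carry the same factors \<open>h\<close> on the left and \<open>g'\<close> on the
  right and can be added.\<close>

lemma form_preserving_conj:
  fixes B :: "'k::field mat"
  assumes B: "B \<in> carrier_mat N N" and c: "conj_by N g g'" and g: "transpose_mat g * B * g = B"
    and X: "X \<in> carrier_mat N N" "transpose_mat X * B + B * X = 0\<^sub>m N N"
  shows "transpose_mat (g * X * g') * B + B * (g * X * g') = 0\<^sub>m N N"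
proof -
  note C = c[unfolded conj_by_def]
  note a = assoc_mult_mat[of _ N N _ N _ N]
  define h where "h = transpose_mat g'"
  have h: "h \<in> carrier_mat N N" using C by (simp add: h_def)
  have hg: "h * transpose_mat g = 1\<^sub>m N"
    unfolding h_def using C transpose_mult[of g N N g' N] by simp
  have gB: "transpose_mat g * B = B * g'"
  proof -
    have "transpose_mat g * B = transpose_mat g * B * (g * g')" using C B by simp
    also have "\<dots> = transpose_mat g * B * g * g'" by (rule a[symmetric]) (use C B in auto)
    finally show ?thesis unfolding g .
  qed
  have Bg: "B * g = h * B"
  proof -
    have "B * g = (h * transpose_mat g) * (B * g)" unfolding hg using B C by simp
    also have "\<dots> = h * (transpose_mat g * (B * g))" by (rule a) (use B C h in auto)
    also have "transpose_mat g * (B * g) = transpose_mat g * B * g" by (rule a[symmetric]) (use B C in auto)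
    finally show ?thesis unfolding g .
  qed
  have 1: "transpose_mat (g * X * g') * B = h * (transpose_mat X * B) * g'"
  proof -
    have "transpose_mat (g * X * g') = h * (transpose_mat X * transpose_mat g)"
    proof -
      have "transpose_mat (g * X * g') = h * transpose_mat (g * X)"
        unfolding h_def by (rule transpose_mult[of _ N N _ N]) (use C X in auto)
      also have "transpose_mat (g * X) = transpose_mat X * transpose_mat g"
        by (rule transpose_mult[of _ N N _ N]) (use C X in auto)
      finally show ?thesis .
    qed
    then have "transpose_mat (g * X * g') * B = h * (transpose_mat X * transpose_mat g) * B" by simp
    also have "\<dots> = h * (transpose_mat X * transpose_mat g * B)" by (rule a) (use B C X h in auto)
    also have "transpose_mat X * transpose_mat g * B = transpose_mat X * (B * g')"
      unfolding gB[symmetric] by (rule a) (use B C X in auto)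
    also have "\<dots> = transpose_mat X * B * g'" by (rule a[symmetric]) (use B C X in auto)
    also have "h * (transpose_mat X * B * g') = h * (transpose_mat X * B) * g'" by (rule a[symmetric]) (use B C X h in auto)
    finally show ?thesis .
  qed
  have 2: "B * (g * X * g') = h * (B * X) * g'"
  proof -
    have "B * (g * X * g') = B * (g * X) * g'" by (rule a[symmetric]) (use B C X in auto)
    also have "B * (g * X) = B * g * X" by (rule a[symmetric]) (use B C X in auto)
    also have "\<dots> = h * (B * X)" unfolding Bg by (rule a) (use B C X h in auto)
    finally show ?thesis .
  qed
  have "h * (transpose_mat X * B) * g' + h * (B * X) * g' = h * (transpose_mat X * B + B * X) * g'"
  proof -
    have "h * (transpose_mat X * B + B * X) = h * (transpose_mat X * B) + h * (B * X)"
      by (rule mult_add_distrib_mat[of _ N N _ N]) (use B X h in auto)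
    moreover have "(h * (transpose_mat X * B) + h * (B * X)) * g' = h * (transpose_mat X * B) * g' + h * (B * X) * g'"
      by (rule add_mult_distrib_mat[of _ N N _ _ N]) (use B C X h in auto)
    ultimately show ?thesis by simp
  qed
  also have "\<dots> = 0\<^sub>m N N" unfolding X(2) using h C left_mult_zero_mat[of g' N N] by auto
  finally show ?thesis unfolding 1 2 .
qed

lemma adj_group_conj:
  assumes "(g, h, u) \<in> adj_group n a b"
  shows "conj_by (2 * n) g (mat_inv g)" "conj_by (a + b) h (mat_inv h)"
  using assms Sp_det[of g n] mat_inv[of g "2 * n"] mat_inv[of h "a + b"]
  by (auto simp: adj_group_def Sp_group_def SO_group_def conj_by_def)

lemma Ad_lie_alg:
  assumes g: "g \<in> adj_group n a b" and x: "x \<in> lie_alg n a b"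
  shows "Ad g x \<in> lie_alg n a b"
proof -
  obtain g1 g2 g3 X Y z where gx: "g = (g1, g2, g3)" "x = (X, Y, z)" by (metis prod_cases3)
  note c = adj_group_conj[OF g[unfolded gx]]
  have g1: "transpose_mat g1 * symp_form n * g1 = symp_form n" and g2: "transpose_mat g2 * Q_form a b * g2 = Q_form a b"
    using g by (auto simp: gx adj_group_def Sp_group_def SO_group_def)
  have X: "X \<in> carrier_mat (2 * n) (2 * n)" "transpose_mat X * symp_form n + symp_form n * X = 0\<^sub>m (2 * n) (2 * n)"
    and Y: "Y \<in> carrier_mat (a + b) (a + b)" "transpose_mat Y * Q_form a b + Q_form a b * Y = 0\<^sub>m (a + b) (a + b)"
    using x by (auto simp: gx lie_alg_def sp_lie_def so_lie_def)
  have J: "(symp_form n :: 'a mat) \<in> carrier_mat (2 * n) (2 * n)" and Q: "(Q_form a b :: 'a mat) \<in> carrier_mat (a + b) (a + b)"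
    by (auto simp: symp_form_def Q_form_def)
  show ?thesis
    using form_preserving_conj[OF J c(1) g1 X] form_preserving_conj[OF Q c(2) g2 Y] c X(1) Y(1)
    by (auto simp: gx lie_alg_def sp_lie_def so_lie_def conj_by_def)
qed

lemma adj_group_nonempty: "(1\<^sub>m (2 * n), 1\<^sub>m (a + b), 1) \<in> (adj_group n a b :: 'k::field_char_0 lie set)"
  by (auto simp: adj_group_def Sp_group_def SO_group_def symp_form_def Q_form_def)

text \<open>An invariant function is its own average, with all weight on one transformation.
  Conversely, any convex combination over the orbit of an invariant function returns it, since the
  weights sum to 1; this gives the uniqueness that the definite description requires.\<close>

lemma average_invariant:
  fixes P :: "'x \<Rightarrow> 'k::real_normed_field fps"
  assumes inv: "\<And>\<gamma> x. \<gamma> \<in> \<Gamma> \<Longrightarrow> x \<in> A \<Longrightarrow> P (\<gamma> x) = P x" and ne: "\<Gamma> \<noteq> {}" and x: "x \<in> A"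
  shows "average A \<Gamma> P x = P x"
  unfolding average_def
proof (rule the_equality)
  obtain \<gamma>0 where g0: "\<gamma>0 \<in> \<Gamma>" using ne by blast
  have "is_average A \<Gamma> P P"
    unfolding is_average_def
    by (intro conjI exI[of _ "{\<gamma>0}"] exI[of _ "\<lambda>_. 1"]) (use g0 inv in auto)
  then show "\<exists>R. is_average A \<Gamma> P R \<and> P x = R x" by blast
next
  fix r assume "\<exists>R. is_average A \<Gamma> P R \<and> r = R x"
  then obtain R where R: "is_average A \<Gamma> P R" "r = R x" by blast
  then obtain F w where F: "finite F" "F \<subseteq> \<Gamma>" "sum w F = (1::real)"
    and e: "\<forall>x\<in>A. R x = (\<Sum>\<gamma>\<in>F. fps_const (of_real (w \<gamma>)) * P (\<gamma> x))"
    unfolding is_average_def by blast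
  have "r = (\<Sum>\<gamma>\<in>F. fps_const (of_real (w \<gamma>)) * P x)"
    using e x R(2) F(2) inv by (auto intro!: sum.cong)
  also have "\<dots> = fps_const (of_real (sum w F)) * P x"
    by (simp add: sum_distrib_right cst_sum)
  finally show "r = P x" using F(3) by simp
qed

subsection \<open>Bernoulli and Euler kernels\<close>

text \<open>\<open>Zs \<sigma>\<close> is \<open>z / (e\<^sup>z - \<sigma>)\<close> for \<open>\<sigma> = 1\<close> and for \<open>\<sigma> = -1\<close>; see \<open>Zs_mult\<close>.\<close>

definition Zs :: "'k::field_char_0 \<Rightarrow> 'k fps" where
  "Zs \<sigma> = (if \<sigma> = 1 then A_series * fps_exp (-(1/2)) else fps_X * inverse (fps_exp 1 + 1))"

lemma Zs_mult:
  assumes "\<sigma> = 1 \<or> \<sigma> = (-1 :: 'k::field_char_0)"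
  shows "Zs \<sigma> * (fps_exp 1 - fps_const \<sigma>) = fps_X"
  using assms
proof
  assume s: "\<sigma> = 1"
  have "fps_exp (-(1/2)) * fps_exp 1 = (fps_exp (1/2) :: 'k fps)"
    by (simp flip: fps_exp_add_mult)
  then have "Zs \<sigma> * (fps_exp 1 - fps_const \<sigma>) = A_series * (fps_exp (1/2) - fps_exp (-(1/2)))"
    by (simp add: Zs_def s right_diff_distrib mult.assoc)
  then show ?thesis by (simp add: A_series_mult)
next
  assume s: "\<sigma> = -1"
  have "inverse (fps_exp 1 + 1) * (fps_exp 1 + 1) = (1 :: 'k fps)"
    by (rule inverse_mult_eq_1) (simp add: fps_exp_def)
  then show ?thesis by (simp add: Zs_def s mult.assoc flip: fps_const_neg)
qed

text \<open>For \<open>\<sigma> = 1\<close> this is the Bernoulli polynomial of degree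
  \<open>m\<close> divided by \<open>m!\<close>; for \<open>\<sigma> = -1\<close> and
  \<open>m \<ge> 1\<close> it is the Euler polynomial of degree \<open>m - 1\<close> divided by
  \<open>2 (m - 1)!\<close>.\<close>

definition Bp :: "real \<Rightarrow> nat \<Rightarrow> real \<Rightarrow> real" where
  "Bp \<sigma> m x = fps_nth (Zs \<sigma> * fps_exp x) m"

lemma Bp_sum: "Bp \<sigma> m x = (\<Sum>i\<le>m. fps_nth (Zs \<sigma>) i * (x ^ (m - i) / fact (m - i)))"
  by (simp add: Bp_def fps_mult_nth fps_exp_def atMost_atLeast0)

context
  fixes \<sigma> :: real
  assumes \<sigma>: "\<sigma> = 1 \<or> \<sigma> = -1"
begin

text \<open>The difference of the generating functions is
  \<open>z (e^z - \<sigma>) / (e^z - \<sigma>) = z\<close>. On the circle only the kernel of order 1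
  has a jump.\<close>

lemma Bp_jump: "Bp \<sigma> m 1 - \<sigma> * Bp \<sigma> m 0 = (if m = 1 then 1 else 0)"
proof -
  have "Bp \<sigma> m 1 - \<sigma> * Bp \<sigma> m 0 = fps_nth (Zs \<sigma> * (fps_exp 1 - fps_const \<sigma>)) m"
    by (simp add: Bp_def right_diff_distrib)
  then show ?thesis by (simp add: Zs_mult[OF \<sigma>])
qed

text \<open>The constant coefficient is 0 for \<open>\<sigma> = -1\<close>, so multiplying it by
  \<open>\<sigma>\<close> never changes it; the correction terms of the convolution cancel for this
  reason.\<close>

lemma Bp_0: "Bp \<sigma> 0 x = fps_nth (Zs \<sigma>) 0" "(1 - \<sigma>) * fps_nth (Zs \<sigma>) 0 = 0"
proof -
  show b: "Bp \<sigma> 0 x = fps_nth (Zs \<sigma>) 0" for x by (simp add: Bp_sum)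
  show "(1 - \<sigma>) * fps_nth (Zs \<sigma>) 0 = 0" using Bp_jump[of 0] by (simp add: b algebra_simps)
qed

lemma Bp_deriv: "(Bp \<sigma> (Suc m) has_real_derivative Bp \<sigma> m x) (at x)"
proof -
  have "((\<lambda>x. \<Sum>i\<le>Suc m. fps_nth (Zs \<sigma>) i * (x ^ (Suc m - i) / fact (Suc m - i))) has_real_derivative
      (\<Sum>i\<le>Suc m. fps_nth (Zs \<sigma>) i * (if i = Suc m then 0 else x ^ (m - i) / fact (m - i)))) (at x)"
  proof (rule DERIV_sum, rule DERIV_cmult)
    fix i assume i: "i \<in> {..Suc m}"
    show "((\<lambda>x. x ^ (Suc m - i) / fact (Suc m - i)) has_real_derivative (if i = Suc m then 0 else x ^ (m - i) / fact (m - i))) (at x)"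
    proof (cases "i = Suc m")
      case False
      then have e: "Suc m - i = Suc (m - i)" using i by auto
      have "((\<lambda>x. x ^ Suc (m - i) / fact (Suc (m - i))) has_real_derivative x ^ (m - i) / fact (m - i)) (at x)"
        by (rule DERIV_cong[OF DERIV_cdivide[OF DERIV_pow]]) (simp del: of_nat_Suc)
      then show ?thesis unfolding e using False by simp
    qed simp
  qed
  also have "(\<Sum>i\<le>Suc m. fps_nth (Zs \<sigma>) i * (if i = Suc m then 0 else x ^ (m - i) / fact (m - i))) = Bp \<sigma> m x"
    by (simp add: Bp_sum)
  finally show ?thesis by (simp add: Bp_sum[abs_def])
qed

lemma Bp_cont: "continuous_on A (Bp \<sigma> m)"
proof (cases m)
  case 0
  have "Bp \<sigma> 0 = (\<lambda>_. fps_nth (Zs \<sigma>) 0)" by (rule ext) (rule Bp_0)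
  then show ?thesis using 0 by simp
next
  case (Suc q)
  then show ?thesis using Bp_deriv[of q] by (auto intro!: continuous_at_imp_continuous_on DERIV_isCont)
qed

text \<open>
  The kernel on the circle obtained by extending \<open>Bp \<sigma> m\<close> from \<open>[0, 1]\<close> periodically (\<open>\<sigma> = 1\<close>) or
  antiperiodically (\<open>\<sigma> = -1\<close>); up to normalization, \<open>m = 1\<close> is the propagator.
\<close>

definition Kf :: "nat \<Rightarrow> real \<Rightarrow> real \<Rightarrow> real" where
  "Kf m s t = (if s < t then Bp \<sigma> m (t - s) else \<sigma> * Bp \<sigma> m (t - s + 1))"

lemma Bp_measurable [measurable]: "Bp \<sigma> m \<in> borel_measurable borel"
  by (rule borel_measurable_continuous_onI[OF Bp_cont])

lemma Kf_measurable [measurable]: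
  assumes [measurable]: "f \<in> borel_measurable M" "g \<in> borel_measurable M"
  shows "(\<lambda>x. Kf m (f x) (g x)) \<in> borel_measurable M"
  unfolding Kf_def by measurable

lemma Kf_bounded: "\<exists>B. \<forall>s\<in>{0..1}. \<forall>t\<in>{0..1}. \<bar>Kf m s t\<bar> \<le> B"
proof -
  have "compact (Bp \<sigma> m ` {-1..2})" by (intro compact_continuous_image Bp_cont compact_Icc)
  then obtain B where B: "\<And>x. x \<in> {-1..2} \<Longrightarrow> \<bar>Bp \<sigma> m x\<bar> \<le> B"
    using compact_imp_bounded bounded_iff by (metis (no_types, lifting) imageI real_norm_def)
  have "\<bar>Kf m s t\<bar> \<le> B" if "s \<in> {0..1}" "t \<in> {0..1}" for s t
    using that B[of "t - s"] B[of "t - s + 1"] \<sigma> by (auto simp: Kf_def abs_mult)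
  then show ?thesis by blast
qed

text \<open>From order 2 on the kernel is continuous across the diagonal: the value on the branch
  \<open>s = t\<close> agrees with the limit from \<open>s < t\<close>.\<close>

lemma Kf_diag:
  assumes "m \<ge> 2"
  shows "Kf m t t = Bp \<sigma> m 0"
proof -
  have "\<sigma> * Bp \<sigma> m 1 = (\<sigma> * \<sigma>) * Bp \<sigma> m 0" using Bp_jump[of m] assms by simp
  moreover have "\<sigma> * \<sigma> = 1" using \<sigma> by auto
  ultimately show ?thesis by (simp add: Kf_def)
qed

text \<open>Integration by parts stops after two terms, because \<open>Bp \<sigma> 1\<close> has a
  constant derivative, the 0th coefficient of \<open>Zs \<sigma>\<close>.\<close>

definition prim :: "nat \<Rightarrow> real \<Rightarrow> real \<Rightarrow> real \<Rightarrow> real" where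
  "prim m p q u = - (Bp \<sigma> 1 (u - p) * Bp \<sigma> (m + 1) (q - u) + fps_nth (Zs \<sigma>) 0 * Bp \<sigma> (m + 2) (q - u))"

lemma prim_integral:
  assumes "l \<le> r"
  shows "((\<lambda>u. Bp \<sigma> 1 (u - p) * Bp \<sigma> m (q - u)) has_integral (prim m p q r - prim m p q l)) {l..r}"
proof (rule fundamental_theorem_of_calculus[OF assms])
  fix u assume "u \<in> {l..r}"
  have d1: "((\<lambda>u. Bp \<sigma> 1 (u - p)) has_real_derivative fps_nth (Zs \<sigma>) 0) (at u)"
  proof -
    have "((\<lambda>u. u - p) has_real_derivative 1) (at u)" by (auto intro!: derivative_eq_intros)
    from DERIV_chain2[where f = "Bp \<sigma> (Suc 0)" and g = "\<lambda>u. u - p", OF Bp_deriv[of 0 "u - p"] this]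
    show ?thesis by (simp add: Bp_0(1))
  qed
  have d2: "((\<lambda>u. Bp \<sigma> (Suc j) (q - u)) has_real_derivative - Bp \<sigma> j (q - u)) (at u)" for j
  proof -
    have "((\<lambda>u. q - u) has_real_derivative -1) (at u)" by (auto intro!: derivative_eq_intros)
    from DERIV_chain2[where f = "Bp \<sigma> (Suc j)" and g = "\<lambda>u. q - u", OF Bp_deriv[of j "q - u"] this]
    show ?thesis by simp
  qed
  have "(prim m p q has_real_derivative Bp \<sigma> 1 (u - p) * Bp \<sigma> m (q - u)) (at u)"
    unfolding prim_def[abs_def]
    using d1 d2[of m] d2[of "Suc m"]
    by (auto intro!: derivative_eq_intros simp: algebra_simps)
  then show "(prim m p q has_vector_derivative Bp \<sigma> 1 (u - p) * Bp \<sigma> m (q - u)) (at u within {l..r})"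
    by (simp add: has_real_derivative_iff_has_vector_derivative has_vector_derivative_at_within)
qed

text \<open>The interval is split at \<open>s\<close> and \<open>t\<close>, and on each piece
  \<open>prim\<close> is an antiderivative. The boundary terms at 0 and 1 cancel by
  (anti)periodicity, those at \<open>t\<close> because the kernels of order at least 2 are
  continuous. At \<open>s\<close> the unit jump of the kernel of order 1 survives and produces the
  kernel of order \<open>m + 1\<close>.\<close>

lemma Kf_conv_HK:
  assumes s: "s \<in> {0..1}" and t: "t \<in> {0..1}" and m: "m \<ge> 1"
  shows "((\<lambda>u. Kf 1 s u * Kf m u t) has_integral (- \<sigma> * Kf (m + 1) s t)) {0..1}"
proof -
  have ss: "\<sigma> * \<sigma> = 1" using \<sigma> by auto
  have z: "fps_nth (Zs \<sigma>) 0 * \<sigma> = fps_nth (Zs \<sigma>) 0" using Bp_0(2) by (simp add: algebra_simps)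
  have zx: "\<sigma> * (fps_nth (Zs \<sigma>) 0 * x) = fps_nth (Zs \<sigma>) 0 * x" for x using z by (metis mult.assoc mult.commute)
  have j1: "Bp \<sigma> (Suc 0) 1 = 1 + \<sigma> * Bp \<sigma> (Suc 0) 0" using Bp_jump[of 1] by simp
  have jm: "Bp \<sigma> (Suc m) 1 = \<sigma> * Bp \<sigma> (Suc m) 0" "Bp \<sigma> (Suc (Suc m)) 1 = \<sigma> * Bp \<sigma> (Suc (Suc m)) 0"
    using Bp_jump[of "m + 1"] Bp_jump[of "m + 2"] m by auto
  have sx: "\<sigma> * (\<sigma> * x) = x" for x using ss by (simp flip: mult.assoc)
  show ?thesis
  proof (cases "s < t")
    case True
    \<comment> \<open>Left of \<open>s\<close> the first kernel is on its second branch, whose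
      argument is shifted by 1: hence \<open>s - 1\<close> and the factor \<open>\<sigma>\<close>.
      Right of \<open>t\<close> the second kernel shifts in the same way, to
      \<open>t + 1\<close>.\<close>
    have 1: "((\<lambda>u. Kf 1 s u * Kf m u t) has_integral \<sigma> * (prim m (s - 1) t s - prim m (s - 1) t 0)) {0..s}"
      by (rule has_integral_spike_finite[OF _ _ has_integral_mult_right[OF prim_integral]]) (use True s in \<open>auto simp: Kf_def algebra_simps\<close>)
    have 2: "((\<lambda>u. Kf 1 s u * Kf m u t) has_integral (prim m s t t - prim m s t s)) {s..t}"
      by (rule has_integral_spike_finite[of "{s, t}", OF _ _ prim_integral]) (use True s in \<open>auto simp: Kf_def\<close>)
    have 3: "((\<lambda>u. Kf 1 s u * Kf m u t) has_integral \<sigma> * (prim m s (t + 1) 1 - prim m s (t + 1) t)) {t..1}"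
      by (rule has_integral_spike_finite[OF _ _ has_integral_mult_right[OF prim_integral]]) (use True t in \<open>auto simp: Kf_def algebra_simps\<close>)
    have "((\<lambda>u. Kf 1 s u * Kf m u t) has_integral (\<sigma> * (prim m (s - 1) t s - prim m (s - 1) t 0) + (prim m s t t - prim m s t s)
       + \<sigma> * (prim m s (t + 1) 1 - prim m s (t + 1) t))) {0..1}"
      using True s t by (intro has_integral_combine[OF _ _ has_integral_combine[OF _ _ 1 2] 3]) auto
    also have "\<sigma> * (prim m (s - 1) t s - prim m (s - 1) t 0) + (prim m s t t - prim m s t s)
       + \<sigma> * (prim m s (t + 1) 1 - prim m s (t + 1) t) = - \<sigma> * Kf (m + 1) s t"
      using True by (simp add: prim_def Kf_def j1 jm algebra_simps sx zx)
    finally show ?thesis .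
  next
    case False
    then have ts: "t \<le> s" by simp
    have 1: "((\<lambda>u. Kf 1 s u * Kf m u t) has_integral \<sigma> * (prim m (s - 1) t t - prim m (s - 1) t 0)) {0..t}"
      by (rule has_integral_spike_finite[of "{t, s}", OF _ _ has_integral_mult_right[OF prim_integral]]) (use ts t in \<open>auto simp: Kf_def algebra_simps\<close>)
    have 2: "((\<lambda>u. Kf 1 s u * Kf m u t) has_integral (prim m (s - 1) (t + 1) s - prim m (s - 1) (t + 1) t)) {t..s}"
      by (rule has_integral_spike_finite[of "{t, s}", OF _ _ prim_integral]) (use ts sx in \<open>auto simp: Kf_def algebra_simps\<close>)
    have 3: "((\<lambda>u. Kf 1 s u * Kf m u t) has_integral \<sigma> * (prim m s (t + 1) 1 - prim m s (t + 1) s)) {s..1}"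
      by (rule has_integral_spike_finite[of "{t, s}", OF _ _ has_integral_mult_right[OF prim_integral]]) (use ts s in \<open>auto simp: Kf_def algebra_simps\<close>)
    have "((\<lambda>u. Kf 1 s u * Kf m u t) has_integral (\<sigma> * (prim m (s - 1) t t - prim m (s - 1) t 0) +
       (prim m (s - 1) (t + 1) s - prim m (s - 1) (t + 1) t) + \<sigma> * (prim m s (t + 1) 1 - prim m s (t + 1) s))) {0..1}"
      using ts s t by (intro has_integral_combine[OF _ _ has_integral_combine[OF _ _ 1 2] 3]) auto
    also have "\<sigma> * (prim m (s - 1) t t - prim m (s - 1) t 0) +
       (prim m (s - 1) (t + 1) s - prim m (s - 1) (t + 1) t) + \<sigma> * (prim m s (t + 1) 1 - prim m s (t + 1) s) = - \<sigma> * Kf (m + 1) s t"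
      using ts by (simp add: prim_def Kf_def j1 jm algebra_simps sx zx)
    finally show ?thesis .
  qed
qed

lemma Kf_conv:
  assumes s: "s \<in> {0..1}" and t: "t \<in> {0..1}" and m: "m \<ge> 1"
  shows "set_lebesgue_integral lborel {0..1} (\<lambda>u. Kf 1 s u * Kf m u t) = - \<sigma> * Kf (m + 1) s t"
    and "set_integrable lborel {0..1} (\<lambda>u. Kf 1 s u * Kf m u t)"
proof -
  obtain B1 Bm where B: "\<And>u. u \<in> {0..1} \<Longrightarrow> \<bar>Kf 1 s u\<bar> \<le> B1" "\<And>u. u \<in> {0..1} \<Longrightarrow> \<bar>Kf m u t\<bar> \<le> Bm"
    using Kf_bounded[of 1] Kf_bounded[of m] s t by blast
  show i: "set_integrable lborel {0..1} (\<lambda>u. Kf 1 s u * Kf m u t)"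
    unfolding set_integrable_def
  proof (rule integrableI_bounded_set_indicator[where B = "B1 * Bm"])
    show "AE u in lborel. u \<in> {0..1} \<longrightarrow> norm (Kf 1 s u * Kf m u t) \<le> B1 * Bm"
      using B by (auto simp: abs_mult intro!: AE_I2 mult_mono order_trans[OF abs_ge_zero])
  qed auto
  show "set_lebesgue_integral lborel {0..1} (\<lambda>u. Kf 1 s u * Kf m u t) = - \<sigma> * Kf (m + 1) s t"
    using set_borel_integral_eq_integral(2)[OF i] Kf_conv_HK[OF assms] by (simp add: integral_unique)
qed

end

subsection \<open>Integration over the cube\<close>

abbreviation cubeM :: "nat \<Rightarrow> (nat \<Rightarrow> real) measure" where
  "cubeM n \<equiv> PiM {1..n} (\<lambda>_. lborel)"

definition cubeI :: "nat \<Rightarrow> ((nat \<Rightarrow> real) \<Rightarrow> 'k::{real_normed_field, euclidean_space}) \<Rightarrow> 'k" where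
  "cubeI n f = set_lebesgue_integral (cubeM n) (PiE {1..n} (\<lambda>_. {0..1})) f"

text \<open>The bound is global rather than on the cube, so that products and fixed coordinates
  cause no side conditions. Integrability follows because the cube has finite measure.\<close>

definition nice :: "nat \<Rightarrow> ((nat \<Rightarrow> real) \<Rightarrow> 'k::{real_normed_field, euclidean_space}) \<Rightarrow> bool" where
  "nice n f \<longleftrightarrow> f \<in> borel_measurable (cubeM n) \<and> (\<exists>B. \<forall>v. norm (f v) \<le> B)"

lemma lborel_prod: "product_sigma_finite (\<lambda>_::nat. lborel :: real measure)"
  by (simp add: product_sigma_finite_def sigma_finite_lborel)

lemma cube_emeasure:
  assumes "finite I"
  shows "emeasure (PiM I (\<lambda>_::nat. lborel :: real measure)) (PiE I (\<lambda>_. {0..1})) = 1"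
    "PiE I (\<lambda>_. {0..1}) \<in> sets (PiM I (\<lambda>_::nat. lborel :: real measure))"
proof -
  interpret product_sigma_finite "\<lambda>_::nat. lborel :: real measure" by (rule lborel_prod)
  show "emeasure (PiM I (\<lambda>_::nat. lborel :: real measure)) (PiE I (\<lambda>_. {0..1})) = 1"
    using assms by (subst emeasure_PiM) auto
  show "PiE I (\<lambda>_. {0..1}) \<in> sets (PiM I (\<lambda>_::nat. lborel :: real measure))"
    using assms by (intro sets_PiM_I_finite) auto
qed

lemma nice_integrable:
  assumes "nice n f"
  shows "set_integrable (cubeM n) (PiE {1..n} (\<lambda>_. {0..1})) f"
proof -
  obtain B where B: "\<And>v. norm (f v) \<le> B" using assms by (auto simp: nice_def)
  show ?thesis
    unfolding set_integrable_def
    by (rule integrableI_bounded_set_indicator[where B = B])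
      (use assms B cube_emeasure[of "{1..n}"] in \<open>auto simp: nice_def intro!: AE_I2\<close>)
qed

lemma nice_const: "nice n (\<lambda>_. c)"
  by (auto simp: nice_def)

lemma nice_add: "nice n f \<Longrightarrow> nice n g \<Longrightarrow> nice n (\<lambda>v. f v + g v)"
  unfolding nice_def by (auto intro!: borel_measurable_add) (metis add_mono norm_triangle_le)

lemma nice_mult: "nice n f \<Longrightarrow> nice n g \<Longrightarrow> nice n (\<lambda>v. f v * g v)"
  for f :: "(nat \<Rightarrow> real) \<Rightarrow> 'k::{real_normed_field, euclidean_space}"
proof -
  assume f: "nice n f" and g: "nice n g"
  then obtain B C where B: "\<And>v. norm (f v) \<le> B" "\<And>v. norm (g v) \<le> C" by (auto simp: nice_def)
  have "norm (f v * g v) \<le> B * C" for v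
    unfolding norm_mult using B[of v] by (intro mult_mono) (auto intro: order_trans[OF norm_ge_zero])
  moreover have "(\<lambda>v. f v * g v) \<in> borel_measurable (cubeM n)"
    using f g by (auto simp: nice_def intro!: borel_measurable_times)
  ultimately show ?thesis by (auto simp: nice_def)
qed

lemma nice_sum: "(\<And>x. x \<in> X \<Longrightarrow> nice n (f x)) \<Longrightarrow> nice n (\<lambda>v. \<Sum>x\<in>X. f x v)"
  by (induction X rule: infinite_finite_induct) (auto intro: nice_const nice_add)

lemma nice_upd:
  assumes "nice n f" "i \<in> {1..n}"
  shows "nice n (\<lambda>v. f (v(i := u)))"
proof -
  have "(\<lambda>v. v(i := u)) \<in> measurable (cubeM n) (cubeM n)"
    using assms(2) by (intro measurable_fun_upd[where J = "{1..n}"]) auto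
  then have "(\<lambda>v. f (v(i := u))) \<in> borel_measurable (cubeM n)"
    using assms(1) unfolding nice_def by (auto intro: measurable_compose)
  then show ?thesis using assms(1) by (auto simp: nice_def)
qed

lemma cubeI_add: "nice n f \<Longrightarrow> nice n g \<Longrightarrow> cubeI n (\<lambda>v. f v + g v) = cubeI n f + cubeI n g"
  unfolding cubeI_def by (rule set_integral_add(2); rule nice_integrable; assumption)

lemma cubeI_cmult: "cubeI n (\<lambda>v. c * f v) = c * cubeI n f"
  for f :: "(nat \<Rightarrow> real) \<Rightarrow> 'k::{real_normed_field, euclidean_space}"
  unfolding cubeI_def by (rule set_integral_mult_right)

lemma cubeI_zero: "cubeI n (\<lambda>_. 0) = 0"
  by (simp add: cubeI_def set_lebesgue_integral_def)

lemma cubeI_sum: "(\<And>x. x \<in> X \<Longrightarrow> nice n (f x)) \<Longrightarrow> cubeI n (\<lambda>v. \<Sum>x\<in>X. f x v) = (\<Sum>x\<in>X. cubeI n (f x))"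
proof (induction X rule: infinite_finite_induct)
  case (insert x X)
  then have "cubeI n (\<lambda>v. f x v + (\<Sum>x\<in>X. f x v)) = cubeI n (f x) + cubeI n (\<lambda>v. \<Sum>x\<in>X. f x v)"
    by (intro cubeI_add nice_sum) auto
  then show ?case using insert by simp
qed (auto simp: cubeI_zero)

lemma cubeI_const: "cubeI n (\<lambda>_. c) = c"
proof -
  have "measure (cubeM n) (PiE {1..n} (\<lambda>_. {0..1})) = 1"
    using cube_emeasure(1)[of "{1..n}"] by (simp add: measure_def)
  then show ?thesis
    unfolding cubeI_def set_lebesgue_integral_def
    using cube_emeasure[of "{1..n}"] by (subst integral_scaleR_left) (auto simp: integrable_indicator_iff)
qed

text \<open>The inner integral still runs over all coordinates. Coordinate \<open>i\<close> is then
  integrated once more over an interval of length 1 on which the integrand is constant, which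
  changes nothing and keeps the index set fixed throughout.\<close>

lemma cubeI_fubini:
  fixes f :: "(nat \<Rightarrow> real) \<Rightarrow> 'k::{real_normed_field, euclidean_space}"
  assumes f: "nice n f" and i: "i \<in> {1..n}"
  shows "cubeI n f = set_lebesgue_integral lborel {0..1} (\<lambda>u. cubeI n (\<lambda>v. f (v(i := u))))"
proof -
  interpret product_sigma_finite "\<lambda>_::nat. lborel :: real measure" by (rule lborel_prod)
  define I0 where "I0 = {1..n} - {i}"
  have I0: "finite I0" "i \<notin> I0" "insert i I0 = {1..n}" using i by (auto simp: I0_def)
  define M0 where "M0 = PiM I0 (\<lambda>_. lborel :: real measure)"
  interpret M0: sigma_finite_measure M0 unfolding M0_def by (rule sigma_finite[OF I0(1)])
  interpret pair: pair_sigma_finite M0 "lborel :: real measure" ..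
  define C0 where "C0 = PiE I0 (\<lambda>_. {0..1 :: real})"
  have C0: "C0 \<in> sets M0" "emeasure M0 C0 = 1"
    using cube_emeasure[OF I0(1)] by (auto simp: C0_def M0_def)
  have ins: "cubeI n h = (\<integral>x. (\<integral>y. indicator C0 x *\<^sub>R (indicator {0..1} y *\<^sub>R h (x(i := y))) \<partial>lborel) \<partial>M0)"
    if h: "nice n h" for h :: "(nat \<Rightarrow> real) \<Rightarrow> 'k"
  proof -
    have "cubeI n h = (\<integral>x. (\<integral>y. indicator (PiE {1..n} (\<lambda>_. {0..1})) (x(i := y)) *\<^sub>R h (x(i := y)) \<partial>lborel) \<partial>M0)"
      unfolding cubeI_def set_lebesgue_integral_def M0_def
      using product_integral_insert[OF I0(1,2), unfolded I0(3)] nice_integrable[OF h] by (simp add: set_integrable_def)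
    also have "\<dots> = (\<integral>x. (\<integral>y. indicator C0 x *\<^sub>R (indicator {0..1} y *\<^sub>R h (x(i := y))) \<partial>lborel) \<partial>M0)"
    proof (intro Bochner_Integration.integral_cong refl)
      fix x y assume "x \<in> space M0"
      then have x: "x \<in> extensional I0" by (auto simp: M0_def space_PiM PiE_def)
      have "x(i := y) \<in> PiE {1..n} (\<lambda>_. {0..1}) \<longleftrightarrow> x \<in> C0 \<and> y \<in> {0..1}"
        unfolding C0_def I0(3)[symmetric] using x I0(2)
        by (auto simp: PiE_def Pi_def extensional_def split: if_splits)
      then show "indicator (PiE {1..n} (\<lambda>_. {0..1})) (x(i := y)) *\<^sub>R h (x(i := y)) = indicator C0 x *\<^sub>R (indicator {0..1} y *\<^sub>R h (x(i := y)))"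
        by (auto simp: indicator_def)
    qed
    finally show ?thesis .
  qed
  obtain B where B: "\<And>v. norm (f v) \<le> B" using f by (auto simp: nice_def)
  have meas: "(\<lambda>(x, y). f (x(i := y))) \<in> borel_measurable (M0 \<Otimes>\<^sub>M lborel)"
  proof -
    have "(\<lambda>(x, y). x(i := y)) \<in> measurable (M0 \<Otimes>\<^sub>M lborel) (cubeM n)"
      using measurable_add_dim[of i I0 "\<lambda>_. lborel :: real measure"] unfolding I0(3) M0_def .
    then have "(\<lambda>p. f ((\<lambda>(x, y). x(i := y)) p)) \<in> borel_measurable (M0 \<Otimes>\<^sub>M lborel)"
      using f unfolding nice_def by (auto intro: measurable_compose)
    then show ?thesis by (simp add: case_prod_beta')
  qed
  have int: "integrable (M0 \<Otimes>\<^sub>M lborel) (\<lambda>(x, y). indicator C0 x *\<^sub>R (indicator {0..1} y *\<^sub>R f (x(i := y))))"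
  proof -
    have "integrable (M0 \<Otimes>\<^sub>M lborel) (\<lambda>p. indicator (C0 \<times> {0..1}) p *\<^sub>R (\<lambda>(x, y). f (x(i := y))) p)"
    proof (rule integrableI_bounded_set_indicator[where B = B])
      show "C0 \<times> {0..1::real} \<in> sets (M0 \<Otimes>\<^sub>M lborel)" using C0(1) by (intro pair_measureI) simp_all
      have "emeasure (M0 \<Otimes>\<^sub>M lborel) (C0 \<times> {0..1::real}) = emeasure M0 C0 * emeasure lborel {0..1::real}"
        using C0 by (intro lborel.emeasure_pair_measure_Times) auto
      then show "emeasure (M0 \<Otimes>\<^sub>M lborel) (C0 \<times> {0..1::real}) < \<infinity>" using C0 by simp
    qed (use meas B in \<open>auto intro!: AE_I2\<close>)
    then show ?thesis
      by (rule Bochner_Integration.integrable_cong[THEN iffD1, rotated -1]) (auto simp: indicator_def)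
  qed
  have inner: "cubeI n (\<lambda>v. f (v(i := u))) = (\<integral>x. indicator C0 x *\<^sub>R f (x(i := u)) \<partial>M0)" for u
  proof -
    have "(\<integral>y. indicator C0 x *\<^sub>R (indicator {0..1::real} y *\<^sub>R f (x(i := u))) \<partial>lborel) = indicator C0 x *\<^sub>R f (x(i := u))" for x
    proof -
      have "(\<integral>y. indicator {0..1 :: real} y *\<^sub>R f (x(i := u)) \<partial>lborel) = f (x(i := u))"
        by (subst integral_scaleR_left) (auto simp: integrable_indicator_iff)
      then show ?thesis by simp
    qed
    then show ?thesis unfolding ins[OF nice_upd[OF f i]] by (simp add: fun_upd_upd)
  qed
  have "cubeI n f = (\<integral>y. (\<integral>x. indicator C0 x *\<^sub>R (indicator {0..1} y *\<^sub>R f (x(i := y))) \<partial>M0) \<partial>lborel)"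
    unfolding ins[OF f] by (rule pair.Fubini_integral[OF int, symmetric])
  also have "\<dots> = (\<integral>y. indicator {0..1} y *\<^sub>R cubeI n (\<lambda>v. f (v(i := y))) \<partial>lborel)"
    unfolding inner by (intro Bochner_Integration.integral_cong refl) (auto simp: indicator_def)
  finally show ?thesis by (simp add: set_lebesgue_integral_def)
qed

section \<open>Integrals of power series, taken coefficient by coefficient\<close>

definition niceF :: "nat \<Rightarrow> ((nat \<Rightarrow> real) \<Rightarrow> 'k::{real_normed_field, euclidean_space} fps) \<Rightarrow> bool" where
  "niceF n f \<longleftrightarrow> (\<forall>N. nice n (\<lambda>v. fps_nth (f v) N))"

definition fexp :: "nat \<Rightarrow> ((nat \<Rightarrow> real) \<Rightarrow> 'k::{real_normed_field, euclidean_space} fps) \<Rightarrow> 'k fps" where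
  "fexp n f = Abs_fps (\<lambda>N. cubeI n (\<lambda>v. fps_nth (f v) N))"

definition iint :: "(real \<Rightarrow> 'k::{real_normed_field, euclidean_space} fps) \<Rightarrow> 'k fps" where
  "iint f = Abs_fps (\<lambda>N. set_lebesgue_integral lborel {0..1} (\<lambda>u. fps_nth (f u) N))"

lemma niceF_const: "niceF n (\<lambda>_. a)"
  by (simp add: niceF_def nice_const)

lemma niceF_add: "niceF n f \<Longrightarrow> niceF n g \<Longrightarrow> niceF n (\<lambda>v. f v + g v)"
  by (simp add: niceF_def nice_add)

lemma niceF_sum: "(\<And>x. x \<in> X \<Longrightarrow> niceF n (f x)) \<Longrightarrow> niceF n (\<lambda>v. \<Sum>x\<in>X. f x v)"
  by (simp add: niceF_def fps_sum_nth nice_sum)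

lemma niceF_mult_left: "niceF n f \<Longrightarrow> niceF n (\<lambda>v. a * f v)"
  by (simp add: niceF_def fps_mult_nth) (intro allI nice_sum nice_mult nice_const; simp)

lemma niceF_cst_mult: "nice n g \<Longrightarrow> niceF n f \<Longrightarrow> niceF n (\<lambda>v. cst (g v) * f v)"
  by (simp add: niceF_def nice_mult)

lemma niceF_upd: "niceF n f \<Longrightarrow> i \<in> {1..n} \<Longrightarrow> niceF n (\<lambda>v. f (v(i := u)))"
  by (auto simp: niceF_def intro: nice_upd)

lemma fexp_const: "fexp n (\<lambda>_. a) = a"
  by (simp add: fexp_def cubeI_const fps_eq_iff)

lemma fexp_add: "niceF n f \<Longrightarrow> niceF n g \<Longrightarrow> fexp n (\<lambda>v. f v + g v) = fexp n f + fexp n g"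
  by (simp add: fexp_def niceF_def cubeI_add fps_eq_iff)

lemma fexp_sum: "(\<And>x. x \<in> X \<Longrightarrow> niceF n (f x)) \<Longrightarrow> fexp n (\<lambda>v. \<Sum>x\<in>X. f x v) = (\<Sum>x\<in>X. fexp n (f x))"
  by (simp add: fexp_def niceF_def cubeI_sum fps_eq_iff fps_sum_nth)

lemma fexp_mult_left:
  assumes "niceF n f"
  shows "fexp n (\<lambda>v. a * f v) = a * fexp n f"
proof (rule fps_ext)
  fix N
  have "cubeI n (\<lambda>v. \<Sum>i=0..N. fps_nth a i * fps_nth (f v) (N - i)) = (\<Sum>i=0..N. cubeI n (\<lambda>v. fps_nth a i * fps_nth (f v) (N - i)))"
    using assms by (intro cubeI_sum nice_mult nice_const) (auto simp: niceF_def)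
  then show "fps_nth (fexp n (\<lambda>v. a * f v)) N = fps_nth (a * fexp n f) N"
    by (simp add: fexp_def fps_mult_nth cubeI_cmult)
qed

lemma fexp_fubini:
  assumes "niceF n f" "i \<in> {1..n}"
  shows "fexp n f = iint (\<lambda>u. fexp n (\<lambda>v. f (v(i := u))))"
proof (rule fps_ext)
  fix N
  show "fps_nth (fexp n f) N = fps_nth (iint (\<lambda>u. fexp n (\<lambda>v. f (v(i := u))))) N"
    using cubeI_fubini[of n "\<lambda>v. fps_nth (f v) N" i] assms by (simp add: fexp_def iint_def niceF_def)
qed

subsection \<open>The cochain as an integral of loop expansions\<close>

definition cpsi :: "(nat \<Rightarrow> real) \<Rightarrow> nat \<Rightarrow> nat \<Rightarrow> 'k::real_normed_field" where
  "cpsi v i j = of_real (psi ((v(0 := 0)) i - (v(0 := 0)) j))"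

lemma nice_cpsi:
  assumes "i \<le> n" "j \<le> n"
  shows "nice n (\<lambda>v. cpsi v i j :: 'k::{real_normed_field, euclidean_space})"
proof -
  have m: "(\<lambda>v. (v(0 := 0)) i) \<in> borel_measurable (cubeM n)" if "i \<le> n" for i
    using that by (cases "i = 0") (auto intro!: measurable_component_singleton[where M = "\<lambda>_. lborel", simplified])
  have "(\<lambda>v. psi ((v(0 := 0)) i - (v(0 := 0)) j)) \<in> borel_measurable (cubeM n)"
    unfolding psi_def frac_def using m[OF assms(1)] m[OF assms(2)] by measurable
  moreover have "\<bar>psi x\<bar> \<le> 1" for x using frac_ge_0[of x] frac_lt_1[of x] by (simp add: psi_def abs_le_iff)
  ultimately show ?thesis
    unfolding nice_def cpsi_def by (auto intro!: exI[of _ 1] borel_measurable_of_real)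
qed

lemma nice_skew:
  assumes "i \<le> n" "j \<le> n"
  shows "nice n (\<lambda>v. skew (cpsi v) i j :: 'k::{real_normed_field, euclidean_space})"
    "nice n (\<lambda>v. odd_prop (cpsi v) i j :: 'k)"
proof -
  have neg: "nice n (\<lambda>v. - f v)" if "nice n f" for f :: "(nat \<Rightarrow> real) \<Rightarrow> 'k"
    using nice_mult[OF nice_const[of n "-1"] that] by simp
  have s: "nice n (\<lambda>v. skew (cpsi v) i j :: 'k)" if "i \<le> n" "j \<le> n" for i j
    using nice_cpsi[OF that] neg[OF nice_cpsi[OF that(2,1)]] nice_const[of n "0 :: 'k"]
    by (cases i j rule: linorder_cases) (simp_all add: skew_def)
  show "nice n (\<lambda>v. skew (cpsi v) i j :: 'k)" by (rule s[OF assms])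
  have "nice n (\<lambda>v. skew (cpsi v) i j + - skew (cpsi v) 0 j + skew (cpsi v) 0 i :: 'k)"
    using assms by (intro nice_add neg s) auto
  then show "nice n (\<lambda>v. odd_prop (cpsi v) i j :: 'k)" by (simp add: odd_prop_def)
qed

lemma nice_scale: "nice n g \<Longrightarrow> nice n (\<lambda>v. - (g v / c))"
  for g :: "(nat \<Rightarrow> real) \<Rightarrow> 'k::{real_normed_field, euclidean_space}"
  using nice_mult[OF nice_const[of n "- (1 / c)"], of g] by simp

text \<open>By the recursions every value is a polynomial in the propagators with constant power
  series as coefficients, and the propagators are bounded and measurable.\<close>

lemma niceF_loops:
  fixes x :: "nat \<Rightarrow> 'k::{real_normed_field, euclidean_space} lie"
  assumes ab: "a \<le> b" and x: "\<And>r. r \<in> {1..n} \<Longrightarrow> x r \<in> lie_alg n a b"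
  shows "distinct rs \<Longrightarrow> set rs \<subseteq> {1..n} \<Longrightarrow> niceF n (\<lambda>v. Wx n a b n (cpsi v) x rs) \<and>
    (\<forall>y\<in>{1..n}. \<forall>w\<in>{1..n}. \<forall>Z\<in>carrier_mat (2 * n) (2 * n). niceF n (\<lambda>v. Te n a b n (cpsi v) x y w rs Z)) \<and>
    (\<forall>y\<in>{1..n}. \<forall>w\<in>{1..n}. \<forall>Z\<in>carrier_mat (a + b) (a + b). niceF n (\<lambda>v. To n a b n (cpsi v) x y w rs Z))"
proof (induction "length rs" arbitrary: rs rule: less_induct)
  case less
  note rs = less.prems
  have Xc: "Xv x r \<in> carrier_mat (2 * n) (2 * n)" "Yv x r \<in> carrier_mat (a + b) (a + b)" if "r \<in> {1..n}" for r
    using XY_carrier[of a b n x n r] ab x that by auto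
  have rem: "length (remove1 r qs) < length qs" "distinct (remove1 r qs)" "set (remove1 r qs) \<subseteq> {1..n}"
    if "r \<in> set qs" "distinct qs" "set qs \<subseteq> {1..n}" for r and qs :: "nat list"
    using that set_remove1_subset[of r qs] length_pos_if_in_set[OF that(1)] by (auto simp: length_remove1)
  have IH: "niceF n (\<lambda>v. Wx n a b n (cpsi v) x qs)"
    "\<And>y w Z. y \<in> {1..n} \<Longrightarrow> w \<in> {1..n} \<Longrightarrow> Z \<in> carrier_mat (2 * n) (2 * n) \<Longrightarrow> niceF n (\<lambda>v. Te n a b n (cpsi v) x y w qs Z)"
    "\<And>y w Z. y \<in> {1..n} \<Longrightarrow> w \<in> {1..n} \<Longrightarrow> Z \<in> carrier_mat (a + b) (a + b) \<Longrightarrow> niceF n (\<lambda>v. To n a b n (cpsi v) x y w qs Z)"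
    if "length qs < length rs" "distinct qs" "set qs \<subseteq> {1..n}" for qs
    using less.hyps[OF that] by auto
  have sk: "nice n (\<lambda>v. - (skew (cpsi v) i j / c) :: 'k)" "nice n (\<lambda>v. - (odd_prop (cpsi v) i j / c) :: 'k)"
    if "i \<in> {1..n}" "j \<in> {1..n}" for i j c
    using nice_skew[of i n j] that by (auto intro: nice_scale)
  have W: "niceF n (\<lambda>v. Wx n a b n (cpsi v) x rs)"
  proof (cases rs)
    case Nil
    then show ?thesis using Wx_Nil[of a b n x n] ab x by (simp add: niceF_const)
  next
    case (Cons y qs)
    have q: "distinct qs" "set qs \<subseteq> {1..n}" "y \<in> {1..n}" "length qs < length rs" using rs Cons by auto
    have rq: "r \<in> {1..n}" "length (remove1 r qs) < length rs" if "r \<in> set qs" for r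
      using q that rem[OF that q(1,2)] by auto
    have "niceF n (\<lambda>v. cst (zv x y) * Wx n a b n (cpsi v) x qs +
      (fps_X * (\<Sum>r\<in>set qs. cst (- (skew (cpsi v) y r / 4)) * Te n a b n (cpsi v) x r y (remove1 r qs) (Xv x r)) +
       fps_X * (\<Sum>r\<in>set qs. cst (- (odd_prop (cpsi v) y r / 4)) * To n a b n (cpsi v) x r y (remove1 r qs) (Yv x r))))"
      using rq q Xc rem[OF _ q(1,2)] by (intro niceF_add niceF_mult_left niceF_sum niceF_cst_mult sk IH) auto
    then show ?thesis unfolding Cons using Wx_rec[of a b n x n qs y] ab x q by simp
  qed
  have rr: "r \<in> {1..n}" if "r \<in> set rs" for r using rs that by auto
  have "niceF n (\<lambda>v. Te n a b n (cpsi v) x y w rs Z)"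
    if y: "y \<in> {1..n}" "w \<in> {1..n}" and Z: "Z \<in> carrier_mat (2 * n) (2 * n)" for y w Z
  proof -
    have "niceF n (\<lambda>v. fps_X * (cst (- (skew (cpsi v) y w / 2) * mtr (2 * n) (Z * Xv x w)) * Wx n a b n (cpsi v) x rs +
      (\<Sum>r\<in>set rs. cst (- (skew (cpsi v) y r / 2)) * Te n a b n (cpsi v) x r w (remove1 r rs) (Xv x r * Z))))"
      using rr rem[OF _ rs] Xc Z y
      by (intro niceF_add niceF_mult_left niceF_sum niceF_cst_mult sk IH W nice_mult nice_const mult_carrier_mat) auto
    then show ?thesis using Te_rec[of a b n x n rs y w Z] ab x rs y Z by simp
  qed
  moreover have "niceF n (\<lambda>v. To n a b n (cpsi v) x y w rs Z)"
    if y: "y \<in> {1..n}" "w \<in> {1..n}" and Z: "Z \<in> carrier_mat (a + b) (a + b)" for y w Z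
  proof -
    have "nice n (\<lambda>v. odd_prop (cpsi v) y w / 2 :: 'k)" using sk(2)[OF y, of "-2"] by simp
    then have "niceF n (\<lambda>v. fps_X * (cst (odd_prop (cpsi v) y w / 2 * mtr (a + b) (Z * Yv x w)) * Wx n a b n (cpsi v) x rs +
      (\<Sum>r\<in>set rs. cst (- (odd_prop (cpsi v) y r / 2)) * To n a b n (cpsi v) x r w (remove1 r rs) (Yv x r * Z))))"
      using rr rem[OF _ rs] Xc Z y
      by (intro niceF_add niceF_mult_left niceF_sum niceF_cst_mult sk IH W nice_mult nice_const mult_carrier_mat) auto
    then show ?thesis using To_rec[of a b n x n rs y w Z] ab x rs y Z by simp
  qed
  ultimately show ?case using W by blast
qed

lemma niceF_d:
  assumes "\<And>ms. niceF n (\<lambda>v. t v ms)"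
  shows "niceF n (\<lambda>v. d_even i u (t v) ms)" "niceF n (\<lambda>v. d_odd i u (t v) ms)"
proof -
  show "niceF n (\<lambda>v. d_even i u (t v) ms)" unfolding d_even_eq by (intro niceF_mult_left assms)
  show "niceF n (\<lambda>v. d_odd i u (t v) ms)"
    unfolding d_odd_eq using niceF_mult_left[OF assms] by (cases "occ i u ms") (simp_all add: niceF_const)
qed

lemma niceF_Dop:
  fixes t :: "(nat \<Rightarrow> real) \<Rightarrow> 'k::{real_normed_field, euclidean_space} wc_tensor"
  assumes t: "\<And>ms. niceF n (\<lambda>v. t v ms)"
  shows "niceF n (\<lambda>v. Dop n a b n (cpsi v) (t v) ms)"
proof -
  have neg: "niceF n (\<lambda>v. - f v)" if "niceF n f" for f :: "(nat \<Rightarrow> real) \<Rightarrow> 'k fps"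
    using niceF_mult_left[OF that, of "-1"] by simp
  have e: "Dop n a b n (cpsi v) (t v) ms = (\<Sum>j\<le>n. \<Sum>i<j. fps_X * (cst (cpsi v i j) * (cst (1/2) *
      (\<Sum>l<n. d_even i l (d_even j (n + l) (t v)) ms + - d_even i (n + l) (d_even j l (t v)) ms) +
      cst (1/2) * (\<Sum>u<a + b. \<Sum>w<a + b. cst (h_form a b u w) * d_odd j w (d_odd i u (t v)) ms))))" for v
    by (simp add: Dop_def alpha_op_def g_op_def mult.assoc)
  show ?thesis unfolding e
    by (intro niceF_sum niceF_mult_left niceF_cst_mult nice_cpsi niceF_add neg niceF_d t) auto
qed

lemma niceF_funpow_Dop: "niceF n (\<lambda>v. (Dop n a b n (cpsi v) ^^ q) t ms)"
  for t :: "'k::{real_normed_field, euclidean_space} wc_tensor"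
  by (induction q arbitrary: ms) (auto intro: niceF_const niceF_Dop)

lemma niceF_exp_pair_op: "niceF n (\<lambda>v. exp_pair_op n a b n (cpsi v) t ms)"
  for t :: "'k::{real_normed_field, euclidean_space} wc_tensor"
  unfolding niceF_def exp_pair_op_eq exp_op_def
proof (intro allI)
  fix N
  have "nice n (\<lambda>v. \<Sum>q\<le>N. (1 / fact q) * fps_nth ((Dop n a b n (cpsi v) ^^ q) t ms) N)"
    by (intro nice_sum nice_mult nice_const niceF_funpow_Dop[unfolded niceF_def, rule_format])
  then show "nice n (\<lambda>v. fps_nth (Abs_fps (\<lambda>N. \<Sum>q\<le>N. fps_nth ((Dop n a b n (cpsi v) ^^ q) t ms) N / fact q)) N)"
    by simp
qed

text \<open>\<open>Upsilon\<close> is a finite linear combination of coefficients of its argument,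
  so it may be taken under the integral.\<close>

lemma P_form_eq:
  fixes xs :: "'k::{real_normed_field, euclidean_space} lie list"
  assumes ab: "a \<le> b" and xs: "length xs = n" "set xs \<subseteq> lie_alg n a b"
  shows "P_form n a b xs = fexp n (\<lambda>v. Wx n a b n (cpsi v) (\<lambda>r. xs ! (r - 1)) [1..<Suc n])"
proof (rule fps_ext)
  fix N
  let ?t = "tensor (Theta a b # map (Phi n a b) xs)"
  let ?F = "factorizations n (top_mono a b)"
  have om: "omega_op n a b v = exp_pair_op n a b n (cpsi v)" for v
    by (simp add: omega_op_def cpsi_def[abs_def])
  have x: "(\<lambda>r. xs ! (r - 1)) r \<in> lie_alg n a b" if "r \<in> {1..n}" for r
    using that xs nth_mem[of "r - 1" xs] by auto
  have m: "xs = map (\<lambda>r. xs ! (r - 1)) [1..<Suc n]"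
    using xs(1) by (intro nth_equalityI) (auto simp del: upt_Suc)
  have "fps_nth (P_form n a b xs) N = (\<Sum>ms\<in>?F. (berezin_sign a b * sort_sign ms) * cubeI n (\<lambda>v. fps_nth (exp_pair_op n a b n (cpsi v) ?t ms) N))"
    by (simp add: P_form_def Upsilon_nth cube_integral_def cubeI_def om)
  also have "\<dots> = cubeI n (\<lambda>v. \<Sum>ms\<in>?F. (berezin_sign a b * sort_sign ms) * fps_nth (exp_pair_op n a b n (cpsi v) ?t ms) N)"
    unfolding cubeI_cmult[symmetric] using niceF_exp_pair_op[of n a b ?t]
    by (intro cubeI_sum[symmetric] nice_mult nice_const) (auto simp: niceF_def)
  also have "\<dots> = cubeI n (\<lambda>v. fps_nth (Upsilon a b n (exp_pair_op n a b n (cpsi v) ?t)) N)"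
    by (simp add: Upsilon_nth)
  also have "\<dots> = cubeI n (\<lambda>v. fps_nth (Wx n a b n (cpsi v) (\<lambda>r. xs ! (r - 1)) [1..<Suc n]) N)"
    using Upsilon_Phi[OF ab, of n "\<lambda>r. xs ! (r - 1)" n xs] x m by simp
  finally show "fps_nth (P_form n a b xs) N = fps_nth (fexp n (\<lambda>v. Wx n a b n (cpsi v) (\<lambda>r. xs ! (r - 1)) [1..<Suc n])) N"
    by (simp add: fexp_def)
qed

text \<open>The three definitions stand under hypotheses on \<open>a\<close>, \<open>b\<close>,
  \<open>k\<close> and the vertices; the choice \<open>a = b = k = 0\<close> satisfies all of
  them.\<close>

lemma vertex_data: "Xv x r = fst (x r)" "Yv x r = fst (snd (x r))" "zv x r = snd (snd (x r))"
  using Xv_def[where a = 0 and b = 0 and k = 0] Yv_def[where a = 0 and b = 0 and k = 0] zv_def[where a = 0 and b = 0 and k = 0] by auto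

lemma P_form_Ad:
  fixes xs :: "'k::{real_normed_field, euclidean_space} lie list"
  assumes ab: "a \<le> b" and xs: "length xs = n" "set xs \<subseteq> lie_alg n a b" and g: "g \<in> adj_group n a b"
  shows "P_form n a b (map (Ad g) xs) = P_form n a b xs"
proof -
  obtain g1 g2 g3 where g3: "g = (g1, g2, g3)" by (metis prod_cases3)
  note c = adj_group_conj[OF g[unfolded g3]]
  have x: "xs ! (r - 1) \<in> lie_alg n a b" "map (Ad g) xs ! (r - 1) = Ad g (xs ! (r - 1))" if "r \<in> {1..n}" for r
    using that xs nth_mem[of "r - 1" xs] by auto
  have x': "map (Ad g) xs ! (r - 1) \<in> lie_alg n a b" if "r \<in> {1..n}" for r
    using x[OF that] Ad_lie_alg[OF g] by simp
  have Ad: "Xv (\<lambda>r. map (Ad g) xs ! (r - 1)) r = g1 * Xv (\<lambda>r. xs ! (r - 1)) r * mat_inv g1"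
    "Yv (\<lambda>r. map (Ad g) xs ! (r - 1)) r = g2 * Yv (\<lambda>r. xs ! (r - 1)) r * mat_inv g2"
    "zv (\<lambda>r. map (Ad g) xs ! (r - 1)) r = zv (\<lambda>r. xs ! (r - 1)) r" if "r \<in> {1..n}" for r
  proof -
    obtain X Y z where e: "xs ! (r - 1) = (X, Y, z)" by (metis prod_cases3)
    show "Xv (\<lambda>r. map (Ad g) xs ! (r - 1)) r = g1 * Xv (\<lambda>r. xs ! (r - 1)) r * mat_inv g1"
      "Yv (\<lambda>r. map (Ad g) xs ! (r - 1)) r = g2 * Yv (\<lambda>r. xs ! (r - 1)) r * mat_inv g2"
      "zv (\<lambda>r. map (Ad g) xs ! (r - 1)) r = zv (\<lambda>r. xs ! (r - 1)) r"
      unfolding vertex_data x(2)[OF that] e by (simp_all add: g3)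
  qed
  have W: "Wx n a b n (cpsi v) (\<lambda>r. map (Ad g) xs ! (r - 1)) [1..<Suc n] = Wx n a b n (cpsi v) (\<lambda>r. xs ! (r - 1)) [1..<Suc n]" for v
    by (rule conjunct1[OF Wx_cong[OF ab, where R = "{1..n}" and g = g1 and g' = "mat_inv g1" and h = g2 and h' = "mat_inv g2"]])
      (use x(1) x' c Ad in auto)
  have s: "set (map (Ad g) xs) \<subseteq> lie_alg n a b"
    using Ad_lie_alg[OF g] xs(2) by (metis (no_types, lifting) image_subset_iff set_map subsetD)
  show ?thesis
    unfolding P_form_eq[OF ab xs] P_form_eq[OF ab _ s, unfolded length_map, OF xs(1)] W ..
qed

lemma ad_average_P_form:
  fixes xs :: "'k::{real_normed_field, euclidean_space} lie list"
  assumes ab: "a \<le> b" and xs: "length xs = n" "set xs \<subseteq> lie_alg n a b"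
  shows "ad_average n a b n (P_form n a b) xs = P_form n a b xs"
proof -
  have "\<forall>\<gamma>\<in>(\<lambda>g. map (Ad g)) ` adj_group n a b. \<forall>ys\<in>{xs. length xs = n \<and> set xs \<subseteq> lie_alg n a b}.
      P_form n a b (\<gamma> ys) = P_form n a b ys"
    using P_form_Ad[OF ab] by blast
  moreover have "(\<lambda>g. map (Ad g)) ` (adj_group n a b :: 'k lie set) \<noteq> {}"
    using adj_group_nonempty by blast
  ultimately show ?thesis
    unfolding ad_average_def using xs by (intro average_invariant) auto
qed

subsection \<open>Logarithmic derivative of the genus\<close>

abbreviation tD :: "'r::comm_ring_1 fps \<Rightarrow> 'r fps" where
  "tD f \<equiv> fps_X * fps_deriv f"

lemma tD_mult: "tD (f * g) = tD f * g + f * tD g"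
  by (simp add: algebra_simps)

lemma tD_prod:
  assumes "finite S"
  shows "tD (\<Prod>j\<in>S. f j) = (\<Sum>k\<in>S. \<Prod>j\<in>S. if j = k then tD (f j) else f j)"
  using assms
proof induction
  case (insert x S)
  have "(\<Prod>j\<in>insert x S. if j = k then tD (f j) else f j) = f x * (\<Prod>j\<in>S. if j = k then tD (f j) else f j)" if "k \<in> S" for k
    using that insert.hyps by (subst prod.insert) auto
  then have "(\<Sum>k\<in>S. \<Prod>j\<in>insert x S. if j = k then tD (f j) else f j) = f x * tD (\<Prod>j\<in>S. f j)"
    by (simp add: insert.IH sum_distrib_left)
  moreover have "(\<Prod>j\<in>insert x S. if j = x then tD (f j) else f j) = tD (f x) * (\<Prod>j\<in>S. f j)"
  proof -
    have "(\<Prod>j\<in>S. if j = x then tD (f j) else f j) = (\<Prod>j\<in>S. f j)"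
      using insert.hyps by (intro prod.cong) auto
    then show ?thesis using insert.hyps by (subst prod.insert) auto
  qed
  moreover have "tD (\<Prod>j\<in>insert x S. f j) = tD (f x) * (\<Prod>j\<in>S. f j) + f x * tD (\<Prod>j\<in>S. f j)"
    unfolding prod.insert[OF insert.hyps] tD_mult ..
  ultimately show ?case unfolding sum.insert[OF insert.hyps] by (simp only:)
qed simp

text \<open>Jacobi's formula without inverting \<open>F\<close>. Differentiating column
  \<open>k\<close> replaces it by \<open>F\<close> times column \<open>k\<close> of
  \<open>L\<close>, and by Cramer's rule the determinant is then multiplied by the entry
  \<open>L $$ (k, k)\<close>.\<close>

lemma tD_det:
  fixes F :: "'r::comm_ring_1 fps mat"
  assumes F: "F \<in> carrier_mat m m" and L: "L \<in> carrier_mat m m" and d: "map_mat tD F = F * L"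
  shows "tD (Determinant.det F) = (\<Sum>k<m. L $$ (k, k)) * Determinant.det F"
proof -
  let ?R = "\<lambda>k. replace_col F (F *\<^sub>v col L k) k"
  have sg: "tD (signof p * g) = signof p * tD g" for p :: "nat \<Rightarrow> nat" and g :: "'r fps"
    by (simp add: sign_def algebra_simps)
  have R: "?R k \<in> carrier_mat m m" for k using F by (simp add: replace_col_def)
  have ent: "?R k $$ (i, j) = (if j = k then tD (F $$ (i, j)) else F $$ (i, j))" if "i < m" "j < m" for i j k
  proof -
    have "(F * L) $$ (i, j) = tD (F $$ (i, j))" using that F by (simp flip: d)
    then have "(F *\<^sub>v col L j) $ i = tD (F $$ (i, j))" using that F L by simp
    then show ?thesis using that F by (auto simp: replace_col_def)
  qed
  have pm: "p j < m" if "p permutes {0..<m}" "j < m" for p j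
    using permutes_in_image[OF that(1), of j] that(2) by auto
  have "tD (Determinant.det F) = (\<Sum>p | p permutes {0..<m}. tD (signof p * (\<Prod>j<m. F $$ (p j, j))))"
    unfolding det_col[OF F] by (simp add: fps_deriv_sum sum_distrib_left)
  also have "\<dots> = (\<Sum>p | p permutes {0..<m}. \<Sum>k<m. signof p * (\<Prod>j<m. ?R k $$ (p j, j)))"
  proof (rule sum.cong[OF refl])
    fix p assume p: "p \<in> {p. p permutes {0..<m}}"
    have "tD (\<Prod>j<m. F $$ (p j, j)) = (\<Sum>k<m. \<Prod>j<m. ?R k $$ (p j, j))"
      unfolding tD_prod[OF finite_lessThan] using p pm
      by (intro sum.cong[OF refl] prod.cong[OF refl]) (simp add: ent)
    then show "tD (signof p * (\<Prod>j<m. F $$ (p j, j))) = (\<Sum>k<m. signof p * (\<Prod>j<m. ?R k $$ (p j, j)))"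
      unfolding sg by (simp only: sum_distrib_left)
  qed
  also have "\<dots> = (\<Sum>k<m. Determinant.det (?R k))"
    unfolding det_col[OF R] by (rule sum.swap)
  also have "\<dots> = (\<Sum>k<m. L $$ (k, k) * Determinant.det F)"
    using L by (intro sum.cong[OF refl], subst cramer_lemma_mat[OF F]) auto
  finally show ?thesis by (simp add: sum_distrib_right)
qed

section \<open>Power series evaluated at a matrix\<close>

lemma pow_mat_plus:
  assumes "X \<in> carrier_mat m m"
  shows "X ^\<^sub>m (p + q) = X ^\<^sub>m p * X ^\<^sub>m q"
proof (induction q)
  case (Suc q)
  have "X ^\<^sub>m (p + Suc q) = X ^\<^sub>m p * X ^\<^sub>m q * X" by (simp add: Suc)
  also have "\<dots> = X ^\<^sub>m p * (X ^\<^sub>m q * X)" by (rule assoc_mult_mat) (use assms in auto)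
  finally show ?case by simp
qed (use assms in simp)

lemma scaled_mat_carrier: "X \<in> carrier_mat m m \<Longrightarrow> scaled_mat f X \<in> carrier_mat m m"
  by (simp add: scaled_mat_def)

text \<open>Powers of one matrix multiply like powers of the variable. Evaluation at
  \<open>X\<close> therefore turns the scalar identity \<open>f * l = tD f\<close> into the matrix
  identity that \<open>tD_det\<close> asks for.\<close>

lemma scaled_mat_mult:
  assumes X: "X \<in> carrier_mat m m"
  shows "scaled_mat f X * scaled_mat g X = scaled_mat (f * g) X"
proof (rule eq_matI)
  fix i j assume "i < dim_row (scaled_mat (f * g) X)" "j < dim_col (scaled_mat (f * g) X)"
  then have ij: "i < m" "j < m" using X by (auto simp: scaled_mat_def)
  have P: "(X ^\<^sub>m k) \<in> carrier_mat m m" for k using X by simp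
  have e: "fps_nth (scaled_mat h X $$ (u, w)) k = cst (fps_nth h k * (X ^\<^sub>m k) $$ (u, w)) * fps_X ^ k" if "u < m" "w < m" for h u w k
    using that X by (simp add: scaled_mat_def)
  have "(scaled_mat f X * scaled_mat g X) $$ (i, j) = (\<Sum>q<m. scaled_mat f X $$ (i, q) * scaled_mat g X $$ (q, j))"
    by (rule mat_mult_entry[OF scaled_mat_carrier[OF X] scaled_mat_carrier[OF X] ij])
  also have "\<dots> = scaled_mat (f * g) X $$ (i, j)"
  proof (rule fps_ext)
    fix k
    have "fps_nth (\<Sum>q<m. scaled_mat f X $$ (i, q) * scaled_mat g X $$ (q, j)) k =
      (\<Sum>q<m. \<Sum>p=0..k. cst (fps_nth f p * fps_nth g (k - p) * ((X ^\<^sub>m p) $$ (i, q) * (X ^\<^sub>m (k - p)) $$ (q, j))) * fps_X ^ k)"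
      unfolding fps_sum_nth fps_mult_nth
    proof (intro sum.cong[OF refl])
      fix q p assume q: "q \<in> {..<m}" and p: "p \<in> {0..k}"
      have "fps_X ^ p * fps_X ^ (k - p) = (fps_X ^ k :: 'a fps)" using p by (simp flip: power_add)
      then have "A * fps_X ^ p * (B * fps_X ^ (k - p)) = A * B * (fps_X ^ k :: 'a fps)" for A B
        by (metis mult.assoc mult.left_commute)
      then have c: "cst A * fps_X ^ p * (cst B * fps_X ^ (k - p)) = cst (A * B) * (fps_X ^ k :: 'a fps)" for A B
        by (simp only: fps_const_mult)
      have q': "q < m" using q by simp
      show "fps_nth (scaled_mat f X $$ (i, q)) p * fps_nth (scaled_mat g X $$ (q, j)) (k - p) =
         cst (fps_nth f p * fps_nth g (k - p) * ((X ^\<^sub>m p) $$ (i, q) * (X ^\<^sub>m (k - p)) $$ (q, j))) * fps_X ^ k"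
        unfolding e[OF ij(1) q'] e[OF q' ij(2)] c by (simp only: mult_ac)
    qed
    also have "\<dots> = (\<Sum>p=0..k. cst (fps_nth f p * fps_nth g (k - p) * (\<Sum>q<m. (X ^\<^sub>m p) $$ (i, q) * (X ^\<^sub>m (k - p)) $$ (q, j))) * fps_X ^ k)"
      by (subst sum.swap) (simp add: sum_distrib_left sum_distrib_right cst_sum)
    also have "\<dots> = (\<Sum>p=0..k. cst (fps_nth f p * fps_nth g (k - p) * (X ^\<^sub>m k) $$ (i, j)) * fps_X ^ k)"
    proof (rule sum.cong[OF refl])
      fix p assume "p \<in> {0..k}"
      then have "X ^\<^sub>m k = X ^\<^sub>m p * X ^\<^sub>m (k - p)" using pow_mat_plus[OF X, of p "k - p"] by simp
      then have "(X ^\<^sub>m k) $$ (i, j) = (\<Sum>q<m. (X ^\<^sub>m p) $$ (i, q) * (X ^\<^sub>m (k - p)) $$ (q, j))"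
        using mat_mult_entry[OF P P ij] by simp
      then show "cst (fps_nth f p * fps_nth g (k - p) * (\<Sum>q<m. (X ^\<^sub>m p) $$ (i, q) * (X ^\<^sub>m (k - p)) $$ (q, j))) * fps_X ^ k =
        cst (fps_nth f p * fps_nth g (k - p) * (X ^\<^sub>m k) $$ (i, j)) * fps_X ^ k" by simp
    qed
    also have "\<dots> = fps_nth (scaled_mat (f * g) X $$ (i, j)) k"
      using ij by (simp add: e fps_mult_nth sum_distrib_right cst_sum)
    finally show "fps_nth (\<Sum>q<m. scaled_mat f X $$ (i, q) * scaled_mat g X $$ (q, j)) k = fps_nth (scaled_mat (f * g) X $$ (i, j)) k" .
  qed
  finally show "(scaled_mat f X * scaled_mat g X) $$ (i, j) = scaled_mat (f * g) X $$ (i, j)" .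
qed (use X in \<open>auto simp: scaled_mat_def\<close>)

lemma tD_scaled_mat: "map_mat tD (scaled_mat f X) = scaled_mat (tD f) X"
proof (rule eq_matI)
  fix i j assume "i < dim_row (scaled_mat (tD f) X)" "j < dim_col (scaled_mat (tD f) X)"
  then show "map_mat tD (scaled_mat f X) $$ (i, j) = scaled_mat (tD f) X $$ (i, j)"
    unfolding fps_mult_fps_X_deriv_shift
    by (auto simp: scaled_mat_def fps_eq_iff mult.assoc fps_X_power_nth simp flip: fps_of_nat)
qed (auto simp: scaled_mat_def)

lemma tD_det_scaled:
  assumes X: "X \<in> carrier_mat m m" and l: "f * l = tD f"
  shows "tD (Determinant.det (scaled_mat f X)) =
    Abs_fps (\<lambda>k. cst (fps_nth l k * mtr m (X ^\<^sub>m k)) * fps_X ^ k) * Determinant.det (scaled_mat f X)"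
proof -
  have tr: "(\<Sum>k<m. scaled_mat l X $$ (k, k)) = Abs_fps (\<lambda>k. cst (fps_nth l k * mtr m (X ^\<^sub>m k)) * fps_X ^ k)"
    using X by (auto simp: fps_eq_iff fps_sum_nth scaled_mat_def mtr_def sum_distrib_left sum_distrib_right fps_X_power_nth)
  have d: "map_mat tD (scaled_mat f X) = scaled_mat f X * scaled_mat l X"
    unfolding tD_scaled_mat scaled_mat_mult[OF X] l ..
  show ?thesis
    unfolding tr[symmetric] by (rule tD_det[OF scaled_mat_carrier[OF X] scaled_mat_carrier[OF X] d])
qed

lemma det_scaled_0:
  fixes X :: "'k::comm_ring_1 mat"
  assumes X: "X \<in> carrier_mat m m" and f: "fps_nth f 0 = 1"
  shows "fps_nth (Determinant.det (scaled_mat f X)) 0 = 1"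
proof -
  interpret h: comm_ring_hom "\<lambda>f :: 'k fps fps. fps_nth f 0"
    by unfold_locales simp_all
  have "map_mat (\<lambda>f. fps_nth f 0) (scaled_mat f X) = 1\<^sub>m m"
    using X f by (intro eq_matI) (auto simp: scaled_mat_def)
  then show ?thesis using h.hom_det[of "scaled_mat f X"] by simp
qed

text \<open>Uniqueness is known; for existence, the binomial series with exponent \<open>1/2\<close>
  is lifted to constant coefficients in the ring of power series and \<open>f - 1\<close> is
  substituted.\<close>

lemma sqrt_series:
  fixes f :: "'k::field_char_0 fps fps"
  assumes f: "fps_nth f 0 = 1"
  shows "fps_nth (sqrt_series f) 0 = 1" "sqrt_series f * sqrt_series f = f"
proof -
  define B where "B = (fps_binomial (1/2) :: 'k fps)"
  define C where "C = Abs_fps (\<lambda>k. cst (fps_nth B k))"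
  have "B * B = 1 + fps_X"
    unfolding B_def fps_binomial_add_mult[symmetric] by (simp add: fps_binomial_1)
  then have BB: "(\<Sum>i=0..k. fps_nth B i * fps_nth B (k - i)) = fps_nth (1 + fps_X) k" for k
    by (simp flip: fps_mult_nth)
  have CC: "C * C = 1 + fps_X"
  proof (rule fps_ext)
    fix k
    have "fps_nth (C * C) k = cst (\<Sum>i=0..k. fps_nth B i * fps_nth B (k - i))"
      by (simp add: fps_mult_nth C_def cst_sum)
    also have "\<dots> = fps_nth (1 + fps_X) k" unfolding BB by simp
    finally show "fps_nth (C * C) k = fps_nth (1 + fps_X) k" .
  qed
  have z: "fps_nth (f - 1) 0 = 0" using f by simp
  have "(C oo (f - 1)) * (C oo (f - 1)) = f"
    unfolding fps_compose_mult_distrib[OF z, symmetric] CC fps_compose_add_distrib fps_X_fps_compose_startby0[OF z] by simp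
  moreover have "fps_nth (C oo (f - 1)) 0 = 1" by (simp add: C_def B_def)
  moreover have "(2 :: 'k fps) \<noteq> 0" by simp
  ultimately have "sqrt_series f = C oo (f - 1)" by (intro sqrt_series_unique)
  then show "fps_nth (sqrt_series f) 0 = 1" "sqrt_series f * sqrt_series f = f"
    using \<open>(C oo (f - 1)) * (C oo (f - 1)) = f\<close> \<open>fps_nth (C oo (f - 1)) 0 = 1\<close> by auto
qed

text \<open>\<open>logd 1\<close> and \<open>logd (-1)\<close> are \<open>X f' / f\<close> for \<open>f = A_series\<close> and \<open>f = cosh_series\<close>.\<close>

definition logd :: "'k::field_char_0 \<Rightarrow> 'k fps" where
  "logd \<sigma> = (if \<sigma> = 1 then 1 - cst (1/2) * fps_X - Zs 1 else cst (1/2) * fps_X - Zs (-1))"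

text \<open>The logarithmic derivative of \<open>(X/2) / sinh (X/2)\<close> is
  \<open>1 - (X/2) coth (X/2)\<close>, and \<open>(X/2) coth (X/2) = X/2 + X / (e^X - 1)\<close>.
  The identity is checked after multiplication by the nonzero series
  \<open>2 sinh (X/2)\<close>.\<close>

lemma logd_A: "A_series * logd 1 = tD (A_series :: 'k::field_char_0 fps)"
proof -
  let ?p = "fps_exp (1/2) :: 'k fps" and ?m = "fps_exp (-(1/2)) :: 'k fps" and ?A = "A_series :: 'k fps"
  let ?D = "?p - ?m"
  let ?h = "cst (1/2) :: 'k fps"
  have h: "?h + ?h = 1" by (simp add: fps_eq_iff)
  have AD: "?A * ?D = fps_X" by (rule A_series_mult)
  have dD: "fps_deriv ?D = ?h * (?p + ?m)"
    by (simp add: algebra_simps flip: fps_const_neg)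
  have e: "fps_deriv ?A * ?D + ?A * (?h * (?p + ?m)) = 1"
    using arg_cong[OF AD, of fps_deriv] by (simp add: dD add.commute del: fps_deriv_sub)
  have "?D * (?A * logd 1) = ?A * (?D - fps_X * (?h * (?p + ?m)))"
  proof -
    have "Zs 1 * ?D = (?A * ?D) * ?m" by (simp add: Zs_def mult_ac)
    then have "Zs 1 * ?D = fps_X * ?m" unfolding AD .
    then have "?D * logd 1 = ?D - ?h * fps_X * ?D - fps_X * ?m" by (simp add: logd_def algebra_simps)
    also have "fps_X * ?m = (?h + ?h) * (fps_X * ?m)" unfolding h by simp
    also have "?D - ?h * fps_X * ?D - (?h + ?h) * (fps_X * ?m) = ?D - fps_X * (?h * (?p + ?m))"
      by (simp only: algebra_simps)
    finally show ?thesis by (simp only: mult.left_commute[of ?D])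
  qed
  also have "\<dots> = fps_X - fps_X * (?A * (?h * (?p + ?m)))"
    using AD by (simp only: right_diff_distrib mult.left_commute[of ?A])
  also have "\<dots> = fps_X * (1 - ?A * (?h * (?p + ?m)))" by (simp only: right_diff_distrib mult_1_right)
  also have "1 - ?A * (?h * (?p + ?m)) = fps_deriv ?A * ?D" using e by (simp only: eq_diff_eq diff_eq_eq)
  also have "fps_X * (fps_deriv ?A * ?D) = ?D * tD ?A" by (simp only: mult_ac)
  finally have "?D * (?A * logd 1) = ?D * tD ?A" .
  moreover have "?D \<noteq> 0" using AD by auto
  ultimately show ?thesis by simp
qed

text \<open>Here the logarithmic derivative is
  \<open>(X/2) tanh (X/2) = X/2 - X / (e^X + 1)\<close>.\<close>

lemma logd_cosh: "cosh_series * logd (-1) = tD (cosh_series :: 'k::field_char_0 fps)"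
proof -
  let ?p = "fps_exp (1/2) :: 'k fps" and ?m = "fps_exp (-(1/2)) :: 'k fps"
  let ?h = "cst (1/2) :: 'k fps"
  have h: "?h + ?h = 1" by (simp add: fps_eq_iff)
  have pm: "?p * ?p = fps_exp 1" "?p * ?m = 1" by (simp_all flip: fps_exp_add_mult)
  have "Zs (-1) * (fps_exp 1 + 1) = (fps_X :: 'k fps)" using Zs_mult[of "-1 :: 'k"] by (simp flip: fps_const_neg)
  then have "Zs (-1) * ((?p + ?m) * ?p) * ?m = fps_X * ?m" by (simp add: distrib_right pm mult.commute[of ?m])
  then have z: "Zs (-1) * (?p + ?m) = fps_X * ?m" by (simp add: mult.assoc pm)
  have d: "tD (cosh_series :: 'k fps) = fps_X * (?h * (?h * (?p - ?m)))"
    unfolding cosh_series_def by (simp add: algebra_simps flip: fps_const_neg)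
  have "cosh_series * logd (-1) = ?h * (?h * fps_X * (?p + ?m) - Zs (-1) * (?p + ?m))"
    by (simp add: cosh_series_def logd_def algebra_simps del: fps_const_mult)
  also have "\<dots> = ?h * (?h * fps_X * (?p + ?m) - (?h + ?h) * (fps_X * ?m))" unfolding z h by simp
  also have "\<dots> = tD cosh_series" unfolding d by (simp only: algebra_simps)
  finally show ?thesis .
qed

text \<open>Both genus series are even with constant coefficient 1, so the recursion for the
  coefficients of \<open>tD f\<close> forces the odd coefficients of the logarithmic derivative to
  vanish. From degree 2 on it is \<open>- Zs \<sigma>\<close> by construction.\<close>

lemma logd_nth:
  fixes \<sigma> :: "'k::field_char_0"
  assumes s: "\<sigma> = 1 \<or> \<sigma> = -1"
  shows "fps_nth (logd \<sigma>) 0 = 0" "odd k \<Longrightarrow> fps_nth (logd \<sigma>) k = 0" "k \<ge> 2 \<Longrightarrow> fps_nth (logd \<sigma>) k = - fps_nth (Zs \<sigma>) k"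
proof -
  obtain f :: "'k fps" where f: "f * logd \<sigma> = tD f" "fps_nth f 0 = 1" "\<And>k. odd k \<Longrightarrow> fps_nth f k = 0"
  proof (cases "\<sigma> = 1")
    case True
    then show ?thesis using that[of A_series] logd_A A_series_0 A_series_odd by metis
  next
    case False
    then show ?thesis using that[of cosh_series] logd_cosh s by (auto simp: cosh_series_nth)
  qed
  have z: "(\<Sum>i=0..k. fps_nth f i * fps_nth (logd \<sigma>) (k - i)) = of_nat k * fps_nth f k" for k
    using arg_cong[OF f(1), of "\<lambda>g. fps_nth g k"] by (simp add: fps_mult_nth[of f] fps_mult_fps_X_deriv_shift)
  show "fps_nth (logd \<sigma>) 0 = 0" using z[of 0] f(2) by simp
  show "fps_nth (logd \<sigma>) k = 0" if "odd k" for k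
    using that
  proof (induction k rule: less_induct)
    case (less k)
    have "fps_nth f i * fps_nth (logd \<sigma>) (k - i) = 0" if "i \<in> {0..k} - {0}" for i
    proof (cases "odd i")
      case False
      then have "fps_nth (logd \<sigma>) (k - i) = 0" using that less.prems by (intro less.IH) auto
      then show ?thesis by simp
    qed (simp add: f(3))
    then have "(\<Sum>i\<in>{0..k} - {0}. fps_nth f i * fps_nth (logd \<sigma>) (k - i)) = 0" by (simp add: sum.neutral)
    then show ?case using z[of k] f(2) f(3)[OF less.prems] sum.remove[of "{0..k}" 0 "\<lambda>i. fps_nth f i * fps_nth (logd \<sigma>) (k - i)"] by simp
  qed
  show "fps_nth (logd \<sigma>) k = - fps_nth (Zs \<sigma>) k" if "k \<ge> 2"
    using that s by (auto simp: logd_def)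
qed

lemma Zs_odd:
  fixes \<sigma> :: "'k::field_char_0"
  assumes "\<sigma> = 1 \<or> \<sigma> = -1" "odd k" "k \<ge> 2"
  shows "fps_nth (Zs \<sigma>) k = 0"
  using logd_nth(2)[OF assms(1,2)] logd_nth(3)[OF assms(1,3)] by simp

text \<open>The kernels are real while the traces lie in the ground field. The embedded real series
  solves the same equation \<open>Z * (e^z - \<sigma>) = z\<close>, and division by a nonzero series
  is unique.\<close>

lemma Zs_of_real:
  assumes s: "\<sigma> = 1 \<or> \<sigma> = -1"
  shows "fps_nth (Zs (of_real \<sigma>)) k = (of_real (fps_nth (Zs \<sigma>) k) :: 'k::real_normed_field)"
proof -
  define H :: "real fps \<Rightarrow> 'k fps" where "H f = Abs_fps (\<lambda>k. of_real (fps_nth f k))" for f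
  have Hm: "H (f * g) = H f * H g" for f g by (simp add: H_def fps_eq_iff fps_mult_nth)
  have HE: "H (fps_exp 1 - cst \<sigma>) = fps_exp 1 - cst (of_real \<sigma>)" by (auto simp: H_def fps_eq_iff fps_exp_def)
  have "H (Zs \<sigma>) * (fps_exp 1 - cst (of_real \<sigma>)) = H fps_X"
    unfolding HE[symmetric] Hm[symmetric] Zs_mult[OF s] ..
  also have "H fps_X = fps_X" by (auto simp: H_def fps_eq_iff fps_X_def)
  also have "fps_X = Zs (of_real \<sigma>) * (fps_exp 1 - cst (of_real \<sigma> :: 'k))"
    using s by (intro Zs_mult[symmetric]) auto
  finally have e: "H (Zs \<sigma>) * (fps_exp 1 - cst (of_real \<sigma>)) = Zs (of_real \<sigma>) * (fps_exp 1 - cst (of_real \<sigma>))" .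
  have "fps_nth (fps_exp 1 - cst (of_real \<sigma> :: 'k)) 1 \<noteq> 0" by (simp add: fps_exp_def)
  then have "fps_exp 1 - cst (of_real \<sigma> :: 'k) \<noteq> 0" by (metis fps_zero_nth)
  then have "H (Zs \<sigma>) = Zs (of_real \<sigma>)" using e by simp
  then show ?thesis by (simp add: H_def fps_eq_iff)
qed

text \<open>The operator \<open>tD\<close> in the ray variable is applied to the square root times
  the exponential. Jacobi's formula gives traces of powers, the square root gives the factor
  \<open>1/2\<close>, and the terms \<open>m < 2\<close> drop out because the logarithmic
  derivatives start in degree 2.\<close>

lemma genus_rec:
  fixes X Y :: "'k::field_char_0 mat"
  assumes X: "X \<in> carrier_mat M M" and Y: "Y \<in> carrier_mat N N"
  shows "fps_nth (genus (X, Y, z)) 0 = 1"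
    and "of_nat (Suc k) * fps_nth (genus (X, Y, z)) (Suc k) = cst z * fps_nth (genus (X, Y, z)) k -
      cst (1/2) * (\<Sum>m=2..Suc k. cst (fps_nth (Zs 1) m * mtr M (X ^\<^sub>m m) + fps_nth (Zs (-1)) m * mtr N (Y ^\<^sub>m m)) * fps_X ^ m *
        fps_nth (genus (X, Y, z)) (Suc k - m))"
proof -
  define dA where "dA = Determinant.det (scaled_mat A_series X)"
  define dB where "dB = Determinant.det (scaled_mat cosh_series Y)"
  define s where "s = sqrt_series (dA * dB)"
  define E where "E = (scaled_exp z :: 'k fps fps)"
  define T where "T = Abs_fps (\<lambda>k. cst (fps_nth (logd 1) k * mtr M (X ^\<^sub>m k)) * fps_X ^ k) +
     Abs_fps (\<lambda>k. cst (fps_nth (logd (-1)) k * mtr N (Y ^\<^sub>m k)) * fps_X ^ k)"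
  define G where "G = genus (X, Y, z)"
  have G: "G = s * E" by (simp add: G_def s_def E_def dA_def dB_def)
  have d0: "fps_nth (dA * dB) 0 = 1"
    using det_scaled_0[OF X, of A_series] det_scaled_0[OF Y, of cosh_series] by (simp add: dA_def dB_def A_series_0 cosh_series_nth)
  note s = sqrt_series[OF d0, folded s_def]
  show "fps_nth (genus (X, Y, z)) 0 = 1"
    unfolding G_def[symmetric] G using s(1) by (simp add: E_def scaled_exp_def)
  have "tD (dA * dB) = T * (dA * dB)"
    unfolding tD_mult unfolding dA_def dB_def tD_det_scaled[OF X logd_A] tD_det_scaled[OF Y logd_cosh] T_def by (simp only: algebra_simps)
  \<comment> \<open>The equation \<open>s * s = dA * dB\<close> is differentiated and a factor
    \<open>s\<close> cancelled, so no derivative of a square root is required.\<close>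
  then have "tD s * s + s * tD s = T * (s * s)" unfolding s(2)[symmetric] tD_mult by simp
  then have "s * (2 * tD s) = s * (T * s)" by (simp add: algebra_simps)
  moreover have "s \<noteq> 0" using s(1) by auto
  ultimately have ts: "2 * tD s = T * s" by simp
  have tE: "tD E = fps_X * (fps_const (cst z) * E)"
  proof -
    have "of_nat (Suc q) * (z ^ Suc q / fact (Suc q)) = z * (z ^ q / fact q)" for q by (simp del: of_nat_Suc)
    then have "of_nat (Suc q) * cst (z ^ Suc q / fact (Suc q)) = cst z * cst (z ^ q / fact q)" for q
      by (simp only: fps_of_nat[symmetric] fps_const_mult)
    then have "fps_deriv E = fps_const (cst z) * E"
      by (intro fps_ext) (simp add: E_def scaled_exp_def del: of_nat_Suc fps_const_mult power_Suc fact_Suc)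
    then show ?thesis by simp
  qed
  have "2 * tD G = (2 * tD s) * E + 2 * (s * tD E)" unfolding G tD_mult by (simp only: algebra_simps)
  also have "\<dots> = T * G + 2 * (fps_X * (fps_const (cst z) * G))"
    unfolding ts tE G by (simp only: mult_ac)
  finally have "fps_nth (2 * tD G) (Suc k) = fps_nth (T * G + 2 * (fps_X * (fps_const (cst z) * G))) (Suc k)" by simp
  then have r: "2 * (of_nat (Suc k) * fps_nth G (Suc k)) = fps_nth (T * G) (Suc k) + 2 * (cst z * fps_nth G k)"
    unfolding mult_2 fps_add_nth by (simp del: of_nat_Suc)
  have T0: "fps_nth T m = - (cst (fps_nth (Zs 1) m * mtr M (X ^\<^sub>m m) + fps_nth (Zs (-1)) m * mtr N (Y ^\<^sub>m m)) * fps_X ^ m)" if "m \<ge> 2" for m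
    using logd_nth(3)[of "1 :: 'k" m] logd_nth(3)[of "-1 :: 'k" m] that
    by (simp add: T_def distrib_right flip: fps_const_add fps_const_neg)
  have T01: "fps_nth T m = 0" if "m < 2" for m
  proof -
    have "fps_nth (logd \<sigma>) m = 0" if "\<sigma> = 1 \<or> \<sigma> = -1" for \<sigma> :: 'k
      using logd_nth(1)[OF that] logd_nth(2)[OF that, of 1] \<open>m < 2\<close> by (cases "m = 0") (auto simp: less_2_cases_iff)
    then show ?thesis by (simp add: T_def)
  qed
  have "fps_nth (T * G) (Suc k) = (\<Sum>m=2..Suc k. fps_nth T m * fps_nth G (Suc k - m))"
    unfolding fps_mult_nth by (rule sum.mono_neutral_right) (auto simp: T01)
  also have "\<dots> = - (\<Sum>m=2..Suc k. cst (fps_nth (Zs 1) m * mtr M (X ^\<^sub>m m) + fps_nth (Zs (-1)) m * mtr N (Y ^\<^sub>m m)) * fps_X ^ m * fps_nth G (Suc k - m))" (is "_ = - ?S")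
    unfolding sum_negf[symmetric] by (rule sum.cong[OF refl]) (simp add: T0 del: fps_const_add fps_const_mult)
  finally have "2 * (of_nat (Suc k) * fps_nth G (Suc k)) = 2 * (cst z * fps_nth G k) - ?S" using r by simp
  then have "cst (1/2) * 2 * (of_nat (Suc k) * fps_nth G (Suc k)) = cst (1/2) * 2 * (cst z * fps_nth G k) - cst (1/2) * ?S"
    by (simp only: mult.assoc right_diff_distrib)
  moreover have "cst (1/2) * 2 = (1 :: 'k fps)" by (simp flip: numeral_fps_const)
  ultimately show "of_nat (Suc k) * fps_nth (genus (X, Y, z)) (Suc k) = cst z * fps_nth (genus (X, Y, z)) k -
      cst (1/2) * (\<Sum>m=2..Suc k. cst (fps_nth (Zs 1) m * mtr M (X ^\<^sub>m m) + fps_nth (Zs (-1)) m * mtr N (Y ^\<^sub>m m)) * fps_X ^ m *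
        fps_nth (genus (X, Y, z)) (Suc k - m))"
    unfolding G_def[symmetric] by simp
qed

subsection \<open>Integrating the loops\<close>

lemma iint_ae:
  assumes "finite F" and "\<And>u. u \<in> {0<..<1} \<Longrightarrow> u \<notin> F \<Longrightarrow> g u = h u"
  shows "iint g = iint h"
proof (rule fps_ext)
  fix N
  have "(\<integral>u. indicator {0..1} u *\<^sub>R fps_nth (g u) N \<partial>lborel) = (\<integral>u. indicator {0..1} u *\<^sub>R fps_nth (h u) N \<partial>lborel)"
    by (rule integral_discrete_difference[where X = "insert 0 (insert 1 F)"])
      (use assms in \<open>auto simp: indicator_def countable_finite\<close>)
  then show "fps_nth (iint g) N = fps_nth (iint h) N"
    by (simp add: iint_def set_lebesgue_integral_def)
qed

lemma iint_lin:
  fixes A :: "'l \<Rightarrow> 'k::{real_normed_field, euclidean_space} fps"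
  assumes L: "finite L" and h: "\<And>l. l \<in> L \<Longrightarrow> set_integrable lborel {0..1} (h l)"
  shows "iint (\<lambda>u. \<Sum>l\<in>L. cst (of_real (h l u)) * A l) =
    (\<Sum>l\<in>L. cst (of_real (set_lebesgue_integral lborel {0..1} (h l))) * A l)"
proof (rule fps_ext)
  fix N
  have "(\<integral>u. indicator {0..1} u *\<^sub>R (\<Sum>l\<in>L. of_real (h l u) * fps_nth (A l) N) \<partial>lborel) =
    (\<integral>u. (\<Sum>l\<in>L. (indicator {0..1} u *\<^sub>R h l u) *\<^sub>R fps_nth (A l) N) \<partial>lborel)"
    by (simp add: scaleR_sum_right scaleR_conv_of_real mult.assoc sum_distrib_left)
  also have "\<dots> = (\<Sum>l\<in>L. \<integral>u. (indicator {0..1} u *\<^sub>R h l u) *\<^sub>R fps_nth (A l) N \<partial>lborel)"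
    using h by (intro Bochner_Integration.integral_sum integrable_scaleR_left) (simp add: set_integrable_def)
  also have "\<dots> = (\<Sum>l\<in>L. (\<integral>u. indicator {0..1} u *\<^sub>R h l u \<partial>lborel) *\<^sub>R fps_nth (A l) N)"
    using h by (intro sum.cong[OF refl] integral_scaleR_left) (simp add: set_integrable_def)
  also have "\<dots> = (\<Sum>l\<in>L. of_real (set_lebesgue_integral lborel {0..1} (h l)) * fps_nth (A l) N)"
    by (simp only: scaleR_conv_of_real set_lebesgue_integral_def)
  finally show "fps_nth (iint (\<lambda>u. \<Sum>l\<in>L. cst (of_real (h l u)) * A l)) N =
    fps_nth (\<Sum>l\<in>L. cst (of_real (set_lebesgue_integral lborel {0..1} (h l))) * A l) N"
    by (simp add: iint_def set_lebesgue_integral_def fps_sum_nth)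
qed

lemma iint_const: "iint (\<lambda>_. A) = A"
  using iint_lin[of "{()}" "\<lambda>_ _. 1" "\<lambda>_. A"] by (simp add: set_integrable_def set_lebesgue_integral_def)

text \<open>The common shape of even and odd chains when all vertices are equal. The accumulated
  matrix is then a power, so \<open>T\<close> is indexed by its exponent, and \<open>\<tau>\<close>
  gives the traces of powers. \<open>W_dep\<close> and \<open>T_dep\<close> let a coordinate be
  integrated once the slot carrying it has left the expression.\<close>

locale loop_kernel =
  fixes n :: nat and \<sigma> :: real
    and C :: "(nat \<Rightarrow> real) \<Rightarrow> nat \<Rightarrow> nat \<Rightarrow> 'k::{real_normed_field, euclidean_space}"
    and W :: "(nat \<Rightarrow> real) \<Rightarrow> nat list \<Rightarrow> 'k fps"
    and T :: "(nat \<Rightarrow> real) \<Rightarrow> nat \<Rightarrow> nat \<Rightarrow> nat list \<Rightarrow> nat \<Rightarrow> 'k fps"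
    and \<tau> :: "nat \<Rightarrow> 'k"
  assumes \<sigma>: "\<sigma> = 1 \<or> \<sigma> = -1"
    and C: "y \<in> {1..n} \<Longrightarrow> r \<in> {1..n} \<Longrightarrow> v y \<in> {0<..<1} \<Longrightarrow> v r \<in> {0<..<1} \<Longrightarrow> v y \<noteq> v r \<Longrightarrow>
      C v y r = - (2 * of_real (\<sigma> * Kf \<sigma> 1 (v y) (v r)))"
    and nice_C: "y \<in> {1..n} \<Longrightarrow> r \<in> {1..n} \<Longrightarrow> nice n (\<lambda>v. - (C v y r / d))"
    and nice_W: "distinct rs \<Longrightarrow> set rs \<subseteq> {1..n} \<Longrightarrow> niceF n (\<lambda>v. W v rs)"
    and nice_T: "distinct rs \<Longrightarrow> set rs \<subseteq> {1..n} \<Longrightarrow> y \<in> {1..n} \<Longrightarrow> w \<in> {1..n} \<Longrightarrow> niceF n (\<lambda>v. T v y w rs m)"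
    and W_dep: "distinct rs \<Longrightarrow> set rs \<subseteq> {1..n} \<Longrightarrow> (\<And>i. i \<in> set rs \<Longrightarrow> v i = v' i) \<Longrightarrow> W v rs = W v' rs"
    and T_dep: "distinct rs \<Longrightarrow> set rs \<subseteq> {1..n} \<Longrightarrow> y \<in> {1..n} \<Longrightarrow> w \<in> {1..n} \<Longrightarrow>
      (\<And>i. i \<in> insert y (insert w (set rs)) \<Longrightarrow> v i = v' i) \<Longrightarrow> T v y w rs m = T v' y w rs m"
    and T_rec: "distinct rs \<Longrightarrow> set rs \<subseteq> {1..n} \<Longrightarrow> y \<in> {1..n} \<Longrightarrow> w \<in> {1..n} \<Longrightarrow>
      T v y w rs m = fps_X * (cst (of_real \<sigma> * - (C v y w / 2) * \<tau> (Suc m)) * W v rs +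
        (\<Sum>r\<in>set rs. cst (- (C v y r / 2)) * T v r w (remove1 r rs) (Suc m)))"
begin

lemma ss: "\<sigma> * \<sigma> = 1" "of_real \<sigma> * of_real \<sigma> = (1 :: 'k)"
proof -
  show "\<sigma> * \<sigma> = 1" using \<sigma> by auto
  then show "of_real \<sigma> * of_real \<sigma> = (1 :: 'k)" by (simp flip: of_real_mult)
qed

lemma conv:
  assumes "s \<in> {0<..<1}" "t \<in> {0<..<1}"
  shows "iint (\<lambda>u. cst (of_real (Kf \<sigma> 1 s u)) * (D * (\<Sum>l\<le>k. cst (\<alpha> l * of_real (Kf \<sigma> (Suc l) u t)) * B l))) =
    D * (\<Sum>l\<le>k. cst (\<alpha> l * of_real (- \<sigma> * Kf \<sigma> (Suc (Suc l)) s t)) * (B l :: 'k fps))"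
proof -
  have st: "s \<in> {0..1}" "t \<in> {0..1}" using assms by auto
  have "cst (of_real (Kf \<sigma> 1 s u)) * (D * (\<Sum>l\<le>k. cst (\<alpha> l * of_real (Kf \<sigma> (Suc l) u t)) * B l)) =
      (\<Sum>l\<le>k. cst (of_real (Kf \<sigma> 1 s u * Kf \<sigma> (Suc l) u t)) * (D * (cst (\<alpha> l) * B l)))" for u
    unfolding sum_distrib_left of_real_mult fps_const_mult[symmetric] by (rule sum.cong[OF refl]) (simp only: mult_ac)
  then have "iint (\<lambda>u. cst (of_real (Kf \<sigma> 1 s u)) * (D * (\<Sum>l\<le>k. cst (\<alpha> l * of_real (Kf \<sigma> (Suc l) u t)) * B l))) =
    iint (\<lambda>u. \<Sum>l\<le>k. cst (of_real (Kf \<sigma> 1 s u * Kf \<sigma> (Suc l) u t)) * (D * (cst (\<alpha> l) * B l)))"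
    by (simp only:)
  also have "\<dots> = (\<Sum>l\<le>k. cst (of_real (set_lebesgue_integral lborel {0..1} (\<lambda>u. Kf \<sigma> 1 s u * Kf \<sigma> (Suc l) u t))) * (D * (cst (\<alpha> l) * B l)))"
    by (rule iint_lin) (use Kf_conv(2)[OF \<sigma> st] in auto)
  also have "\<dots> = (\<Sum>l\<le>k. cst (of_real (- \<sigma> * Kf \<sigma> (Suc (Suc l)) s t)) * (D * (cst (\<alpha> l) * B l)))"
    by (rule sum.cong[OF refl]) (use Kf_conv(1)[OF \<sigma> st] in \<open>simp only: Suc_eq_plus1 le_add2\<close>)
  also have "\<dots> = D * (\<Sum>l\<le>k. cst (\<alpha> l * of_real (- \<sigma> * Kf \<sigma> (Suc (Suc l)) s t)) * B l)"
    unfolding sum_distrib_left fps_const_mult[symmetric] by (rule sum.cong[OF refl]) (simp only: mult_ac)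
  finally show ?thesis .
qed

text \<open>A chain with ends fixed at \<open>s\<close> and \<open>t\<close>, integrated over its
  \<open>k\<close> free vertices, of which \<open>l\<close> enter the chain. There are
  \<open>k! / (k - l)!\<close> ordered choices, and the remaining vertices bring
  \<open>(k - l)! g (k - l)\<close>. Each inserted vertex contributes \<open>\<sigma>\<close> from
  the propagator and \<open>- \<sigma>\<close> from the convolution, hence
  \<open>(-1) ^ l\<close>.\<close>

definition open_loop :: "(nat \<Rightarrow> 'k fps) \<Rightarrow> nat \<Rightarrow> nat \<Rightarrow> real \<Rightarrow> real \<Rightarrow> 'k fps" where
  "open_loop g k m s t = of_nat (fact k) *
     (\<Sum>l\<le>k. cst ((-1) ^ l * \<tau> (Suc m + l) * of_real (Kf \<sigma> (Suc l) s t)) * (fps_X ^ Suc l * g (k - l)))"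

text \<open>The points \<open>s = t\<close> and the boundary of the cube are excluded: there \<open>\<psi>\<close> jumps, and they form a null set.\<close>

lemma T_integral:
  assumes W: "\<And>rs. distinct rs \<Longrightarrow> set rs \<subseteq> {1..n} \<Longrightarrow> length rs \<le> k \<Longrightarrow>
      fexp n (\<lambda>v. W v rs) = of_nat (fact (length rs)) * g (length rs)"
    and yw: "y \<in> {1..n}" "w \<in> {1..n}" "y \<noteq> w" and rs: "distinct rs" "set rs \<subseteq> {1..n} - {y, w}" "length rs = k"
    and st: "s \<in> {0<..<1}" "t \<in> {0<..<1}" "s \<noteq> t"
  shows "fexp n (\<lambda>v. T (v(y := s, w := t)) y w rs m) = open_loop g k m s t"
  using assms
proof (induction k arbitrary: y rs s m)
  case (0 y rs s m)
  have e: "T (v(y := s, w := t)) y w rs m = fps_X * (cst (\<tau> (Suc m) * of_real (Kf \<sigma> 1 s t)) * W v rs)" for v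
  proof -
    have "C (v(y := s, w := t)) y w = - (2 * of_real (\<sigma> * Kf \<sigma> 1 s t))"
      using C[of y w "v(y := s, w := t)"] 0 by simp
    then have "of_real \<sigma> * - (C (v(y := s, w := t)) y w / 2) = of_real (Kf \<sigma> 1 s t)"
      using ss by (simp flip: mult.assoc)
    moreover have "W (v(y := s, w := t)) rs = W v rs"
      by (rule W_dep) (use 0 in auto)
    ultimately show ?thesis using T_rec[of rs y w "v(y := s, w := t)" m] 0 by (simp add: mult_ac)
  qed
  have W: "fexp n (\<lambda>v. W v rs) = g 0" using 0 by simp
  have nW: "niceF n (\<lambda>v. W v rs)" by (rule nice_W) (use 0 in auto)
  show ?case
    unfolding e fexp_mult_left[OF niceF_mult_left[OF nW]] fexp_mult_left[OF nW] W by (simp add: open_loop_def mult_ac)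
next
  case (Suc j y rs s m)
  note yw = \<open>y \<in> {1..n}\<close> \<open>w \<in> {1..n}\<close> \<open>y \<noteq> w\<close> and rs = \<open>distinct rs\<close> \<open>set rs \<subseteq> {1..n} - {y, w}\<close> \<open>length rs = Suc j\<close>
    and st = \<open>s \<in> {0<..<1}\<close> \<open>t \<in> {0<..<1}\<close> \<open>s \<noteq> t\<close>
  have rsn: "set rs \<subseteq> {1..n}" using rs by blast
  let ?v = "\<lambda>v. v(y := s, w := t)"
  let ?K = "Kf \<sigma> 1 s t"
  let ?f = "\<lambda>r v. cst (- (C v y r / 2)) * T v r w (remove1 r rs) (Suc m)"
  let ?S = "\<Sum>l\<le>j. cst ((-1) ^ Suc l * \<tau> (Suc (Suc m) + l) * of_real (Kf \<sigma> (Suc (Suc l)) s t)) * (fps_X ^ Suc l * g (j - l))"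
  have rem: "distinct (remove1 r rs)" "set (remove1 r rs) = set rs - {r}" "length (remove1 r rs) = j" "r \<in> {1..n}" "r \<noteq> y" "r \<noteq> w"
    if "r \<in> set rs" for r
    using that rs by (auto simp: length_remove1)
  have nf: "niceF n (?f r)" if "r \<in> set rs" for r
    by (intro niceF_cst_mult nice_C nice_T) (use rem[OF that] yw rsn in auto)
  have nfv: "niceF n (\<lambda>v. ?f r (?v v))" if "r \<in> set rs" for r
    using niceF_upd[OF niceF_upd[OF nf[OF that] yw(2), of t] yw(1), of s] by simp
  have nW: "niceF n (\<lambda>v. W v rs)" by (rule nice_W) (use rs in auto)
  have e: "T (?v v) y w rs m = fps_X * (cst (\<tau> (Suc m) * of_real ?K) * W v rs + (\<Sum>r\<in>set rs. ?f r (?v v)))" for v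
  proof -
    have "C (?v v) y w = - (2 * of_real (\<sigma> * ?K))"
      using C[of y w "?v v"] yw st by simp
    then have "of_real \<sigma> * - (C (?v v) y w / 2) = of_real ?K"
      using ss by (simp flip: mult.assoc)
    moreover have "W (?v v) rs = W v rs"
      by (rule W_dep) (use rs in auto)
    ultimately show ?thesis using T_rec[of rs y w "?v v" m] rs(1) rsn yw by (simp only: mult_ac)
  qed
  \<comment> \<open>The position \<open>u\<close> of the next vertex \<open>r\<close> is integrated
    last. By locality the remaining chain from \<open>r\<close> to \<open>w\<close> forgets
    \<open>y\<close>, so the induction hypothesis evaluates it between \<open>u\<close> and
    \<open>t\<close>; the convolution with the propagator from \<open>s\<close> to \<open>u\<close>
    then raises the order of every kernel by one.\<close>
  have step: "fexp n (\<lambda>v. ?f r (?v v)) = of_nat (fact j) * ?S" if r: "r \<in> set rs" for r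
  proof -
    note rr = rem[OF r]
    have "fexp n (\<lambda>v. ?f r (?v v)) = iint (\<lambda>u. fexp n (\<lambda>v. ?f r (?v (v(r := u)))))"
      by (rule fexp_fubini[OF nfv[OF r] rr(4)])
    also have "\<dots> = iint (\<lambda>u. cst (of_real (Kf \<sigma> 1 s u)) * (cst (of_real \<sigma>) * of_nat (fact j) *
       (\<Sum>l\<le>j. cst ((-1) ^ l * \<tau> (Suc (Suc m) + l) * of_real (Kf \<sigma> (Suc l) u t)) * (fps_X ^ Suc l * g (j - l)))))"
    proof (rule iint_ae[of "{s, t}"])
      fix u :: real assume u: "u \<in> {0<..<1}" "u \<notin> {s, t}"
      have f: "?f r (?v (v(r := u))) = cst (of_real (\<sigma> * Kf \<sigma> 1 s u)) * T (v(r := u, w := t)) r w (remove1 r rs) (Suc m)" for v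
      proof -
        have "C (?v (v(r := u))) y r = - (2 * of_real (\<sigma> * Kf \<sigma> 1 s u))"
          using C[of y r "?v (v(r := u))"] yw st u rr by simp
        moreover have "T (?v (v(r := u))) r w (remove1 r rs) (Suc m) = T (v(r := u, w := t)) r w (remove1 r rs) (Suc m)"
          by (rule T_dep) (use rr rs yw in auto)
        ultimately show ?thesis by simp
      qed
      have IH: "fexp n (\<lambda>v. T (v(r := u, w := t)) r w (remove1 r rs) (Suc m)) = open_loop g j (Suc m) u t"
        by (rule Suc.IH) (use Suc.prems(1) rr rs yw u st in auto)
      have "niceF n (\<lambda>v. T v r w (remove1 r rs) (Suc m))"
        by (rule nice_T) (use rr rsn yw in auto)
      from niceF_upd[OF niceF_upd[OF this yw(2), of t] rr(4), of u]
      have nT: "niceF n (\<lambda>v. T (v(r := u, w := t)) r w (remove1 r rs) (Suc m))" by simp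
      show "fexp n (\<lambda>v. ?f r (?v (v(r := u)))) = cst (of_real (Kf \<sigma> 1 s u)) * (cst (of_real \<sigma>) * of_nat (fact j) *
       (\<Sum>l\<le>j. cst ((-1) ^ l * \<tau> (Suc (Suc m) + l) * of_real (Kf \<sigma> (Suc l) u t)) * (fps_X ^ Suc l * g (j - l))))"
        unfolding f fexp_mult_left[OF nT] IH open_loop_def of_real_mult fps_const_mult[symmetric] by (simp only: mult_ac)
    qed simp
    also have "\<dots> = cst (of_real \<sigma>) * of_nat (fact j) *
       (\<Sum>l\<le>j. cst ((-1) ^ l * \<tau> (Suc (Suc m) + l) * of_real (- \<sigma> * Kf \<sigma> (Suc (Suc l)) s t)) * (fps_X ^ Suc l * g (j - l)))"
      by (rule conv[OF st(1,2)])
    also have "\<dots> = of_nat (fact j) * ?S"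
    proof -
      have "cst (of_real \<sigma>) * cst (a * of_real (- \<sigma> * b)) = cst (- a * of_real b :: 'k)" for a b
        using ss(2) by (simp add: mult_ac)
      then have k1: "cst (of_real \<sigma>) * (cst (a * of_real (- \<sigma> * b)) * B) = cst (- a * of_real b :: 'k) * B" for a b B
        by (simp only: flip: mult.assoc)
      have "cst (of_real \<sigma>) * (\<Sum>l\<le>j. cst ((-1) ^ l * \<tau> (Suc (Suc m) + l) * of_real (- \<sigma> * Kf \<sigma> (Suc (Suc l)) s t)) * (fps_X ^ Suc l * g (j - l))) = ?S"
        unfolding sum_distrib_left k1 by simp
      from this[symmetric] show ?thesis by (simp only: mult_ac)
    qed
    finally show ?thesis .
  qed
  have "fexp n (\<lambda>v. T (?v v) y w rs m) = fps_X * (cst (\<tau> (Suc m) * of_real ?K) * (of_nat (fact (Suc j)) * g (Suc j)) + (\<Sum>r\<in>set rs. of_nat (fact j) * ?S))"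
  proof -
    have W: "fexp n (\<lambda>v. W v rs) = of_nat (fact (Suc j)) * g (Suc j)" using Suc.prems(1)[OF rs(1) rsn] rs(3) by simp
    have "fexp n (\<lambda>v. T (?v v) y w rs m) = fps_X * fexp n (\<lambda>v. cst (\<tau> (Suc m) * of_real ?K) * W v rs + (\<Sum>r\<in>set rs. ?f r (?v v)))"
      unfolding e by (rule fexp_mult_left) (intro niceF_add niceF_mult_left nW niceF_sum nfv)
    also have "fexp n (\<lambda>v. cst (\<tau> (Suc m) * of_real ?K) * W v rs + (\<Sum>r\<in>set rs. ?f r (?v v))) =
      fexp n (\<lambda>v. cst (\<tau> (Suc m) * of_real ?K) * W v rs) + fexp n (\<lambda>v. \<Sum>r\<in>set rs. ?f r (?v v))"
      by (rule fexp_add) (intro niceF_mult_left nW niceF_sum nfv; assumption)+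
    also have "fexp n (\<lambda>v. cst (\<tau> (Suc m) * of_real ?K) * W v rs) = cst (\<tau> (Suc m) * of_real ?K) * (of_nat (fact (Suc j)) * g (Suc j))"
      unfolding fexp_mult_left[OF nW] W ..
    also have "fexp n (\<lambda>v. \<Sum>r\<in>set rs. ?f r (?v v)) = (\<Sum>r\<in>set rs. of_nat (fact j) * ?S)"
      by (rule trans[OF fexp_sum sum.cong[OF refl step]]) (rule nfv)
    finally show ?thesis .
  qed
  also have "(\<Sum>r\<in>set rs. of_nat (fact j) * ?S) = of_nat (fact (Suc j)) * ?S"
  proof -
    have "card (set rs) = Suc j" using rs distinct_card by metis
    then show ?thesis by (simp only: sum_constant fact_Suc of_nat_mult of_nat_id mult.assoc)
  qed
  also have "fps_X * (cst (\<tau> (Suc m) * of_real ?K) * (of_nat (fact (Suc j)) * g (Suc j)) + of_nat (fact (Suc j)) * ?S) =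
     of_nat (fact (Suc j)) * (cst (\<tau> (Suc m) * of_real ?K) * (fps_X ^ Suc 0 * g (Suc j)) + fps_X * ?S)"
    by (simp only: distrib_left mult_ac power_Suc power_0 mult_1_right)
  also have "\<dots> = open_loop g (Suc j) m s t"
  proof -
    have "fps_X * ?S = (\<Sum>l\<le>j. cst ((-1) ^ Suc l * \<tau> (Suc m + Suc l) * of_real (Kf \<sigma> (Suc (Suc l)) s t)) * (fps_X ^ Suc (Suc l) * g (Suc j - Suc l)))"
      unfolding sum_distrib_left power_Suc[of fps_X "Suc _"] diff_Suc_Suc add_Suc_right add_Suc
      by (rule sum.cong[OF refl]) (simp only: mult_ac)
    then show ?thesis unfolding open_loop_def sum.atMost_Suc_shift by simp
  qed
  finally show ?case .
qed

text \<open>The positions of \<open>y\<close> and of the neighbour \<open>r\<close> are kept for the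
  end, and what lies between is an open chain from \<open>r\<close> back to \<open>y\<close>. The
  last convolution has both ends at the position of \<open>y\<close>, where a kernel of order
  \<open>m \<ge> 2\<close> takes the value of the coefficient of \<open>Zs \<sigma>\<close>. This no
  longer depends on the position, so the outermost integral is that of a constant.\<close>

lemma closed_loop:
  assumes W: "\<And>rs. distinct rs \<Longrightarrow> set rs \<subseteq> {1..n} \<Longrightarrow> length rs \<le> length qs \<Longrightarrow>
      fexp n (\<lambda>v. W v rs) = of_nat (fact (length rs)) * g (length rs)"
    and y: "y \<in> {1..n}" and qs: "distinct qs" "set qs \<subseteq> {1..n} - {y}"
  shows "fexp n (\<lambda>v. fps_X * (\<Sum>r\<in>set qs. cst (- (C v y r / 4)) * T v r y (remove1 r qs) 1)) =
    of_nat (fact (length qs)) * (cst (1/2) * (\<Sum>m=2..Suc (length qs).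
      cst (- ((-1) ^ m * of_real (fps_nth (Zs \<sigma>) m) * \<tau> m)) * fps_X ^ m * g (Suc (length qs) - m)))"
proof (cases "length qs")
  case 0
  then show ?thesis by (simp add: fexp_const)
next
  case (Suc j)
  let ?f = "\<lambda>r v. cst (- (C v y r / 4)) * T v r y (remove1 r qs) 1"
  let ?S = "\<Sum>l\<le>j. cst (- ((-1) ^ Suc (Suc l) * of_real (fps_nth (Zs \<sigma>) (Suc (Suc l))) * \<tau> (Suc (Suc l)))) * (fps_X ^ Suc l * g (j - l))"
  have qn: "set qs \<subseteq> {1..n}" using qs by blast
  have rem: "distinct (remove1 r qs)" "set (remove1 r qs) = set qs - {r}" "length (remove1 r qs) = j" "r \<in> {1..n}" "r \<noteq> y"
    if "r \<in> set qs" for r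
    using that qs Suc by (auto simp: length_remove1)
  have nf: "niceF n (?f r)" if "r \<in> set qs" for r
    by (intro niceF_cst_mult nice_C nice_T) (use rem[OF that] y qn in auto)
  have step: "fexp n (?f r) = of_nat (fact j) * (cst (1/2) * ?S)" if r: "r \<in> set qs" for r
  proof -
    note rr = rem[OF r]
    have "fexp n (?f r) = iint (\<lambda>t. fexp n (\<lambda>v. ?f r (v(y := t))))"
      by (rule fexp_fubini[OF nf[OF r] y])
    also have "\<dots> = iint (\<lambda>t. of_nat (fact j) * (cst (1/2) * ?S))"
    proof (rule iint_ae[of "{}"])
      fix t :: real assume t: "t \<in> {0<..<1}"
      have "fexp n (\<lambda>v. ?f r (v(y := t))) = iint (\<lambda>u. fexp n (\<lambda>v. ?f r (v(r := u, y := t))))"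
        by (rule fexp_fubini[OF niceF_upd[OF nf[OF r] y] rr(4)])
      also have "\<dots> = iint (\<lambda>u. cst (of_real (Kf \<sigma> 1 t u)) * (cst (of_real (\<sigma> / 2)) * of_nat (fact j) *
         (\<Sum>l\<le>j. cst ((-1) ^ l * \<tau> (Suc 1 + l) * of_real (Kf \<sigma> (Suc l) u t)) * (fps_X ^ Suc l * g (j - l)))))"
      proof (rule iint_ae[of "{t}"])
        fix u :: real assume u: "u \<in> {0<..<1}" "u \<notin> {t}"
        have f: "?f r (v(r := u, y := t)) = cst (of_real (\<sigma> / 2 * Kf \<sigma> 1 t u)) * T (v(r := u, y := t)) r y (remove1 r qs) 1" for v
          using C[of y r "v(r := u, y := t)"] y t u rr by simp
        have T: "fexp n (\<lambda>v. T (v(r := u, y := t)) r y (remove1 r qs) 1) = open_loop g j 1 u t"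
          by (rule T_integral) (use W rr qs y u t Suc in auto)
        have "niceF n (\<lambda>v. T v r y (remove1 r qs) 1)"
          by (rule nice_T) (use rr qn y in auto)
        from niceF_upd[OF niceF_upd[OF this y, of t] rr(4), of u]
        have nT: "niceF n (\<lambda>v. T (v(r := u, y := t)) r y (remove1 r qs) 1)" by simp
        show "fexp n (\<lambda>v. ?f r (v(r := u, y := t))) = cst (of_real (Kf \<sigma> 1 t u)) * (cst (of_real (\<sigma> / 2)) * of_nat (fact j) *
         (\<Sum>l\<le>j. cst ((-1) ^ l * \<tau> (Suc 1 + l) * of_real (Kf \<sigma> (Suc l) u t)) * (fps_X ^ Suc l * g (j - l))))"
          unfolding f fexp_mult_left[OF nT] T open_loop_def of_real_mult[of "\<sigma> / 2"] fps_const_mult[symmetric] by (simp only: mult_ac)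
      qed simp
      also have "\<dots> = cst (of_real (\<sigma> / 2)) * of_nat (fact j) *
         (\<Sum>l\<le>j. cst ((-1) ^ l * \<tau> (Suc 1 + l) * of_real (- \<sigma> * Kf \<sigma> (Suc (Suc l)) t t)) * (fps_X ^ Suc l * g (j - l)))"
        by (rule conv[OF t t])
      also have "\<dots> = of_nat (fact j) * (cst (1/2) * ?S)"
      proof -
        \<comment> \<open>The order is at least 2, so the diagonal value is unambiguous.\<close>
        have K: "Kf \<sigma> (Suc (Suc l)) t t = fps_nth (Zs \<sigma>) (Suc (Suc l))" for l
          using Kf_diag[OF \<sigma>, of "Suc (Suc l)" t] by (simp add: Bp_def)
        have "cst (of_real (\<sigma> / 2)) * cst (a * b * of_real (- \<sigma> * c)) = cst (1/2) * cst (- (a * of_real c * b) :: 'k)" for a b c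
          using ss(2) by (simp add: mult_ac)
        then have k1: "cst (of_real (\<sigma> / 2)) * (cst (a * b * of_real (- \<sigma> * c)) * B) = cst (1/2) * (cst (- (a * of_real c * b) :: 'k) * B)" for a b c B
          by (simp only: flip: mult.assoc)
        have "cst (of_real (\<sigma> / 2)) * (\<Sum>l\<le>j. cst ((-1) ^ l * \<tau> (Suc 1 + l) * of_real (- \<sigma> * Kf \<sigma> (Suc (Suc l)) t t)) * (fps_X ^ Suc l * g (j - l))) = cst (1/2) * ?S"
          unfolding sum_distrib_left K k1 by simp
        from this[symmetric] show ?thesis by (simp only: mult_ac)
      qed
      finally show "fexp n (\<lambda>v. ?f r (v(y := t))) = of_nat (fact j) * (cst (1/2) * ?S)" .
    qed simp
    finally show ?thesis by (simp only: iint_const)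
  qed
  have "fexp n (\<lambda>v. fps_X * (\<Sum>r\<in>set qs. ?f r v)) = fps_X * (\<Sum>r\<in>set qs. of_nat (fact j) * (cst (1/2) * ?S))"
  proof -
    have "fexp n (\<lambda>v. fps_X * (\<Sum>r\<in>set qs. ?f r v)) = fps_X * fexp n (\<lambda>v. \<Sum>r\<in>set qs. ?f r v)"
      by (rule fexp_mult_left) (intro niceF_sum nf)
    also have "fexp n (\<lambda>v. \<Sum>r\<in>set qs. ?f r v) = (\<Sum>r\<in>set qs. of_nat (fact j) * (cst (1/2) * ?S))"
      by (rule trans[OF fexp_sum sum.cong[OF refl step]]) (rule nf)
    finally show ?thesis .
  qed
  also have "(\<Sum>r\<in>set qs. of_nat (fact j) * (cst (1/2) * ?S)) = of_nat (fact (Suc j)) * (cst (1/2) * ?S)"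
  proof -
    have "card (set qs) = Suc j" using qs Suc distinct_card by metis
    then show ?thesis by (simp only: sum_constant fact_Suc of_nat_mult of_nat_id mult.assoc)
  qed
  also have "fps_X * (of_nat (fact (Suc j)) * (cst (1/2) * ?S)) = of_nat (fact (Suc j)) * (cst (1/2) * (fps_X * ?S))"
    by (simp only: mult_ac)
  \<comment> \<open>The loop consists of \<open>y\<close>, \<open>r\<close> and \<open>l\<close>
    further vertices, so its length is \<open>m = l + 2\<close>.\<close>
  also have "fps_X * ?S = (\<Sum>m=2..Suc (Suc j). cst (- ((-1) ^ m * of_real (fps_nth (Zs \<sigma>) m) * \<tau> m)) * fps_X ^ m * g (Suc (Suc j) - m))"
  proof -
    have "{2..Suc (Suc j)} = (\<lambda>l. Suc (Suc l)) ` {..j}"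
      by (simp add: numeral_2_eq_2 image_image[symmetric, of Suc Suc] image_Suc_atMost image_Suc_atLeastAtMost)
    then have "(\<Sum>m=2..Suc (Suc j). cst (- ((-1) ^ m * of_real (fps_nth (Zs \<sigma>) m) * \<tau> m)) * fps_X ^ m * g (Suc (Suc j) - m)) =
      (\<Sum>l\<le>j. cst (- ((-1) ^ Suc (Suc l) * of_real (fps_nth (Zs \<sigma>) (Suc (Suc l))) * \<tau> (Suc (Suc l)))) * fps_X ^ Suc (Suc l) * g (Suc (Suc j) - Suc (Suc l)))"
      by (simp only:) (subst sum.reindex; simp add: inj_on_def)
    then show ?thesis
      unfolding sum_distrib_left diff_Suc_Suc power_Suc[of fps_X "Suc _"] by (simp only: mult_ac)
  qed
  finally show ?thesis unfolding Suc .
qed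

end

subsection \<open>The diagonal value\<close>

text \<open>The first two coefficients of \<open>Zs\<close> follow from the vanishing of those of
  \<open>logd\<close>. They give \<open>x - 1/2\<close> for \<open>\<sigma> = 1\<close> and the
  constant \<open>1/2\<close> for \<open>\<sigma> = -1\<close>.\<close>

lemma Kf_1:
  "Kf 1 1 s t = (if s < t then t - s - 1/2 else t - s + 1/2)"
  "Kf (-1) 1 s t = (if s < t then 1/2 else - (1/2))"
proof -
  have z: "fps_nth (Zs 1) 0 = (1 :: real)" "fps_nth (Zs 1) (Suc 0) = - (1/2 :: real)"
    using logd_nth(1)[of "1 :: real"] logd_nth(2)[of "1 :: real" 1] by (simp_all add: logd_def)
  have z': "fps_nth (Zs (-1)) 0 = (0 :: real)" "fps_nth (Zs (-1)) (Suc 0) = (1/2 :: real)"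
    using logd_nth(1)[of "-1 :: real"] logd_nth(2)[of "-1 :: real" 1] by (simp_all add: logd_def)
  show "Kf 1 1 s t = (if s < t then t - s - 1/2 else t - s + 1/2)"
    by (simp add: Kf_def Bp_sum z)
  show "Kf (-1) 1 s t = (if s < t then 1/2 else - (1/2))"
    by (simp add: Kf_def Bp_sum z')
qed

lemma psi_diff:
  assumes "s \<in> {0<..<1}" "t \<in> {0<..<1}" "s \<noteq> t"
  shows "psi (s - t) = (if s < t then 2 * (s - t) + 1 else 2 * (s - t) - 1)"
proof (cases "s < t")
  case True
  have "frac (s - t) = s - t + 1" unfolding frac_unique_iff using assms True by auto
  then show ?thesis using True by (simp add: psi_def)
next
  case False
  have "frac (s - t) = s - t" unfolding frac_eq using assms False by auto
  then show ?thesis using False by (simp add: psi_def)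
qed

lemma psi_neg:
  assumes "t \<in> {0<..<1}"
  shows "psi (- t) = 1 - 2 * t"
proof -
  have "frac (- t) = 1 - t" unfolding frac_unique_iff using assms by auto
  then show ?thesis by (simp add: psi_def)
qed

text \<open>
  The slot 0 terms in the odd propagator cancel the linear part of the even one and leave
  \<open>sgn (v r - v y)\<close>.
\<close>

lemma propagators:
  fixes v :: "nat \<Rightarrow> real"
  assumes y: "y \<ge> 1" "v y \<in> {0<..<1}" and r: "r \<ge> 1" "v r \<in> {0<..<1}" and ne: "v y \<noteq> v r"
  shows "skew (cpsi v) y r = (- (2 * of_real (1 * Kf 1 1 (v y) (v r))) :: 'k::real_normed_field)"
    and "odd_prop (cpsi v) y r = (- (2 * of_real (- 1 * Kf (-1) 1 (v y) (v r))) :: 'k)"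
proof -
  have s: "skew (cpsi v) y r = (of_real (if v y < v r then 2 * (v y - v r) + 1 else 2 * (v y - v r) - 1) :: 'k)"
  proof (cases y r rule: linorder_cases)
    case less
    then show ?thesis using y r psi_diff[OF y(2) r(2) ne] by (simp add: skew_def cpsi_def)
  next
    case greater
    then show ?thesis using y r ne psi_diff[OF r(2) y(2) ne[symmetric]] by (auto simp: skew_def cpsi_def)
  qed (use ne in simp)
  have z: "skew (cpsi v) 0 i = (of_real (1 - 2 * v i) :: 'k)" if "i \<ge> 1" "v i \<in> {0<..<1}" for i
    using that psi_neg[of "v i"] by (simp add: skew_def cpsi_def)
  show "skew (cpsi v) y r = (- (2 * of_real (1 * Kf 1 1 (v y) (v r))) :: 'k)"
    unfolding s Kf_1 by (simp add: algebra_simps)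
  show "odd_prop (cpsi v) y r = (- (2 * of_real (- 1 * Kf (-1) 1 (v y) (v r))) :: 'k)"
    unfolding odd_prop_def s Kf_1 z[OF y] z[OF r] by (simp add: algebra_simps)
qed

section \<open>The two kernels when all vertices are equal\<close>

context
  fixes n a b :: nat and X Y :: "'k::{real_normed_field, euclidean_space} mat" and z :: 'k
  assumes ab: "a \<le> b" and x: "(X, Y, z) \<in> lie_alg n a b"
begin

abbreviation "W v \<equiv> Wx n a b n (cpsi v) (\<lambda>_. (X, Y, z))"
abbreviation "TE v y w rs m \<equiv> Te n a b n (cpsi v) (\<lambda>_. (X, Y, z)) y w rs (X ^\<^sub>m m)"
abbreviation "TO v y w rs m \<equiv> To n a b n (cpsi v) (\<lambda>_. (X, Y, z)) y w rs (Y ^\<^sub>m m)"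

lemma XY: "X \<in> carrier_mat (2 * n) (2 * n)" "Y \<in> carrier_mat (a + b) (a + b)"
  using x by (auto simp: lie_alg_def sp_lie_def so_lie_def)

text \<open>\<open>Wx_cong\<close> with identity matrices for the conjugation. The odd propagator
  also involves slot 0, whose position is 0 for both arguments.\<close>

lemma loops_dep:
  assumes R: "R \<subseteq> {1..n}" and v: "\<And>i. i \<in> R \<Longrightarrow> v i = v' i" and rs: "distinct rs" "set rs \<subseteq> R"
  shows "W v rs = W v' rs" "y \<in> R \<Longrightarrow> w \<in> R \<Longrightarrow> TE v y w rs m = TE v' y w rs m"
    "y \<in> R \<Longrightarrow> w \<in> R \<Longrightarrow> TO v y w rs m = TO v' y w rs m"
proof -
  have c: "cpsi v i j = (cpsi v' i j :: 'k)" if "i \<in> insert 0 R" "j \<in> insert 0 R" for i j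
    using that v by (auto simp: cpsi_def)
  have sk: "skew (cpsi v) i j = (skew (cpsi v') i j :: 'k)" if "i \<in> insert 0 R" "j \<in> insert 0 R" for i j
    using c[OF that] c[OF that(2,1)] by (simp add: skew_def)
  have od: "odd_prop (cpsi v) i j = (odd_prop (cpsi v') i j :: 'k)" if "i \<in> R" "j \<in> R" for i j
    using that by (simp add: odd_prop_def sk)
  have cg: "W v rs = W v' rs \<and>
    (\<forall>y\<in>R. \<forall>w\<in>R. \<forall>Z\<in>carrier_mat (2 * n) (2 * n). Te n a b n (cpsi v) (\<lambda>_. (X, Y, z)) y w rs (1\<^sub>m (2 * n) * Z * 1\<^sub>m (2 * n)) =
      Te n a b n (cpsi v') (\<lambda>_. (X, Y, z)) y w rs Z) \<and>
    (\<forall>y\<in>R. \<forall>w\<in>R. \<forall>Z\<in>carrier_mat (a + b) (a + b). To n a b n (cpsi v) (\<lambda>_. (X, Y, z)) y w rs (1\<^sub>m (a + b) * Z * 1\<^sub>m (a + b)) =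
      To n a b n (cpsi v') (\<lambda>_. (X, Y, z)) y w rs Z)"
    by (rule Wx_cong[OF ab, where R = R]) (use x R sk od XY rs conj_by_one in \<open>auto simp: vertex_data\<close>)
  show "W v rs = W v' rs" using cg by blast
  have P: "X ^\<^sub>m m \<in> carrier_mat (2 * n) (2 * n)" "Y ^\<^sub>m m \<in> carrier_mat (a + b) (a + b)" using XY by auto
  have "1\<^sub>m (2 * n) * X ^\<^sub>m m * 1\<^sub>m (2 * n) = X ^\<^sub>m m" "1\<^sub>m (a + b) * Y ^\<^sub>m m * 1\<^sub>m (a + b) = Y ^\<^sub>m m"
    unfolding left_mult_one_mat[OF P(1)] left_mult_one_mat[OF P(2)] right_mult_one_mat[OF P(1)] right_mult_one_mat[OF P(2)] by (rule refl)+
  then show "y \<in> R \<Longrightarrow> w \<in> R \<Longrightarrow> TE v y w rs m = TE v' y w rs m"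
    "y \<in> R \<Longrightarrow> w \<in> R \<Longrightarrow> TO v y w rs m = TO v' y w rs m"
    using cg P by metis+
qed

lemma pow_mat_left: "M \<in> carrier_mat N N \<Longrightarrow> M * M ^\<^sub>m m = M ^\<^sub>m Suc m"
  using pow_mat_plus[of M N 1 m] by simp

lemma even_kernel: "loop_kernel n 1 (\<lambda>v. skew (cpsi v)) W TE (\<lambda>m. mtr (2 * n) (X ^\<^sub>m m))"
proof
  fix v :: "nat \<Rightarrow> real" and y r :: nat
  assume "y \<in> {1..n}" "r \<in> {1..n}" "v y \<in> {0<..<1}" "v r \<in> {0<..<1}" "v y \<noteq> v r"
  then show "skew (cpsi v) y r = (- (2 * of_real (1 * Kf 1 1 (v y) (v r))) :: 'k)"
    by (intro propagators(1)) auto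
next
  fix y r :: nat and d :: 'k assume "y \<in> {1..n}" "r \<in> {1..n}"
  then show "nice n (\<lambda>v. - (skew (cpsi v) y r / d))" by (intro nice_scale nice_skew(1)) auto
next
  fix rs assume "distinct rs" "set rs \<subseteq> {1..n}"
  then show "niceF n (\<lambda>v. W v rs)" using niceF_loops[OF ab x] by blast
next
  fix rs y w m assume "distinct rs" "set rs \<subseteq> {1..n}" "y \<in> {1..n}" "w \<in> {1..n}"
  moreover have "X ^\<^sub>m m \<in> carrier_mat (2 * n) (2 * n)" using XY by simp
  ultimately show "niceF n (\<lambda>v. TE v y w rs m)" using niceF_loops[OF ab x, of rs] by blast
next
  fix rs and v v' :: "nat \<Rightarrow> real" assume "distinct rs" "set rs \<subseteq> {1..n}" "\<And>i. i \<in> set rs \<Longrightarrow> v i = v' i"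
  then show "W v rs = W v' rs" using loops_dep(1)[of "set rs" v v' rs] by blast
next
  fix rs y w m and v v' :: "nat \<Rightarrow> real"
  assume h: "distinct rs" "set rs \<subseteq> {1..n}" "y \<in> {1..n}" "w \<in> {1..n}" "\<And>i. i \<in> insert y (insert w (set rs)) \<Longrightarrow> v i = v' i"
  show "TE v y w rs m = TE v' y w rs m"
    by (rule loops_dep(2)[of "insert y (insert w (set rs))"]) (use h in auto)
next
  fix rs y w m and v :: "nat \<Rightarrow> real"
  assume h: "distinct rs" "set rs \<subseteq> {1..n}" "y \<in> {1..n}" "w \<in> {1..n}"
  have P: "X ^\<^sub>m m \<in> carrier_mat (2 * n) (2 * n)" using XY by simp
  show "TE v y w rs m = fps_X * (cst (of_real 1 * - (skew (cpsi v) y w / 2) * mtr (2 * n) (X ^\<^sub>m Suc m)) * W v rs +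
     (\<Sum>r\<in>set rs. cst (- (skew (cpsi v) y r / 2)) * TE v r w (remove1 r rs) (Suc m)))"
    using Te_rec[OF ab x h P, of "cpsi v"] unfolding vertex_data fst_conv pow_mat_left[OF XY(1)] by simp
qed simp

lemma odd_kernel: "loop_kernel n (-1) (\<lambda>v. odd_prop (cpsi v)) W TO (\<lambda>m. mtr (a + b) (Y ^\<^sub>m m))"
proof
  fix v :: "nat \<Rightarrow> real" and y r :: nat
  assume "y \<in> {1..n}" "r \<in> {1..n}" "v y \<in> {0<..<1}" "v r \<in> {0<..<1}" "v y \<noteq> v r"
  then show "odd_prop (cpsi v) y r = (- (2 * of_real (- 1 * Kf (-1) 1 (v y) (v r))) :: 'k)"
    by (intro propagators(2)) auto
next
  fix y r :: nat and d :: 'k assume "y \<in> {1..n}" "r \<in> {1..n}"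
  then show "nice n (\<lambda>v. - (odd_prop (cpsi v) y r / d))" by (intro nice_scale nice_skew(2)) auto
next
  fix rs assume "distinct rs" "set rs \<subseteq> {1..n}"
  then show "niceF n (\<lambda>v. W v rs)" using niceF_loops[OF ab x] by blast
next
  fix rs y w m assume "distinct rs" "set rs \<subseteq> {1..n}" "y \<in> {1..n}" "w \<in> {1..n}"
  moreover have "Y ^\<^sub>m m \<in> carrier_mat (a + b) (a + b)" using XY by simp
  ultimately show "niceF n (\<lambda>v. TO v y w rs m)" using niceF_loops[OF ab x, of rs] by blast
next
  fix rs and v v' :: "nat \<Rightarrow> real" assume "distinct rs" "set rs \<subseteq> {1..n}" "\<And>i. i \<in> set rs \<Longrightarrow> v i = v' i"
  then show "W v rs = W v' rs" using loops_dep(1)[of "set rs" v v' rs] by blast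
next
  fix rs y w m and v v' :: "nat \<Rightarrow> real"
  assume h: "distinct rs" "set rs \<subseteq> {1..n}" "y \<in> {1..n}" "w \<in> {1..n}" "\<And>i. i \<in> insert y (insert w (set rs)) \<Longrightarrow> v i = v' i"
  show "TO v y w rs m = TO v' y w rs m"
    by (rule loops_dep(3)[of "insert y (insert w (set rs))"]) (use h in auto)
next
  fix rs y w m and v :: "nat \<Rightarrow> real"
  assume h: "distinct rs" "set rs \<subseteq> {1..n}" "y \<in> {1..n}" "w \<in> {1..n}"
  have P: "Y ^\<^sub>m m \<in> carrier_mat (a + b) (a + b)" using XY by simp
  show "TO v y w rs m = fps_X * (cst (of_real (-1) * - (odd_prop (cpsi v) y w / 2) * mtr (a + b) (Y ^\<^sub>m Suc m)) * W v rs +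
     (\<Sum>r\<in>set rs. cst (- (odd_prop (cpsi v) y r / 2)) * TO v r w (remove1 r rs) (Suc m)))"
    using To_rec[OF ab x h P, of "cpsi v"] unfolding vertex_data fst_conv snd_conv pow_mat_left[OF XY(2)] by simp
qed simp

text \<open>The first vertex is split off, and the integrated even and odd loops reproduce the
  recursion of \<open>genus_rec\<close>, multiplied by the global sign and a factorial. Arbitrary
  sublists have to be covered because a loop removes vertices from anywhere in the list.\<close>

lemma W_integral:
  assumes "distinct rs" "set rs \<subseteq> {1..n}"
  shows "fexp n (\<lambda>v. W v rs) = of_nat (fact (length rs)) * ((-1) ^ (a + (b - a) div 2) * fps_nth (genus (X, Y, z)) (length rs))"
  using assms
proof (induction "length rs" arbitrary: rs rule: less_induct)
  case less
  define g where "g k = (-1) ^ (a + (b - a) div 2) * fps_nth (genus (X, Y, z)) k" for k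
  note rec = genus_rec(1)[OF XY, where z = z] genus_rec(2)[OF XY, where z = z]
  show ?case
  proof (cases rs)
    case Nil
    then show ?thesis using Wx_Nil[OF ab x] by (simp add: fexp_const rec(1) del: genus.simps)
  next
    case (Cons y qs)
    have q: "distinct qs" "set qs \<subseteq> {1..n}" "y \<in> {1..n}" "y \<notin> set qs" "length qs < length rs" using less.prems Cons by auto
    have qy: "set qs \<subseteq> {1..n} - {y}" using q by blast
    let ?k = "length qs"
    have W: "fexp n (\<lambda>v. W v ps) = of_nat (fact (length ps)) * g (length ps)"
      if "distinct ps" "set ps \<subseteq> {1..n}" "length ps \<le> ?k" for ps
      unfolding g_def using less.hyps[of ps] that q(5) by simp
    let ?E = "\<lambda>v. fps_X * (\<Sum>r\<in>set qs. cst (- (skew (cpsi v) y r / 4)) * TE v r y (remove1 r qs) 1)"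
    let ?O = "\<lambda>v. fps_X * (\<Sum>r\<in>set qs. cst (- (odd_prop (cpsi v) y r / 4)) * TO v r y (remove1 r qs) 1)"
    have e: "W v rs = cst z * W v qs + (?E v + ?O v)" for v
    proof -
      have "X = X ^\<^sub>m 1" "Y = Y ^\<^sub>m 1" using XY by auto
      then show ?thesis
        using Wx_rec[OF ab x q(1-3), of "cpsi v"] unfolding Cons vertex_data fst_conv snd_conv by metis
    qed
    interpret E: loop_kernel n 1 "\<lambda>v. skew (cpsi v)" W TE "\<lambda>m. mtr (2 * n) (X ^\<^sub>m m)" by (rule even_kernel)
    interpret O: loop_kernel n "-1" "\<lambda>v. odd_prop (cpsi v)" W TO "\<lambda>m. mtr (a + b) (Y ^\<^sub>m m)" by (rule odd_kernel)
    have rem: "distinct (remove1 r qs)" "set (remove1 r qs) \<subseteq> {1..n}" "r \<in> {1..n}" if "r \<in> set qs" for r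
      using that q set_remove1_subset[of r qs] by auto
    have nW: "niceF n (\<lambda>v. W v qs)" by (rule E.nice_W[OF q(1,2)])
    have nE: "niceF n ?E" by (intro niceF_mult_left niceF_sum niceF_cst_mult E.nice_C E.nice_T rem q(3); assumption)
    have nO: "niceF n ?O" by (intro niceF_mult_left niceF_sum niceF_cst_mult O.nice_C O.nice_T rem q(3); assumption)
    have EE: "fexp n ?E = of_nat (fact ?k) * (cst (1/2) * (\<Sum>m=2..Suc ?k.
        cst (- ((-1) ^ m * of_real (fps_nth (Zs 1) m) * mtr (2 * n) (X ^\<^sub>m m))) * fps_X ^ m * g (Suc ?k - m)))"
      by (rule E.closed_loop[OF W q(3,1) qy])
    have OO: "fexp n ?O = of_nat (fact ?k) * (cst (1/2) * (\<Sum>m=2..Suc ?k.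
        cst (- ((-1) ^ m * of_real (fps_nth (Zs (-1)) m) * mtr (a + b) (Y ^\<^sub>m m))) * fps_X ^ m * g (Suc ?k - m)))"
      by (rule O.closed_loop[OF W q(3,1) qy])
    have "fexp n (\<lambda>v. W v rs) = cst z * fexp n (\<lambda>v. W v qs) + (fexp n ?E + fexp n ?O)"
      unfolding e fexp_add[OF niceF_mult_left[OF nW] niceF_add[OF nE nO]] fexp_add[OF nE nO] fexp_mult_left[OF nW] ..
    also have "\<dots> = of_nat (fact ?k) * (cst z * g ?k + cst (1/2) * (
      (\<Sum>m=2..Suc ?k. cst (- ((-1) ^ m * of_real (fps_nth (Zs 1) m) * mtr (2 * n) (X ^\<^sub>m m))) * fps_X ^ m * g (Suc ?k - m)) +
      (\<Sum>m=2..Suc ?k. cst (- ((-1) ^ m * of_real (fps_nth (Zs (-1)) m) * mtr (a + b) (Y ^\<^sub>m m))) * fps_X ^ m * g (Suc ?k - m))))"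
      unfolding W[OF q(1,2) order_refl] EE OO
      by (simp only: distrib_left mult_ac)
    also have "(\<Sum>m=2..Suc ?k. cst (- ((-1) ^ m * of_real (fps_nth (Zs 1) m) * mtr (2 * n) (X ^\<^sub>m m))) * fps_X ^ m * g (Suc ?k - m)) +
      (\<Sum>m=2..Suc ?k. cst (- ((-1) ^ m * of_real (fps_nth (Zs (-1)) m) * mtr (a + b) (Y ^\<^sub>m m))) * fps_X ^ m * g (Suc ?k - m)) =
      - (\<Sum>m=2..Suc ?k. cst (fps_nth (Zs 1) m * mtr (2 * n) (X ^\<^sub>m m) + fps_nth (Zs (-1)) m * mtr (a + b) (Y ^\<^sub>m m)) * fps_X ^ m * g (Suc ?k - m))"
      unfolding sum_negf[symmetric] sum.distrib[symmetric]
    proof (rule sum.cong[OF refl])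
      fix m assume m: "m \<in> {2..Suc ?k}"
      \<comment> \<open>The sign left over from the chain is harmless: from degree 2 on
        \<open>Zs\<close> has even coefficients only.\<close>
      have Zr: "(-1) ^ m * of_real (fps_nth (Zs \<sigma>) m) = (fps_nth (Zs (of_real \<sigma>)) m :: 'k)" if s: "\<sigma> = 1 \<or> \<sigma> = -1" for \<sigma>
      proof (cases "even m")
        case False
        then have "fps_nth (Zs \<sigma>) m = 0" using m by (intro Zs_odd[OF s]) auto
        then show ?thesis by (simp add: Zs_of_real[OF s])
      qed (simp add: Zs_of_real[OF s])
      have z: "(-1) ^ m * of_real (fps_nth (Zs 1) m) = (fps_nth (Zs 1) m :: 'k)" "(-1) ^ m * of_real (fps_nth (Zs (-1)) m) = (fps_nth (Zs (-1)) m :: 'k)"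
        using Zr[of 1] Zr[of "-1"] by simp_all
      show "cst (- ((-1) ^ m * of_real (fps_nth (Zs 1) m) * mtr (2 * n) (X ^\<^sub>m m))) * fps_X ^ m * g (Suc ?k - m) +
        cst (- ((-1) ^ m * of_real (fps_nth (Zs (-1)) m) * mtr (a + b) (Y ^\<^sub>m m))) * fps_X ^ m * g (Suc ?k - m) =
        - (cst (fps_nth (Zs 1) m * mtr (2 * n) (X ^\<^sub>m m) + fps_nth (Zs (-1)) m * mtr (a + b) (Y ^\<^sub>m m)) * fps_X ^ m * g (Suc ?k - m))"
        unfolding z fps_const_neg[symmetric] fps_const_add[symmetric] by (simp only: distrib_right mult_minus_left minus_add_distrib)
    qed
    also have "cst z * g ?k + cst (1/2) * - (\<Sum>m=2..Suc ?k. cst (fps_nth (Zs 1) m * mtr (2 * n) (X ^\<^sub>m m) + fps_nth (Zs (-1)) m * mtr (a + b) (Y ^\<^sub>m m)) * fps_X ^ m * g (Suc ?k - m)) =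
      (-1) ^ (a + (b - a) div 2) * (of_nat (Suc ?k) * fps_nth (genus (X, Y, z)) (Suc ?k))"
      unfolding rec(2) g_def by (simp only: right_diff_distrib sum_distrib_left mult_minus_right diff_conv_add_uminus distrib_left mult_ac)
    also have "of_nat (fact ?k) * ((-1) ^ (a + (b - a) div 2) * (of_nat (Suc ?k) * fps_nth (genus (X, Y, z)) (Suc ?k))) =
      of_nat (fact (length rs)) * ((-1) ^ (a + (b - a) div 2) * fps_nth (genus (X, Y, z)) (length rs))"
      by (simp only: Cons length_Cons fact_Suc of_nat_mult of_nat_id mult_ac)
    finally show ?thesis .
  qed
qed

end

theorem theorem8p13:
  fixes n a b c :: nat and x :: "'k::{real_normed_field, euclidean_space} lie"
  assumes "a \<le> b" and "c = (b - a) div 2" and "x \<in> lie_alg n a b"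
  shows "ad_average n a b n (P_form n a b) (replicate n x)
         = (-1) ^ (a + c) * degree_form n (genus x)"
proof -
  obtain X Y z where x: "x = (X, Y, z)" by (metis prod_cases3)
  have rep: "length (replicate n x) = n" "set (replicate n x) \<subseteq> lie_alg n a b" using assms(3) by auto
  have "ad_average n a b n (P_form n a b) (replicate n x) = fexp n (\<lambda>v. Wx n a b n (cpsi v) (\<lambda>r. replicate n x ! (r - 1)) [1..<Suc n])"
    unfolding ad_average_P_form[OF assms(1) rep] by (rule P_form_eq[OF assms(1) rep])
  \<comment> \<open>The list and the constant assignment of vertices have to agree on the slots from
    1 to \<open>n\<close> only.\<close>
  also have "\<dots> = fexp n (\<lambda>v. Wx n a b n (cpsi v) (\<lambda>_. (X, Y, z)) [1..<Suc n])"
  proof -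
    have nth: "replicate n x ! (r - 1) = (X, Y, z)" if "r \<in> {1..n}" for r using that x by auto
    have c: "X \<in> carrier_mat (2 * n) (2 * n)" "Y \<in> carrier_mat (a + b) (a + b)"
      using XY[OF assms(1) assms(3)[unfolded x]] by auto
    have "Wx n a b n (cpsi v) (\<lambda>r. replicate n x ! (r - 1)) [1..<Suc n] = Wx n a b n (cpsi v) (\<lambda>_. (X, Y, z)) [1..<Suc n]" for v
      by (rule conjunct1[OF Wx_cong[OF assms(1), where R = "{1..n}", OF _ _ _ _ _ conj_by_one conj_by_one]])
        (use nth assms(3) x c in \<open>auto simp: vertex_data simp del: nth_replicate\<close>)
    then show ?thesis by simp
  qed
  \<comment> \<open>The factorial counting the orders of the \<open>n\<close> equal vertices is the
    normalization in \<open>degree_form\<close>.\<close>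
  also have "\<dots> = of_nat (fact n) * ((-1) ^ (a + (b - a) div 2) * fps_nth (genus (X, Y, z)) n)"
    using W_integral[OF assms(1) assms(3)[unfolded x], of "[1..<Suc n]"] by (simp add: atLeastLessThanSuc_atLeastAtMost del: upt_Suc genus.simps)
  finally show ?thesis unfolding assms(2) degree_form_def x by (simp add: mult_ac del: genus.simps)
qed

end
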